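(* Assume that $\mathbb{K}$ is algebraically closed and let $A$ be a generalized Sklyanin algebra over $\mathbb{K}$. Then $A$ satisfies $H_A(t)=(1-t)^{-3}$ if and only if the defining relations of $A$ can be turned into those of an algebra from $\mathcal{P}_j$ for some $1\le j\le 6$ by means of a permutation of the variables, a scaling of the variables and a normalization of the relations (multiplying each relation by a non-zero constant). Furthermore, $A$ is Koszul if $j\le5$ and $A$ is non-Koszul if $j=6$.
   Context: For $\xi=(p_1,p_2,p_3,q_1,q_2,q_3,r_1,r_2,r_3)\in\mathbb{K}^9$, the generalized Sklyanin algebra $\widehat{Q}^\xi$ is the associative unital $\mathbb{K}$-algebra given by the generators $x,y,z$ and the relations $p_1yz+q_1zy+r_1xx=0$, $p_2zx+q_2xz+r_2yy=0$, $p_3xy+q_3yx+r_3zz=0$, graded by $\deg x=\deg y=\deg z=1$. Write $\mathbb{K}^*=\mathbb{K}\setminus\{0\}$. The classes $\mathcal{P}_1,\dots,\mathcal{P}_6$ of generalized Sklyanin algebras are: $\mathcal{P}_1$: the Sklyanin algebras $Q^{p,q,r}$ given by the relations $pyz+qzy+rxx=0$, $pzx+qxz+ryy=0$, $pxy+qyx+rzz=0$ with $p,q,r\in\mathbb{K}$, $(pq,pr,qr)\neq(0,0,0)$ and $(p^3-q^3,p^3-r^3)\neq(0,0)$; $\mathcal{P}_2$: relations of the shape $yz-azy=0$, $bzx-xz=0$, $xy-cyx=0$, where $a,b,c\in\mathbb{K}$; $\mathcal{P}_3$: relations of the shape $yz-azy=0$, $bzx-xz+yy=0$, $xy-ayx=0$,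 where $a,b\in\mathbb{K}$; $\mathcal{P}_4$: relations of the shape $yz-azy=0$, $azx-xz+yy=0$, $xy-ayx-zz=0$, where $a\in\mathbb{K}$; $\mathcal{P}_5$: relations of the shape $yz+\theta zy+\theta^2xx=0$, $zx+\theta^4xz+\theta^2yy=0$, $xy+\theta^7yx+\theta^2zz=0$, where $\theta\in\mathbb{K}$ satisfies $\theta^9=1$ and $\theta^3\neq1$; $\mathcal{P}_6$: relations of the shape $xx=0$, $\alpha zx+xz+yy=0$, $xy+\frac1\alpha yx+zz=0$, where $\alpha\in\mathbb{K}^*$. A scaling of the variables is a substitution multiplying each of $x,y,z$ by a non-zero constant. For a graded algebra $A$ with finite-dimensional components $A_j$, $H_A(t)=\sum_{j\ge 0}\dim_{\mathbb{K}}A_j\,t^j$. A quadratic algebra $A$ (generated in degree 1 with $A_0=\mathbb{K}$ and quadratic relations) is Koszul if the graded right $A$-module $\mathbb{K}$ (via the augmentation map) has a free resolution $\dots\to M_m\to\dots\to M_1\to A\to\mathbb{K}\to0$ by graded free right $A$-modules with degree-preserving maps, the second last arrow being the augmentation map and each $M_m$ being generated in degree $m$.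
   Formalization: In P_4 the relation azx−xz+yy=0 with a∈K is replaced by (1/a)zx−xz+yy=0 with a∈K*: as printed, the two reductions of xyz give (1−a²)zzz=0, so dim A_3=9 instead of 10 unless a²=1, and the stated equivalence fails. *)

theory Defs
  imports
    "HOL-Library.Poly_Mapping"
    "HOL-Library.Multiset"
    "HOL-Algebra.QuotRing"
    "HOL-Algebra.Embedded_Algebras"
    "HOL-Computational_Algebra.Polynomial"
    "HOL-Computational_Algebra.Formal_Power_Series"
begin

section \<open>The free algebra on x, y, z\<close>

datatype var = VX | VY | VZ

datatype word = Word (letters: "var list")

instantiation word :: monoid_add
begin
definition zero_word :: word where "zero_word = Word []"
definition plus_word :: "word \<Rightarrow> word \<Rightarrow> word"
  where "plus_word u v = Word (letters u @ letters v)"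
instance
  by standard (simp_all add: zero_word_def plus_word_def)
end

text \<open>With concatenation as the addition of exponents, the convolution product of
  \<^theory>\<open>HOL-Library.Poly_Mapping\<close> is the multiplication of noncommutative polynomials.\<close>

type_synonym 'k free_alg = "word \<Rightarrow>\<^sub>0 'k"

definition scal :: "'k \<Rightarrow> 'k::field free_alg"
  where "scal c = Poly_Mapping.single 0 c"

definition gen :: "var \<Rightarrow> 'k::field free_alg"
  where "gen v = Poly_Mapping.single (Word [v]) 1"

abbreviation gX :: "'k::field free_alg" where "gX \<equiv> gen VX"
abbreviation gY :: "'k::field free_alg" where "gY \<equiv> gen VY"
abbreviation gZ :: "'k::field free_alg" where "gZ \<equiv> gen VZ"

definition homog :: "nat \<Rightarrow> 'k::field free_alg set"
  where "homog j = {f. \<forall>w\<in>Poly_Mapping.keys f. length (letters w) = j}"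

definition free_ring :: "'k::field free_alg ring"
  where "free_ring = \<lparr>carrier = UNIV, monoid.mult = (*), one = 1, zero = 0, add = (+)\<rparr>"

lemma ring_free_ring: "ring (free_ring :: 'k::field free_alg ring)"
proof (rule ringI)
  show "abelian_group (free_ring :: 'k free_alg ring)"
    by (rule abelian_groupI)
       (auto simp: free_ring_def ac_simps intro: exI[of _ "- x" for x] left_minus)
  show "monoid (free_ring :: 'k free_alg ring)"
    by (rule monoidI) (auto simp: free_ring_def mult.assoc)
qed (auto simp: free_ring_def algebra_simps)


section \<open>Algebras given by relations\<close>

definition rel_ideal :: "'k::field free_alg set \<Rightarrow> 'k free_alg set"
  where "rel_ideal R = genideal free_ring R"

definition alg :: "'k::field free_alg set \<Rightarrow> 'k free_alg set ring"
  where "alg R = free_ring Quot (rel_ideal R)"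

definition cls :: "'k::field free_alg set \<Rightarrow> 'k free_alg \<Rightarrow> 'k free_alg set"
  where "cls R f = rel_ideal R +>\<^bsub>free_ring\<^esub> f"

text \<open>The copy of the ground field and the graded components inside the quotient.
  They are used for homogeneous \<^term>\<open>R\<close> only.\<close>

definition base_field :: "'k::field free_alg set \<Rightarrow> 'k free_alg set set"
  where "base_field R = cls R ` range scal"

definition component :: "'k::field free_alg set \<Rightarrow> nat \<Rightarrow> 'k free_alg set set"
  where "component R j = cls R ` homog j"

definition hilbert_series :: "'k::field free_alg set \<Rightarrow> rat fps"
  where "hilbert_series R =
    Abs_fps (\<lambda>j. of_nat (ring.dim (alg R) (base_field R) (component R j)))"


section \<open>Koszul algebras\<close>

text \<open>The value of the augmentation map on a residue class is the common constant term of
  its elements.\<close>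

definition augmentation :: "'k::field free_alg set \<Rightarrow> 'k free_alg set \<Rightarrow> 'k"
  where "augmentation R a = the_elem ((\<lambda>f. Poly_Mapping.lookup f 0) ` a)"

text \<open>\<^term>\<open>free_module R B\<close> is the free right module with basis \<^term>\<open>B\<close> over the algebra
  \<^term>\<open>alg R\<close>, realised as coordinate functions of finite support. Its elements of degree \<open>j\<close>,
  when all basis elements sit in degree \<open>m\<close>, form \<^term>\<open>free_module_component R B m j\<close>.
  Bases are sets of natural numbers. This does not restrict the notion of a Koszul algebra: if
  \<open>M\<^sub>m\<close> is generated in degree \<open>m\<close> for every \<open>m\<close>, then exactness embeds the degree \<open>m + 1\<close> part of
  \<open>M\<^sub>m\<^sub>+\<^sub>1\<close> into that of \<open>M\<^sub>m\<close>, so by induction on \<open>m\<close> all ranks are finite.\<close>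

definition free_module ::
    "'k::field free_alg set \<Rightarrow> nat set \<Rightarrow> (nat \<Rightarrow> 'k free_alg set) set"
  where "free_module R B =
    {u. (\<forall>i. u i \<in> carrier (alg R)) \<and> (\<forall>i. i \<notin> B \<longrightarrow> u i = \<zero>\<^bsub>alg R\<^esub>)
        \<and> finite {i. u i \<noteq> \<zero>\<^bsub>alg R\<^esub>}}"

definition free_module_component ::
    "'k::field free_alg set \<Rightarrow> nat set \<Rightarrow> nat \<Rightarrow> nat \<Rightarrow> (nat \<Rightarrow> 'k free_alg set) set"
  where "free_module_component R B m j =
    {u \<in> free_module R B.
       \<forall>i. if m \<le> j then u i \<in> component R (j - m) else u i = \<zero>\<^bsub>alg R\<^esub>}"

definition right_linear ::
    "'k::field free_alg set \<Rightarrow> nat set \<Rightarrow> nat set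
      \<Rightarrow> ((nat \<Rightarrow> 'k free_alg set) \<Rightarrow> (nat \<Rightarrow> 'k free_alg set)) \<Rightarrow> bool"
  where "right_linear R B B' d \<longleftrightarrow>
    d \<in> free_module R B \<rightarrow> free_module R B' \<and>
    (\<forall>u\<in>free_module R B. \<forall>v\<in>free_module R B.
       d (\<lambda>i. u i \<oplus>\<^bsub>alg R\<^esub> v i) = (\<lambda>i. d u i \<oplus>\<^bsub>alg R\<^esub> d v i)) \<and>
    (\<forall>u\<in>free_module R B. \<forall>a\<in>carrier (alg R).
       d (\<lambda>i. u i \<otimes>\<^bsub>alg R\<^esub> a) = (\<lambda>i. d u i \<otimes>\<^bsub>alg R\<^esub> a))"

text \<open>Here \<open>d m\<close> is the map \<open>M\<^sub>m\<^sub>+\<^sub>1 \<rightarrow> M\<^sub>m\<close> of the resolution, and \<open>M\<^sub>0\<close> is the algebra itself.\<close>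

definition koszul :: "'k::field free_alg set \<Rightarrow> bool"
  where "koszul R \<longleftrightarrow>
    (\<exists>(B :: nat \<Rightarrow> nat set) d.
       B 0 = {0} \<and>
       (\<forall>m. right_linear R (B (Suc m)) (B m) (d m)) \<and>
       (\<forall>m j. d m ` free_module_component R (B (Suc m)) (Suc m) j
                \<subseteq> free_module_component R (B m) m j) \<and>
       (\<forall>m. d (Suc m) ` free_module R (B (Suc (Suc m)))
              = {u \<in> free_module R (B (Suc m)). d m u = (\<lambda>i. \<zero>\<^bsub>alg R\<^esub>)}) \<and>
       d 0 ` free_module R (B 1) = {u \<in> free_module R (B 0). augmentation R (u 0) = 0} \<and>
       augmentation R ` carrier (alg R) = UNIV)"


section \<open>Generalized Sklyanin algebras\<close>

definition sklyanin_rels ::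
    "'k \<Rightarrow> 'k \<Rightarrow> 'k \<Rightarrow> 'k \<Rightarrow> 'k \<Rightarrow> 'k \<Rightarrow> 'k \<Rightarrow> 'k \<Rightarrow> 'k \<Rightarrow> 'k::field free_alg list"
  where "sklyanin_rels p1 p2 p3 q1 q2 q3 r1 r2 r3 =
    [scal p1 * gY * gZ + scal q1 * gZ * gY + scal r1 * gX * gX,
     scal p2 * gZ * gX + scal q2 * gX * gZ + scal r2 * gY * gY,
     scal p3 * gX * gY + scal q3 * gY * gX + scal r3 * gZ * gZ]"

definition class_P1 :: "'k::field free_alg list set"
  where "class_P1 =
    {[scal p * gY * gZ + scal q * gZ * gY + scal r * gX * gX,
      scal p * gZ * gX + scal q * gX * gZ + scal r * gY * gY,
      scal p * gX * gY + scal q * gY * gX + scal r * gZ * gZ] | p q r.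
      (p * q, p * r, q * r) \<noteq> (0, 0, 0) \<and> (p ^ 3 - q ^ 3, p ^ 3 - r ^ 3) \<noteq> (0, 0)}"

definition class_P2 :: "'k::field free_alg list set"
  where "class_P2 =
    {[gY * gZ - scal a * gZ * gY,
      scal b * gZ * gX - gX * gZ,
      gX * gY - scal c * gY * gX] | a b c. True}"

definition class_P3 :: "'k::field free_alg list set"
  where "class_P3 =
    {[gY * gZ - scal a * gZ * gY,
      scal b * gZ * gX - gX * gZ + gY * gY,
      gX * gY - scal a * gY * gX] | a b. True}"

text \<open>In the next class the coefficient of \<open>zx\<close> is \<open>1/a\<close> with \<open>a \<noteq> 0\<close>, whereas the source prints
  \<open>azx\<close> with arbitrary \<open>a\<close>. That is a misprint. For a coefficient \<open>\<beta>\<close> in place of \<open>1/a\<close>, reducing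
  \<open>xyz\<close> by \<open>xy \<rightarrow> ayx + zz\<close>, \<open>xz \<rightarrow> \<beta>zx + yy\<close>, \<open>yz \<rightarrow> azy\<close> in the two possible ways gives
  \<open>a\<^sup>2\<beta> zyx + a yyy + zzz\<close> and \<open>a\<^sup>2\<beta> zyx + a yyy + a\<beta> zzz\<close>. Hence \<open>zzz = 0\<close> and the degree 3
  component has dimension 9 instead of 10 unless \<open>a\<beta> = 1\<close>, while for \<open>a\<beta> = 1\<close> the words
  \<open>z\<^sup>iy\<^sup>jx\<^sup>k\<close> form a basis.\<close>

definition class_P4 :: "'k::field free_alg list set"
  where "class_P4 =
    {[gY * gZ - scal a * gZ * gY,
      scal (1 / a) * gZ * gX - gX * gZ + gY * gY,
      gX * gY - scal a * gY * gX - gZ * gZ] | a. a \<noteq> 0}"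

definition class_P5 :: "'k::field free_alg list set"
  where "class_P5 =
    {[gY * gZ + scal \<theta> * gZ * gY + scal (\<theta> ^ 2) * gX * gX,
      gZ * gX + scal (\<theta> ^ 4) * gX * gZ + scal (\<theta> ^ 2) * gY * gY,
      gX * gY + scal (\<theta> ^ 7) * gY * gX + scal (\<theta> ^ 2) * gZ * gZ] | \<theta>.
      \<theta> ^ 9 = 1 \<and> \<theta> ^ 3 \<noteq> 1}"

definition class_P6 :: "'k::field free_alg list set"
  where "class_P6 =
    {[gX * gX,
      scal \<alpha> * gZ * gX + gX * gZ + gY * gY,
      gX * gY + scal (1 / \<alpha>) * gY * gX + gZ * gZ] | \<alpha>. \<alpha> \<noteq> 0}"

definition class_P :: "nat \<Rightarrow> 'k::field free_alg list set"
  where "class_P j =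
    (if j = 1 then class_P1 else if j = 2 then class_P2 else if j = 3 then class_P3
     else if j = 4 then class_P4 else if j = 5 then class_P5
     else if j = 6 then class_P6 else {})"

definition subst_vars :: "(var \<Rightarrow> 'k free_alg) \<Rightarrow> 'k::field free_alg \<Rightarrow> 'k free_alg"
  where "subst_vars \<phi> f =
    (\<Sum>w\<in>Poly_Mapping.keys f. scal (Poly_Mapping.lookup f w) * prod_list (map \<phi> (letters w)))"

text \<open>A system of defining relations is unordered, hence the comparison of multisets: permuting
  the variables also permutes the three shapes of relations.\<close>

definition turned_into :: "'k::field free_alg list \<Rightarrow> 'k free_alg list \<Rightarrow> bool"
  where "turned_into R R' \<longleftrightarrow>
    (\<exists>\<sigma> s c. bij \<sigma> \<and> (\<forall>v. s v \<noteq> 0) \<and> length c = length R \<and> 0 \<notin> set c \<and>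
       mset (map2 (\<lambda>k f. scal k * subst_vars (\<lambda>v. scal (s v) * gen (\<sigma> v)) f) c R) = mset R')"

end

theory Submission
  imports Defs
begin

text \<open>Let \<open>J\<close> be the ideal of relations and \<open>F\<close> the free algebra. The Hilbert series is determined
  by the dimensions of \<open>J\<^sub>n\<close>, and \<open>J\<^sub>n\<^sub>+\<^sub>2\<close> is the sum of \<open>\<Sum> x\<^sub>v J\<^sub>n\<^sub>+\<^sub>1\<close> and \<open>\<Sum> r\<^sub>v F\<^sub>n\<close>, so that everything
  depends on the size of the intersection of these two spaces.

  In the classes \<open>\<P>\<^sub>1\<close> to \<open>\<P>\<^sub>5\<close> there is a potential \<open>w = \<Sum> r\<^sub>v l\<^sub>v = \<Sum> x\<^sub>v n\<^sub>v\<close> with linear \<open>l\<^sub>v\<close> and with \<open>n\<^sub>v\<close> in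
  the span of the relations. The intersection contains \<open>\<Sum> r\<^sub>v J\<^sub>n + w F\<^sub>n\<^sub>-\<^sub>1\<close>, which bounds the algebra from
  below. Over an algebraically closed field, point modules and line modules \<open>A/zA\<close> bound it from above.
  Both bounds agree, hence the intersection is as small as possible, and this is the exactness of the
  complex \<open>A \<rightarrow> A\<^sup>3 \<rightarrow> A\<^sup>3 \<rightarrow> A\<close> given by \<open>w\<close>. The class \<open>\<P>\<^sub>6\<close> is a limit of algebras of type \<open>\<P>\<^sub>1\<close>, and the
  bound from below survives by semicontinuity. It is not Koszul because its only syzygy of degree
  three is \<open>xxx\<close>, which generates too few syzygies of degree four.

  Conversely, a Hilbert series \<open>(1 - t)\<^sup>-\<^sup>3\<close> forces the space of syzygies of degree three to be
  one-dimensional. The relations are homogeneous for the grading of \<open>x, y, z\<close> by \<open>0, 1, 2\<close> modulo \<open>3\<close>,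
  so the syzygy is homogeneous as well. If none of the relations is a square, then weight \<open>0\<close> leads to
  \<open>\<P>\<^sub>1\<close> to \<open>\<P>\<^sub>4\<close> and the other weights lead to \<open>\<P>\<^sub>5\<close>. If one of them is a square, counting in degree four
  leaves \<open>\<P>\<^sub>6\<close>. The degenerate cases have only few words in their relations, and the number of
  words avoiding these grows exponentially.\<close>

section \<open>Linear algebra in a vector space of arbitrary dimension\<close>

text \<open>The bounds from above and from below cannot be established one after the other. By
  \<open>dim J_(n+2) + dim (intersection) = 3 dim J_(n+1) + 3^(n+1)\<close>, the known part of the
  intersection bounds the algebra from below only once its own dimension is known, and for this
  \<open>w f \<in> \<Sum> r_v J\<close> must imply \<open>f \<in> J\<close>. That is injectivity of
  multiplication by a suitable linear form \<open>z\<close> on the algebra, and it follows from the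
  line bound together with the exact dimensions in two consecutive lower degrees. Hence one
  induction on the degree carries both bounds. In \<open>\<P>\<^sub>6\<close> the syzygy is
  \<open>xxx\<close>, its linear factor \<open>x\<close> is a zero divisor, and the argument
  collapses; therefore the deformation. Algebraic closedness is used mainly for two things: the line
  \<open>z = 0\<close> has to meet the plane cubic of points killing some relation, and the normal
  forms need cube roots. In the converse direction any two syzygies of degree three are
  proportional. Many degenerate coefficient patterns are refuted by writing down a second
  one.\<close>

locale linear_space = vector_space
begin

text \<open>\<open>dim\<close> is a natural number and carries no information for a space without a
  finite basis. The free algebra is such a space, so the dimension counts below carry this
  hypothesis.\<close>

definition fin_spanned :: "'b set \<Rightarrow> bool"
  where "fin_spanned S \<longleftrightarrow> (\<exists>B. finite B \<and> S \<subseteq> span B)"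

lemma fin_spanned_subset: "fin_spanned T \<Longrightarrow> S \<subseteq> T \<Longrightarrow> fin_spanned S"
  unfolding fin_spanned_def by blast

lemma fin_spanned_sums:
  assumes "fin_spanned S" "fin_spanned T"
  shows "fin_spanned {x + y | x y. x \<in> S \<and> y \<in> T}"
proof -
  obtain B C where "finite B" "S \<subseteq> span B" "finite C" "T \<subseteq> span C"
    using assms unfolding fin_spanned_def by blast
  then have "finite (B \<union> C)" "{x + y | x y. x \<in> S \<and> y \<in> T} \<subseteq> span (B \<union> C)"
    by (auto simp: span_Un)
  then show ?thesis unfolding fin_spanned_def by blast
qed

lemma independent_finite:
  assumes "fin_spanned S" "independent B" "B \<subseteq> S"
  shows "finite B"
proof -
  obtain C where "finite C" "S \<subseteq> span C" using assms(1) unfolding fin_spanned_def by blast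
  then show ?thesis using independent_span_bound[of C B] assms by auto
qed

lemma independent_card_le:
  assumes "fin_spanned S" "independent B" "B \<subseteq> S"
  shows "card B \<le> dim S"
proof -
  obtain C where C: "C \<subseteq> S" "independent C" "S \<subseteq> span C" "card C = dim S"
    using basis_exists by blast
  have "finite C" by (rule independent_finite[OF assms(1) C(2,1)])
  then have "card B \<le> card C" using independent_span_bound[of C B] assms C by auto
  then show ?thesis using C by simp
qed

lemma dim_le_fin_spanned:
  assumes "fin_spanned T" "S \<subseteq> T"
  shows "dim S \<le> dim T"
proof -
  obtain C where C: "C \<subseteq> S" "independent C" "S \<subseteq> span C" "card C = dim S"
    using basis_exists by blast
  then show ?thesis using independent_card_le[OF assms(1), of C] assms by auto
qed

lemma subspace_eq_of_dim_le:
  assumes "fin_spanned T" "S \<subseteq> T" "subspace S" "dim T \<le> dim S"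
  shows "S = T"
proof (rule ccontr)
  assume "S \<noteq> T"
  then obtain x where x: "x \<in> T" "x \<notin> S" using assms(2) by blast
  obtain C where C: "C \<subseteq> S" "independent C" "S \<subseteq> span C" "card C = dim S"
    using basis_exists by blast
  have fC: "finite C" using independent_finite[OF assms(1) C(2)] C assms by blast
  have "span C \<subseteq> S" using span_minimal C assms by blast
  then have "x \<notin> span C" using x by blast
  then have "independent (insert x C)" using independent_insertI C by blast
  moreover have "insert x C \<subseteq> T" using x C assms by blast
  ultimately have "card (insert x C) \<le> dim T" using independent_card_le[OF assms(1)] by blast
  moreover have "card (insert x C) = Suc (dim S)"
    using fC C \<open>x \<notin> span C\<close> span_base[of x C] by (subst card_insert_disjoint) auto
  ultimately show False using assms by simp
qed

text \<open>Bases \<open>C\<close> of \<open>S\<close> and \<open>D\<close> of \<open>T\<close> are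
  grown from one basis \<open>B\<close> of \<open>S \<inter> T\<close>; then
  \<open>C \<union> D\<close> is a basis of the sum and \<open>C \<inter> D = B\<close>.\<close>

lemma dim_sums_Int':
  assumes "subspace S" "subspace T" "fin_spanned S" "fin_spanned T"
  shows "dim {x + y | x y. x \<in> S \<and> y \<in> T} + dim (S \<inter> T) = dim S + dim T"
proof -
  obtain B where B: "B \<subseteq> S \<inter> T" "independent B" "S \<inter> T \<subseteq> span B" "card B = dim (S \<inter> T)"
    using basis_exists by blast
  have finST: "fin_spanned (S \<inter> T)" using assms(3) fin_spanned_subset by blast
  have fB: "finite B" using independent_finite[OF finST B(2,1)] .
  obtain C where C: "B \<subseteq> C" "C \<subseteq> S" "independent C" "S \<subseteq> span C"
    using maximal_independent_subset_extend[of B S] B by blast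
  obtain D where D: "B \<subseteq> D" "D \<subseteq> T" "independent D" "T \<subseteq> span D"
    using maximal_independent_subset_extend[of B T] B by blast
  have fC: "finite C" and fD: "finite D"
    using independent_finite[OF assms(3) C(3,2)] independent_finite[OF assms(4) D(3,2)] by auto
  have spC: "span C = S" and spD: "span D = T" and spB: "span B = S \<inter> T"
    using span_subspace C D B assms subspace_inter by metis+
  have CD: "C \<inter> D = B"
  proof
    show "C \<inter> D \<subseteq> B"
    proof
      fix x assume x: "x \<in> C \<inter> D"
      then have "x \<in> span B" using C D spB by blast
      show "x \<in> B"
      proof (rule ccontr)
        assume "x \<notin> B"
        then have "B \<subseteq> C - {x}" using C by blast
        then have "x \<in> span (C - {x})" using \<open>x \<in> span B\<close> span_mono by blast
        then show False using C(3) x dependent_def by blast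
      qed
    qed
  qed (use C D in blast)
  have ind: "independent (C \<union> D)"
  proof (rule independent_if_scalars_zero)
    show "finite (C \<union> D)" using fC fD by simp
    fix f x assume 0: "(\<Sum>x\<in>C \<union> D. scale (f x) x) = 0" and xin: "x \<in> C \<union> D"
    have eq: "(\<Sum>x\<in>C. scale (f x) x) + (\<Sum>x\<in>D - B. scale (f x) x) = 0"
    proof -
      have "C \<union> D = C \<union> (D - B)" "C \<inter> (D - B) = {}" using CD C D by auto
      then show ?thesis using 0 fC fD by (simp add: sum.union_disjoint)
    qed
    have "(\<Sum>x\<in>D - B. scale (f x) x) \<in> span D" by (intro span_sum span_scale span_base) auto
    moreover have "(\<Sum>x\<in>C. scale (f x) x) \<in> span C" by (intro span_sum span_scale span_base) auto
    moreover have "(\<Sum>x\<in>D - B. scale (f x) x) = - (\<Sum>x\<in>C. scale (f x) x)"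
      using eq by (metis add_eq_0_iff)
    ultimately have "(\<Sum>x\<in>D - B. scale (f x) x) \<in> span B"
      using spB spC spD subspace_neg[OF assms(1)] by auto
    then obtain g where g: "(\<Sum>x\<in>D - B. scale (f x) x) = (\<Sum>x\<in>B. scale (g x) x)"
      unfolding span_finite[OF fB] by auto
    \<comment> \<open>The part over \<open>D - B\<close> lies in both spaces, so it equals a
      combination of \<open>B\<close> with coefficients \<open>g\<close>; moving it across gives a
      relation inside the independent set \<open>D\<close>.\<close>
    have "(\<Sum>x\<in>D. scale (if x \<in> B then - g x else f x) x) = 0"
    proof -
      have "D = (D - B) \<union> B" using D by auto
      then have "(\<Sum>x\<in>D. scale (if x \<in> B then - g x else f x) x)
        = (\<Sum>x\<in>D - B. scale (if x \<in> B then - g x else f x) x)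
         + (\<Sum>x\<in>B. scale (if x \<in> B then - g x else f x) x)"
        using sum.union_disjoint[of "D - B" B "\<lambda>x. scale (if x \<in> B then - g x else f x) x"] fD fB by auto
      also have "\<dots> = 0" using g by (simp add: sum_negf)
      finally show ?thesis .
    qed
    then have hD: "\<And>v. v \<in> D \<Longrightarrow> (if v \<in> B then - g v else f v) = 0"
      using independentD[OF D(3) fD subset_refl, of "\<lambda>x. if x \<in> B then - g x else f x"] by blast
    then have fz: "\<And>v. v \<in> D - B \<Longrightarrow> f v = 0" by (metis DiffD1 DiffD2)
    then have "(\<Sum>x\<in>C. scale (f x) x) = 0" using eq by simp
    then have "\<And>v. v \<in> C \<Longrightarrow> f v = 0" using independentD[OF C(3) fC subset_refl, of f] by blast
    then show "f x = 0" using xin fz C by blast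
  qed
  have "dim {x + y | x y. x \<in> S \<and> y \<in> T} = card (C \<union> D)"
    using ind span_Un[of C D] spC spD dim_span_eq_card_independent by metis
  moreover have "card (C \<union> D) + card (C \<inter> D) = card C + card D" using card_Un_Int fC fD by metis
  moreover have "card C = dim S" "card D = dim T"
    using C D basis_card_eq_dim by auto
  ultimately show ?thesis using CD B by simp
qed

end

lemma dim_linear_image:
  assumes "Vector_Spaces.linear s1 s2 f" "module.subspace s1 S" "inj_on f S" 
  shows "vector_space.dim s2 (f ` S) = vector_space.dim s1 S"
proof -
  interpret Vector_Spaces.linear s1 s2 f by fact
  obtain B where B: "B \<subseteq> S" "vs1.independent B" "S \<subseteq> vs1.span B" "card B = vs1.dim S"
    using vs1.basis_exists by blast
  have sp: "vs1.span B = S" using B assms(2) by (simp add: vs1.span_subspace)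
  have "vs2.independent (f ` B)"
    using independent_injective_image[OF B(2)] sp assms(3) by simp
  moreover have "f ` S = vs2.span (f ` B)" using span_image[of B] sp by simp
  ultimately have "vs2.dim (f ` S) = card (f ` B)" by (simp add: vs2.dim_eq_card_independent)
  also have "\<dots> = card B" using B assms(3) by (meson card_image inj_on_subset)
  finally show ?thesis using B by simp
qed


section \<open>The free algebra as a graded vector space\<close>

lemma UNIV_var: "UNIV = {VX, VY, VZ}"
  using var.exhaust by blast

instance var :: finite
  by standard (simp add: UNIV_var)

lemma sum_var: "sum f (UNIV :: var set) = f VX + f VY + f VZ"
  by (simp add: UNIV_var add.assoc)

lemma all_var: "(\<forall>v. P v) \<longleftrightarrow> P VX \<and> P VY \<and> P VZ"
  by (metis var.exhaust)

definition smul :: "'k \<Rightarrow> 'k free_alg \<Rightarrow> 'k::field free_alg" (infixr \<open>*\<^sub>s\<close> 75)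
  where "c *\<^sub>s f = scal c * f"

abbreviation lk :: "'k::field free_alg \<Rightarrow> var list \<Rightarrow> 'k"
  where "lk f l \<equiv> Poly_Mapping.lookup f (Word l)"

definition mon :: "var list \<Rightarrow> 'k::field free_alg"
  where "mon l = Poly_Mapping.single (Word l) 1"

lemma free_alg_eqI: "(\<And>l. lk f l = lk g l) \<Longrightarrow> f = g"
  by (metis poly_mapping_eqI word.collapse)

lemma lookup_smul: "Poly_Mapping.lookup (c *\<^sub>s f) w = c * Poly_Mapping.lookup f w"
proof -
  have "c *\<^sub>s f = Poly_Mapping.map ((*) c) f"
    by (simp add: smul_def scal_def mult_map_scale_conv_mult)
  then show ?thesis by (simp add: Poly_Mapping.map.rep_eq when_def)
qed

lemma smul_mult_left [simp]: "(c *\<^sub>s f) * g = c *\<^sub>s (f * g)"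
  by (simp add: smul_def mult.assoc)

lemma sum_singles: "f = (\<Sum>w\<in>Poly_Mapping.keys f. Poly_Mapping.single w (Poly_Mapping.lookup f w))"
  by (rule poly_mapping_eqI)
     (auto simp: lookup_sum lookup_single when_def sum.delta in_keys_iff)

lemma free_alg_induct [case_names single add]:
  assumes "\<And>l c. P (Poly_Mapping.single (Word l) c)" "\<And>f g. P f \<Longrightarrow> P g \<Longrightarrow> P (f + g)"
  shows "P (f :: 'k::field free_alg)"
proof -
  have "P (\<Sum>w\<in>A. Poly_Mapping.single w (Poly_Mapping.lookup f w))" for A
  proof (induction A rule: infinite_finite_induct)
    case (insert w A)
    then show ?case using assms(1)[of "letters w"] by (simp add: assms(2))
  qed (use assms(1)[of "[]" 0] in auto)
  then show ?thesis using sum_singles[of f] by metis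
qed

lemma smul_mult_right [simp]: "f * (c *\<^sub>s g) = c *\<^sub>s (f * g)"
proof -
  have "f * scal c = scal c * f"
    by (induction f rule: free_alg_induct)
       (simp_all add: scal_def mult_single mult.commute algebra_simps)
  then show ?thesis by (metis smul_def mult.assoc)
qed

global_interpretation fa: linear_space "smul :: 'k::field \<Rightarrow> _"
  by unfold_locales
     (auto intro!: free_alg_eqI simp: lookup_smul lookup_add algebra_simps)

lemma smul_linear_left: "Vector_Spaces.linear smul smul (\<lambda>f. g * f)"
  by unfold_locales (simp_all add: algebra_simps)

lemma scal_mult: "scal c * f = c *\<^sub>s f" by (simp add: smul_def)

lemma gen_eq_mon: "gen v = mon [v]" by (simp add: gen_def mon_def)

lemma one_eq_mon: "1 = mon []"
  by (simp add: mon_def zero_word_def[symmetric])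

lemma mon_mult [simp]: "mon l * mon m = mon (l @ m)"
  by (simp add: mon_def mult_single plus_word_def)

lemma lookup_mon: "lk (mon l) m = (if l = m then 1 else 0)"
  by (simp add: mon_def lookup_single when_def)

lemma lookup_gen: "lk (gen v) m = (if m = [v] then 1 else 0)"
  by (auto simp: gen_eq_mon lookup_mon)

lemma lookup_gen_mult:
  "lk (gen v * f) l = (case l of [] \<Rightarrow> 0 | u # m \<Rightarrow> if u = v then lk f m else 0)"
  by (induction f rule: free_alg_induct)
     (auto simp: gen_def mult_single plus_word_def lookup_single when_def lookup_add algebra_simps
       split: list.splits)

text \<open>Left division by a letter: the coefficient of \<open>v\<close> in the decomposition of
  the free algebra into the constants and the right ideals generated by the letters.\<close>

definition tail :: "var \<Rightarrow> 'k::field free_alg \<Rightarrow> 'k free_alg"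
  where "tail v f = Poly_Mapping.map_key (\<lambda>w. Word (v # letters w)) f"

lemma lookup_tail: "lk (tail v f) l = lk f (v # l)"
proof -
  have "inj (\<lambda>w. Word (v # letters w))" by (auto simp: inj_def word.expand)
  then show ?thesis unfolding tail_def by (simp add: map_key.rep_eq)
qed

lemma tail_zero [simp]: "tail v 0 = 0"
  and tail_add [simp]: "tail v (f + g) = tail v f + tail v g"
  and tail_diff [simp]: "tail v (f - g) = tail v f - tail v g"
  and tail_uminus [simp]: "tail v (- f) = - tail v f"
  and tail_smul [simp]: "tail v (c *\<^sub>s f) = c *\<^sub>s tail v f"
  and tail_gen_mult [simp]: "tail v (gen u * f) = (if u = v then f else 0)"
  and tail_gen [simp]: "tail v (gen u) = (if u = v then 1 else 0)"
  by (auto intro!: free_alg_eqI simp: lookup_tail lookup_add lookup_minus lookup_smul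
      lookup_gen_mult lookup_gen one_eq_mon lookup_mon)

lemma tail_sum: "tail v (sum f A) = (\<Sum>x\<in>A. tail v (f x))"
  by (induction A rule: infinite_finite_induct) auto

lemma tail_expand: "f = lk f [] *\<^sub>s 1 + (\<Sum>v\<in>UNIV. gen v * tail v f)"
proof (rule free_alg_eqI)
  fix l show "lk f l = lk (lk f [] *\<^sub>s 1 + (\<Sum>v\<in>UNIV. gen v * tail v f)) l"
  proof (cases l)
    case (Cons u m)
    then show ?thesis
      by (cases u) (auto simp: sum_var lookup_add lookup_smul one_eq_mon lookup_mon lookup_gen_mult lookup_tail)
  qed (auto simp: sum_var lookup_add lookup_smul one_eq_mon lookup_mon lookup_gen_mult)
qed

text \<open>The Leibniz rule of a Fox derivative: the first letter of a product belongs to the left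
  factor, except where that factor contributes only its constant term.\<close>

lemma tail_mult: "tail v (f * g) = tail v f * g + lk f [] *\<^sub>s tail v g"
proof -
  have "f * g = lk f [] *\<^sub>s g + (\<Sum>v\<in>UNIV. gen v * (tail v f * g))"
    by (subst tail_expand[of f]) (simp add: distrib_right sum_distrib_right mult.assoc)
  then have "tail v (f * g) = lk f [] *\<^sub>s tail v g + (\<Sum>u\<in>UNIV. tail v (gen u * (tail u f * g)))"
    by (simp add: tail_sum)
  then show ?thesis by (cases v) (simp_all add: sum_var)
qed


subsection \<open>Grading\<close>

lemma homog_iff: "f \<in> homog n \<longleftrightarrow> (\<forall>l. length l \<noteq> n \<longrightarrow> lk f l = 0)"
proof
  assume f: "f \<in> homog n"
  show "\<forall>l. length l \<noteq> n \<longrightarrow> lk f l = 0"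
  proof (intro allI impI)
    fix l :: "var list" assume "length l \<noteq> n"
    then have "Word l \<notin> Poly_Mapping.keys f" using f unfolding homog_def by force
    then show "lk f l = 0" by (simp add: in_keys_iff)
  qed
next
  assume h: "\<forall>l. length l \<noteq> n \<longrightarrow> lk f l = 0"
  show "f \<in> homog n"
    unfolding homog_def
  proof clarify
    fix w assume "w \<in> Poly_Mapping.keys f"
    then show "length (letters w) = n" using h[rule_format, of "letters w"] by (auto simp: in_keys_iff)
  qed
qed

lemma homog_subspace: "fa.subspace (homog n)"
  by (auto simp: fa.subspace_def homog_iff lookup_add lookup_smul)

lemma homog_zero [simp]: "0 \<in> homog n"
  and homog_add [intro]: "f \<in> homog n \<Longrightarrow> g \<in> homog n \<Longrightarrow> f + g \<in> homog n"
  and homog_diff [intro]: "f \<in> homog n \<Longrightarrow> g \<in> homog n \<Longrightarrow> f - g \<in> homog n"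
  and homog_uminus [intro]: "f \<in> homog n \<Longrightarrow> - f \<in> homog n"
  and homog_smul [intro]: "f \<in> homog n \<Longrightarrow> c *\<^sub>s f \<in> homog n"
  by (auto simp: homog_iff lookup_add lookup_minus lookup_smul)

lemma homog_sum: "(\<And>x. x \<in> A \<Longrightarrow> f x \<in> homog n) \<Longrightarrow> sum f A \<in> homog n"
  using fa.subspace_sum[OF homog_subspace] .

lemma homog_mon: "mon l \<in> homog n \<longleftrightarrow> length l = n"
  by (auto simp: homog_iff lookup_mon)

lemma homog_gen [simp]: "gen v \<in> homog (Suc 0)"
  by (simp add: gen_eq_mon homog_mon)

lemma homog_one [simp]: "1 \<in> homog 0"
  by (simp add: one_eq_mon homog_mon)

lemma homog_mult: "f \<in> homog m \<Longrightarrow> g \<in> homog n \<Longrightarrow> f * g \<in> homog (m + n)"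
  using keys_mult[of f g] by (fastforce simp: homog_def plus_word_def)

lemma homog_gen_mult: "f \<in> homog n \<Longrightarrow> gen v * f \<in> homog (Suc n)"
  using homog_mult[OF homog_gen, of f n v] by simp

lemma homog_lin_mult: "u \<in> homog (Suc 0) \<Longrightarrow> f \<in> homog n \<Longrightarrow> u * f \<in> homog (Suc n)"
  using homog_mult[of u "Suc 0" f n] by simp

lemma homog_quad_mult: "u \<in> homog 2 \<Longrightarrow> f \<in> homog n \<Longrightarrow> u * f \<in> homog (Suc (Suc n))"
  using homog_mult[of u 2 f n] by simp

lemma homog_tail: "f \<in> homog (Suc n) \<Longrightarrow> tail v f \<in> homog n"
  by (auto simp: homog_iff lookup_tail)

lemma homog_expand: "f \<in> homog (Suc n) \<Longrightarrow> f = (\<Sum>v\<in>UNIV. gen v * tail v f)"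
  by (subst tail_expand) (simp add: homog_iff)

lemma homog_0_eq: "f \<in> homog 0 \<Longrightarrow> f = lk f [] *\<^sub>s 1"
  by (rule free_alg_eqI) (auto simp: homog_iff lookup_smul one_eq_mon lookup_mon)

definition part :: "nat \<Rightarrow> 'k::field free_alg \<Rightarrow> 'k free_alg"
  where "part n f = (\<Sum>w\<in>{w \<in> Poly_Mapping.keys f. length (letters w) = n}.
    Poly_Mapping.single w (Poly_Mapping.lookup f w))"

lemma lookup_part: "lk (part n f) l = (if length l = n then lk f l else 0)"
proof -
  have "lk (part n f) l = (\<Sum>w\<in>{w \<in> Poly_Mapping.keys f. length (letters w) = n}.
      if w = Word l then lk f l else 0)"
    unfolding part_def lookup_sum by (intro sum.cong) (auto simp: lookup_single when_def)
  also have "\<dots> = (if length l = n then lk f l else 0)"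
    by (auto simp: sum.delta in_keys_iff)
  finally show ?thesis .
qed

lemma part_homog [simp]: "part n f \<in> homog n"
  by (auto simp: homog_iff lookup_part)

lemma part_add: "part n (f + g) = part n f + part n g"
  and part_diff: "part n (f - g) = part n f - part n g"
  and part_smul: "part n (c *\<^sub>s f) = c *\<^sub>s part n f"
  and part_zero [simp]: "part n 0 = 0"
  by (auto intro!: free_alg_eqI simp: lookup_part lookup_add lookup_minus lookup_smul)

lemma part_sum: "part n (sum f A) = (\<Sum>x\<in>A. part n (f x))"
  by (induction A rule: infinite_finite_induct) (auto simp: part_add)

lemma part_of_homog: "f \<in> homog m \<Longrightarrow> part n f = (if m = n then f else 0)"
  by (auto intro!: free_alg_eqI simp: lookup_part homog_iff)

lemma finite_parts: obtains N where "\<And>n. n \<ge> N \<Longrightarrow> part n f = 0" "f = (\<Sum>n<N. part n f)"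
proof -
  define N where "N = Suc (Max (insert 0 ((length \<circ> letters) ` Poly_Mapping.keys f)))"
  have N: "lk f l = 0" if "length l \<ge> N" for l
  proof (rule ccontr)
    assume "lk f l \<noteq> 0"
    then have "length l \<in> (length \<circ> letters) ` Poly_Mapping.keys f"
      by (force simp: in_keys_iff image_iff)
    then have "length l \<le> Max (insert 0 ((length \<circ> letters) ` Poly_Mapping.keys f))"
      by (intro Max_ge) auto
    then show False using that N_def by simp
  qed
  have "part n f = 0" if "n \<ge> N" for n
    using N that by (intro free_alg_eqI) (auto simp: lookup_part)
  moreover have "f = (\<Sum>n<N. part n f)"
    by (rule free_alg_eqI) (use N not_less in \<open>auto simp: lookup_sum lookup_part sum.delta\<close>)
  ultimately show ?thesis using that by blast
qed

lemma part_mult_homog: "u \<in> homog k \<Longrightarrow> part (k + n) (u * f) = u * part n f"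
proof -
  assume u: "u \<in> homog k"
  obtain N where N: "\<And>n. n \<ge> N \<Longrightarrow> part n f = 0" "f = (\<Sum>n<N. part n f)"
    using finite_parts by blast
  have "part (k + n) (u * f) = (\<Sum>m<N. part (k + n) (u * part m f))"
    by (subst N(2)) (simp add: sum_distrib_left part_sum)
  also have "\<dots> = (\<Sum>m<N. if m = n then u * part n f else 0)"
    by (intro sum.cong refl, subst part_of_homog[OF homog_mult[OF u part_homog]]) auto
  also have "\<dots> = u * part n f" using N(1)[of n] by (auto simp: sum.delta not_less)
  finally show ?thesis .
qed

lemma part_mult_homog_low: "u \<in> homog k \<Longrightarrow> n < k \<Longrightarrow> part n (u * f) = 0"
proof -
  assume u: "u \<in> homog k" and "n < k"
  obtain N where N: "\<And>n. n \<ge> N \<Longrightarrow> part n f = 0" "f = (\<Sum>n<N. part n f)"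
    using finite_parts by blast
  have "part n (u * f) = (\<Sum>m<N. part n (u * part m f))"
    by (subst N(2)) (simp add: sum_distrib_left part_sum)
  also have "\<dots> = 0"
    by (intro sum.neutral ballI, subst part_of_homog[OF homog_mult[OF u part_homog]])
       (use \<open>n < k\<close> in auto)
  finally show ?thesis .
qed


subsection \<open>Combinations with coefficients in a subspace\<close>

definition ssum :: "'a::ab_group_add set \<Rightarrow> 'a set \<Rightarrow> 'a set"
  where "ssum S T = {x + y | x y. x \<in> S \<and> y \<in> T}"

lemma ssumI: "x \<in> S \<Longrightarrow> y \<in> T \<Longrightarrow> x + y \<in> ssum S T"
  unfolding ssum_def by blast

lemma ssumE:
  assumes "z \<in> ssum S T" obtains x y where "x \<in> S" "y \<in> T" "z = x + y"
  using assms unfolding ssum_def by blast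

lemmas ssum_subspace = fa.subspace_sums[folded ssum_def]
lemmas ssum_fin_spanned = fa.fin_spanned_sums[folded ssum_def]
lemmas dim_ssum = fa.dim_sums_Int'[folded ssum_def]

definition combos :: "(var \<Rightarrow> 'k::field free_alg) \<Rightarrow> 'k free_alg set \<Rightarrow> 'k free_alg set"
  where "combos g S = {\<Sum>v\<in>UNIV. g v * s v | s. \<forall>v. s v \<in> S}"

text \<open>Freeness of the right ideal generated by the three elements; it makes
  \<open>combos g S\<close> a direct sum of three copies of \<open>S\<close>.\<close>

definition right_indep :: "(var \<Rightarrow> 'k::field free_alg) \<Rightarrow> bool"
  where "right_indep g \<longleftrightarrow> (\<forall>s. (\<Sum>v\<in>UNIV. g v * s v) = 0 \<longrightarrow> (\<forall>v. s v = 0))"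

lemma combosI: "(\<And>v. s v \<in> S) \<Longrightarrow> (\<Sum>v\<in>UNIV. g v * s v) \<in> combos g S"
  unfolding combos_def by blast

lemma combosE:
  assumes "f \<in> combos g S"
  obtains s where "\<forall>v. s v \<in> S" "f = (\<Sum>v\<in>UNIV. g v * s v)"
  using assms unfolding combos_def by blast

lemma combos_single:
  assumes "s \<in> S" "fa.subspace S"
  shows "g v * s \<in> combos g S"
proof -
  have "(\<Sum>u\<in>UNIV. g u * (if u = v then s else 0)) \<in> combos g S"
    by (rule combosI) (use assms fa.subspace_0 in auto)
  then show ?thesis by (cases v) (simp_all add: sum_var)
qed

lemma combos_sum_eq:
  "combos g S = ssum (ssum ((*) (g VX) ` S) ((*) (g VY) ` S)) ((*) (g VZ) ` S)" (is "_ = ?R")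
proof
  show "combos g S \<subseteq> ?R" by (auto simp: combos_def sum_var intro!: ssumI)
  show "?R \<subseteq> combos g S"
  proof
    fix f assume "f \<in> ?R"
    then obtain a b c where "a \<in> S" "b \<in> S" "c \<in> S" and f: "f = g VX * a + g VY * b + g VZ * c"
      by (auto elim!: ssumE)
    then have "(\<Sum>v\<in>UNIV. g v * (case v of VX \<Rightarrow> a | VY \<Rightarrow> b | VZ \<Rightarrow> c)) \<in> combos g S"
      by (intro combosI) (simp split: var.split)
    then show "f \<in> combos g S" by (simp add: sum_var f)
  qed
qed

lemma subspace_image_mult:
  "fa.subspace S \<Longrightarrow> fa.subspace ((*) g ` S)"
  unfolding fa.subspace_def
  by (auto simp: image_iff) (metis mult_zero_right, metis distrib_left, metis smul_mult_right)

lemma fin_spanned_image_mult: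
  assumes "fa.fin_spanned S" shows "fa.fin_spanned ((*) g ` S)"
proof -
  interpret Vector_Spaces.linear smul smul "(*) g" by (rule smul_linear_left)
  show ?thesis using assms spans_image unfolding fa.fin_spanned_def by (metis finite_imageI)
qed

lemma combos_subspace: "fa.subspace S \<Longrightarrow> fa.subspace (combos g S)"
  by (simp add: combos_sum_eq ssum_subspace subspace_image_mult)

lemma combos_fin_spanned: "fa.fin_spanned S \<Longrightarrow> fa.fin_spanned (combos g S)"
  by (simp add: combos_sum_eq ssum_fin_spanned fin_spanned_image_mult)

lemma dim_mult_image:
  assumes "\<And>s. g * s = 0 \<Longrightarrow> s = 0" "fa.subspace S"
  shows "fa.dim ((*) g ` S) = fa.dim S"
proof (rule dim_linear_image[OF smul_linear_left assms(2)])
  show "inj_on ((*) g) S"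
  proof (rule inj_onI)
    fix x y assume "g * x = g * y"
    then have "g * (x - y) = 0" by (simp add: algebra_simps)
    then show "x = y" using assms(1) by fastforce
  qed
qed

lemma right_indepD:
  assumes "right_indep g" "g VX * a + g VY * b + g VZ * c = 0"
  shows "a = 0" "b = 0" "c = 0"
proof -
  have "(\<Sum>v\<in>UNIV. g v * (case v of VX \<Rightarrow> a | VY \<Rightarrow> b | VZ \<Rightarrow> c)) = 0"
    using assms(2) by (simp add: sum_var)
  then have "\<forall>v. (case v of VX \<Rightarrow> a | VY \<Rightarrow> b | VZ \<Rightarrow> c) = 0"
    using assms(1) unfolding right_indep_def by blast
  then show "a = 0" "b = 0" "c = 0" by (metis var.case)+
qed

lemma right_indep_inj:
  assumes "right_indep g" "(\<Sum>v\<in>UNIV. g v * s v) = (\<Sum>v\<in>UNIV. g v * t v)"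
  shows "s = t"
proof -
  have "(\<Sum>v\<in>UNIV. g v * (s v - t v)) = 0"
    using assms(2) by (simp add: right_diff_distrib sum_subtractf)
  then have "\<forall>v. s v - t v = 0" using assms(1) unfolding right_indep_def by (elim allE[of _ "\<lambda>v. s v - t v"]) simp
  then show ?thesis by auto
qed

lemma dim_0: "fa.dim {0} = 0"
  by (metis fa.dim_span fa.span_empty fa.independent_empty fa.dim_eq_card_independent card.empty)

lemma dim_combos:
  assumes "right_indep g" "fa.subspace S" "fa.fin_spanned S"
  shows "fa.dim (combos g S) = 3 * fa.dim S"
proof -
  define X Y Z where "X = (*) (g VX) ` S" and "Y = (*) (g VY) ` S" and "Z = (*) (g VZ) ` S"
  have i: "s = 0" if "g v * s = 0" for v s
    using that right_indepD[OF assms(1), of s 0 0] right_indepD[OF assms(1), of 0 s 0]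
      right_indepD[OF assms(1), of 0 0 s] by (cases v) auto
  have sub: "fa.subspace X" "fa.subspace Y" "fa.subspace Z"
    and fin: "fa.fin_spanned X" "fa.fin_spanned Y" "fa.fin_spanned Z"
    unfolding X_def Y_def Z_def using subspace_image_mult fin_spanned_image_mult assms by auto
  have dims: "fa.dim X = fa.dim S" "fa.dim Y = fa.dim S" "fa.dim Z = fa.dim S"
    unfolding X_def Y_def Z_def using dim_mult_image[OF i assms(2)] by auto
  have "X \<inter> Y \<subseteq> {0}"
  proof
    fix x assume "x \<in> X \<inter> Y"
    then have "x \<in> X" "x \<in> Y" by auto
    then obtain a where a: "x = g VX * a" unfolding X_def by blast
    from \<open>x \<in> Y\<close> obtain b where "x = g VY * b" unfolding Y_def by blast
    with a show "x \<in> {0}" using right_indepD(1)[OF assms(1), of a "- b" 0] by simp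
  qed
  then have XY: "X \<inter> Y = {0}" using sub fa.subspace_0 by blast
  have "ssum X Y \<inter> Z \<subseteq> {0}"
  proof
    fix x assume "x \<in> ssum X Y \<inter> Z"
    then have "x \<in> ssum X Y" "x \<in> Z" by auto
    then obtain c where c: "x = g VZ * c" unfolding Z_def by blast
    from \<open>x \<in> ssum X Y\<close> obtain a b where "x = g VX * a + g VY * b"
      unfolding X_def Y_def by (blast elim: ssumE)
    with c show "x \<in> {0}" using right_indepD(3)[OF assms(1), of a b "- c"] by simp
  qed
  then have XYZ: "ssum X Y \<inter> Z = {0}" using sub fa.subspace_0 ssum_subspace by blast
  have "fa.dim (ssum X Y) = fa.dim X + fa.dim Y"
    "fa.dim (ssum (ssum X Y) Z) = fa.dim (ssum X Y) + fa.dim Z"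
    using dim_ssum[OF sub(1,2) fin(1,2)] XY XYZ
      dim_ssum[OF ssum_subspace[OF sub(1,2)] sub(3) ssum_fin_spanned[OF fin(1,2)] fin(3)] by (simp_all add: dim_0)
  then show ?thesis using combos_sum_eq[of g S] dims unfolding X_def Y_def Z_def by auto
qed

lemma right_indep_gen: "right_indep gen"
  unfolding right_indep_def
proof (intro allI impI)
  fix s v assume "(\<Sum>u\<in>UNIV. gen u * s u) = (0 :: 'a free_alg)"
  then have "tail v (\<Sum>u\<in>UNIV. gen u * s u) = 0" by simp
  then show "s v = 0" by (cases v) (simp_all add: tail_sum sum_var)
qed

lemma homog_Suc: "homog (Suc n) = combos gen (homog n :: 'k::field free_alg set)"
proof
  show "homog (Suc n) \<subseteq> combos gen (homog n :: 'k free_alg set)"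
  proof
    fix f :: "'k free_alg" assume "f \<in> homog (Suc n)"
    then show "f \<in> combos gen (homog n)"
      using homog_expand[of f n] combosI[of "\<lambda>v. tail v f" "homog n" gen] homog_tail by metis
  qed
  show "combos gen (homog n) \<subseteq> (homog (Suc n) :: 'k free_alg set)"
    unfolding combos_def by (auto intro!: homog_sum homog_gen_mult)
qed

lemma homog_0_span: "homog 0 = fa.span {1}"
  using homog_0_eq by (force simp: fa.span_singleton homog_smul)

lemma homog_fin_spanned: "fa.fin_spanned (homog n)"
proof (induction n)
  case 0
  then show ?case unfolding fa.fin_spanned_def homog_0_span by (intro exI[of _ "{1}"]) simp
next
  case (Suc n)
  then show ?case by (simp add: homog_Suc combos_fin_spanned homog_subspace)
qed

lemma dim_homog: "fa.dim (homog n :: 'k::field free_alg set) = 3 ^ n"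
proof (induction n)
  case 0
  have "fa.independent {1 :: 'k free_alg}" by simp
  then show ?case unfolding homog_0_span by (subst fa.dim_span_eq_card_independent) auto
next
  case (Suc n)
  then show ?case
    by (simp add: homog_Suc dim_combos right_indep_gen homog_subspace homog_fin_spanned)
qed


section \<open>Quadratic algebras\<close>

text \<open>A product \<open>u r_v w\<close> of words around a relation starts either with a letter
  of \<open>u\<close> or with the relation itself. Sorting by this builds the two-sided ideal degree
  by degree from right combinations only, and the intersection of the two summands becomes the space
  of syzygies.\<close>

fun rel_part :: "(var \<Rightarrow> 'k::field free_alg) \<Rightarrow> nat \<Rightarrow> 'k free_alg set" where
  "rel_part r 0 = {0}"
| "rel_part r (Suc 0) = {0}"
| "rel_part r (Suc (Suc n)) =
    ssum (combos gen (rel_part r (Suc n))) (combos r (homog n))"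

lemma rel_part_subspace: "fa.subspace (rel_part r n)"
  by (induction r n rule: rel_part.induct)
     (simp_all add: ssum_subspace combos_subspace homog_subspace)

lemma rel_part_gen_mult:
  assumes "f \<in> rel_part r n" shows "gen v * f \<in> rel_part r (Suc n)"
proof (cases n)
  case (Suc m)
  have "gen v * f + 0 \<in> rel_part r (Suc n)"
    unfolding Suc rel_part.simps
    by (intro ssumI combos_single rel_part_subspace fa.subspace_0 combos_subspace homog_subspace)
       (use assms Suc in simp)
  then show ?thesis by simp
qed (use assms in simp)

lemma rel_part_rel_mult:
  assumes "f \<in> homog n" shows "r v * f \<in> rel_part r (Suc (Suc n))"
proof -
  have "0 + r v * f \<in> rel_part r (Suc (Suc n))"
    unfolding rel_part.simps
    by (intro ssumI combos_single rel_part_subspace fa.subspace_0 combos_subspace homog_subspace)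
       (rule assms)
  then show ?thesis by simp
qed

lemma rel_part_zero [simp]: "0 \<in> rel_part r n"
  by (simp add: fa.subspace_0 rel_part_subspace)

lemma rel_part_add: "f \<in> rel_part r n \<Longrightarrow> g \<in> rel_part r n \<Longrightarrow> f + g \<in> rel_part r n"
  by (simp add: fa.subspace_add rel_part_subspace)

lemma rel_part_diff: "f \<in> rel_part r n \<Longrightarrow> g \<in> rel_part r n \<Longrightarrow> f - g \<in> rel_part r n"
  by (simp add: fa.subspace_diff rel_part_subspace)

lemma rel_part_smul: "f \<in> rel_part r n \<Longrightarrow> c *\<^sub>s f \<in> rel_part r n"
  by (simp add: fa.subspace_scale rel_part_subspace)

lemma rel_part_sum: "(\<And>x. x \<in> A \<Longrightarrow> f x \<in> rel_part r n) \<Longrightarrow> sum f A \<in> rel_part r n"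
  by (rule fa.subspace_sum[OF rel_part_subspace])

lemma rel_part_induct [consumes 1, case_names zero gen rel add]:
  assumes "f \<in> rel_part r n"
    and zero: "\<And>n. P n 0"
    and gen: "\<And>n f v. f \<in> rel_part r n \<Longrightarrow> P n f \<Longrightarrow> P (Suc n) (gen v * f)"
    and rel: "\<And>n f v. f \<in> homog n \<Longrightarrow> P (Suc (Suc n)) (r v * f)"
    and add: "\<And>n f g. P n f \<Longrightarrow> P n g \<Longrightarrow> P n (f + g)"
  shows "P n f"
  using assms(1)
proof (induction n arbitrary: f)
  case (Suc m)
  show ?case
  proof (cases m)
    case 0
    then show ?thesis using Suc.prems zero by simp
  next
    case (Suc k)
    have "f \<in> ssum (combos gen (rel_part r m)) (combos r (homog k))"
      using Suc.prems by (simp add: Suc)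
    then obtain a b where ab: "a \<in> combos gen (rel_part r m)" "b \<in> combos r (homog k)" "f = a + b"
      by (rule ssumE)
    obtain s where s: "\<forall>v. s v \<in> rel_part r m" and a: "a = (\<Sum>v\<in>UNIV. gen v * s v)"
      using ab(1) by (rule combosE)
    obtain t where t: "\<forall>v. t v \<in> homog k" and b: "b = (\<Sum>v\<in>UNIV. r v * t v)"
      using ab(2) by (rule combosE)
    have f: "f = (\<Sum>v\<in>UNIV. gen v * s v) + (\<Sum>v\<in>UNIV. r v * t v)" using ab a b by simp
    have "P (Suc m) (gen v * s v)" for v using gen[OF s[rule_format]] Suc.IH[OF s[rule_format]] by blast
    moreover have "P (Suc m) (r v * t v)" for v using rel[OF t[rule_format]] Suc by simp
    ultimately show ?thesis unfolding f sum_var by (intro add)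
  qed
qed (simp add: zero)

definition quadratic :: "(var \<Rightarrow> 'k::field free_alg) \<Rightarrow> bool"
  where "quadratic r \<longleftrightarrow> (\<forall>v. r v \<in> homog 2)"

lemma quadraticD: "quadratic r \<Longrightarrow> r v \<in> homog 2"
  by (simp add: quadratic_def)

lemma rel_part_homog:
  assumes "quadratic r" "f \<in> rel_part r n"
  shows "f \<in> homog n"
  using assms(2)
  by (induction rule: rel_part_induct)
     (simp_all add: homog_gen_mult homog_quad_mult quadraticD[OF assms(1)] homog_add)

lemma rel_part_fin_spanned:
  assumes "quadratic r" shows "fa.fin_spanned (rel_part r n)"
proof (rule fa.fin_spanned_subset[OF homog_fin_spanned])
  show "rel_part r n \<subseteq> homog n" using rel_part_homog[OF assms] by (rule subsetI)
qed

lemma rel_part_homog_mult: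
  assumes "f \<in> rel_part r n" "g \<in> homog m" shows "f * g \<in> rel_part r (n + m)"
  using assms(1)
proof (induction rule: rel_part_induct)
  case (gen n f v)
  then show ?case using rel_part_gen_mult[of "f * g" r "n + m" v] by (simp add: mult.assoc)
next
  case (rel n f v)
  then show ?case
    using rel_part_rel_mult[OF homog_mult[OF rel assms(2)], of r v] by (simp add: mult.assoc)
qed (auto simp: distrib_right intro: rel_part_add)

lemma rel_part_homog_left_mult:
  assumes "f \<in> rel_part r n" "g \<in> homog m" shows "g * f \<in> rel_part r (m + n)"
  using assms(2)
proof (induction m arbitrary: g)
  case 0
  then show ?case using homog_0_eq[OF 0] rel_part_smul[OF assms(1)]
    by (metis add_0 mult_1 smul_mult_left)
next
  case (Suc m)
  have "(\<Sum>v\<in>UNIV. gen v * (tail v g * f)) \<in> rel_part r (Suc m + n)"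
    using rel_part_gen_mult[OF Suc.IH[OF homog_tail[OF Suc.prems]]]
    by (intro rel_part_sum) simp
  then show ?case
    by (subst homog_expand[OF Suc.prems]) (simp add: sum_distrib_right mult.assoc)
qed


subsection \<open>The ideal of relations\<close>

lemma free_ring_simps [simp]:
  "carrier free_ring = UNIV" "monoid.mult free_ring = (*)" "monoid.one free_ring = 1" "ring.zero free_ring = 0"
  "ring.add free_ring = (+)"
  by (simp_all add: free_ring_def)

interpretation free_ring: ring free_ring by (rule ring_free_ring)

lemma free_ring_minus [simp]: "a_inv free_ring f = - f"
  by (rule free_ring.minus_equality) auto

lemma free_ring_ideal_iff:
  "ideal I free_ring \<longleftrightarrow>
    0 \<in> I \<and> (\<forall>f\<in>I. \<forall>g\<in>I. f - g \<in> I) \<and> (\<forall>f\<in>I. \<forall>g. f * g \<in> I \<and> g * f \<in> I)" (is "_ \<longleftrightarrow> ?R")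
proof
  assume I: "ideal I free_ring"
  then interpret ideal I free_ring .
  show ?R
  proof (intro conjI ballI allI)
    show "0 \<in> I" using zero_closed by simp
    show "f - g \<in> I" if "f \<in> I" "g \<in> I" for f g
      using a_closed[OF that(1) a_inv_closed[OF that(2)]] by simp
    show "f * g \<in> I" if "f \<in> I" for f g using I_r_closed[OF that, of g] by simp
    show "g * f \<in> I" if "f \<in> I" for f g using I_l_closed[OF that, of g] by simp
  qed
next
  assume R: ?R
  then have neg: "- f \<in> I" if "f \<in> I" for f using that diff_0[of f] by metis
  have add: "f + g \<in> I" if "f \<in> I" "g \<in> I" for f g
    using R neg that by (metis diff_minus_eq_add)
  show "ideal I free_ring"
  proof (rule idealI[OF ring_free_ring])
    show "subgroup I (add_monoid free_ring)"
    proof (rule subgroup.intro)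
      show "inv\<^bsub>add_monoid free_ring\<^esub> f \<in> I" if "f \<in> I" for f
        using neg[OF that] free_ring_minus[of f] by (metis a_inv_def)
    qed (use R add in auto)
  qed (use R in auto)
qed

definition graded_hull :: "(nat \<Rightarrow> 'k::field free_alg set) \<Rightarrow> 'k free_alg set"
  where "graded_hull J = {f. \<forall>n. part n f \<in> J n}"

text \<open>The graded hull is itself an ideal, since a homogeneous part of a product is a sum of
  products of parts. Conversely, every element of \<open>rel_part\<close> is produced by operations
  under which an ideal is closed.\<close>

lemma rel_ideal_eq:
  fixes r :: "var \<Rightarrow> 'k::field free_alg"
  assumes r: "quadratic r"
  shows "rel_ideal (range r) = graded_hull (rel_part r)"
proof
  have ideal: "ideal (graded_hull (rel_part r)) free_ring"
    unfolding free_ring_ideal_iff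
  proof (intro conjI ballI allI)
    show "0 \<in> graded_hull (rel_part r)" by (simp add: graded_hull_def)
    show "f - g \<in> graded_hull (rel_part r)"
      if "f \<in> graded_hull (rel_part r)" "g \<in> graded_hull (rel_part r)" for f g
      using that by (simp add: graded_hull_def part_diff rel_part_diff)
    fix f g :: "'k free_alg" assume f: "f \<in> graded_hull (rel_part r)"
    obtain M where M: "f = (\<Sum>n<M. part n f)" using finite_parts by blast
    obtain N where N: "g = (\<Sum>n<N. part n g)" using finite_parts by blast
    have fn: "part n f \<in> rel_part r n" for n using f by (simp add: graded_hull_def)
    have *: "part k u \<in> rel_part r k" if "u \<in> rel_part r m" for k m u
      using that part_of_homog[OF rel_part_homog[OF r that], of k] by auto
    have "f * g = (\<Sum>m<M. \<Sum>n<N. part m f * part n g)"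
      by (subst M, subst N) (simp add: sum_product)
    then show "f * g \<in> graded_hull (rel_part r)"
      using *[OF rel_part_homog_mult[OF fn part_homog]]
      by (simp add: graded_hull_def part_sum rel_part_sum)
    have "g * f = (\<Sum>n<N. \<Sum>m<M. part n g * part m f)"
      by (subst M, subst N) (simp add: sum_product)
    then show "g * f \<in> graded_hull (rel_part r)"
      using *[OF rel_part_homog_left_mult[OF fn part_homog]]
      by (simp add: graded_hull_def part_sum rel_part_sum)
  qed
  have "r v \<in> graded_hull (rel_part r)" for v
    using rel_part_rel_mult[of 1 0 r v] part_of_homog[OF quadraticD[OF r, of v]]
    by (auto simp: graded_hull_def numeral_2_eq_2)
  then show "rel_ideal (range r) \<subseteq> graded_hull (rel_part r)"
    unfolding rel_ideal_def by (intro free_ring.genideal_minimal[OF ideal]) auto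
  have I: "ideal (rel_ideal (range r)) free_ring"
    unfolding rel_ideal_def by (rule free_ring.genideal_ideal) simp
  have rI: "r v \<in> rel_ideal (range r)" for v
    using free_ring.genideal_self[of "range r"] unfolding rel_ideal_def by auto
  have add: "f + g \<in> rel_ideal (range r)" if "f \<in> rel_ideal (range r)" "g \<in> rel_ideal (range r)" for f g
    using additive_subgroup.a_closed[OF ideal.axioms(1)[OF I] that] by simp
  have zero: "0 \<in> rel_ideal (range r)"
    and mult: "\<And>f g. f \<in> rel_ideal (range r) \<Longrightarrow> f * g \<in> rel_ideal (range r) \<and> g * f \<in> rel_ideal (range r)"
    using I[unfolded free_ring_ideal_iff] by blast+
  have *: "f \<in> rel_ideal (range r)" if "f \<in> rel_part r n" for f n
    using that
  proof (induction rule: rel_part_induct)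
    case (rel n f v) then show ?case using rI mult by blast
  next
    case (gen n f v) then show ?case using mult by blast
  qed (simp_all add: add zero)
  show "graded_hull (rel_part r) \<subseteq> rel_ideal (range r)"
  proof
    fix f assume f: "f \<in> graded_hull (rel_part r)"
    obtain M where M: "f = (\<Sum>n<M. part n f)" using finite_parts by blast
    have "(\<Sum>n\<in>A. part n f) \<in> rel_ideal (range r)" for A
      by (induction A rule: infinite_finite_induct)
         (use zero add[OF *] f in \<open>auto simp: graded_hull_def\<close>)
    then show "f \<in> rel_ideal (range r)" using M by metis
  qed
qed


subsection \<open>The quotient algebra\<close>

lemma rel_ideal_ideal: "ideal (rel_ideal R) free_ring"
  unfolding rel_ideal_def by (rule free_ring.genideal_ideal) simp

lemma rel_ideal_zero [simp]: "0 \<in> rel_ideal R"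
  and rel_ideal_diff: "f \<in> rel_ideal R \<Longrightarrow> g \<in> rel_ideal R \<Longrightarrow> f - g \<in> rel_ideal R"
  and rel_ideal_mult_right: "f \<in> rel_ideal R \<Longrightarrow> f * g \<in> rel_ideal R"
  and rel_ideal_mult_left: "f \<in> rel_ideal R \<Longrightarrow> g * f \<in> rel_ideal R"
  using rel_ideal_ideal[of R, unfolded free_ring_ideal_iff] by blast+

lemma rel_ideal_add: "f \<in> rel_ideal R \<Longrightarrow> g \<in> rel_ideal R \<Longrightarrow> f + g \<in> rel_ideal R"
  using rel_ideal_diff[of f R "0 - g"] rel_ideal_diff[of 0 R g] by simp

lemma rel_ideal_smul: "f \<in> rel_ideal R \<Longrightarrow> c *\<^sub>s f \<in> rel_ideal R"
  by (simp add: smul_def rel_ideal_mult_left)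

lemma rel_ideal_subset: "R \<subseteq> rel_ideal R"
  unfolding rel_ideal_def by (rule free_ring.genideal_self) simp

lemma rel_ideal_sum: "(\<And>x. x \<in> A \<Longrightarrow> f x \<in> rel_ideal R) \<Longrightarrow> sum f A \<in> rel_ideal R"
  by (induction A rule: infinite_finite_induct) (auto intro: rel_ideal_add)

lemma cls_hom: "ring_hom_ring free_ring (alg R) (cls R)"
  using ideal.rcos_ring_hom_ring[OF rel_ideal_ideal, of R]
  unfolding alg_def cls_def[abs_def] .

lemma alg_ring: "ring (alg R)"
  unfolding alg_def by (rule ideal.quotient_is_ring[OF rel_ideal_ideal])

lemma carrier_alg: "carrier (alg R) = range (cls R)"
  unfolding alg_def cls_def FactRing_def A_RCOSETS_def RCOSETS_def a_r_coset_def
  by auto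

lemma cls_closed [simp]: "cls R f \<in> carrier (alg R)"
  by (simp add: carrier_alg)

lemma cls_add: "cls R (f + g) = cls R f \<oplus>\<^bsub>alg R\<^esub> cls R g"
  and cls_mult: "cls R (f * g) = cls R f \<otimes>\<^bsub>alg R\<^esub> cls R g"
  and cls_zero: "cls R 0 = \<zero>\<^bsub>alg R\<^esub>"
  and cls_one: "cls R 1 = \<one>\<^bsub>alg R\<^esub>"
proof -
  interpret ring_hom_ring free_ring "alg R" "cls R" by (rule cls_hom)
  show "cls R (f + g) = cls R f \<oplus>\<^bsub>alg R\<^esub> cls R g" using hom_add[of f g] by simp
  show "cls R (f * g) = cls R f \<otimes>\<^bsub>alg R\<^esub> cls R g" using hom_mult[of f g] by simp
  show "cls R 0 = \<zero>\<^bsub>alg R\<^esub>" using hom_zero by simp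
  show "cls R 1 = \<one>\<^bsub>alg R\<^esub>" using hom_one by simp
qed

lemma mem_cls: "g \<in> cls R f \<longleftrightarrow> g - f \<in> rel_ideal R"
  by (auto simp: cls_def a_r_coset_def r_coset_def image_iff) (metis diff_add_cancel)

lemma cls_eq_iff: "cls R f = cls R g \<longleftrightarrow> f - g \<in> rel_ideal R"
proof
  assume "cls R f = cls R g"
  moreover have "f \<in> cls R f" by (simp add: mem_cls)
  ultimately show "f - g \<in> rel_ideal R" by (simp add: mem_cls)
next
  assume fg: "f - g \<in> rel_ideal R"
  show "cls R f = cls R g"
  proof (rule Set.set_eqI)
    fix h
    have "h - g \<in> rel_ideal R" if "h - f \<in> rel_ideal R"
      using rel_ideal_add[OF fg that] by simp
    moreover have "h - f \<in> rel_ideal R" if "h - g \<in> rel_ideal R"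
      using rel_ideal_diff[OF that fg] by simp
    ultimately show "h \<in> cls R f \<longleftrightarrow> h \<in> cls R g" by (auto simp: mem_cls)
  qed
qed

lemma cls_eq_zero_iff: "cls R f = \<zero>\<^bsub>alg R\<^esub> \<longleftrightarrow> f \<in> rel_ideal R"
  using cls_eq_iff[of R f 0] by (simp add: cls_zero)

lemma scal_hom: "scal (a + b) = scal a + scal b" "scal (a * b) = scal a * scal b"
    "scal (- a) = - scal a" "scal 1 = 1" "scal 0 = 0"
  by (simp_all add: scal_def single_add mult_single single_uminus)

lemma lookup_scal: "lk (scal c) l = (if l = [] then c else 0)"
  by (simp add: scal_def lookup_single when_def zero_word_def)

lemma subfield_scal: "subfield (range scal) (free_ring :: 'k::field free_alg ring)"
proof (rule free_ring.subfieldI)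
  have sub: "subring (range scal) (free_ring :: 'k free_alg ring)"
  proof (rule free_ring.subringI)
    show "\<ominus>\<^bsub>free_ring\<^esub> h \<in> range scal" if h: "h \<in> range scal" for h :: "'k free_alg"
    proof -
      obtain c where "h = scal c" using h by (rule imageE)
      then show ?thesis by (simp flip: scal_hom)
    qed
    show "\<one>\<^bsub>free_ring\<^esub> \<in> range scal" by (simp add: scal_hom(4)[symmetric])
    show "h1 \<otimes>\<^bsub>free_ring\<^esub> h2 \<in> range scal" "h1 \<oplus>\<^bsub>free_ring\<^esub> h2 \<in> range scal"
      if "h1 \<in> range scal" "h2 \<in> range scal" for h1 h2 :: "'k free_alg"
      using that by (auto simp flip: scal_hom)
  qed simp
  show "subcring (range scal) (free_ring :: 'k free_alg ring)"
    by (rule free_ring.subcringI[OF sub]) (auto simp flip: scal_hom simp: mult.commute)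
  have u: "\<exists>g\<in>range scal. g \<otimes>\<^bsub>free_ring\<^esub> scal c = \<one>\<^bsub>free_ring\<^esub> \<and> scal c \<otimes>\<^bsub>free_ring\<^esub> g = \<one>\<^bsub>free_ring\<^esub>"
    if "c \<noteq> 0" for c :: 'k
    using that by (intro bexI[of _ "scal (inverse c)"]) (auto simp flip: scal_hom)
  show "Units (free_ring \<lparr>carrier := range scal\<rparr>) = (range scal - {\<zero>\<^bsub>free_ring\<^esub>} :: 'k free_alg set)"
  proof
    show "Units (free_ring \<lparr>carrier := range scal\<rparr>) \<subseteq> (range scal - {\<zero>\<^bsub>free_ring\<^esub>} :: 'k free_alg set)"
      by (auto simp: Units_def)
    show "(range scal - {\<zero>\<^bsub>free_ring\<^esub>} :: 'k free_alg set) \<subseteq> Units (free_ring \<lparr>carrier := range scal\<rparr>)"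
    proof
      fix f :: "'k free_alg" assume "f \<in> range scal - {\<zero>\<^bsub>free_ring\<^esub>}"
      then obtain c where "f = scal c" by auto
      moreover have "c \<noteq> 0" using \<open>f \<in> _\<close> calculation by (auto simp: scal_hom)
      ultimately show "f \<in> Units (free_ring \<lparr>carrier := range scal\<rparr>)" using u[of c] by (auto simp: Units_def)
    qed
  qed
qed

context
  fixes r :: "var \<Rightarrow> 'k::field free_alg"
  assumes r: "quadratic r"
begin

lemma mem_rel_ideal_iff: "f \<in> rel_ideal (range r) \<longleftrightarrow> (\<forall>n. part n f \<in> rel_part r n)"
  by (simp add: rel_ideal_eq[OF r] graded_hull_def)

lemma mem_rel_ideal_homog: "f \<in> homog n \<Longrightarrow> f \<in> rel_ideal (range r) \<longleftrightarrow> f \<in> rel_part r n"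
  by (auto simp: mem_rel_ideal_iff part_of_homog)

lemma rel_part_in_rel_ideal: "f \<in> rel_part r n \<Longrightarrow> f \<in> rel_ideal (range r)"
  using mem_rel_ideal_homog rel_part_homog[OF r] by blast

lemma one_notin_rel_ideal: "1 \<notin> rel_ideal (range r)"
  using mem_rel_ideal_homog[OF homog_one] by simp

lemma subfield_base: "subfield (base_field (range r)) (alg (range r))"
  unfolding base_field_def
proof (rule ring_hom_ring.img_is_subfield[OF cls_hom subfield_scal])
  show "\<one>\<^bsub>alg (range r)\<^esub> \<noteq> \<zero>\<^bsub>alg (range r)\<^esub>"
    using one_notin_rel_ideal by (simp add: cls_eq_zero_iff flip: cls_one)
qed

text \<open>The bridge between spans of lists over the image of the field in the quotient ring and
  spans in the free algebra.\<close>

lemma Span_cls: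
  "ring.Span (alg (range r)) (base_field (range r)) (map (cls (range r)) cs) = cls (range r) ` fa.span (set cs)"
proof (induction cs)
  case Nil
  then show ?case by (simp add: ring.Span.simps[OF alg_ring] cls_zero)
next
  case (Cons c cs)
  let ?A = "alg (range r)" and ?K = "base_field (range r)" and ?cls = "cls (range r)"
  have "ring.Span ?A ?K (map ?cls (c # cs)) = ring.line_extension ?A ?K (?cls c) (?cls ` fa.span (set cs))"
    using Cons by (simp add: ring.Span.simps[OF alg_ring])
  also have "\<dots> = {?cls (k *\<^sub>s c + g) | k g. g \<in> fa.span (set cs)}"
  proof -
    have "?cls (k *\<^sub>s c + g) = ?cls (scal k) \<otimes>\<^bsub>?A\<^esub> ?cls c \<oplus>\<^bsub>?A\<^esub> ?cls g" for k g
      by (simp add: smul_def cls_add cls_mult)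
    then show ?thesis
      by (intro Set.set_eqI)
         (simp add: ring.line_extension_mem_iff[OF alg_ring] base_field_def image_iff Bex_def, blast)
  qed
  also have "\<dots> = ?cls ` fa.span (set (c # cs))"
  proof -
    have "fa.span (set (c # cs)) = {k *\<^sub>s c + g | k g. g \<in> fa.span (set cs)}"
    proof (intro Set.set_eqI iffI)
      fix x assume "x \<in> fa.span (set (c # cs))"
      then obtain k where "x - k *\<^sub>s c \<in> fa.span (set cs)" by (auto simp: fa.span_insert)
      then show "x \<in> {k *\<^sub>s c + g | k g. g \<in> fa.span (set cs)}"
        by (intro CollectI exI[of _ k] exI[of _ "x - k *\<^sub>s c"]) simp
    next
      fix x assume "x \<in> {k *\<^sub>s c + g | k g. g \<in> fa.span (set cs)}"
      then obtain k g where "x = k *\<^sub>s c + g" "g \<in> fa.span (set cs)" by blast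
      then have "x - k *\<^sub>s c \<in> fa.span (set cs)" by simp
      then show "x \<in> fa.span (set (c # cs))" by (auto simp: fa.span_insert)
    qed
    then show ?thesis by auto
  qed
  finally show ?case .
qed

text \<open>A basis \<open>B\<close> of the relations of degree \<open>n\<close> is completed to a
  basis \<open>C\<close> of all elements of that degree; the classes of \<open>C - B\<close> are a
  basis of the component.\<close>

lemma dim_component:
  "ring.dim (alg (range r)) (base_field (range r)) (component (range r) n)
    = 3 ^ n - fa.dim (rel_part r n)" (is "ring.dim ?A ?K ?C = _")
proof -
  let ?cls = "cls (range r)"
  obtain B where B: "B \<subseteq> rel_part r n" "fa.independent B" "rel_part r n \<subseteq> fa.span B"
    "card B = fa.dim (rel_part r n)" using fa.basis_exists by blast
  have "B \<subseteq> homog n" using B(1) rel_part_homog[OF r] by (auto intro!: subsetI)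
  then obtain C where C: "B \<subseteq> C" "C \<subseteq> homog n" "fa.independent C" "homog n \<subseteq> fa.span C"
    using fa.maximal_independent_subset_extend[of B "homog n"] B by blast
  have fC: "finite C" using fa.independent_finite[OF homog_fin_spanned C(3,2)] .
  have cC: "card C = 3 ^ n" using C fa.basis_card_eq_dim dim_homog by metis
  obtain cs where cs: "set cs = C - B" "distinct cs" using finite_distinct_list fC by (metis finite_Diff)
  have len: "length cs = 3 ^ n - fa.dim (rel_part r n)"
    using distinct_card[OF cs(2)] cs(1) card_Diff_subset[OF finite_subset[OF C(1) fC] C(1)] B(4) cC by simp
  have spB: "fa.span B = rel_part r n" using B fa.span_subspace rel_part_subspace by metis
  have ind: "ring.independent ?A ?K (map ?cls ds)" if "set ds \<subseteq> C - B" "distinct ds" for ds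
    using that
  proof (induction ds)
    case Nil
    then show ?case by (simp add: ring.li_Nil[OF alg_ring])
  next
    case (Cons d ds)
    have "?cls d \<notin> ring.Span ?A ?K (map ?cls ds)"
    proof
      assume "?cls d \<in> ring.Span ?A ?K (map ?cls ds)"
      then obtain g where g: "g \<in> fa.span (set ds)" "?cls d = ?cls g" by (auto simp: Span_cls)
      have "set ds \<subseteq> homog n" using Cons.prems C by auto
      then have "g \<in> homog n" using g(1) fa.span_minimal[OF _ homog_subspace] by blast
      then have "d - g \<in> homog n" using Cons.prems C by auto
      then have "d - g \<in> fa.span B" using g(2) spB by (simp add: cls_eq_iff mem_rel_ideal_homog)
      then have "(d - g) + g \<in> fa.span (B \<union> set ds)"
        using g(1) by (intro fa.span_add) (auto intro: fa.span_mono[THEN subsetD])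
      moreover have "B \<union> set ds \<subseteq> C - {d}" using Cons.prems C by auto
      ultimately have "d \<in> fa.span (C - {d})" using fa.span_mono[of "B \<union> set ds" "C - {d}"] by auto
      then show False using C(3) Cons.prems fa.dependent_def by auto
    qed
    then show ?case using Cons by (auto intro: ring.li_Cons[OF alg_ring])
  qed
  have "?C = ?cls ` fa.span (set cs)"
  proof
    show "?C \<subseteq> ?cls ` fa.span (set cs)"
    proof
      fix a assume "a \<in> ?C"
      then obtain f where f: "f \<in> homog n" "a = ?cls f" by (auto simp: component_def)
      have "f \<in> fa.span (B \<union> set cs)" using f C cs by (metis subsetD Un_Diff_cancel Un_absorb1)
      then obtain b d where "f = b + d" "b \<in> fa.span B" "d \<in> fa.span (set cs)"
        by (auto simp: fa.span_Un)
      then have "?cls f = ?cls d" using spB rel_part_in_rel_ideal by (simp add: cls_eq_iff)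
      then show "a \<in> ?cls ` fa.span (set cs)" using f \<open>d \<in> _\<close> by blast
    qed
    have "fa.span (set cs) \<subseteq> homog n"
      using fa.span_minimal[of "set cs" "homog n"] homog_subspace cs C by auto
    then show "?cls ` fa.span (set cs) \<subseteq> ?C" by (auto simp: component_def)
  qed
  then have "?C = ring.Span ?A ?K (map ?cls cs)" by (simp add: Span_cls)
  then have "ring.dimension ?A (length cs) ?K ?C"
    using ring.dimension_independent[OF alg_ring ind[of cs]] cs by simp
  then show ?thesis
    using ring.dimI[OF alg_ring subfield_base] len unfolding over_def by simp
qed

lemma dim_rel_part_le: "fa.dim (rel_part r n) \<le> 3 ^ n"
  using fa.dim_le_fin_spanned[OF homog_fin_spanned, of "rel_part r n" n] rel_part_homog[OF r]
  by (auto simp: dim_homog)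

lemma hilbert_nth: "fps_nth (hilbert_series (range r)) n = of_nat (3 ^ n - fa.dim (rel_part r n))"
  unfolding hilbert_series_def by (simp add: dim_component)

end

section \<open>The coefficients of the Hilbert series\<close>

lemma inverse_cube_nth: "fps_nth (inverse ((1 - fps_X) ^ 3) :: rat fps) n = of_nat ((n + 2) choose 2)"
proof -
  define g :: "rat fps" where "g = Abs_fps (\<lambda>n. of_nat ((n + 2) choose 2))"
  \<comment> \<open>Multiplication by \<open>1 - X\<close> turns a diagonal of Pascal's triangle
    into the preceding one; three such multiplications lead to \<open>1\<close>.\<close>
  have h: "(1 - fps_X) * Abs_fps (\<lambda>n. of_nat ((n + k + 1) choose (k + 1))) =
      Abs_fps (\<lambda>n. of_nat ((n + k) choose k) :: rat)" for k
  proof (rule fps_ext)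
    fix n
    show "fps_nth ((1 - fps_X) * Abs_fps (\<lambda>n. of_nat ((n + k + 1) choose (k + 1)))) n =
      fps_nth (Abs_fps (\<lambda>n. of_nat ((n + k) choose k) :: rat)) n"
      by (cases n) (simp_all add: left_diff_distrib)
  qed
  have "(1 - fps_X) * Abs_fps (\<lambda>n. of_nat ((n + 0) choose 0)) = (1 :: rat fps)"
    by (rule fps_ext) (simp add: left_diff_distrib)
  then have "(1 - fps_X) ^ 3 * g = 1"
    using h[of 0] h[of 1] by (simp add: g_def power3_eq_cube mult.assoc numeral_2_eq_2)
  then have "g = inverse ((1 - fps_X) ^ 3)"
    by (metis fps_inverse_unique)
  then have "inverse ((1 - fps_X) ^ 3) = g" by simp
  then show ?thesis by (simp add: g_def)
qed

text \<open>The sum avoids the truncated difference of \<open>hilbert_nth\<close>, so that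
  inequalities between dimensions can be combined linearly.\<close>

definition poly_growth :: "(var \<Rightarrow> 'k::field free_alg) \<Rightarrow> nat \<Rightarrow> bool"
  where "poly_growth r n \<longleftrightarrow> fa.dim (rel_part r n) + (n + 2 choose 2) = 3 ^ n"

lemma hilbert_series_iff:
  assumes "quadratic r"
  shows "hilbert_series (range r) = inverse ((1 - fps_X) ^ 3) \<longleftrightarrow> (\<forall>n. poly_growth r n)"
proof -
  have "3 ^ n - fa.dim (rel_part r n) = (n + 2 choose 2) \<longleftrightarrow> poly_growth r n" for n
    using dim_rel_part_le[of r n] assms by (auto simp: poly_growth_def)
  then show ?thesis
    using assms by (simp add: fps_eq_iff hilbert_nth inverse_cube_nth del: of_nat_diff)
qed


declare rel_part.simps(3) [simp del]

section \<open>Truncated point modules and line modules\<close>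

text \<open>Contraction of the first letter with the vector \<open>a\<close>, where an element of
  degree \<open>n\<close> is regarded as an \<open>n\<close>-fold tensor.\<close>

definition con :: "(var \<Rightarrow> 'k) \<Rightarrow> 'k::field free_alg \<Rightarrow> 'k free_alg"
  where "con a f = (\<Sum>v\<in>UNIV. a v *\<^sub>s tail v f)"

text \<open>The value of a linear form at the point \<open>a\<close>; only the part of degree one
  counts.\<close>

definition ev :: "(var \<Rightarrow> 'k) \<Rightarrow> 'k::field free_alg \<Rightarrow> 'k"
  where "ev a u = (\<Sum>v\<in>UNIV. a v * lk u [v])"

lemma con_add: "con a (f + g) = con a f + con a g"
  and con_diff: "con a (f - g) = con a f - con a g"
  and con_smul: "con a (c *\<^sub>s f) = c *\<^sub>s con a f"
  and con_zero [simp]: "con a 0 = 0"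
  by (simp_all add: con_def sum_var fa.scale_right_distrib fa.scale_right_diff_distrib mult.commute)

lemma con_sum: "con a (sum f A) = (\<Sum>x\<in>A. con a (f x))"
  by (induction A rule: infinite_finite_induct) (auto simp: con_add)

lemma con_homog: "f \<in> homog (Suc n) \<Longrightarrow> con a f \<in> homog n"
  by (simp add: con_def homog_sum homog_smul homog_tail)

lemma con_lin: "u \<in> homog (Suc 0) \<Longrightarrow> con a u = ev a u *\<^sub>s 1"
  by (subst homog_0_eq[OF con_homog]) (simp_all add: ev_def con_def lookup_sum lookup_smul lookup_tail)

lemma con_mult:
  assumes "f \<in> homog (Suc n)" shows "con a (f * g) = con a f * g"
proof -
  have "lk f [] = 0" using assms by (simp add: homog_iff)
  then show ?thesis by (simp add: con_def tail_mult sum_distrib_right)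
qed

lemma con_lin_mult: "u \<in> homog (Suc 0) \<Longrightarrow> con a (u * f) = ev a u *\<^sub>s f"
  by (simp add: con_mult con_lin)

lemma tail_lin: "u \<in> homog (Suc 0) \<Longrightarrow> tail v u = lk u [v] *\<^sub>s 1"
  by (subst homog_0_eq[OF homog_tail]) (simp_all add: lookup_tail)

lemma lin_expand: "u \<in> homog (Suc 0) \<Longrightarrow> u = (\<Sum>v\<in>UNIV. lk u [v] *\<^sub>s gen v)"
  by (subst homog_expand) (simp_all add: tail_lin)

lemma lin_mult_eq_0:
  assumes "z \<in> homog (Suc 0)" "z \<noteq> 0" "z * s = 0" shows "s = 0"
proof -
  obtain v where "lk z [v] \<noteq> 0"
  proof (rule ccontr)
    assume "\<not> thesis"
    then have "lk z [v] = 0" for v using that by blast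
    then show False using lin_expand[OF assms(1)] assms(2) by simp
  qed
  moreover have "tail v (z * s) = lk z [v] *\<^sub>s s"
    using assms(1) by (simp add: tail_mult tail_lin homog_iff)
  ultimately show ?thesis using assms(3) by simp
qed

lemma ev_add: "ev a (u + w) = ev a u + ev a w"
  and ev_diff: "ev a (u - w) = ev a u - ev a w"
  and ev_smul: "ev a (c *\<^sub>s u) = c * ev a u"
  and ev_gen: "ev a (gen v) = a v"
  by (auto simp: ev_def sum_var lookup_add lookup_minus lookup_smul lookup_gen algebra_simps) (cases v; simp)

text \<open>The correction by multiples of \<open>gen w\<close> adds up to a multiple of the
  contraction, which is zero. The linear factors that remain vanish at \<open>a\<close>, so the
  kernel of the contraction lies in the right ideal generated by such forms.\<close>

lemma con_eq_0_expand:
  assumes "g \<in> homog (Suc n)" "con a g = 0" "a w \<noteq> 0"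
  shows "g = (\<Sum>v\<in>UNIV. (gen v - (a v / a w) *\<^sub>s gen w) * tail v g)"
proof -
  have "(\<Sum>v\<in>UNIV. (gen v - (a v / a w) *\<^sub>s gen w) * tail v g)
      = (\<Sum>v\<in>UNIV. gen v * tail v g) - gen w * ((1 / a w) *\<^sub>s con a g)"
    by (simp add: con_def sum_var algebra_simps fa.scale_right_distrib)
  then show ?thesis using homog_expand[OF assms(1)] assms(2) by simp
qed

lemma ev_ker_basis: "a w \<noteq> 0 \<Longrightarrow> ev a (gen v - (a v / a w) *\<^sub>s gen w) = 0"
  by (simp add: ev_diff ev_smul ev_gen)

lemma span_rels_homog: "quadratic r \<Longrightarrow> p \<in> fa.span (range r) \<Longrightarrow> p \<in> homog 2"
  using fa.span_minimal[of "range r" "homog 2"] homog_subspace[of 2] quadraticD[of r] by blast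

lemma span_rels_mult:
  assumes "p \<in> fa.span (range r)" "f \<in> homog n"
  shows "p * f \<in> rel_part r (Suc (Suc n))"
  using assms(1)
proof (induction rule: fa.span_induct_alt)
  case (step c x y)
  then have "x * f \<in> rel_part r (Suc (Suc n))" using rel_part_rel_mult[OF assms(2)] by blast
  then show ?case using step by (simp add: distrib_right rel_part_add rel_part_smul)
qed simp

lemma span_range_iff: "p \<in> fa.span (range (r :: var \<Rightarrow> 'k::field free_alg)) \<longleftrightarrow> (\<exists>c. p = (\<Sum>v\<in>UNIV. c v *\<^sub>s r v))"
proof
  assume "p \<in> fa.span (range r)"
  then show "\<exists>c. p = (\<Sum>v\<in>UNIV. c v *\<^sub>s r v)"
  proof (induction rule: fa.span_induct_alt)
    case base
    then show ?case by (intro exI[of _ "\<lambda>_. 0"]) simp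
  next
    case (step k x y)
    then obtain c u where c: "y = (\<Sum>v\<in>UNIV. c v *\<^sub>s r v)" and u: "x = r u" by blast
    have "k *\<^sub>s x + y = (\<Sum>v\<in>UNIV. (c v + (if v = u then k else 0)) *\<^sub>s r v)"
      unfolding c u by (cases u) (simp_all add: sum_var fa.scale_left_distrib add_ac)
    then show ?case by (intro exI)
  qed
next
  assume "\<exists>c. p = (\<Sum>v\<in>UNIV. c v *\<^sub>s r v)"
  then obtain c where p: "p = (\<Sum>v\<in>UNIV. c v *\<^sub>s r v)" by blast
  show "p \<in> fa.span (range r)" unfolding p by (intro fa.span_sum fa.span_scale fa.span_base rangeI)
qed

text \<open>Iterating \<open>a \<mapsto> a'\<close> builds truncated point modules. From these, \<open>z \<mapsto> l\<close> builds truncated line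
  modules, with dimension at most \<open>n + 2\<close> in degree \<open>n + 1\<close>.\<close>

definition point_system :: "(var \<Rightarrow> 'k::field free_alg) \<Rightarrow> (var \<Rightarrow> 'k) set \<Rightarrow> bool"
  where "point_system r Pt \<longleftrightarrow> (\<forall>a\<in>Pt. (\<exists>v. a v \<noteq> 0) \<and>
    (\<exists>a'\<in>Pt. \<forall>u\<in>homog (Suc 0). ev a' u = 0 \<longrightarrow> u \<in> con a ` fa.span (range r)))"

definition line_system ::
    "(var \<Rightarrow> 'k::field free_alg) \<Rightarrow> (var \<Rightarrow> 'k) set \<Rightarrow> 'k free_alg set \<Rightarrow> bool"
  where "line_system r Pt Z \<longleftrightarrow> (\<forall>z\<in>Z. z \<in> homog (Suc 0) \<and> z \<noteq> 0 \<and>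
    (\<exists>a\<in>Pt. \<exists>y\<in>homog (Suc 0). \<exists>l\<in>Z. \<exists>m\<in>homog (Suc 0).
      (\<forall>u\<in>homog (Suc 0). ev a u = 0 \<longrightarrow> u \<in> fa.span {z, y}) \<and> y * l + z * m \<in> fa.span (range r)))"

lemma line_systemE:
  assumes "line_system r Pt Z" "z \<in> Z"
  obtains a y l m where "a \<in> Pt" "z \<in> homog (Suc 0)" "y \<in> homog (Suc 0)" "l \<in> Z" "m \<in> homog (Suc 0)"
    "\<forall>u\<in>homog (Suc 0). ev a u = 0 \<longrightarrow> u \<in> fa.span {z, y}" "y * l + z * m \<in> fa.span (range r)"
  using assms(1)[unfolded line_system_def, rule_format, OF assms(2)] by (elim conjE bexE) (rule that)

text \<open>If \<open>x0\<close> has the value 1 at \<open>a\<close>, then \<open>f\<close> equals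
  \<open>x0 * con a f\<close> up to an element killed by \<open>con a\<close>, and
  \<open>con a f\<close> is treated by induction at the point \<open>a'\<close>. A form
  \<open>u\<close> vanishing at \<open>a'\<close> is the contraction of a relation, which rewrites
  \<open>x0 * u\<close> into something killed by \<open>con a\<close>. So the truncated point module
  is at most one-dimensional in each degree.\<close>

lemma truncated_point_module:
  fixes r :: "var \<Rightarrow> 'k::field free_alg"
  assumes r: "quadratic r" and sys: "point_system r Pt" and a: "a \<in> Pt"
  shows "\<exists>b. \<forall>f\<in>homog (Suc n). \<exists>c g. g \<in> homog (Suc n) \<and> con a g = 0 \<and>
    f - c *\<^sub>s b - g \<in> rel_part r (Suc n)"
  using a
proof (induction n arbitrary: a)
  case 0
  then obtain w where w: "a w \<noteq> 0" using sys unfolding point_system_def by blast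
  show ?case
  proof (intro exI[of _ "(1 / a w) *\<^sub>s gen w"] ballI)
    fix f :: "'k free_alg" assume f: "f \<in> homog (Suc 0)"
    define g where "g = f - ev a f *\<^sub>s (1 / a w) *\<^sub>s gen w"
    have g: "g \<in> homog (Suc 0)" unfolding g_def using f by (intro homog_diff homog_smul homog_gen)
    have "ev a g = 0" using w by (simp add: g_def ev_diff ev_smul ev_gen)
    then have "con a g = 0" using con_lin[OF g] by simp
    moreover have "f - ev a f *\<^sub>s (1 / a w) *\<^sub>s gen w - g = 0" by (simp add: g_def)
    ultimately show "\<exists>c g. g \<in> homog (Suc 0) \<and> con a g = 0 \<and>
        f - c *\<^sub>s (1 / a w) *\<^sub>s gen w - g \<in> rel_part r (Suc 0)"
      using g by (intro exI[of _ "ev a f"] exI[of _ g]) simp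
  qed
next
  case (Suc n)
  obtain w where w: "a w \<noteq> 0" using sys Suc.prems unfolding point_system_def by blast
  obtain a' where a': "a' \<in> Pt"
    "\<forall>u\<in>homog (Suc 0). ev a' u = 0 \<longrightarrow> u \<in> con a ` fa.span (range r)"
    using sys[unfolded point_system_def, rule_format, OF Suc.prems] by (elim conjE bexE) (rule that)
  obtain w' where w': "a' w' \<noteq> 0" using sys a' unfolding point_system_def by blast
  obtain b where b: "\<And>f. f \<in> homog (Suc n) \<Longrightarrow> \<exists>c g. g \<in> homog (Suc n) \<and> con a' g = 0 \<and>
    f - c *\<^sub>s b - g \<in> rel_part r (Suc n)" using Suc.IH[OF a'(1)] by blast
  define x0 where "x0 = (1 / a w) *\<^sub>s gen w"
  have x0: "x0 \<in> homog (Suc 0)" "ev a x0 = 1"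
    using w by (simp_all add: x0_def homog_smul ev_smul ev_gen)
  define u where "u v = gen v - (a' v / a' w') *\<^sub>s gen w'" for v
  have u: "u v \<in> homog (Suc 0)" "ev a' (u v) = 0" for v
    unfolding u_def using ev_ker_basis[of a' w' v] w' by (intro homog_diff homog_smul homog_gen, simp)
  have "\<exists>\<rho>. \<rho> \<in> fa.span (range r) \<and> con a \<rho> = u v" for v using a'(2)[rule_format, OF u, of v] by force
  then obtain \<rho> where \<rho>: "\<And>v. \<rho> v \<in> fa.span (range r)" "\<And>v. con a (\<rho> v) = u v" by metis
  \<comment> \<open>Modulo the relation \<open>\<rho> v\<close>, the product \<open>x0 * u v\<close>
    becomes \<open>- k v\<close>, which lies in the kernel of \<open>con a\<close>.\<close>
  define k where "k v = \<rho> v - x0 * u v" for v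
  have k: "k v \<in> homog (Suc (Suc 0))" "con a (k v) = 0" for v
    using span_rels_homog[OF r \<rho>(1)[of v]] homog_lin_mult[OF x0(1) u(1)[of v]] \<rho>(2)[of v] x0
    by (auto simp: k_def numeral_2_eq_2 con_diff con_lin_mult)
  show ?case
  proof (intro exI[of _ "x0 * b"] ballI)
    fix f :: "'k free_alg" assume f: "f \<in> homog (Suc (Suc n))"
    obtain c g where g: "g \<in> homog (Suc n)" "con a' g = 0" "con a f - c *\<^sub>s b - g \<in> rel_part r (Suc n)"
      using b[OF con_homog[OF f]] by blast
    have gu: "g = (\<Sum>v\<in>UNIV. u v * tail v g)"
      unfolding u_def by (rule con_eq_0_expand[OF g(1,2) w'])
    define g1 where "g1 = (f - x0 * con a f) - (\<Sum>v\<in>UNIV. k v * tail v g)"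
    have tg: "tail v g \<in> homog n" for v using homog_tail[OF g(1)] .
    have "k v * tail v g \<in> homog (Suc (Suc n))" for v
      using homog_mult[OF k(1) tg] by simp
    then have "(\<Sum>v\<in>UNIV. k v * tail v g) \<in> homog (Suc (Suc n))" by (rule homog_sum)
    moreover have "f - x0 * con a f \<in> homog (Suc (Suc n))"
      by (intro homog_diff f homog_lin_mult x0 con_homog)
    ultimately have 1: "g1 \<in> homog (Suc (Suc n))" unfolding g1_def by blast
    have 2: "con a g1 = 0"
      by (simp add: g1_def con_diff con_sum con_lin_mult[OF x0(1)] x0(2) con_mult[OF k(1)] k(2))
    have "x0 * g = (\<Sum>v\<in>UNIV. \<rho> v * tail v g) - (\<Sum>v\<in>UNIV. k v * tail v g)"
      by (subst gu) (simp add: k_def sum_distrib_left sum_subtractf left_diff_distrib mult.assoc)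
    then have "f - c *\<^sub>s (x0 * b) - g1 = x0 * (con a f - c *\<^sub>s b - g) + (\<Sum>v\<in>UNIV. \<rho> v * tail v g)"
      by (simp add: g1_def algebra_simps)
    moreover have "x0 * (con a f - c *\<^sub>s b - g) \<in> rel_part r (Suc (Suc n))"
      using rel_part_homog_left_mult[OF g(3) x0(1)] by simp
    moreover have "(\<Sum>v\<in>UNIV. \<rho> v * tail v g) \<in> rel_part r (Suc (Suc n))"
      by (intro rel_part_sum span_rels_mult \<rho> tg)
    ultimately have "f - c *\<^sub>s (x0 * b) - g1 \<in> rel_part r (Suc (Suc n))"
      by (simp add: rel_part_add)
    then show "\<exists>c g. g \<in> homog (Suc (Suc n)) \<and> con a g = 0 \<and>
        f - c *\<^sub>s (x0 * b) - g \<in> rel_part r (Suc (Suc n))" using 1 2 by blast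
  qed
qed

definition line_bound :: "(var \<Rightarrow> 'k::field free_alg) \<Rightarrow> 'k free_alg \<Rightarrow> nat \<Rightarrow> bool"
  where "line_bound r z n \<longleftrightarrow> (\<exists>B. finite B \<and> card B \<le> n + 2 \<and>
    homog (Suc n) \<subseteq> ssum (ssum (rel_part r (Suc n)) ((*) z ` homog n)) (fa.span B))"

lemma span_pair_coeffs:
  assumes "u \<in> fa.span {z, y}" shows "\<exists>\<alpha> \<beta>. u = \<alpha> *\<^sub>s z + \<beta> *\<^sub>s y"
proof -
  obtain \<alpha> where "u - \<alpha> *\<^sub>s z \<in> fa.span {y}" using assms by (auto simp: fa.span_insert[of z])
  then obtain \<beta> where "u - \<alpha> *\<^sub>s z = \<beta> *\<^sub>s y" by (auto simp: fa.span_singleton)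
  then show ?thesis by (metis add.commute diff_add_cancel)
qed

text \<open>Modulo \<open>z\<close>, an element is a multiple of the generator \<open>b\<close> of
  the point module plus some \<open>y * g2\<close>, because \<open>z\<close> and \<open>y\<close>
  span the forms vanishing at \<open>a\<close>. Since \<open>y * l\<close> lies in
  \<open>z F + J\<close>, only \<open>g2\<close> modulo \<open>l\<close> matters. So each degree
  adds the one vector \<open>b\<close> to \<open>y\<close> times the vectors for \<open>l\<close>
  one degree lower.\<close>

lemma line_system_bound:
  fixes r :: "var \<Rightarrow> 'k::field free_alg"
  assumes r: "quadratic r" and sysP: "point_system r Pt" and sysL: "line_system r Pt Z"
    and z: "z \<in> Z"
  shows "line_bound r z n"
  using z
proof (induction n arbitrary: z)
  case 0
  obtain a y l m where a: "a \<in> Pt" and z: "z \<in> homog (Suc 0)"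
    and span: "\<forall>u\<in>homog (Suc 0). ev a u = 0 \<longrightarrow> u \<in> fa.span {z, y}"
    using sysL 0 by (rule line_systemE)
  obtain w where w: "a w \<noteq> 0" using sysP a unfolding point_system_def by blast
  define x0 where "x0 = (1 / a w) *\<^sub>s gen w"
  have x0: "x0 \<in> homog (Suc 0)" "ev a x0 = 1"
    using w by (simp_all add: x0_def homog_smul ev_smul ev_gen)
  have "homog (Suc 0) \<subseteq> ssum (ssum (rel_part r (Suc 0)) ((*) z ` homog 0)) (fa.span {y, x0})"
  proof
    fix f :: "'k free_alg" assume f: "f \<in> homog (Suc 0)"
    then have "ev a (f - ev a f *\<^sub>s x0) = 0" "f - ev a f *\<^sub>s x0 \<in> homog (Suc 0)"
      using x0 by (auto simp: ev_diff ev_smul)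
    then obtain \<alpha> \<beta> where "f - ev a f *\<^sub>s x0 = \<alpha> *\<^sub>s z + \<beta> *\<^sub>s y"
      using span span_pair_coeffs by blast
    then have "f = (0 + z * (\<alpha> *\<^sub>s 1)) + (\<beta> *\<^sub>s y + ev a f *\<^sub>s x0)" by (simp add: algebra_simps)
    moreover have "0 + z * (\<alpha> *\<^sub>s 1) \<in> ssum (rel_part r (Suc 0)) ((*) z ` homog 0)"
      by (intro ssumI imageI homog_smul) simp_all
    moreover have "\<beta> *\<^sub>s y + ev a f *\<^sub>s x0 \<in> fa.span {y, x0}"
      by (intro fa.span_add fa.span_scale fa.span_base) auto
    ultimately show "f \<in> ssum (ssum (rel_part r (Suc 0)) ((*) z ` homog 0)) (fa.span {y, x0})"
      by (metis ssumI)
  qed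
  moreover have "card {y, x0} \<le> 0 + 2" by (simp add: card_insert_if)
  ultimately show ?case unfolding line_bound_def by (intro exI[of _ "{y, x0}"]) simp
next
  case (Suc n)
  obtain a y l m where a: "a \<in> Pt" and z: "z \<in> homog (Suc 0)" and y: "y \<in> homog (Suc 0)"
    and l: "l \<in> Z" and m: "m \<in> homog (Suc 0)"
    and span: "\<forall>u\<in>homog (Suc 0). ev a u = 0 \<longrightarrow> u \<in> fa.span {z, y}"
    and ylzm: "y * l + z * m \<in> fa.span (range r)"
    using sysL Suc.prems by (rule line_systemE)
  obtain w where w: "a w \<noteq> 0" using sysP a unfolding point_system_def by blast
  obtain b where b: "\<And>f. f \<in> homog (Suc (Suc n)) \<Longrightarrow> \<exists>c g. g \<in> homog (Suc (Suc n)) \<and> con a g = 0 \<and>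
    f - c *\<^sub>s b - g \<in> rel_part r (Suc (Suc n))" using truncated_point_module[OF r sysP a, of "Suc n"] by blast
  obtain B where B: "finite B" "card B \<le> n + 2"
    "homog (Suc n) \<subseteq> ssum (ssum (rel_part r (Suc n)) ((*) l ` homog n)) (fa.span B)"
    using Suc.IH[OF l] unfolding line_bound_def by blast
  define u where "u v = gen v - (a v / a w) *\<^sub>s gen w" for v
  have "u v \<in> homog (Suc 0)" "ev a (u v) = 0" for v
    unfolding u_def using ev_ker_basis[of a w v] w by (intro homog_diff homog_smul homog_gen, simp)
  then have "\<exists>\<alpha> \<beta>. u v = \<alpha> *\<^sub>s z + \<beta> *\<^sub>s y" for v using span span_pair_coeffs by blast
  then obtain \<alpha> \<beta> where u: "\<And>v. u v = \<alpha> v *\<^sub>s z + \<beta> v *\<^sub>s y" by metis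
  let ?B = "insert b ((*) y ` B)"
  have "homog (Suc (Suc n)) \<subseteq>
    ssum (ssum (rel_part r (Suc (Suc n))) ((*) z ` homog (Suc n))) (fa.span ?B)"
  proof
    fix f :: "'k free_alg" assume f: "f \<in> homog (Suc (Suc n))"
    obtain c g where g: "g \<in> homog (Suc (Suc n))" "con a g = 0"
      "f - c *\<^sub>s b - g \<in> rel_part r (Suc (Suc n))" using b[OF f] by blast
    have "g = (\<Sum>v\<in>UNIV. u v * tail v g)" unfolding u_def by (rule con_eq_0_expand[OF g(1,2) w])
    then have g12: "g = z * (\<Sum>v\<in>UNIV. \<alpha> v *\<^sub>s tail v g) + y * (\<Sum>v\<in>UNIV. \<beta> v *\<^sub>s tail v g)"
      (is "_ = z * ?g1 + y * ?g2") by (simp add: u sum_var algebra_simps)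
    have gh: "?g1 \<in> homog (Suc n)" "?g2 \<in> homog (Suc n)"
      by (intro homog_sum homog_smul homog_tail g)+
    then have "?g2 \<in> ssum (ssum (rel_part r (Suc n)) ((*) l ` homog n)) (fa.span B)" using B(3) by blast
    then obtain q g3 s where q: "q \<in> rel_part r (Suc n)" and g3: "g3 \<in> homog n" and s: "s \<in> fa.span B"
      and g2: "?g2 = q + l * g3 + s" by (force elim!: ssumE)
    have f_eq: "f = ((f - c *\<^sub>s b - g) + y * q + (y * l + z * m) * g3) + z * (?g1 - m * g3) + (c *\<^sub>s b + y * s)"
      using g12 g2 by (simp add: algebra_simps)
    have 1: "(f - c *\<^sub>s b - g) + y * q + (y * l + z * m) * g3 \<in> rel_part r (Suc (Suc n))"
      using rel_part_homog_left_mult[OF q y] span_rels_mult[OF ylzm g3] g(3) by (intro rel_part_add) auto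
    have 2: "z * (?g1 - m * g3) \<in> (*) z ` homog (Suc n)"
      using gh homog_lin_mult[OF m g3] by blast
    have 3: "c *\<^sub>s b + y * s \<in> fa.span ?B"
    proof (intro fa.span_add fa.span_scale)
      have "y * s \<in> fa.span ((*) y ` B)"
      proof -
        interpret Vector_Spaces.linear smul smul "(*) y" by (rule smul_linear_left)
        show ?thesis using s span_image by blast
      qed
      then show "y * s \<in> fa.span ?B" using fa.span_mono[of "(*) y ` B" ?B] by blast
    qed (simp add: fa.span_base)
    show "f \<in> ssum (ssum (rel_part r (Suc (Suc n))) ((*) z ` homog (Suc n))) (fa.span ?B)"
      by (subst f_eq) (intro ssumI 1 2 3)
  qed
  moreover have "card ?B \<le> Suc n + 2"
    using B(1,2) card_image_le[OF B(1), of "(*) y"] card_insert_le_m1[of "Suc n + 2" "(*) y ` B" b] by simp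
  ultimately show ?case using B(1) unfolding line_bound_def by (intro exI[of _ ?B]) simp
qed


section \<open>The Hilbert series and exactness of the Koszul complex\<close>

lemma tri_Suc: "(Suc n + 2 choose 2) = (n + 2 choose 2) + (n + 2)"
  by (simp add: numeral_2_eq_2)

lemma dim_homog_mult:
  assumes "\<And>s. w * s = 0 \<Longrightarrow> s = 0" "quadratic r"
  shows "fa.dim ((*) w ` homog n) = 3 ^ n" "fa.dim ((*) w ` rel_part r n) = fa.dim (rel_part r n)"
  using dim_mult_image[of w, OF assms(1)] homog_subspace[of n] rel_part_subspace[of r n] dim_homog
  by metis+

lemma line_bound_dim:
  assumes r: "quadratic r" and z: "z \<in> homog (Suc 0)" "z \<noteq> 0" and lb: "line_bound r z n"
  shows "3 ^ Suc n + fa.dim (rel_part r (Suc n) \<inter> (*) z ` homog n)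
      \<le> fa.dim (rel_part r (Suc n)) + 3 ^ n + (n + 2)"
    and "(*) z ` rel_part r n \<subseteq> rel_part r (Suc n) \<inter> (*) z ` homog n"
    and "fa.dim (rel_part r n) \<le> fa.dim (rel_part r (Suc n) \<inter> (*) z ` homog n)"
proof -
  have inj: "s = 0" if "z * s = 0" for s using lin_mult_eq_0[OF z that] .
  note subs = rel_part_subspace subspace_image_mult homog_subspace
  note fins = rel_part_fin_spanned[OF r] fin_spanned_image_mult homog_fin_spanned
  obtain B where B: "finite B" "card B \<le> n + 2"
    "homog (Suc n) \<subseteq> ssum (ssum (rel_part r (Suc n)) ((*) z ` homog n)) (fa.span B)"
    using lb unfolding line_bound_def by blast
  let ?S = "ssum (rel_part r (Suc n)) ((*) z ` homog n)"
  have fB: "fa.fin_spanned (fa.span B)" using B(1) unfolding fa.fin_spanned_def by blast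
  have S: "fa.subspace ?S" "fa.fin_spanned ?S" by (intro ssum_subspace ssum_fin_spanned subs fins)+
  have "3 ^ Suc n \<le> fa.dim (ssum ?S (fa.span B))"
    using fa.dim_le_fin_spanned[OF ssum_fin_spanned[OF S(2) fB] B(3)] by (simp add: dim_homog)
  also have "\<dots> \<le> fa.dim ?S + fa.dim (fa.span B)"
    using dim_ssum[OF S(1) fa.subspace_span S(2) fB] by linarith
  also have "fa.dim (fa.span B) \<le> n + 2"
    using fa.dim_le_card'[OF B(1)] B(2) by simp
  finally have "3 ^ Suc n \<le> fa.dim ?S + (n + 2)" by simp
  moreover have "fa.dim ?S + fa.dim (rel_part r (Suc n) \<inter> (*) z ` homog n)
      = fa.dim (rel_part r (Suc n)) + 3 ^ n"
    using dim_ssum[of "rel_part r (Suc n)" "(*) z ` homog n"] dim_homog_mult(1)[where w=z and n=n, OF inj r]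
    by (simp add: subs fins)
  ultimately show "3 ^ Suc n + fa.dim (rel_part r (Suc n) \<inter> (*) z ` homog n)
      \<le> fa.dim (rel_part r (Suc n)) + 3 ^ n + (n + 2)" by linarith
  show sub: "(*) z ` rel_part r n \<subseteq> rel_part r (Suc n) \<inter> (*) z ` homog n"
    using rel_part_homog_left_mult[OF _ z(1), of _ r n] rel_part_homog[OF r] by auto
  have "fa.fin_spanned (rel_part r (Suc n) \<inter> (*) z ` homog n)"
    using fa.fin_spanned_subset[OF rel_part_fin_spanned[OF r, of "Suc n"]] by blast
  then show "fa.dim (rel_part r n) \<le> fa.dim (rel_part r (Suc n) \<inter> (*) z ` homog n)"
    using fa.dim_le_fin_spanned[OF _ sub] dim_homog_mult(2)[where w=z and n=n, OF inj r] by simp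
qed

text \<open>By the exact sequence \<open>A_n -> A_(n+1) -> (A/zA)_(n+1) -> 0\<close> at most
  \<open>n + 2\<close> dimensions are new, and \<open>n + 2\<close> is the increment of the binomial
  coefficient.\<close>

lemma line_bound_upper:
  assumes "quadratic r" "z \<in> homog (Suc 0)" "z \<noteq> 0" "line_bound r z n"
    "3 ^ n \<le> fa.dim (rel_part r n) + (n + 2 choose 2)"
  shows "3 ^ Suc n \<le> fa.dim (rel_part r (Suc n)) + (Suc n + 2 choose 2)"
  using line_bound_dim[OF assms(1-4)] assms(5) unfolding tri_Suc by linarith

text \<open>With the exact dimensions in degrees \<open>n\<close> and \<open>n + 1\<close> the
  estimate by the line module is attained, and nothing is left for the kernel of multiplication by
  \<open>z\<close>.\<close>

lemma line_injective:
  assumes r: "quadratic r" and z: "z \<in> homog (Suc 0)" "z \<noteq> 0" and lb: "line_bound r z n"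
    and g: "poly_growth r n" "poly_growth r (Suc n)"
    and f: "f \<in> homog n" "z * f \<in> rel_part r (Suc n)"
  shows "f \<in> rel_part r n"
proof -
  have inj: "s = 0" if "z * s = 0" for s using lin_mult_eq_0[OF z that] .
  have "fa.dim (rel_part r (Suc n) \<inter> (*) z ` homog n) \<le> fa.dim ((*) z ` rel_part r n)"
    using line_bound_dim(1)[OF r z lb] g dim_homog_mult(2)[where w=z and n=n, OF inj r]
    unfolding poly_growth_def tri_Suc by linarith
  moreover have "fa.fin_spanned (rel_part r (Suc n) \<inter> (*) z ` homog n)"
    using fa.fin_spanned_subset[OF rel_part_fin_spanned[OF r, of "Suc n"]] by blast
  ultimately have "(*) z ` rel_part r n = rel_part r (Suc n) \<inter> (*) z ` homog n"
    using fa.subspace_eq_of_dim_le line_bound_dim(2)[OF r z lb] subspace_image_mult rel_part_subspace by metis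
  then obtain g where "g \<in> rel_part r n" "z * f = z * g" using f by blast
  then have "z * (f - g) = 0" by (simp add: algebra_simps)
  then show ?thesis using inj \<open>g \<in> _\<close> by fastforce
qed


lemma poly_growth_0: "poly_growth r 0"
  by (simp add: poly_growth_def dim_0 numeral_2_eq_2)

lemma poly_growth_1: "poly_growth r (Suc 0)"
  by (simp add: poly_growth_def dim_0 numeral_2_eq_2)

lemma dim_rel_part_Suc_Suc:
  assumes "quadratic r" "right_indep r"
  shows "fa.dim (rel_part r (Suc (Suc n)))
      + fa.dim (combos gen (rel_part r (Suc n)) \<inter> combos r (homog n))
    = 3 * fa.dim (rel_part r (Suc n)) + 3 ^ Suc n"
  using dim_ssum[of "combos gen (rel_part r (Suc n))" "combos r (homog n)"] assms
  by (simp add: rel_part.simps(3) combos_subspace combos_fin_spanned rel_part_subspace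
      rel_part_fin_spanned homog_subspace homog_fin_spanned dim_combos right_indep_gen dim_homog)

text \<open>All \<open>r v\<close> have degree two, so in \<open>\<Sum> r v * s v\<close> the first
  two letters of a word come from \<open>r\<close> and the rest from \<open>s\<close>. Fixing the
  rest \<open>m\<close> gives a scalar dependence between the relations.\<close>

lemma right_indep_of_independent:
  assumes r: "quadratic r" and ind: "\<And>c. (\<Sum>v\<in>UNIV. c v *\<^sub>s r v) = 0 \<Longrightarrow> \<forall>v. c v = 0"
  shows "right_indep r"
  unfolding right_indep_def
proof (intro allI impI)
  fix s v assume 0: "(\<Sum>v\<in>UNIV. r v * s v) = 0"
  have tt: "tail b (tail a (r u * f)) = lk (r u) [a, b] *\<^sub>s f" for a b u f
  proof -
    have 1: "r u \<in> homog (Suc (Suc 0))" using quadraticD[OF r, of u] by (simp add: numeral_2_eq_2)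
    have "tail b (tail a (r u)) = lk (tail b (tail a (r u))) [] *\<^sub>s 1"
      by (intro homog_0_eq homog_tail 1)
    moreover have "lk (r u) [] = 0" "lk (tail a (r u)) [] = 0"
      using 1 homog_tail[OF 1, of a] by (auto simp: homog_iff)
    ultimately show ?thesis by (simp add: tail_mult lookup_tail)
  qed
  have z: "(\<Sum>v\<in>UNIV. lk (r v) [a, b] *\<^sub>s s v) = 0" for a b
    using arg_cong[OF 0, of "\<lambda>f. tail b (tail a f)"] by (simp add: tail_sum tt)
  have "lk (s v) m = 0" for m
  proof -
    have "(\<Sum>v\<in>UNIV. lk (s v) m *\<^sub>s r v) = 0"
    proof (rule free_alg_eqI)
      fix l
      show "lk (\<Sum>v\<in>UNIV. lk (s v) m *\<^sub>s r v) l = lk 0 l"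
      proof (cases "length l = 2")
        case True
        then obtain a b where l: "l = [a, b]" by (metis length_0_conv length_Suc_conv numeral_2_eq_2)
        have "lk (\<Sum>v\<in>UNIV. lk (r v) [a, b] *\<^sub>s s v) m = 0" by (simp add: z)
        then show ?thesis by (simp add: l lookup_sum lookup_smul mult.commute)
      next
        case False
        then have "lk (r u) l = 0" for u using quadraticD[OF r, of u] by (simp add: homog_iff)
        then show ?thesis by (simp add: lookup_sum lookup_smul)
      qed
    qed
    then show ?thesis using ind[of "\<lambda>v. lk (s v) m"] by simp
  qed
  then show "s v = 0" by (intro free_alg_eqI) simp
qed

text \<open>The element \<open>\<Sum> r v * l v = \<Sum> gen v * nn v\<close> is a syzygy of degree
  three. The form \<open>z\<close> in the span of the \<open>l v\<close> turns the condition that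
  all \<open>l v * f\<close> vanish in the algebra into the vanishing of \<open>z * f\<close>, and
  there the line bound applies.\<close>

locale potential =
  fixes r l nn :: "var \<Rightarrow> 'k::field free_alg" and z :: "'k free_alg"
  assumes quad: "quadratic r" and indep: "right_indep r"
    and l: "\<And>v. l v \<in> homog (Suc 0)" and nn: "\<And>v. nn v \<in> fa.span (range r)"
    and w_eq: "(\<Sum>v\<in>UNIV. r v * l v) = (\<Sum>v\<in>UNIV. gen v * nn v)"
    and z: "z \<in> homog (Suc 0)" "z \<noteq> 0" and z_l: "z \<in> fa.span (range l)"
    and bound: "\<And>n. line_bound r z n"
begin

definition w where "w = (\<Sum>v\<in>UNIV. r v * l v)"

lemma z_mult_eq: "\<exists>c. \<forall>f. z * f = (\<Sum>v\<in>UNIV. c v *\<^sub>s (l v * f))"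
proof -
  obtain c where "z = (\<Sum>v\<in>UNIV. c v *\<^sub>s l v)" using z_l span_range_iff by blast
  then show ?thesis by (intro exI[of _ c]) (simp add: sum_distrib_right)
qed

lemma w_mult_eq_0: "w * f = 0 \<Longrightarrow> f = 0"
proof -
  assume "w * f = 0"
  then have "(\<Sum>v\<in>UNIV. r v * (l v * f)) = 0" by (simp add: w_def sum_distrib_right mult.assoc)
  then have "\<forall>v. l v * f = 0" using indep unfolding right_indep_def by (elim allE[of _ "\<lambda>v. l v * f"]) simp
  then have "z * f = 0" using z_mult_eq by auto
  then show "f = 0" by (rule lin_mult_eq_0[OF z])
qed

lemma z_injective:
  assumes "poly_growth r n" "poly_growth r (Suc n)" "f \<in> homog n" "\<And>v. l v * f \<in> rel_part r (Suc n)"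
  shows "f \<in> rel_part r n"
proof (rule line_injective[OF quad z bound assms(1-3)])
  obtain c where "z * f = (\<Sum>v\<in>UNIV. c v *\<^sub>s (l v * f))" using z_mult_eq by blast
  then show "z * f \<in> rel_part r (Suc n)" using assms(4) by (simp add: rel_part_sum rel_part_smul)
qed

text \<open>The syzygies of degree \<open>n + 3\<close> that are visible beforehand: the trivial
  ones, with coefficients in the ideal, and the multiples of \<open>w\<close>.\<close>

definition syz where "syz n = ssum (combos r (rel_part r (Suc n))) ((*) w ` homog n)"

lemma syz_subspace: "fa.subspace (syz n)"
  unfolding syz_def by (intro ssum_subspace combos_subspace rel_part_subspace subspace_image_mult homog_subspace)

lemma rel_mult_rel_part: "f \<in> rel_part r n \<Longrightarrow> r v * f = (\<Sum>u\<in>UNIV. gen u * (tail u (r v) * f))"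
  "f \<in> rel_part r n \<Longrightarrow> tail u (r v) * f \<in> rel_part r (Suc n)"
proof -
  have r2: "r v \<in> homog (Suc (Suc 0))" using quadraticD[OF quad, of v] by (simp add: numeral_2_eq_2)
  show "r v * f = (\<Sum>u\<in>UNIV. gen u * (tail u (r v) * f))"
    by (subst homog_expand[OF r2]) (simp add: sum_distrib_right mult.assoc)
  show "f \<in> rel_part r n \<Longrightarrow> tail u (r v) * f \<in> rel_part r (Suc n)"
    using rel_part_homog_left_mult[OF _ homog_tail[OF r2]] by simp
qed

lemma syz_subset: "syz n \<subseteq> combos gen (rel_part r (Suc (Suc n))) \<inter> combos r (homog (Suc n))"
proof
  fix f assume "f \<in> syz n"
  then obtain a h where a: "a \<in> combos r (rel_part r (Suc n))" and h: "h \<in> homog n" and f: "f = a + w * h"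
    unfolding syz_def by (auto elim!: ssumE)
  obtain s where s: "\<forall>v. s v \<in> rel_part r (Suc n)" and a_eq: "a = (\<Sum>v\<in>UNIV. r v * s v)"
    using a by (rule combosE)
  have "a = (\<Sum>v\<in>UNIV. gen v * (\<Sum>u\<in>UNIV. tail v (r u) * s u))"
    unfolding a_eq rel_mult_rel_part(1)[OF s[rule_format]] sum_distrib_left by (rule sum.swap)
  moreover have "w * h = (\<Sum>v\<in>UNIV. gen v * (nn v * h))"
    by (simp add: w_def w_eq sum_distrib_right mult.assoc)
  ultimately have f1: "f = (\<Sum>v\<in>UNIV. gen v * ((\<Sum>u\<in>UNIV. tail v (r u) * s u) + nn v * h))"
    by (simp add: f distrib_left sum.distrib)
  have t1: "(\<Sum>u\<in>UNIV. tail v (r u) * s u) + nn v * h \<in> rel_part r (Suc (Suc n))" for v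
    using s span_rels_mult[OF nn h] rel_mult_rel_part(2) by (intro rel_part_add rel_part_sum) auto
  have 1: "f \<in> combos gen (rel_part r (Suc (Suc n)))" unfolding f1 by (rule combosI) (rule t1)
  have f2: "f = (\<Sum>v\<in>UNIV. r v * (s v + l v * h))"
    by (simp add: f a_eq w_def distrib_left sum.distrib sum_distrib_right mult.assoc)
  have t2: "s v + l v * h \<in> homog (Suc n)" for v
    by (intro homog_add homog_lin_mult[OF l h] rel_part_homog[OF quad] s[rule_format])
  have "f \<in> combos r (homog (Suc n))" unfolding f2 by (rule combosI) (rule t2)
  then show "f \<in> combos gen (rel_part r (Suc (Suc n))) \<inter> combos r (homog (Suc n))" using 1 by blast
qed

text \<open>If \<open>w * f = \<Sum> r v * s v\<close> with all \<open>s v\<close> in the ideal,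
  right independence gives \<open>l v * f = s v\<close>, and \<open>z_injective\<close> puts
  \<open>f\<close> into the ideal. So the two summands meet exactly in \<open>w J_n\<close>.\<close>

lemma dim_syz:
  assumes "poly_growth r n" "poly_growth r (Suc n)"
  shows "fa.dim (syz n) + fa.dim (rel_part r n) = 3 * fa.dim (rel_part r (Suc n)) + 3 ^ n"
proof -
  have "combos r (rel_part r (Suc n)) \<inter> (*) w ` homog n = (*) w ` rel_part r n"
  proof
    show "combos r (rel_part r (Suc n)) \<inter> (*) w ` homog n \<subseteq> (*) w ` rel_part r n"
    proof
      fix x assume "x \<in> combos r (rel_part r (Suc n)) \<inter> (*) w ` homog n"
      then obtain f where f: "f \<in> homog n" "x = w * f" and "x \<in> combos r (rel_part r (Suc n))" by blast
      from this(3) obtain s where s: "\<forall>v. s v \<in> rel_part r (Suc n)" "x = (\<Sum>v\<in>UNIV. r v * s v)"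
        by (rule combosE)
      have "(\<Sum>v\<in>UNIV. r v * (l v * f)) = (\<Sum>v\<in>UNIV. r v * s v)"
        using f s by (simp add: w_def sum_distrib_right mult.assoc)
      then have "(\<lambda>v. l v * f) = s" by (rule right_indep_inj[OF indep])
      then have "l v * f \<in> rel_part r (Suc n)" for v using s by (metis)
      then show "x \<in> (*) w ` rel_part r n" using z_injective[OF assms f(1)] f by blast
    qed
    show "(*) w ` rel_part r n \<subseteq> combos r (rel_part r (Suc n)) \<inter> (*) w ` homog n"
    proof
      fix x assume "x \<in> (*) w ` rel_part r n"
      then obtain f where f: "f \<in> rel_part r n" "x = w * f" by blast
      have "(\<Sum>v\<in>UNIV. r v * (l v * f)) \<in> combos r (rel_part r (Suc n))"
        using rel_part_homog_left_mult[OF f(1) l] by (intro combosI) simp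
      then show "x \<in> combos r (rel_part r (Suc n)) \<inter> (*) w ` homog n"
        using f rel_part_homog[OF quad] by (auto simp: w_def sum_distrib_right mult.assoc)
    qed
  qed
  then show ?thesis
    using dim_ssum[of "combos r (rel_part r (Suc n))" "(*) w ` homog n"]
      dim_homog_mult[where w=w and n=n, OF w_mult_eq_0 quad]
    unfolding syz_def[symmetric]
    by (simp add: combos_subspace combos_fin_spanned rel_part_subspace rel_part_fin_spanned quad
      homog_subspace homog_fin_spanned dim_combos indep subspace_image_mult fin_spanned_image_mult)
qed

lemma fin_spanned_inter:
  "fa.fin_spanned (combos gen (rel_part r (Suc (Suc n))) \<inter> combos r (homog (Suc n)))"
  using fa.fin_spanned_subset[OF combos_fin_spanned[OF homog_fin_spanned, of r "Suc n"]] by blast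

text \<open>Both bounds in degree \<open>m + 3\<close> rest on exact values in lower degrees: the
  upper one through the line module from degree \<open>m + 2\<close>, the lower one through
  \<open>dim_syz\<close>, whose injectivity needs the degrees \<open>m\<close> and
  \<open>m + 1\<close>.\<close>

lemma growth: "poly_growth r n"
proof (induction n rule: less_induct)
  case (less n)
  consider "n = 0" | "n = 1" | "n = 2" | m where "n = Suc (Suc (Suc m))"
    by (metis One_nat_def Suc_1 not0_implies_Suc)
  then show ?case
  proof cases
    case 3
    have "combos gen (rel_part r (Suc 0)) \<inter> combos r (homog 0) = {0}"
    proof -
      have "combos gen (rel_part r (Suc 0)) = {0}" by (auto simp: combos_def intro!: exI[of _ "\<lambda>_. 0"])
      then show ?thesis using fa.subspace_0[OF combos_subspace[OF homog_subspace]] by blast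
    qed
    then have "fa.dim (rel_part r 2) = 3"
      using dim_rel_part_Suc_Suc[OF quad indep, of 0] by (simp add: dim_0 numeral_2_eq_2)
    then show ?thesis by (simp add: 3 poly_growth_def eval_nat_numeral)
  next
    case (4 m)
    then have g: "poly_growth r m" "poly_growth r (Suc m)" "poly_growth r (Suc (Suc m))"
      using less by auto
    have "3 ^ Suc (Suc m) \<le> fa.dim (rel_part r (Suc (Suc m))) + (Suc (Suc m) + 2 choose 2)"
      using g(3) unfolding poly_growth_def by linarith
    then have up: "3 ^ Suc (Suc (Suc m)) \<le> fa.dim (rel_part r (Suc (Suc (Suc m)))) + (Suc (Suc (Suc m)) + 2 choose 2)"
      by (rule line_bound_upper[OF quad z bound])
    have "fa.dim (syz m) \<le> fa.dim (combos gen (rel_part r (Suc (Suc m))) \<inter> combos r (homog (Suc m)))"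
      by (rule fa.dim_le_fin_spanned[OF fin_spanned_inter syz_subset])
    \<comment> \<open>For \<open>a_n = dim A_n\<close> this is
      \<open>a_(m+3) \<ge> 3 a_(m+2) - 3 a_(m+1) + a_m\<close>, and the third differences of the
      binomial coefficients vanish.\<close>
    then have "fa.dim (rel_part r (Suc (Suc (Suc m)))) + (Suc (Suc (Suc m)) + 2 choose 2) \<le> 3 ^ Suc (Suc (Suc m))"
      using dim_rel_part_Suc_Suc[OF quad indep, of "Suc m"] dim_syz[OF g(1,2)] g
      unfolding poly_growth_def tri_Suc power_Suc by linarith
    then show ?thesis using up unfolding 4 poly_growth_def by linarith
  qed (simp_all add: poly_growth_0 poly_growth_1)
qed

text \<open>With the growth known in all degrees the same count is an equality, so the intersection
  has no room for further syzygies.\<close>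

lemma syz_eq: "combos gen (rel_part r (Suc (Suc n))) \<inter> combos r (homog (Suc n)) = syz n"
proof (rule sym, rule fa.subspace_eq_of_dim_le[OF fin_spanned_inter syz_subset syz_subspace])
  show "fa.dim (combos gen (rel_part r (Suc (Suc n))) \<inter> combos r (homog (Suc n))) \<le> fa.dim (syz n)"
    using dim_rel_part_Suc_Suc[OF quad indep, of "Suc n"] dim_syz[OF growth growth, of n]
      growth[of n] growth[of "Suc n"] growth[of "Suc (Suc n)"] growth[of "Suc (Suc (Suc n))"]
    unfolding poly_growth_def tri_Suc power_Suc by linarith
qed

abbreviation I where "I \<equiv> rel_ideal (range r)"

lemma part_mult_in:
  assumes "u \<in> homog k" "u * f \<in> I" shows "u * part n f \<in> rel_part r (k + n)"
  using assms mem_rel_ideal_iff[OF quad] part_mult_homog[OF assms(1), of n f] by metis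

lemma sum_parts_in_I:
  assumes "\<And>n. part n f \<in> rel_part r n" shows "f \<in> I"
  using assms mem_rel_ideal_iff[OF quad] by blast

lemma exact_3:
  assumes "\<And>v. l v * f \<in> I" shows "f \<in> I"
proof (rule sum_parts_in_I)
  fix n
  show "part n f \<in> rel_part r n"
  proof (rule z_injective[OF growth growth part_homog])
    fix v show "l v * part n f \<in> rel_part r (Suc n)" using part_mult_in[OF l assms, of v n] by simp
  qed
qed

lemma part_combo:
  assumes "\<And>v. g v \<in> homog k"
  shows "part (k + n) (\<Sum>v\<in>UNIV. g v * s v) = (\<Sum>v\<in>UNIV. g v * part n (s v))"
  by (simp add: part_sum part_mult_homog[OF assms])

text \<open>In each degree \<open>\<Sum> r v * s v\<close> equals
  \<open>\<Sum> gen u * (\<Sum> tail u (r v) * s v)\<close> and so lies in the intersection, hence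
  in \<open>syz\<close>. Comparing the coefficients of the \<open>r v\<close> yields
  \<open>s v = l v * h\<close> modulo the ideal.\<close>

lemma exact_2:
  assumes "\<And>u. (\<Sum>v\<in>UNIV. tail u (r v) * s v) \<in> I"
  shows "\<exists>f. \<forall>v. s v - l v * f \<in> I"
proof -
  have t1: "tail u (r v) \<in> homog (Suc 0)" for u v
    using homog_tail[of "r v" "Suc 0" u] quadraticD[OF quad, of v] by (simp add: numeral_2_eq_2)
  have r2: "r v \<in> homog (Suc (Suc 0))" for v using quadraticD[OF quad, of v] by (simp add: numeral_2_eq_2)
  have in_J: "(\<Sum>v\<in>UNIV. tail u (r v) * part n (s v)) \<in> rel_part r (Suc n)" for u n
    using assms[of u, unfolded mem_rel_ideal_iff[OF quad], rule_format, of "Suc n"] part_combo[of "\<lambda>v. tail u (r v)" "Suc 0" n s, OF t1] by simp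
  have eq: "(\<Sum>v\<in>UNIV. r v * part n (s v)) = (\<Sum>u\<in>UNIV. gen u * (\<Sum>v\<in>UNIV. tail u (r v) * part n (s v)))" for n
  proof -
    have "r v * f = (\<Sum>u\<in>UNIV. gen u * (tail u (r v) * f))" for v f
      by (subst homog_expand[OF r2]) (simp add: sum_distrib_right mult.assoc)
    then show ?thesis by (simp only: sum_distrib_left) (rule sum.swap)
  qed
  \<comment> \<open>A multiple of \<open>l v\<close> has no constant term, so the constant terms of
    \<open>s\<close> have to vanish outright; they do, because the ideal is zero in degree
    one.\<close>
  have "part 0 (s v) = 0" for v
  proof -
    have "(\<Sum>v\<in>UNIV. r v * part 0 (s v)) = 0" using in_J[of _ 0] by (simp add: eq)
    then show ?thesis using indep unfolding right_indep_def by (elim allE[of _ "\<lambda>v. part 0 (s v)"]) simp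
  qed
  have "\<exists>f. f \<in> homog n \<and> (\<forall>v. part (Suc n) (s v) - l v * f \<in> rel_part r (Suc n))" for n
  proof -
    have "(\<Sum>v\<in>UNIV. r v * part (Suc n) (s v)) \<in> combos gen (rel_part r (Suc (Suc n))) \<inter> combos r (homog (Suc n))"
      by (intro IntI combosI part_homog, subst eq) (intro combosI in_J)
    then have "(\<Sum>v\<in>UNIV. r v * part (Suc n) (s v)) \<in> syz n" by (simp add: syz_eq)
    then obtain a h where a: "a \<in> combos r (rel_part r (Suc n))" and h: "h \<in> homog n"
      and e: "(\<Sum>v\<in>UNIV. r v * part (Suc n) (s v)) = a + w * h"
      unfolding syz_def by (auto elim!: ssumE)
    obtain t where t: "\<forall>v. t v \<in> rel_part r (Suc n)" and a_eq: "a = (\<Sum>v\<in>UNIV. r v * t v)"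
      using a by (rule combosE)
    have "(\<Sum>v\<in>UNIV. r v * part (Suc n) (s v)) = (\<Sum>v\<in>UNIV. r v * (t v + l v * h))"
      by (simp add: e a_eq w_def distrib_left sum.distrib sum_distrib_right mult.assoc)
    then have "(\<lambda>v. part (Suc n) (s v)) = (\<lambda>v. t v + l v * h)" by (rule right_indep_inj[OF indep])
    then have "part (Suc n) (s v) - l v * h = t v" for v by (metis add_diff_cancel_right')
    then show ?thesis using t h by auto
  qed
  then obtain h where h: "\<And>n. h n \<in> homog n" "\<And>n v. part (Suc n) (s v) - l v * h n \<in> rel_part r (Suc n)" by metis
  \<comment> \<open>Solutions \<open>h n\<close> have been chosen in every degree. A finite sum of
    them suffices, since beyond \<open>N\<close> the components of \<open>s\<close> are
    zero.\<close>
  obtain N where N: "\<And>n v. n \<ge> N \<Longrightarrow> part n (s v) = 0"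
  proof -
    have "\<exists>N. \<forall>n\<ge>N. part n (s v) = 0" for v using finite_parts[of "s v"] by metis
    then obtain M where M: "\<And>v n. n \<ge> M v \<Longrightarrow> part n (s v) = 0" by metis
    have "M v \<le> M VX + M VY + M VZ" for v by (cases v) auto
    then show ?thesis using that[of "M VX + M VY + M VZ"] M le_trans by metis
  qed
  define f where "f = (\<Sum>n<N. h n)"
  have pf: "part n f = (if n < N then h n else 0)" for n
    by (simp add: f_def part_sum part_of_homog[OF h(1)] sum.delta)
  have "s v - l v * f \<in> I" for v
  proof (rule sum_parts_in_I)
    fix n
    show "part n (s v - l v * f) \<in> rel_part r n"
    proof (cases n)
      case 0
      then show ?thesis using \<open>part 0 (s v) = 0\<close> part_mult_homog_low[OF l, of 0 v f] by (simp add: part_diff)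
    next
      case (Suc m)
      have "part n (s v - l v * f) = part (Suc m) (s v) - l v * part m f"
        using part_mult_homog[OF l, of m v f] by (simp add: Suc part_diff)
      then show ?thesis using h(2)[of m v] N[of "Suc m" v] by (auto simp: pf Suc not_less)
    qed
  qed
  then show ?thesis by blast
qed

text \<open>The recursion for the ideal writes \<open>\<Sum> gen v * s v\<close> as
  \<open>\<Sum> gen v * q v + \<Sum> r v * t v\<close> with all \<open>q v\<close> in the ideal;
  \<open>tail u\<close> then compares the coefficients of the variable \<open>u\<close>.\<close>

lemma exact_1:
  assumes "(\<Sum>v\<in>UNIV. gen v * s v) \<in> I"
  shows "\<exists>t. \<forall>u. s u - (\<Sum>v\<in>UNIV. tail u (r v) * t v) \<in> I"
proof -
  have t1: "tail u (r v) \<in> homog (Suc 0)" for u v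
    using homog_tail[of "r v" "Suc 0" u] quadraticD[OF quad, of v] by (simp add: numeral_2_eq_2)
  have in_J: "(\<Sum>v\<in>UNIV. gen v * part n (s v)) \<in> rel_part r (Suc n)" for n
    using assms[unfolded mem_rel_ideal_iff[OF quad], rule_format, of "Suc n"] part_combo[of gen "Suc 0" n s, OF homog_gen] by simp
  have p0: "part 0 (s v) = 0" for v
  proof -
    have "(\<Sum>v\<in>UNIV. gen v * part 0 (s v)) = 0" using in_J[of 0] by simp
    then have "(\<lambda>v. part 0 (s v)) = (\<lambda>_. 0)" by (intro right_indep_inj[OF right_indep_gen]) simp
    then show ?thesis by metis
  qed
  have "\<exists>t. \<forall>u. (\<forall>v. t v \<in> homog n) \<and> part (Suc n) (s u) - (\<Sum>v\<in>UNIV. tail u (r v) * t v) \<in> rel_part r (Suc n)" for n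
  proof -
    have "(\<Sum>v\<in>UNIV. gen v * part (Suc n) (s v)) \<in> ssum (combos gen (rel_part r (Suc n))) (combos r (homog n))"
      using in_J[of "Suc n"] by (simp add: rel_part.simps(3))
    then obtain a b where a: "a \<in> combos gen (rel_part r (Suc n))" and b: "b \<in> combos r (homog n)"
      and e: "(\<Sum>v\<in>UNIV. gen v * part (Suc n) (s v)) = a + b" by (rule ssumE)
    obtain q where q: "\<forall>v. q v \<in> rel_part r (Suc n)" and a_eq: "a = (\<Sum>v\<in>UNIV. gen v * q v)"
      using a by (rule combosE)
    obtain t where t: "\<forall>v. t v \<in> homog n" and b_eq: "b = (\<Sum>v\<in>UNIV. r v * t v)"
      using b by (rule combosE)
    have "lk (r v) [] = 0" for v using quadraticD[OF quad, of v] by (simp add: homog_iff)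
    then have "tail u b = (\<Sum>v\<in>UNIV. tail u (r v) * t v)" for u
      by (simp add: b_eq tail_sum tail_mult)
    moreover have "tail u a = q u" for u by (cases u) (simp_all add: a_eq sum_var)
    moreover have "tail u (\<Sum>v\<in>UNIV. gen v * part (Suc n) (s v)) = part (Suc n) (s u)" for u
      by (cases u) (simp_all add: sum_var)
    ultimately have "part (Suc n) (s u) - (\<Sum>v\<in>UNIV. tail u (r v) * t v) = q u" for u
      using e by (metis add_diff_cancel_right' tail_add)
    then show ?thesis using q t by (intro exI[of _ t]) auto
  qed
  then obtain t where t: "\<And>n v. t n v \<in> homog n"
    "\<And>n u. part (Suc n) (s u) - (\<Sum>v\<in>UNIV. tail u (r v) * t n v) \<in> rel_part r (Suc n)" by metis
  obtain N where N: "\<And>n v. n \<ge> N \<Longrightarrow> part n (s v) = 0"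
  proof -
    have "\<exists>N. \<forall>n\<ge>N. part n (s v) = 0" for v using finite_parts[of "s v"] by metis
    then obtain M where M: "\<And>v n. n \<ge> M v \<Longrightarrow> part n (s v) = 0" by metis
    have "M v \<le> M VX + M VY + M VZ" for v by (cases v) auto
    then show ?thesis using that[of "M VX + M VY + M VZ"] M le_trans by metis
  qed
  define f where "f v = (\<Sum>n<N. t n v)" for v
  have pf: "part n (f v) = (if n < N then t n v else 0)" for n v
    by (simp add: f_def part_sum part_of_homog[OF t(1)] sum.delta)
  have "s u - (\<Sum>v\<in>UNIV. tail u (r v) * f v) \<in> I" for u
  proof (rule sum_parts_in_I)
    fix n
    show "part n (s u - (\<Sum>v\<in>UNIV. tail u (r v) * f v)) \<in> rel_part r n"
    proof (cases n)
      case 0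
      have "part 0 (tail u (r v) * f v) = 0" for v by (rule part_mult_homog_low[OF t1]) simp
      then show ?thesis using p0 by (simp add: 0 part_diff part_sum)
    next
      case (Suc m)
      have "part n (s u - (\<Sum>v\<in>UNIV. tail u (r v) * f v)) = part (Suc m) (s u) - (\<Sum>v\<in>UNIV. tail u (r v) * part m (f v))"
        using part_combo[of "\<lambda>v. tail u (r v)" "Suc 0" m f, OF t1] by (simp add: Suc part_diff)
      then show ?thesis using t(2)[of m u] N[of "Suc m" u]
        by (cases "m < N") (simp_all add: pf Suc)
    qed
  qed
  then show ?thesis by blast
qed

lemma exact_0: "lk f [] = 0 \<Longrightarrow> \<exists>s. f = (\<Sum>v\<in>UNIV. gen v * s v)"
  using tail_expand[of f] by (intro exI[of _ "\<lambda>v. tail v f"]) simp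

end


section \<open>Koszulness\<close>

lemma augmentation_cls:
  assumes "quadratic r" shows "augmentation (range r) (cls (range r) f) = lk f []"
proof -
  have "Poly_Mapping.lookup g 0 = lk f []" if "g \<in> cls (range r) f" for g
  proof -
    have "part 0 (g - f) \<in> rel_part r 0"
      using that unfolding mem_cls mem_rel_ideal_iff[OF assms] by blast
    then have "lk (part 0 (g - f)) [] = 0" by simp
    then show ?thesis by (simp add: lookup_part lookup_minus zero_word_def)
  qed
  moreover have "f \<in> cls (range r) f" by (simp add: mem_cls)
  ultimately have "(\<lambda>f. Poly_Mapping.lookup f 0) ` cls (range r) f = {lk f []}" by auto
  then show ?thesis by (simp add: augmentation_def)
qed

text \<open>Three columns suffice, because no module of the complex has rank above three. The
  coordinates outside \<open>B'\<close> are set to zero, as membership in \<open>free_module\<close>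
  demands.\<close>

definition matrix_map :: "'k::field free_alg set \<Rightarrow> nat set \<Rightarrow> (nat \<Rightarrow> nat \<Rightarrow> 'k free_alg)
    \<Rightarrow> (nat \<Rightarrow> 'k free_alg set) \<Rightarrow> (nat \<Rightarrow> 'k free_alg set)"
  where "matrix_map R B' M u = (\<lambda>i. if i \<in> B' then
    cls R (M i 0) \<otimes>\<^bsub>alg R\<^esub> u 0 \<oplus>\<^bsub>alg R\<^esub> cls R (M i 1) \<otimes>\<^bsub>alg R\<^esub> u 1 \<oplus>\<^bsub>alg R\<^esub> cls R (M i 2) \<otimes>\<^bsub>alg R\<^esub> u 2
    else \<zero>\<^bsub>alg R\<^esub>)"

lemma matrix_map_cls: "matrix_map R B' M (\<lambda>i. cls R (f i)) =
   (\<lambda>i. cls R (if i \<in> B' then M i 0 * f 0 + M i 1 * f 1 + M i 2 * f 2 else 0))"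
  by (rule ext) (simp add: matrix_map_def cls_add cls_mult cls_zero)

lemma free_module_rep:
  assumes "u \<in> free_module R B"
  shows "\<exists>f. u = (\<lambda>i. cls R (f i)) \<and> (\<forall>i. i \<notin> B \<longrightarrow> f i = 0)"
proof -
  have "\<forall>i. \<exists>f. u i = cls R f \<and> (i \<notin> B \<longrightarrow> f = 0)"
  proof
    fix i
    show "\<exists>f. u i = cls R f \<and> (i \<notin> B \<longrightarrow> f = 0)"
    proof (cases "i \<in> B")
      case True
      have "u i \<in> range (cls R)" using assms by (simp add: free_module_def carrier_alg)
      then show ?thesis using True by auto
    next
      case False
      then show ?thesis using assms by (auto simp: free_module_def cls_zero intro!: exI[of _ 0])
    qed
  qed
  then obtain f where "\<forall>i. u i = cls R (f i) \<and> (i \<notin> B \<longrightarrow> f i = 0)" by metis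
  then show ?thesis by (intro exI[of _ f]) auto
qed

lemma cls_free_module:
  assumes "finite B" "\<And>i. i \<notin> B \<Longrightarrow> f i = 0"
  shows "(\<lambda>i. cls R (f i)) \<in> free_module R B"
proof -
  have "{i. cls R (f i) \<noteq> \<zero>\<^bsub>alg R\<^esub>} \<subseteq> B" using assms(2) by (auto simp flip: cls_zero)
  then show ?thesis using assms finite_subset by (auto simp: free_module_def simp flip: cls_zero)
qed

lemma matrix_map_linear:
  assumes "finite B'"
  shows "right_linear R B B' (matrix_map R B' M)"
  unfolding right_linear_def
proof (intro conjI ballI funcsetI)
  fix u assume "u \<in> free_module R B"
  then obtain f where u: "u = (\<lambda>i. cls R (f i))" using free_module_rep by blast
  show "matrix_map R B' M u \<in> free_module R B'"
    unfolding u matrix_map_cls by (rule cls_free_module[OF assms]) simp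
  { fix v assume "v \<in> free_module R B"
    then obtain g where v: "v = (\<lambda>i. cls R (g i))" using free_module_rep by blast
    show "matrix_map R B' M (\<lambda>i. u i \<oplus>\<^bsub>alg R\<^esub> v i) =
        (\<lambda>i. matrix_map R B' M u i \<oplus>\<^bsub>alg R\<^esub> matrix_map R B' M v i)"
      unfolding u v cls_add[symmetric] matrix_map_cls
      by (rule ext) (simp add: algebra_simps flip: cls_add) }
  fix a assume "a \<in> carrier (alg R)"
  then obtain g where a: "a = cls R g" by (auto simp: carrier_alg)
  show "matrix_map R B' M (\<lambda>i. u i \<otimes>\<^bsub>alg R\<^esub> a) = (\<lambda>i. matrix_map R B' M u i \<otimes>\<^bsub>alg R\<^esub> a)"
    unfolding u a cls_mult[symmetric] matrix_map_cls
    by (rule ext) (simp add: algebra_simps flip: cls_mult)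
qed

lemma matrix_map_graded:
  assumes "finite B'" "\<And>i j. M i j \<in> homog (Suc 0)"
  shows "matrix_map R B' M ` free_module_component R B (Suc m) j \<subseteq> free_module_component R B' m j"
proof
  fix x assume "x \<in> matrix_map R B' M ` free_module_component R B (Suc m) j"
  then obtain u where u: "u \<in> free_module R B" and x: "x = matrix_map R B' M u"
    and comp: "\<forall>i. if Suc m \<le> j then u i \<in> component R (j - Suc m) else u i = \<zero>\<^bsub>alg R\<^esub>"
    by (auto simp: free_module_component_def)
  have x1: "x \<in> free_module R B'"
    using matrix_map_linear[OF assms(1)] u x unfolding right_linear_def by blast
  have "\<forall>i. \<exists>f. u i = cls R f \<and> (if Suc m \<le> j then f \<in> homog (j - Suc m) else f = 0)"
  proof
    fix i show "\<exists>f. u i = cls R f \<and> (if Suc m \<le> j then f \<in> homog (j - Suc m) else f = 0)"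
      using comp[rule_format, of i] by (cases "Suc m \<le> j") (auto simp: component_def cls_zero)
  qed
  then obtain f where f: "\<forall>i. u i = cls R (f i) \<and> (if Suc m \<le> j then f i \<in> homog (j - Suc m) else f i = 0)"
    by metis
  have ue: "u = (\<lambda>i. cls R (f i))" using f by auto
  have "if m \<le> j then x i \<in> component R (j - m) else x i = \<zero>\<^bsub>alg R\<^esub>" for i
  proof (cases "Suc m \<le> j")
    case True
    then have "f k \<in> homog (j - Suc m)" for k using f by simp
    then have "M i k * f k \<in> homog (j - m)" for k
      using homog_lin_mult[OF assms(2), of "f k" "j - Suc m" i k] True by (metis Suc_diff_Suc less_eq_Suc_le)
    then have "(if i \<in> B' then M i 0 * f 0 + M i 1 * f 1 + M i 2 * f 2 else 0) \<in> homog (j - m)" by auto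
    then show ?thesis using True unfolding x ue matrix_map_cls by (auto simp: component_def)
  next
    case False
    then have "f k = 0" for k using f by simp
    then have "x i = cls R 0" unfolding x ue matrix_map_cls by simp
    moreover have "cls R 0 \<in> cls R ` homog (j - m)" by (rule imageI) simp
    ultimately show ?thesis unfolding component_def by (simp add: cls_zero)
  qed
  then show "x \<in> free_module_component R B' m j" using x1 by (simp add: free_module_component_def)
qed

definition nat_var :: "nat \<Rightarrow> var"
  where "nat_var i = (if i = 0 then VX else if i = 1 then VY else VZ)"

definition var_nat :: "var \<Rightarrow> nat"
  where "var_nat v = (case v of VX \<Rightarrow> 0 | VY \<Rightarrow> 1 | VZ \<Rightarrow> 2)"

lemma nat_var_var_nat [simp]: "nat_var (var_nat v) = v"
  by (simp add: nat_var_def var_nat_def split: var.split)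

lemma var_nat_nat_var: "i \<in> {0, 1, 2} \<Longrightarrow> var_nat (nat_var i) = i"
  by (auto simp: nat_var_def var_nat_def)

lemma var_nat_in: "var_nat v \<in> {0, 1, 2}"
  by (cases v) (simp_all add: var_nat_def)

section \<open>The Koszul complex of a potential\<close>

context potential
begin

text \<open>The ranks are 1, 3, 3, 1. The differentials are the row \<open>x\<close> of the
  variables, the matrix \<open>N\<close> of the tails, for which \<open>r = x N\<close>, and the
  column \<open>l\<close>, so that \<open>w = x N l\<close>.\<close>

definition koszul_basis :: "nat \<Rightarrow> nat set"
  where "koszul_basis m = (if m = 0 \<or> m = 3 then {0} else if m < 3 then {0, 1, 2} else {})"

definition koszul_matrix :: "nat \<Rightarrow> nat \<Rightarrow> nat \<Rightarrow> 'k free_alg"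
  where "koszul_matrix m i j =
    (if m = 0 then gen (nat_var j) else if m = 1 then tail (nat_var i) (r (nat_var j))
     else if m = 2 \<and> j = 0 then l (nat_var i) else 0)"

abbreviation koszul_diff where
  "koszul_diff m \<equiv> matrix_map (range r) (koszul_basis m) (koszul_matrix m)"

lemma koszul_matrix_homog: "koszul_matrix m i j \<in> homog (Suc 0)"
  using l homog_tail[of "r (nat_var j)" "Suc 0" "nat_var i"] quadraticD[OF quad, of "nat_var j"]
  by (auto simp: koszul_matrix_def numeral_2_eq_2)

lemma koszul_basis_simps [simp]:
  "koszul_basis 0 = {0}" "koszul_basis (Suc 0) = {0, 1, 2}" "koszul_basis 2 = {0, 1, 2}" "koszul_basis 3 = {0}"
  "m > 3 \<Longrightarrow> koszul_basis m = {}"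
  by (auto simp: koszul_basis_def)

lemma koszul_basis_finite [simp]: "finite (koszul_basis m)"
  by (simp add: koszul_basis_def)

lemma zero_fun_iff: "(\<lambda>i. cls (range r) (f i)) = (\<lambda>i. \<zero>\<^bsub>alg (range r)\<^esub>) \<longleftrightarrow> (\<forall>i. f i \<in> I)"
  by (simp add: fun_eq_iff cls_eq_zero_iff)

lemma cls_fun_eq_iff: "(\<lambda>i. cls (range r) (f i)) = (\<lambda>i. cls (range r) (g i)) \<longleftrightarrow> (\<forall>i. f i - g i \<in> I)"
  by (simp add: fun_eq_iff cls_eq_iff)

lemma diff_0_cls: "koszul_diff 0 (\<lambda>i. cls (range r) (f i)) =
    (\<lambda>i. cls (range r) (if i = 0 then \<Sum>v\<in>UNIV. gen v * f (var_nat v) else 0))"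
  unfolding matrix_map_cls
  by (rule ext, rule arg_cong[of _ _ "cls (range r)"]) (simp add: koszul_matrix_def sum_var nat_var_def var_nat_def)

lemma diff_1_cls: "koszul_diff 1 (\<lambda>i. cls (range r) (f i)) =
    (\<lambda>i. cls (range r) (if i \<in> {0, 1, 2} then \<Sum>v\<in>UNIV. tail (nat_var i) (r v) * f (var_nat v) else 0))"
  unfolding matrix_map_cls
  by (rule ext, rule arg_cong[of _ _ "cls (range r)"]) (simp add: koszul_matrix_def sum_var nat_var_def var_nat_def)

lemma diff_2_cls: "koszul_diff 2 (\<lambda>i. cls (range r) (f i)) =
    (\<lambda>i. cls (range r) (if i \<in> {0, 1, 2} then l (nat_var i) * f 0 else 0))"
  unfolding matrix_map_cls
  by (rule ext, rule arg_cong[of _ _ "cls (range r)"]) (simp add: koszul_matrix_def sum_var nat_var_def var_nat_def)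

lemma lookup_rel_Nil: "lk (r v) [] = 0"
  using quadraticD[OF quad, of v] by (simp add: homog_iff)

lemma exact_at_1:
  "koszul_diff 1 ` free_module (range r) (koszul_basis 2) =
   {u \<in> free_module (range r) (koszul_basis 1). koszul_diff 0 u = (\<lambda>i. \<zero>\<^bsub>alg (range r)\<^esub>)}" (is "?L = ?R")
proof
  show "?L \<subseteq> ?R"
  proof
    fix x assume "x \<in> ?L"
    then obtain u where u: "u \<in> free_module (range r) (koszul_basis 2)" "x = koszul_diff 1 u" by blast
    then obtain f where f: "u = (\<lambda>i. cls (range r) (f i))" using free_module_rep by blast
    have x1: "x \<in> free_module (range r) (koszul_basis 1)"
      using matrix_map_linear[OF koszul_basis_finite] u unfolding right_linear_def by blast
    have "(\<Sum>u\<in>UNIV. gen u * (\<Sum>v\<in>UNIV. tail u (r v) * f (var_nat v))) = (\<Sum>v\<in>UNIV. r v * f (var_nat v))"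
    proof -
      have "r v * h = (\<Sum>u\<in>UNIV. gen u * (tail u (r v) * h))" for v h
        by (subst tail_expand[of "r v"]) (simp add: lookup_rel_Nil sum_distrib_right mult.assoc)
      then show ?thesis by (simp only: sum_distrib_left) (rule sum.swap)
    qed
    moreover have "(\<Sum>v\<in>UNIV. r v * f (var_nat v)) \<in> I"
      using rel_ideal_subset[of "range r"] by (intro rel_ideal_sum rel_ideal_mult_right) blast
    ultimately have "koszul_diff 0 x = (\<lambda>i. \<zero>\<^bsub>alg (range r)\<^esub>)"
      unfolding u(2) f diff_1_cls diff_0_cls zero_fun_iff by (simp add: var_nat_in[simplified])
    then show "x \<in> ?R" using x1 by simp
  qed
  show "?R \<subseteq> ?L"
  proof
    fix x assume x: "x \<in> ?R"
    then obtain f where f: "x = (\<lambda>i. cls (range r) (f i))" "\<forall>i. i \<notin> koszul_basis 1 \<longrightarrow> f i = 0"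
      using free_module_rep by blast
    have "koszul_diff 0 (\<lambda>i. cls (range r) (f i)) = (\<lambda>i. \<zero>\<^bsub>alg (range r)\<^esub>)"
      using x unfolding f(1) by blast
    then have "\<forall>i::nat. (if i = 0 then \<Sum>v\<in>UNIV. gen v * f (var_nat v) else 0) \<in> I"
      unfolding diff_0_cls zero_fun_iff .
    from this[rule_format, of 0] have "(\<Sum>v\<in>UNIV. gen v * f (var_nat v)) \<in> I" by simp
    then obtain t where t: "\<forall>u. f (var_nat u) - (\<Sum>v\<in>UNIV. tail u (r v) * t v) \<in> I"
      using exact_1[of "\<lambda>v. f (var_nat v)"] by blast
    define h where "h i = (if i \<in> {0, 1, 2} then t (nat_var i) else 0)" for i
    have ht: "h (var_nat v) = t v" for v using var_nat_in[of v] by (auto simp: h_def)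
    have "(\<lambda>i. cls (range r) (h i)) \<in> free_module (range r) (koszul_basis 2)"
      by (rule cls_free_module) (simp_all add: h_def)
    moreover have "x = koszul_diff 1 (\<lambda>i. cls (range r) (h i))"
      unfolding f(1) diff_1_cls cls_fun_eq_iff
    proof
      fix i
      show "f i - (if i \<in> {0, 1, 2} then \<Sum>v\<in>UNIV. tail (nat_var i) (r v) * h (var_nat v) else 0) \<in> I"
        using t[rule_format, of "nat_var i"] f(2) var_nat_nat_var[of i] by (auto simp: ht)
    qed
    ultimately show "x \<in> ?L" by blast
  qed
qed

lemma exact_at_2:
  "koszul_diff 2 ` free_module (range r) (koszul_basis 3) =
   {u \<in> free_module (range r) (koszul_basis 2). koszul_diff 1 u = (\<lambda>i. \<zero>\<^bsub>alg (range r)\<^esub>)}" (is "?L = ?R")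
proof
  show "?L \<subseteq> ?R"
  proof
    fix x assume "x \<in> ?L"
    then obtain u where u: "u \<in> free_module (range r) (koszul_basis 3)" "x = koszul_diff 2 u" by blast
    then obtain f where f: "u = (\<lambda>i. cls (range r) (f i))" using free_module_rep by blast
    have x1: "x \<in> free_module (range r) (koszul_basis 2)"
      using matrix_map_linear[OF koszul_basis_finite] u unfolding right_linear_def by blast
    \<comment> \<open>Applying \<open>tail u\<close> to both expressions of the potential identifies
      row \<open>u\<close> of \<open>N l\<close> with \<open>nn u\<close>, a combination of
      relations.\<close>
    have "(\<Sum>v\<in>UNIV. tail u (r v) * (l v * f 0)) \<in> I" for u
    proof -
      have "tail u (\<Sum>v\<in>UNIV. r v * l v) = (\<Sum>v\<in>UNIV. tail u (r v) * l v)"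
        by (simp add: tail_sum tail_mult lookup_rel_Nil)
      moreover have "tail u (\<Sum>v\<in>UNIV. gen v * nn v) = nn u" by (cases u) (simp_all add: sum_var)
      ultimately have "(\<Sum>v\<in>UNIV. tail u (r v) * (l v * f 0)) = nn u * f 0"
        using w_eq by (simp add: sum_distrib_right mult.assoc[symmetric])
      moreover have "nn u \<in> I" 
      proof -
        obtain c where "nn u = (\<Sum>v\<in>UNIV. c v *\<^sub>s r v)" using nn span_range_iff by blast
        then show ?thesis using rel_ideal_subset[of "range r"] by (auto intro!: rel_ideal_sum rel_ideal_smul)
      qed
      ultimately show ?thesis by (simp add: rel_ideal_mult_right)
    qed
    then have "koszul_diff 1 x = (\<lambda>i. \<zero>\<^bsub>alg (range r)\<^esub>)"
      unfolding u(2) f diff_1_cls diff_2_cls zero_fun_iff by (simp add: var_nat_in[simplified])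
    then show "x \<in> ?R" using x1 by simp
  qed
  show "?R \<subseteq> ?L"
  proof
    fix x assume x: "x \<in> ?R"
    then obtain f where f: "x = (\<lambda>i. cls (range r) (f i))" "\<forall>i. i \<notin> koszul_basis 2 \<longrightarrow> f i = 0"
      using free_module_rep by blast
    have "koszul_diff 1 (\<lambda>i. cls (range r) (f i)) = (\<lambda>i. \<zero>\<^bsub>alg (range r)\<^esub>)"
      using x unfolding f(1) by blast
    then have *: "\<forall>i. (if i \<in> {0, 1, 2} then \<Sum>v\<in>UNIV. tail (nat_var i) (r v) * f (var_nat v) else 0) \<in> I"
      unfolding diff_1_cls zero_fun_iff .
    have "(\<Sum>v\<in>UNIV. tail u (r v) * f (var_nat v)) \<in> I" for u
      using *[rule_format, of "var_nat u"] by (simp only: nat_var_var_nat var_nat_in if_True)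
    then obtain h where h: "\<forall>v. f (var_nat v) - l v * h \<in> I"
      using exact_2[of "\<lambda>v. f (var_nat v)"] by blast
    have "(\<lambda>i. cls (range r) (if i = 0 then h else 0)) \<in> free_module (range r) (koszul_basis 3)"
      by (rule cls_free_module) simp_all
    moreover have "x = koszul_diff 2 (\<lambda>i. cls (range r) (if i = 0 then h else 0))"
      unfolding f(1) diff_2_cls cls_fun_eq_iff
    proof
      fix i
      show "f i - (if i \<in> {0, 1, 2} then l (nat_var i) * (if (0::nat) = 0 then h else 0) else 0) \<in> I"
        using h[rule_format, of "nat_var i"] f(2) var_nat_nat_var[of i] by auto
    qed
    ultimately show "x \<in> ?L" by blast
  qed
qed

lemma free_module_empty: "free_module R {} = {\<lambda>i. \<zero>\<^bsub>alg R\<^esub>}"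
  using ring.ring_simprules(2)[OF alg_ring, of R] by (auto simp: free_module_def)

lemma diff_zero: "matrix_map R B M (\<lambda>i. \<zero>\<^bsub>alg R\<^esub>) = (\<lambda>i. \<zero>\<^bsub>alg R\<^esub>)"
  unfolding cls_zero[symmetric] matrix_map_cls by (rule ext) simp

lemma exact_at_3:
  "koszul_diff 3 ` free_module (range r) (koszul_basis 4) =
   {u \<in> free_module (range r) (koszul_basis 3). koszul_diff 2 u = (\<lambda>i. \<zero>\<^bsub>alg (range r)\<^esub>)}" (is "?L = ?R")
proof -
  have "?R = {\<lambda>i. \<zero>\<^bsub>alg (range r)\<^esub>}"
  proof
    show "?R \<subseteq> {\<lambda>i. \<zero>\<^bsub>alg (range r)\<^esub>}"
    proof
      fix x assume x: "x \<in> ?R"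
      then obtain f where f: "x = (\<lambda>i. cls (range r) (f i))" "\<forall>i. i \<notin> koszul_basis 3 \<longrightarrow> f i = 0"
        using free_module_rep by blast
      have "koszul_diff 2 (\<lambda>i. cls (range r) (f i)) = (\<lambda>i. \<zero>\<^bsub>alg (range r)\<^esub>)"
        using x unfolding f(1) by blast
      then have *: "\<forall>i. (if i \<in> {0, 1, 2} then l (nat_var i) * f 0 else 0) \<in> I"
        unfolding diff_2_cls zero_fun_iff .
      have "l u * f 0 \<in> I" for u
        using *[rule_format, of "var_nat u"] by (simp only: nat_var_var_nat var_nat_in if_True)
      then have "f 0 \<in> I" by (rule exact_3)
      then have "f i \<in> I" for i using f(2) by (cases "i = 0") auto
      then show "x \<in> {\<lambda>i. \<zero>\<^bsub>alg (range r)\<^esub>}" unfolding f(1) using zero_fun_iff by blast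
    qed
    have "(\<lambda>i. cls (range r) 0) \<in> free_module (range r) (koszul_basis 3)"
      by (rule cls_free_module) simp_all
    then show "{\<lambda>i. \<zero>\<^bsub>alg (range r)\<^esub>} \<subseteq> ?R" by (simp add: cls_zero diff_zero)
  qed
  moreover have "?L = {\<lambda>i. \<zero>\<^bsub>alg (range r)\<^esub>}" by (simp add: free_module_empty diff_zero)
  ultimately show ?thesis by simp
qed

lemma exact_at_0:
  "koszul_diff 0 ` free_module (range r) (koszul_basis 1) =
   {u \<in> free_module (range r) (koszul_basis 0). augmentation (range r) (u 0) = 0}" (is "?L = ?R")
proof
  show "?L \<subseteq> ?R"
  proof
    fix x assume "x \<in> ?L"
    then obtain u where u: "u \<in> free_module (range r) (koszul_basis 1)" "x = koszul_diff 0 u" by blast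
    then obtain f where f: "u = (\<lambda>i. cls (range r) (f i))" using free_module_rep by blast
    have "x \<in> free_module (range r) (koszul_basis 0)"
      using matrix_map_linear[OF koszul_basis_finite] u unfolding right_linear_def by blast
    moreover have "augmentation (range r) (x 0) = 0"
      unfolding u(2) f diff_0_cls by (simp add: augmentation_cls[OF quad] lookup_sum lookup_gen_mult)
    ultimately show "x \<in> ?R" by simp
  qed
  show "?R \<subseteq> ?L"
  proof
    fix x assume x: "x \<in> ?R"
    then obtain f where f: "x = (\<lambda>i. cls (range r) (f i))" "\<forall>i. i \<notin> koszul_basis 0 \<longrightarrow> f i = 0"
      using free_module_rep by blast
    have "lk (f 0) [] = 0" using x unfolding f(1) by (simp add: augmentation_cls[OF quad])
    then obtain s where s: "f 0 = (\<Sum>v\<in>UNIV. gen v * s v)" using exact_0 by blast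
    define h where "h i = (if i \<in> {0, 1, 2} then s (nat_var i) else 0)" for i
    have hs: "h (var_nat v) = s v" for v using var_nat_in[of v] by (auto simp: h_def)
    have "(\<lambda>i. cls (range r) (h i)) \<in> free_module (range r) (koszul_basis 1)"
      by (rule cls_free_module) (simp_all add: h_def)
    moreover have "x = koszul_diff 0 (\<lambda>i. cls (range r) (h i))"
      unfolding f(1) diff_0_cls hs s[symmetric] using f(2) by (intro ext arg_cong[of _ _ "cls (range r)"]) auto
    ultimately show "x \<in> ?L" by blast
  qed
qed

theorem koszul: "koszul (range r)"
  unfolding koszul_def
proof (intro exI[of _ koszul_basis] exI[of _ "\<lambda>m. koszul_diff m"] conjI allI)
  show "koszul_basis 0 = {0}" by simp
  show "right_linear (range r) (koszul_basis (Suc m)) (koszul_basis m) (koszul_diff m)" for m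
    by (rule matrix_map_linear) simp
  show "koszul_diff m ` free_module_component (range r) (koszul_basis (Suc m)) (Suc m) j
      \<subseteq> free_module_component (range r) (koszul_basis m) m j" for m j
    by (rule matrix_map_graded[OF koszul_basis_finite koszul_matrix_homog])
  show "koszul_diff 0 ` free_module (range r) (koszul_basis 1) =
    {u \<in> free_module (range r) (koszul_basis 0). augmentation (range r) (u 0) = 0}" by (rule exact_at_0)
  show "augmentation (range r) ` carrier (alg (range r)) = UNIV"
  proof -
    have "c \<in> augmentation (range r) ` carrier (alg (range r))" for c
      using imageI[OF cls_closed[of "range r" "scal c"], of "augmentation (range r)"]
      by (simp add: augmentation_cls[OF quad] lookup_scal)
    then show ?thesis by blast
  qed
  show "koszul_diff (Suc m) ` free_module (range r) (koszul_basis (Suc (Suc m))) =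
    {u \<in> free_module (range r) (koszul_basis (Suc m)). koszul_diff m u = (\<lambda>i. \<zero>\<^bsub>alg (range r)\<^esub>)}" for m
  proof -
    consider "m = 0" | "m = 1" | "m = 2" | "m > 2" by linarith
    then show ?thesis
    proof cases
      case 4
      then show ?thesis by (auto simp: free_module_empty diff_zero)
    qed (use exact_at_1 exact_at_2 exact_at_3 in \<open>simp_all add: eval_nat_numeral\<close>)
  qed
qed

end


section \<open>Generalized Sklyanin relations\<close>

fun nxt :: "var \<Rightarrow> var" where
  "nxt VX = VY" | "nxt VY = VZ" | "nxt VZ = VX"

text \<open>Each relation is indexed by the letter whose square it may contain, so that cyclic
  permutations of the variables act on the coefficients by composition with
  \<open>nxt\<close>.\<close>

definition skl :: "(var \<Rightarrow> 'k) \<Rightarrow> (var \<Rightarrow> 'k) \<Rightarrow> (var \<Rightarrow> 'k) \<Rightarrow> var \<Rightarrow> 'k::field free_alg"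
  where "skl p q r v = p v *\<^sub>s mon [nxt v, nxt (nxt v)] + q v *\<^sub>s mon [nxt (nxt v), nxt v] + r v *\<^sub>s mon [v, v]"

definition vec :: "'k \<Rightarrow> 'k \<Rightarrow> 'k \<Rightarrow> var \<Rightarrow> 'k"
  where "vec a b c v = (case v of VX \<Rightarrow> a | VY \<Rightarrow> b | VZ \<Rightarrow> c)"

lemma vec_simps [simp]: "vec a b c VX = a" "vec a b c VY = b" "vec a b c VZ = c"
  by (simp_all add: vec_def)

lemma set_sklyanin_rels:
  "set (sklyanin_rels p1 p2 p3 q1 q2 q3 r1 r2 r3) = range (skl (vec p1 p2 p3) (vec q1 q2 q3) (vec r1 r2 r3))"
  by (simp add: sklyanin_rels_def skl_def UNIV_var scal_mult gen_eq_mon mult.assoc)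

lemma skl_homog: "skl p q r v \<in> homog 2"
  unfolding skl_def by (intro homog_add homog_smul) (simp_all add: homog_mon)

lemma skl_quadratic: "quadratic (skl p q r)"
  by (simp add: quadratic_def skl_homog)

lemma lookup_skl: "lk (skl p q r v) l =
    (if l = [nxt v, nxt (nxt v)] then p v else if l = [nxt (nxt v), nxt v] then q v
     else if l = [v, v] then r v else 0)"
  by (cases v) (auto simp: skl_def lookup_add lookup_smul lookup_mon)

lemma skl_right_indep:
  assumes "\<And>v. p v \<noteq> 0 \<or> q v \<noteq> 0 \<or> r v \<noteq> 0"
  shows "right_indep (skl p q r)"
proof (rule right_indep_of_independent[OF skl_quadratic], rule allI)
  fix c v assume 0: "(\<Sum>v\<in>UNIV. c v *\<^sub>s skl p q r v) = 0"
  have "(\<Sum>v\<in>UNIV. c v * lk (skl p q r v) l) = 0" for l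
    using arg_cong[OF 0, of "\<lambda>f. lk f l"] by (simp add: lookup_sum lookup_smul)
  from this[of "[nxt v, nxt (nxt v)]"] this[of "[nxt (nxt v), nxt v]"] this[of "[v, v]"] assms[of v]
  show "c v = 0" by (cases v) (auto simp: sum_var lookup_skl)
qed

lemma con_mon: "con a (mon [u, t]) = a u *\<^sub>s gen t"
proof -
  have eq: "mon [u, t] = gen u * gen t" by (simp add: gen_eq_mon)
  show ?thesis unfolding eq by (cases u) (simp_all add: con_def sum_var)
qed

lemma con_skl: "con a (skl p q r v) = (p v * a (nxt v)) *\<^sub>s gen (nxt (nxt v))
    + (q v * a (nxt (nxt v))) *\<^sub>s gen (nxt v) + (r v * a v) *\<^sub>s gen v"
  by (simp add: skl_def con_add con_smul con_mon)

lemma con_in_span_image: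
  fixes r :: "var \<Rightarrow> 'k::field free_alg"
  shows "con a (\<Sum>v\<in>UNIV. c v *\<^sub>s r v) \<in> con a ` fa.span (range r)"
  using span_range_iff[of _ r] by blast


subsection \<open>Classes \<open>\<P>\<^sub>2\<close>, \<open>\<P>\<^sub>3\<close> and \<open>\<P>\<^sub>4\<close>\<close>

text \<open>The weights \<open>b * c\<close>, \<open>a\<close>, \<open>1\<close> on one side and
  \<open>1\<close>, \<open>c\<close>, \<open>a * b\<close> on the other balance the words with three
  different letters. The words \<open>yyy\<close> and \<open>zzz\<close> occur with
  \<open>a * s\<close> against \<open>c * s\<close> and with \<open>t\<close> against
  \<open>a * b * t\<close>, whence the two assumptions. Parameters may vanish here, so the point and
  the line are given explicitly instead of being found on a cubic.\<close>

lemma solvable_potential: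
  fixes a b c s t :: "'k::field"
  assumes "s \<noteq> 0 \<Longrightarrow> a = c" "t \<noteq> 0 \<Longrightarrow> a * b = 1"
  shows "potential (skl (vec 1 b 1) (vec (- a) (- 1) (- c)) (vec 0 s t))
    (vec ((b * c) *\<^sub>s gX) (a *\<^sub>s gY) gZ)
    (vec (skl (vec 1 b 1) (vec (- a) (- 1) (- c)) (vec 0 s t) VX)
       (c *\<^sub>s skl (vec 1 b 1) (vec (- a) (- 1) (- c)) (vec 0 s t) VY)
       ((a * b) *\<^sub>s skl (vec 1 b 1) (vec (- a) (- 1) (- c)) (vec 0 s t) VZ)) gZ"
    (is "potential ?r ?l ?n _")
proof
  show quad: "quadratic ?r" by (rule skl_quadratic)
  show "right_indep ?r"
  proof (rule skl_right_indep)
    show "vec 1 b 1 v \<noteq> 0 \<or> vec (- a) (- 1) (- c) v \<noteq> 0 \<or> vec 0 s t v \<noteq> 0" for v by (cases v) auto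
  qed
  show "?l v \<in> homog (Suc 0)" for v by (cases v) (simp_all add: homog_smul)
  show "?n v \<in> fa.span (range ?r)" for v
    by (cases v) (simp_all add: fa.span_scale fa.span_base)
  show "(\<Sum>v\<in>UNIV. ?r v * ?l v) = (\<Sum>v\<in>UNIV. gen v * ?n v)"
    using assms by (cases "s = 0"; cases "t = 0")
      (simp_all add: sum_var skl_def gen_eq_mon distrib_left distrib_right fa.scale_right_distrib algebra_simps)
  show "gZ \<in> homog (Suc 0)" by simp
  show "gZ \<noteq> (0 :: 'k free_alg)" by (simp add: poly_mapping_eq_iff fun_eq_iff gen_def lookup_single)
  show "gZ \<in> fa.span (range ?l)" using fa.span_base[OF rangeI[of ?l VZ]] by simp
  \<comment> \<open>This point is its own successor: contracting the second and the third relation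
    with it gives \<open>- z\<close> and \<open>y\<close>, which span the forms vanishing
    there.\<close>
  let ?a = "vec 1 0 0 :: var \<Rightarrow> 'k"
  have ker: "u \<in> fa.span {gZ, gY}" if "u \<in> homog (Suc 0)" "ev ?a u = 0" for u :: "'k free_alg"
  proof -
    have "lk u [VX] = 0" using that(2) by (simp add: ev_def sum_var)
    then have "u = lk u [VY] *\<^sub>s gY + lk u [VZ] *\<^sub>s gZ" using lin_expand[OF that(1)] by (simp add: sum_var)
    moreover have "lk u [VY] *\<^sub>s gY + lk u [VZ] *\<^sub>s gZ \<in> fa.span {gZ, gY}"
      by (intro fa.span_add fa.span_scale fa.span_base) auto
    ultimately show ?thesis by simp
  qed
  have pts: "point_system ?r {?a}"
    unfolding point_system_def
  proof (intro ballI conjI)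
    fix a' assume "a' \<in> {?a}" then have a': "a' = ?a" by simp
    show "\<exists>v. a' v \<noteq> 0" using a' by (intro exI[of _ VX]) simp
    show "\<exists>a''\<in>{?a}. \<forall>u\<in>homog (Suc 0). ev a'' u = 0 \<longrightarrow> u \<in> con a' ` fa.span (range ?r)"
    proof (intro bexI[of _ ?a] ballI impI)
      fix u :: "'k free_alg" assume u: "u \<in> homog (Suc 0)" "ev ?a u = 0"
      have "lk u [VX] = 0" using u(2) by (simp add: ev_def sum_var)
      then have "u = lk u [VY] *\<^sub>s gY + lk u [VZ] *\<^sub>s gZ" using lin_expand[OF u(1)] by (simp add: sum_var)
      also have "\<dots> = con a' (\<Sum>v\<in>UNIV. vec 0 (- lk u [VZ]) (lk u [VY]) v *\<^sub>s ?r v)"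
        by (simp add: a' con_sum con_smul con_skl sum_var con_add con_diff)
      finally show "u \<in> con a' ` fa.span (range ?r)" using con_in_span_image by metis
    qed simp
  qed
  have lines: "line_system ?r {?a} {gZ}"
    unfolding line_system_def
  proof (intro ballI conjI)
    fix z' :: "'k free_alg" assume "z' \<in> {gZ}" then have z': "z' = gZ" by simp
    show "z' \<in> homog (Suc 0)" "z' \<noteq> 0" using z' \<open>gZ \<noteq> 0\<close> by auto
    \<comment> \<open>The first relation itself has the shape \<open>y * l + z * m\<close> with
      \<open>l = z\<close>, so the line \<open>z\<close> is its own successor.\<close>
    have "gY * gZ + gZ * (- a *\<^sub>s gY) = ?r VX" by (simp add: skl_def gen_eq_mon)
    then have "gY * gZ + gZ * (- a *\<^sub>s gY) \<in> fa.span (range ?r)" by (simp add: fa.span_base)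
    moreover have "- a *\<^sub>s gY \<in> homog (Suc 0)" by (intro homog_smul homog_gen)
    ultimately show "\<exists>a\<in>{?a}. \<exists>y\<in>homog (Suc 0). \<exists>l\<in>{gZ}. \<exists>m\<in>homog (Suc 0).
      (\<forall>u\<in>homog (Suc 0). ev a u = 0 \<longrightarrow> u \<in> fa.span {z', y}) \<and> y * l + z' * m \<in> fa.span (range ?r)"
      unfolding z' using ker \<open>- a *\<^sub>s gY \<in> homog (Suc 0)\<close>
      by - (rule bexI[of _ ?a], rule bexI[of _ gY], rule bexI[of _ gZ],
          rule bexI[of _ "- a *\<^sub>s gY"], auto)
  qed
  show "line_bound ?r gZ n" for n by (rule line_system_bound[OF quad pts lines]) simp
qed


subsection \<open>Nondegenerate relations\<close>

text \<open>The coefficients are the minors of two columns: these columns are annihilated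
  identically, the third one by the determinant. If all minors vanish, the rows are pairwise
  proportional, and an explicit relation between at most two of them is enough.\<close>

lemma det3_kernel:
  fixes a1 a2 a3 b1 b2 b3 c1 c2 c3 :: "'k::field"
  assumes "a1 * (b2 * c3 - b3 * c2) - a2 * (b1 * c3 - b3 * c1) + a3 * (b1 * c2 - b2 * c1) = 0"
  shows "\<exists>x y z. (x \<noteq> 0 \<or> y \<noteq> 0 \<or> z \<noteq> 0) \<and> x * a1 + y * b1 + z * c1 = 0 \<and>
    x * a2 + y * b2 + z * c2 = 0 \<and> x * a3 + y * b3 + z * c3 = 0"
proof -
  let ?P = "\<lambda>x y z. (x \<noteq> 0 \<or> y \<noteq> 0 \<or> z \<noteq> 0) \<and> x * a1 + y * b1 + z * c1 = 0 \<and>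
    x * a2 + y * b2 + z * c2 = 0 \<and> x * a3 + y * b3 + z * c3 = 0"
  consider "b1 * c2 - c1 * b2 \<noteq> 0 \<or> c1 * a2 - a1 * c2 \<noteq> 0 \<or> a1 * b2 - b1 * a2 \<noteq> 0"
    | "b1 * c3 - c1 * b3 \<noteq> 0 \<or> c1 * a3 - a1 * c3 \<noteq> 0 \<or> a1 * b3 - b1 * a3 \<noteq> 0"
    | "b2 * c3 - c2 * b3 \<noteq> 0 \<or> c2 * a3 - a2 * c3 \<noteq> 0 \<or> a2 * b3 - b2 * a3 \<noteq> 0"
    | (par) "b1 * c2 = c1 * b2" "c1 * a2 = a1 * c2" "a1 * b2 = b1 * a2"
      "b1 * c3 = c1 * b3" "c1 * a3 = a1 * c3" "a1 * b3 = b1 * a3"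
      "b2 * c3 = c2 * b3" "c2 * a3 = a2 * c3" "a2 * b3 = b2 * a3"
    by force
  then show ?thesis
  proof cases
    case 1
    moreover have "(b1 * c2 - c1 * b2) * a3 + (c1 * a2 - a1 * c2) * b3 + (a1 * b2 - b1 * a2) * c3 = 0"
      using assms by (simp add: algebra_simps)
    ultimately have "?P (b1 * c2 - c1 * b2) (c1 * a2 - a1 * c2) (a1 * b2 - b1 * a2)"
      by (simp add: algebra_simps)
    then show ?thesis by blast
  next
    case 2
    moreover have "(b1 * c3 - c1 * b3) * a2 + (c1 * a3 - a1 * c3) * b2 + (a1 * b3 - b1 * a3) * c2 = 0"
    proof -
      have "(b1 * c3 - c1 * b3) * a2 + (c1 * a3 - a1 * c3) * b2 + (a1 * b3 - b1 * a3) * c2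
        = - (a1 * (b2 * c3 - b3 * c2) - a2 * (b1 * c3 - b3 * c1) + a3 * (b1 * c2 - b2 * c1))"
        by (simp add: algebra_simps)
      then show ?thesis using assms by simp
    qed
    ultimately have "?P (b1 * c3 - c1 * b3) (c1 * a3 - a1 * c3) (a1 * b3 - b1 * a3)"
      by (simp add: algebra_simps)
    then show ?thesis by blast
  next
    case 3
    moreover have "(b2 * c3 - c2 * b3) * a1 + (c2 * a3 - a2 * c3) * b1 + (a2 * b3 - b2 * a3) * c1 = 0"
      using assms by (simp add: algebra_simps)
    ultimately have "?P (b2 * c3 - c2 * b3) (c2 * a3 - a2 * c3) (a2 * b3 - b2 * a3)"
      by (simp add: algebra_simps)
    then show ?thesis by blast
  next
    case par
    have b: "b1 * a2 - a1 * b2 = 0" "b1 * a3 - a1 * b3 = 0" "b2 * a1 - a2 * b1 = 0" "b2 * a3 - a2 * b3 = 0"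
      "b3 * a1 - a3 * b1 = 0" "b3 * a2 - a3 * b2 = 0"
      and c: "c1 * a2 - a1 * c2 = 0" "c1 * a3 - a1 * c3 = 0" "c2 * a1 - a2 * c1 = 0" "c2 * a3 - a2 * c3 = 0"
      "c3 * a1 - a3 * c1 = 0" "c3 * a2 - a3 * c2 = 0"
      using par by (simp_all add: mult.commute)
    have h1: "?P b1 (- a1) 0 \<or> ?P c1 0 (- a1)" if "a1 \<noteq> 0 \<or> b1 \<noteq> 0 \<or> c1 \<noteq> 0"
      proof (cases "a1 = 0 \<and> b1 = 0")
      case True
      then have "c1 \<noteq> 0" using that by blast
      then show ?thesis using True c(1,2) by simp
    next
      case False
      then have "b1 \<noteq> 0 \<or> - a1 \<noteq> 0" by auto
      then have "?P b1 (- a1) 0" using b(1,2) by (simp add: mult.commute)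
      then show ?thesis by blast
    qed
    have h2: "?P b2 (- a2) 0 \<or> ?P c2 0 (- a2)" if "a2 \<noteq> 0 \<or> b2 \<noteq> 0 \<or> c2 \<noteq> 0"
      proof (cases "a2 = 0 \<and> b2 = 0")
      case True
      then have "c2 \<noteq> 0" using that by blast
      then show ?thesis using True c(3,4) by simp
    next
      case False
      then have "b2 \<noteq> 0 \<or> - a2 \<noteq> 0" by auto
      then have "?P b2 (- a2) 0" using b(3,4) by (simp add: mult.commute)
      then show ?thesis by blast
    qed
    have h3: "?P b3 (- a3) 0 \<or> ?P c3 0 (- a3)" if "a3 \<noteq> 0 \<or> b3 \<noteq> 0 \<or> c3 \<noteq> 0"
      proof (cases "a3 = 0 \<and> b3 = 0")
      case True
      then have "c3 \<noteq> 0" using that by blast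
      then show ?thesis using True c(5,6) by simp
    next
      case False
      then have "b3 \<noteq> 0 \<or> - a3 \<noteq> 0" by auto
      then have "?P b3 (- a3) 0" using b(5,6) by (simp add: mult.commute)
      then show ?thesis by blast
    qed
    have h4: "?P 1 0 0" if "a1 = 0" "a2 = 0" "a3 = 0" using that by simp
    consider "a1 \<noteq> 0" | "a2 \<noteq> 0" | "a3 \<noteq> 0" | "a1 = 0" "a2 = 0" "a3 = 0" by blast
    then show ?thesis
    proof cases
      case 1
      then have "?P b1 (- a1) 0 \<or> ?P c1 0 (- a1)" using h1 by simp
      then show ?thesis by (elim disjE) (intro exI, assumption)+
    next
      case 2
      then have "?P b2 (- a2) 0 \<or> ?P c2 0 (- a2)" using h2 by simp
      then show ?thesis by (elim disjE) (intro exI, assumption)+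
    next
      case 3
      then have "?P b3 (- a3) 0 \<or> ?P c3 0 (- a3)" using h3 by simp
      then show ?thesis by (elim disjE) (intro exI, assumption)+
    next
      case 4
      then show ?thesis using h4 by (intro exI)
    qed
  qed
qed

text \<open>\<open>n\<close> is the cross product of \<open>f\<close> and \<open>g\<close>, and
  \<open>x\<close> is orthogonal to it. Cramer's rule in the two coordinates other than
  \<open>w\<close>, whose minor is \<open>n w\<close>, gives the coefficients; orthogonality settles
  the coordinate \<open>w\<close>.\<close>

lemma cross_product_span:
  fixes f g x :: "var \<Rightarrow> 'k::field"
  defines "n \<equiv> \<lambda>v. f (nxt v) * g (nxt (nxt v)) - f (nxt (nxt v)) * g (nxt v)"
  assumes "n w \<noteq> 0" "(\<Sum>v\<in>UNIV. n v * x v) = 0"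
  shows "\<exists>c d. \<forall>u. x u = c * f u + d * g u"
proof -
  let ?u = "nxt w" and ?t = "nxt (nxt w)"
  define c where "c = (x ?u * g ?t - x ?t * g ?u) / n w"
  define d where "d = (f ?u * x ?t - f ?t * x ?u) / n w"
  have sum: "n w * x w + n ?u * x ?u + n ?t * x ?t = 0"
    using assms(3) by (cases w) (simp_all add: sum_var algebra_simps)
  have n3: "nxt ?t = w" by (cases w) simp_all
  have "n w * x v = n w * (c * f v + d * g v)" if "v = w \<or> v = ?u \<or> v = ?t" for v
  proof -
    have cn: "n w * (c * f v + d * g v) = (x ?u * g ?t - x ?t * g ?u) * f v + (f ?u * x ?t - f ?t * x ?u) * g v"
      using assms(2) by (simp add: c_def d_def distrib_left)
    have "n w * x v = (x ?u * g ?t - x ?t * g ?u) * f v + (f ?u * x ?t - f ?t * x ?u) * g v"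
    proof (cases "v = w")
      case True
      have "n w * x w = - (n ?u * x ?u) - n ?t * x ?t" using sum by (simp add: algebra_simps eq_neg_iff_add_eq_0)
      then show ?thesis unfolding True by (simp add: n_def n3 algebra_simps)
    next
      case False
      then have "v = ?u \<or> v = ?t" using that by blast
      then show ?thesis by (auto simp: n_def algebra_simps)
    qed
    then show ?thesis using cn by simp
  qed
  moreover have "v = w \<or> v = ?u \<or> v = ?t" for v by (cases w; cases v) simp_all
  ultimately have "x v = c * f v + d * g v" for v using assms(2) mult_left_cancel by blast
  then show ?thesis by blast
qed

definition coef :: "'k::field free_alg \<Rightarrow> var \<Rightarrow> 'k" where "coef u v = lk u [v]"

lemma lin_coef_eqI: "u \<in> homog (Suc 0) \<Longrightarrow> w \<in> homog (Suc 0) \<Longrightarrow> (\<And>v. coef u v = coef w v) \<Longrightarrow> u = w"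
  using lin_expand[of u] lin_expand[of w] by (simp add: coef_def)

lemma coef_simps [simp]: "coef (u + w) v = coef u v + coef w v" "coef (u - w) v = coef u v - coef w v"
  "coef (c *\<^sub>s u) v = c * coef u v" "coef (gen t) v = (if t = v then 1 else 0)" "coef 0 v = 0"
  by (auto simp: coef_def lookup_add lookup_minus lookup_smul lookup_gen)

text \<open>The forms vanishing at \<open>a\<close> have as a basis the \<open>e v\<close> at the
  two letters other than \<open>w\<close>. By exchange, \<open>z\<close> replaces one of these two,
  and \<open>y\<close> is the other.\<close>

lemma ker_complement:
  fixes z :: "'k::field free_alg"
  assumes a: "a w \<noteq> 0" and z: "z \<in> homog (Suc 0)" "z \<noteq> 0" "ev a z = 0"
  shows "\<exists>y\<in>homog (Suc 0). \<forall>u\<in>homog (Suc 0). ev a u = 0 \<longrightarrow> u \<in> fa.span {z, y}"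
proof -
  define e where "e v = gen v - (a v / a w) *\<^sub>s gen w" for v
  have eh: "e v \<in> homog (Suc 0)" for v unfolding e_def by (intro homog_diff homog_smul homog_gen)
  have ew: "e w = 0" using a by (simp add: e_def)
  have exp: "u = (\<Sum>v\<in>UNIV. coef u v *\<^sub>s e v)" if "u \<in> homog (Suc 0)" "ev a u = 0" for u
  proof -
    have "u = (\<Sum>v\<in>UNIV. e v * tail v u)"
      unfolding e_def by (rule con_eq_0_expand[of _ 0]) (use that a con_lin[OF that(1)] in auto)
    then show ?thesis by (simp add: tail_lin[OF that(1)] coef_def)
  qed
  let ?p = "nxt w" and ?t = "nxt (nxt w)"
  have exp2: "u = coef u ?p *\<^sub>s e ?p + coef u ?t *\<^sub>s e ?t" if "u \<in> homog (Suc 0)" "ev a u = 0" for u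
    using exp[OF that] ew by (cases w) (simp_all add: sum_var add_ac)
  have ze: "z = coef z ?p *\<^sub>s e ?p + coef z ?t *\<^sub>s e ?t" by (rule exp2[OF z(1,3)])
  show ?thesis
  proof (cases "coef z ?p = 0")
    case False
    have "e ?p \<in> fa.span {z, e ?t}"
    proof -
      have "e ?p = (1 / coef z ?p) *\<^sub>s z + (- coef z ?t / coef z ?p) *\<^sub>s e ?t"
        using False by (subst ze) (simp add: fa.scale_right_distrib)
      then show ?thesis by (metis fa.span_add fa.span_scale fa.span_base insertI1 insertI2)
    qed
    then show ?thesis
      by (intro bexI[of _ "e ?t"] ballI impI eh, subst exp2)
         (auto intro!: fa.span_add fa.span_scale intro: fa.span_base)
  next
    case True
    then have t0: "coef z ?t \<noteq> 0" using ze z(2) by auto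
    have "e ?t \<in> fa.span {z, e ?p}"
    proof -
      have "e ?t = (1 / coef z ?t) *\<^sub>s z" using t0 True by (subst ze) simp
      then show ?thesis by (metis fa.span_scale fa.span_base insertI1)
    qed
    then show ?thesis
      by (intro bexI[of _ "e ?p"] ballI impI eh, subst exp2)
         (auto intro!: fa.span_add fa.span_scale intro: fa.span_base)
  qed
qed

text \<open>The determinant whose zero set in the projective plane consists of the points \<open>a\<close> annihilating
  some relation by contraction on the left.\<close>

definition skl_det :: "(var \<Rightarrow> 'k) \<Rightarrow> (var \<Rightarrow> 'k) \<Rightarrow> (var \<Rightarrow> 'k) \<Rightarrow> (var \<Rightarrow> 'k) \<Rightarrow> 'k::comm_ring_1"
  where "skl_det p q r a =
    r VX * a VX * (r VY * a VY * (r VZ * a VZ) - q VY * a VX * (p VZ * a VX))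
    - q VX * a VZ * (p VY * a VZ * (r VZ * a VZ) - q VY * a VX * (q VZ * a VY))
    + p VX * a VY * (p VY * a VZ * (p VZ * a VX) - r VY * a VY * (q VZ * a VY))"

lemma skl_det_kernel:
  fixes a :: "var \<Rightarrow> 'k::field"
  assumes "skl_det p q r a = 0"
  shows "\<exists>c. (\<exists>v. c v \<noteq> 0) \<and> con a (\<Sum>v\<in>UNIV. c v *\<^sub>s skl p q r v) = 0"
proof -
  obtain x y z where xyz: "x \<noteq> 0 \<or> y \<noteq> 0 \<or> z \<noteq> 0"
    "x * (r VX * a VX) + y * (p VY * a VZ) + z * (q VZ * a VY) = 0"
    "x * (q VX * a VZ) + y * (r VY * a VY) + z * (p VZ * a VX) = 0"
    "x * (p VX * a VY) + y * (q VY * a VX) + z * (r VZ * a VZ) = 0"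
    using det3_kernel assms unfolding skl_det_def by blast
  have "con a (\<Sum>v\<in>UNIV. vec x y z v *\<^sub>s skl p q r v)
      = (x * (r VX * a VX) + y * (p VY * a VZ) + z * (q VZ * a VY)) *\<^sub>s gX
      + (x * (q VX * a VZ) + y * (r VY * a VY) + z * (p VZ * a VX)) *\<^sub>s gY
      + (x * (p VX * a VY) + y * (q VY * a VX) + z * (r VZ * a VZ)) *\<^sub>s gZ"
    by (simp add: sum_var con_add con_smul con_skl fa.scale_right_distrib fa.scale_left_distrib add_ac)
  also have "\<dots> = 0" unfolding xyz by simp
  finally show ?thesis using xyz(1) by (intro exI[of _ "vec x y z"]) (metis vec_simps)
qed

text \<open>The cubic is restricted to the line \<open>z = 0\<close>, parametrised by
  \<open>b + t d\<close>. If it does not vanish at the point \<open>d\<close> at infinity, the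
  restriction is a polynomial in \<open>t\<close> whose coefficient of degree three is
  \<open>skl_det p q r d\<close>, and it has a root.\<close>

lemma skl_det_root:
  fixes z :: "'k::alg_closed_field free_alg"
  assumes "z \<in> homog (Suc 0)"
  shows "\<exists>a. (\<exists>v. a v \<noteq> 0) \<and> ev a z = 0 \<and> skl_det p q r a = 0"
proof -
  obtain b d :: "var \<Rightarrow> 'k" where bd: "ev b z = 0" "ev d z = 0" "\<And>s t. (\<forall>v. s * b v + t * d v = 0) \<Longrightarrow> s = 0 \<and> t = 0"
  proof -
    let ?z = "coef z"
    consider "?z VX \<noteq> 0" | "?z VX = 0" "?z VY \<noteq> 0" | "?z VX = 0" "?z VY = 0" by blast
    then show ?thesis
    proof cases
      case 1 show ?thesis
        by (rule that[of "vec (?z VY) (- ?z VX) 0" "vec (?z VZ) 0 (- ?z VX)"])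
           (use 1 in \<open>auto simp: ev_def sum_var all_var coef_def\<close>)
    next
      case 2 show ?thesis
        by (rule that[of "vec 1 0 0" "vec 0 (?z VZ) (- ?z VY)"])
           (use 2 in \<open>auto simp: ev_def sum_var all_var coef_def\<close>)
    next
      case 3 show ?thesis
        by (rule that[of "vec 1 0 0" "vec 0 1 0"])
           (use 3 in \<open>auto simp: ev_def sum_var all_var coef_def\<close>)
    qed
  qed
  show ?thesis
  proof (cases "skl_det p q r d = 0")
    case True
    have "\<exists>v. d v \<noteq> 0" using bd(3)[of 0 1] by auto
    then show ?thesis using True bd(2) by blast
  next
    case False
    define P where "P = skl_det (\<lambda>v. [:p v:]) (\<lambda>v. [:q v:]) (\<lambda>v. [:r v:]) (\<lambda>v. [:b v, d v:])"
    have "coeff P 3 = skl_det p q r d"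
      by (simp add: P_def skl_det_def numeral_3_eq_3 algebra_simps)
    then have "degree P > 0" using False le_degree[of P 3] by simp
    then obtain t where t: "poly P t = 0" using alg_closed_imp_poly_has_root by blast
    have "skl_det p q r (\<lambda>v. b v + t * d v) = 0"
    proof -
      have "poly P t = skl_det p q r (\<lambda>v. b v + t * d v)"
        unfolding P_def skl_det_def poly_diff poly_add poly_mult by simp
      then show ?thesis using t by simp
    qed
    moreover have "\<exists>v. b v + t * d v \<noteq> 0" using bd(3)[of 1 t] by auto
    moreover have "ev (\<lambda>v. b v + t * d v) z = 0"
    proof -
      have "ev (\<lambda>v. b v + t * d v) z = ev b z + t * ev d z"
        by (simp add: ev_def sum_var algebra_simps)
      then show ?thesis using bd(1,2) by simp
    qed
    ultimately show ?thesis by (intro exI[of _ "\<lambda>v. b v + t * d v"] conjI)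
  qed
qed

text \<open>The conditions of \<open>class_P1\<close> in a form invariant under scaling: products
  over the three relations replace the cubes, and the first three disjuncts are the cases in which
  one kind of coefficient vanishes.\<close>

definition nondegenerate :: "(var \<Rightarrow> 'k::field) \<Rightarrow> (var \<Rightarrow> 'k) \<Rightarrow> (var \<Rightarrow> 'k) \<Rightarrow> bool"
  where "nondegenerate p q r \<longleftrightarrow>
    (\<forall>v. p v = 0) \<and> (\<forall>v. q v \<noteq> 0) \<and> (\<forall>v. r v \<noteq> 0) \<or>
    (\<forall>v. p v \<noteq> 0) \<and> (\<forall>v. q v = 0) \<and> (\<forall>v. r v \<noteq> 0) \<or>
    (\<forall>v. p v \<noteq> 0) \<and> (\<forall>v. q v \<noteq> 0) \<and> (\<forall>v. r v = 0) \<or>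
    (\<forall>v. p v \<noteq> 0) \<and> (\<forall>v. q v \<noteq> 0) \<and> (\<forall>v. r v \<noteq> 0) \<and>
      \<not> (p VX * p VY * p VZ = q VX * q VY * q VZ \<and> p VX * p VY * p VZ = r VX * r VY * r VZ)"

definition skl_mat :: "(var \<Rightarrow> 'k) \<Rightarrow> (var \<Rightarrow> 'k) \<Rightarrow> (var \<Rightarrow> 'k) \<Rightarrow> (var \<Rightarrow> 'k) \<Rightarrow> var \<Rightarrow> var \<Rightarrow> 'k::field"
  where "skl_mat p q r a v u =
    (if u = v then r v * a v else if u = nxt v then q v * a (nxt (nxt v)) else p v * a (nxt v))"

definition rank_le_one :: "(var \<Rightarrow> var \<Rightarrow> 'k::field) \<Rightarrow> bool"
  where "rank_le_one M \<longleftrightarrow> (\<forall>v w u t. M v u * M w t = M v t * M w u)"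

text \<open>The nine minors equate monomials of degree two in the coordinates. If \<open>p\<close>,
  \<open>q\<close> or \<open>r\<close> vanishes, three of them say that the square of a coordinate
  is zero. Otherwise one vanishing coordinate kills the others, and if none vanishes, evaluating the
  same monomial in two ways gives the excluded equality of the three products.\<close>

lemma nondegenerate_minor:
  assumes nd: "nondegenerate p q r" and rk: "rank_le_one (skl_mat p q r a)"
  shows "a v = 0"
proof -
  note min = rk[unfolded rank_le_one_def, rule_format]
  have 1: "r VX * r VY * (a VX * a VY) = q VX * p VY * (a VZ * a VZ)"
    using min[of VX VX VY VY] by (simp add: skl_mat_def algebra_simps)
  have 2: "r VX * q VY * (a VX * a VX) = p VX * p VY * (a VY * a VZ)"
    using min[of VX VX VY VZ] by (simp add: skl_mat_def algebra_simps)
  have 3: "q VX * q VY * (a VZ * a VX) = p VX * r VY * (a VY * a VY)"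
    using min[of VX VY VY VZ] by (simp add: skl_mat_def algebra_simps)
  have 4: "r VX * p VZ * (a VX * a VX) = q VX * q VZ * (a VY * a VZ)"
    using min[of VX VX VZ VY] by (simp add: skl_mat_def algebra_simps)
  have 5: "r VX * r VZ * (a VX * a VZ) = p VX * q VZ * (a VY * a VY)"
    using min[of VX VX VZ VZ] by (simp add: skl_mat_def algebra_simps)
  have 6: "q VX * r VZ * (a VZ * a VZ) = p VX * p VZ * (a VX * a VY)"
    using min[of VX VY VZ VZ] by (simp add: skl_mat_def algebra_simps)
  have 7: "p VY * p VZ * (a VX * a VZ) = r VY * q VZ * (a VY * a VY)"
    using min[of VY VX VZ VY] by (simp add: skl_mat_def algebra_simps)
  have 8: "p VY * r VZ * (a VZ * a VZ) = q VY * q VZ * (a VX * a VY)"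
    using min[of VY VX VZ VZ] by (simp add: skl_mat_def algebra_simps)
  have 9: "r VY * r VZ * (a VY * a VZ) = q VY * p VZ * (a VX * a VX)"
    using min[of VY VY VZ VZ] by (simp add: skl_mat_def algebra_simps)
  from nd consider
      (a) "\<And>v. p v = 0" "\<And>v. q v \<noteq> 0" "\<And>v. r v \<noteq> 0"
    | (b) "\<And>v. p v \<noteq> 0" "\<And>v. q v = 0" "\<And>v. r v \<noteq> 0"
    | (c) "\<And>v. p v \<noteq> 0" "\<And>v. q v \<noteq> 0" "\<And>v. r v = 0"
    | (d) "\<And>v. p v \<noteq> 0" "\<And>v. q v \<noteq> 0" "\<And>v. r v \<noteq> 0"
      "\<not> (p VX * p VY * p VZ = q VX * q VY * q VZ \<and> p VX * p VY * p VZ = r VX * r VY * r VZ)"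
    unfolding nondegenerate_def by blast
  then have "a VX = 0 \<and> a VY = 0 \<and> a VZ = 0"
  proof cases
    case a then show ?thesis using 2 7 6 by auto
  next
    case b then show ?thesis using 4 3 8 by auto
  next
    case c then show ?thesis using 1 5 9 by auto
  next
    case d
    show ?thesis
    proof (cases "a VX = 0 \<or> a VY = 0 \<or> a VZ = 0")
      case True
      then show ?thesis using 1 5 9 d by auto
    next
      case False
      have "p VX * p VY * p VZ * (a VY * a VZ) = q VX * q VY * q VZ * (a VY * a VZ)"
      proof -
        have "p VZ * (r VX * q VY * (a VX * a VX)) = q VY * (r VX * p VZ * (a VX * a VX))" by (simp add: algebra_simps)
        then show ?thesis unfolding 2 4 by (simp add: algebra_simps)
      qed
      moreover have "p VX * p VY * p VZ * (a VY * a VZ) = r VX * r VY * r VZ * (a VY * a VZ)"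
      proof -
        have "p VZ * (r VX * q VY * (a VX * a VX)) = r VX * (q VY * p VZ * (a VX * a VX))" by (simp add: algebra_simps)
        then show ?thesis unfolding 2 9[symmetric] by (simp add: algebra_simps)
      qed
      ultimately show ?thesis using d(4) False by simp
    qed
  qed
  then show ?thesis by (cases v) auto
qed

lemma coef_con_skl: "coef (con a (skl p q r v)) u = skl_mat p q r a v u"
  by (cases v; cases u) (simp_all add: con_skl skl_mat_def)

text \<open>Some minor is nonzero, so two relations have independent contractions \<open>?f\<close>
  and \<open>?g\<close> at \<open>a\<close>. Their cross product is the next point: the forms
  vanishing at it are combinations of \<open>?f\<close> and \<open>?g\<close>.\<close>

lemma minor_point_system:
  assumes minors: "\<And>a v. rank_le_one (skl_mat p q r a) \<Longrightarrow> a v = 0"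
  shows "point_system (skl p q r) {a. \<exists>v. a v \<noteq> 0}"
  unfolding point_system_def
proof (intro ballI conjI)
  fix a :: "var \<Rightarrow> 'a" assume "a \<in> {a. \<exists>v. a v \<noteq> 0}"
  then obtain v0 where "a v0 \<noteq> 0" by blast
  then show "\<exists>v. a v \<noteq> 0" by blast
  obtain v w u t where ne: "skl_mat p q r a v u * skl_mat p q r a w t \<noteq> skl_mat p q r a v t * skl_mat p q r a w u"
    using minors[of a v0] \<open>a v0 \<noteq> 0\<close> unfolding rank_le_one_def by blast
  let ?f = "skl_mat p q r a v" and ?g = "skl_mat p q r a w"
  define n where "n x = ?f (nxt x) * ?g (nxt (nxt x)) - ?f (nxt (nxt x)) * ?g (nxt x)" for x
  have "\<exists>x. n x \<noteq> 0"
  proof (rule ccontr)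
    assume "\<not> ?thesis"
    then have "n VX = 0" "n VY = 0" "n VZ = 0" by auto
    then show False using ne unfolding n_def by (cases u; cases t) (simp_all add: mult.commute)
  qed
  then obtain x where x: "n x \<noteq> 0" by blast
  show "\<exists>a'\<in>{a. \<exists>v. a v \<noteq> 0}. \<forall>u\<in>homog (Suc 0). ev a' u = 0 \<longrightarrow> u \<in> con a ` fa.span (range (skl p q r))"
  proof (intro bexI[of _ n] ballI impI)
    fix h assume h: "h \<in> homog (Suc 0)" "ev n h = 0"
    have "(\<Sum>v\<in>UNIV. n v * coef h v) = 0" using h(2) by (simp add: ev_def coef_def)
    then obtain c d where cd: "\<forall>u. coef h u = c * ?f u + d * ?g u"
      using cross_product_span[where f = ?f and g = ?g and w = x and x = "coef h"] x unfolding n_def by blast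
    have "h = con a (c *\<^sub>s skl p q r v + d *\<^sub>s skl p q r w)"
    proof (rule lin_coef_eqI[OF h(1)])
      show "con a (c *\<^sub>s skl p q r v + d *\<^sub>s skl p q r w) \<in> homog (Suc 0)"
        using skl_homog by (intro con_homog homog_add homog_smul) (simp_all add: numeral_2_eq_2)
      show "coef h u = coef (con a (c *\<^sub>s skl p q r v + d *\<^sub>s skl p q r w)) u" for u
        using cd by (simp add: con_add con_smul coef_con_skl)
    qed
    moreover have "c *\<^sub>s skl p q r v + d *\<^sub>s skl p q r w \<in> fa.span (range (skl p q r))"
      by (intro fa.span_add fa.span_scale fa.span_base) auto
    ultimately show "h \<in> con a ` fa.span (range (skl p q r))" by blast
  qed (use x in blast)
qed

text \<open>A rank one tensor has vanishing minors, and the coefficient matrix of a combination of the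
  relations is again of the form \<^const>\<open>skl_mat\<close>.\<close>

lemma nondegenerate_no_rank_one:
  assumes nd: "nondegenerate p q r" and zm: "z \<in> homog (Suc 0)" "m \<in> homog (Suc 0)"
    and eq: "(\<Sum>v\<in>UNIV. c v *\<^sub>s skl p q r v) = z * m"
  shows "c v = 0"
proof -
  have zm2: "lk (z * m) [u, t] = lk z [u] * lk m [t]" for u t
  proof -
    have "lk (z * m) [u, t] = lk (tail u (z * m)) [t]" by (simp add: lookup_tail)
    also have "\<dots> = lk z [u] * lk m [t]"
      using zm(1) by (simp add: tail_mult tail_lin homog_iff lookup_smul)
    finally show ?thesis .
  qed
  let ?p = "\<lambda>v. q (nxt v)" and ?q = "\<lambda>v. p (nxt (nxt v))"
  have "skl_mat ?p ?q r c u t = lk (\<Sum>v\<in>UNIV. c v *\<^sub>s skl p q r v) [u, t]" for u t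
    by (cases u; cases t) (simp_all add: skl_mat_def sum_var lookup_add lookup_smul lookup_skl mult.commute)
  then have mat: "skl_mat ?p ?q r c u t = lk z [u] * lk m [t]" for u t by (simp add: eq zm2)
  have prods: "p VZ * p VX * p VY = p VX * p VY * p VZ" "q VY * q VZ * q VX = q VX * q VY * q VZ"
    by (simp_all add: algebra_simps)
  have "nondegenerate ?p ?q r"
    using nd unfolding nondegenerate_def all_var by (simp add: prods) metis
  then show ?thesis by (rule nondegenerate_minor) (simp add: rank_le_one_def mat)
qed

text \<open>The line \<open>z = 0\<close> contains a point \<open>a\<close> of the cubic, at which
  some combination \<open>\<rho>\<close> of the relations is killed by \<open>con a\<close>. Hence
  \<open>\<rho> = y * l + z * m\<close>, and \<open>l = 0\<close> would make \<open>\<rho>\<close> a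
  product of two linear forms.\<close>

lemma nondegenerate_line_system:
  fixes p :: "var \<Rightarrow> 'k::alg_closed_field"
  assumes "nondegenerate p q r"
  shows "line_system (skl p q r) {a. \<exists>v. a v \<noteq> 0} {z \<in> homog (Suc 0). z \<noteq> 0}"
  unfolding line_system_def
proof (intro ballI conjI)
  fix z :: "'k free_alg" assume "z \<in> {z \<in> homog (Suc 0). z \<noteq> 0}"
  then show z: "z \<in> homog (Suc 0)" "z \<noteq> 0" by auto
  obtain a where a: "\<exists>v. a v \<noteq> 0" "ev a z = 0" "skl_det p q r a = 0" using skl_det_root[OF z(1)] by blast
  obtain w where w: "a w \<noteq> 0" using a by blast
  obtain c where c: "\<exists>v. c v \<noteq> 0" "con a (\<Sum>v\<in>UNIV. c v *\<^sub>s skl p q r v) = 0"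
    using skl_det_kernel[OF a(3)] by blast
  obtain y where y: "y \<in> homog (Suc 0)" "\<forall>u\<in>homog (Suc 0). ev a u = 0 \<longrightarrow> u \<in> fa.span {z, y}"
    using ker_complement[OF w z a(2)] by blast
  define \<rho> where "\<rho> = (\<Sum>v\<in>UNIV. c v *\<^sub>s skl p q r v)"
  have \<rho>: "\<rho> \<in> fa.span (range (skl p q r))" unfolding \<rho>_def span_range_iff by blast
  have \<rho>2: "\<rho> \<in> homog (Suc (Suc 0))"
    using span_rels_homog[OF skl_quadratic \<rho>] by (simp add: numeral_2_eq_2)
  define u where "u v = gen v - (a v / a w) *\<^sub>s gen w" for v
  have "u v \<in> homog (Suc 0)" "ev a (u v) = 0" for v
    unfolding u_def using ev_ker_basis[of a w v] w by (intro homog_diff homog_smul homog_gen, simp)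
  then have "\<exists>\<alpha> \<beta>. u v = \<alpha> *\<^sub>s z + \<beta> *\<^sub>s y" for v using y span_pair_coeffs by blast
  then obtain \<alpha> \<beta> where u: "\<And>v. u v = \<alpha> v *\<^sub>s z + \<beta> v *\<^sub>s y" by metis
  have "\<rho> = (\<Sum>v\<in>UNIV. u v * tail v \<rho>)"
    unfolding u_def
  proof (rule con_eq_0_expand[where n = "Suc 0"])
    show "con a \<rho> = 0" using c by (simp add: \<rho>_def)
  qed (rule \<rho>2, rule w)
  then have \<rho>_eq: "\<rho> = y * (\<Sum>v\<in>UNIV. \<beta> v *\<^sub>s tail v \<rho>) + z * (\<Sum>v\<in>UNIV. \<alpha> v *\<^sub>s tail v \<rho>)"
    (is "_ = y * ?l + z * ?m") by (simp add: u sum_var algebra_simps)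
  have lm: "?l \<in> homog (Suc 0)" "?m \<in> homog (Suc 0)"
    by (intro homog_sum homog_smul homog_tail \<rho>2)+
  have "?l \<noteq> 0"
  proof
    assume "?l = 0"
    then have "\<rho> = z * ?m" using \<rho>_eq by simp
    then show False using nondegenerate_no_rank_one[OF assms z(1) lm(2)] c(1) unfolding \<rho>_def by blast
  qed
  then show "\<exists>a\<in>{a. \<exists>v. a v \<noteq> 0}. \<exists>y\<in>homog (Suc 0). \<exists>l\<in>{z \<in> homog (Suc 0). z \<noteq> 0}. \<exists>m\<in>homog (Suc 0).
    (\<forall>u\<in>homog (Suc 0). ev a u = 0 \<longrightarrow> u \<in> fa.span {z, y}) \<and> y * l + z * m \<in> fa.span (range (skl p q r))"
    using a(1) y lm \<rho> \<rho>_eq by (intro bexI[of _ a] bexI[of _ y] bexI[of _ ?l] bexI[of _ ?m]) auto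
qed

lemma nondegenerate_potential:
  fixes p :: "var \<Rightarrow> 'k::alg_closed_field"
  assumes nd: "nondegenerate p q r"
    and l: "\<And>v. l v \<in> homog (Suc 0)" and nn: "\<And>v. nn v \<in> fa.span (range (skl p q r))"
    and w_eq: "(\<Sum>v\<in>UNIV. skl p q r v * l v) = (\<Sum>v\<in>UNIV. gen v * nn v)"
    and ne: "l v \<noteq> 0"
  shows "potential (skl p q r) l nn (l v)"
proof
  show "right_indep (skl p q r)"
    by (rule skl_right_indep) (use nd in \<open>auto simp: nondegenerate_def\<close>)
  have pts: "point_system (skl p q r) {a. \<exists>v. a v \<noteq> 0}"
    by (rule minor_point_system) (rule nondegenerate_minor[OF nd])
  show "line_bound (skl p q r) (l v) n" for n
    by (rule line_system_bound[OF skl_quadratic pts nondegenerate_line_system[OF nd]])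
       (simp add: l ne)
qed (simp_all add: skl_quadratic l nn w_eq ne fa.span_base)

lemma gen_neq_0 [simp]: "gen v \<noteq> 0"
  by (metis coef_simps(4,5) zero_neq_one)

text \<open>Here \<open>w = \<Sum> b v (skl v) v = \<Sum> b v v (skl v)\<close>.\<close>

lemma balanced_potential:
  fixes p :: "var \<Rightarrow> 'k::alg_closed_field"
  assumes nd: "nondegenerate p q r" and b: "\<And>v. b v * p v = P" "\<And>v. b v * q v = Q" "b VX \<noteq> 0"
  shows "potential (skl p q r) (\<lambda>v. b v *\<^sub>s gen v) (\<lambda>v. b v *\<^sub>s skl p q r v) (b VX *\<^sub>s gX)"
proof (rule nondegenerate_potential[OF nd])
  show "b v *\<^sub>s gen v \<in> homog (Suc 0)" for v by (intro homog_smul homog_gen)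
  show "b v *\<^sub>s skl p q r v \<in> fa.span (range (skl p q r))" for v by (intro fa.span_scale fa.span_base) simp
  show "(\<Sum>v\<in>UNIV. skl p q r v * b v *\<^sub>s gen v) = (\<Sum>v\<in>UNIV. gen v * b v *\<^sub>s skl p q r v)"
    by (simp add: sum_var skl_def gen_eq_mon distrib_left distrib_right fa.scale_right_distrib b add_ac)
qed (use b in simp)

text \<open>For the grading of \<open>x, y, z\<close> by \<open>0, 1, 2\<close> modulo 3 this
  potential has weight 2 instead of 0, hence the cyclic shift between the relations and their linear
  factors. The coefficients balance because of \<open>\<theta>^9 = 1\<close>, and
  \<open>\<theta>^3 \<noteq> 1\<close> keeps the product of the \<open>p\<close> and the product of
  the \<open>q\<close> apart.\<close>

lemma exceptional_potential:
  fixes \<theta> :: "'k::alg_closed_field"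
  assumes "\<theta> ^ 9 = 1" "\<theta> ^ 3 \<noteq> 1"
  shows "potential (skl (vec 1 1 1) (vec \<theta> (\<theta> ^ 4) (\<theta> ^ 7)) (vec (\<theta>\<^sup>2) (\<theta>\<^sup>2) (\<theta>\<^sup>2)))
    (vec (\<theta> ^ 6 *\<^sub>s gZ) gX (\<theta> ^ 6 *\<^sub>s gY))
    (vec (\<theta> ^ 4 *\<^sub>s skl (vec 1 1 1) (vec \<theta> (\<theta> ^ 4) (\<theta> ^ 7)) (vec (\<theta>\<^sup>2) (\<theta>\<^sup>2) (\<theta>\<^sup>2)) VY)
       (\<theta> ^ 4 *\<^sub>s skl (vec 1 1 1) (vec \<theta> (\<theta> ^ 4) (\<theta> ^ 7)) (vec (\<theta>\<^sup>2) (\<theta>\<^sup>2) (\<theta>\<^sup>2)) VZ)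
       (\<theta> ^ 7 *\<^sub>s skl (vec 1 1 1) (vec \<theta> (\<theta> ^ 4) (\<theta> ^ 7)) (vec (\<theta>\<^sup>2) (\<theta>\<^sup>2) (\<theta>\<^sup>2)) VX))
    (vec (\<theta> ^ 6 *\<^sub>s gZ) gX (\<theta> ^ 6 *\<^sub>s gY) VY)"
proof (rule nondegenerate_potential)
  have t0: "\<theta> \<noteq> 0" using assms by auto
  have red: "\<theta> ^ (k + 9) = \<theta> ^ k" for k by (simp add: power_add assms(1))
  have pw: "\<theta> ^ 10 = \<theta>" "\<theta> ^ 11 = \<theta>\<^sup>2" "\<theta> ^ 12 = \<theta> ^ 3" "\<theta> ^ 13 = \<theta> ^ 4"
    using red[of 1] red[of 2] red[of 3] red[of 4] by simp_all
  show "nondegenerate (vec 1 1 1) (vec \<theta> (\<theta> ^ 4) (\<theta> ^ 7)) (vec (\<theta>\<^sup>2) (\<theta>\<^sup>2) (\<theta>\<^sup>2))"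
    using t0 assms(2) pw by (simp add: nondegenerate_def all_var flip: power_add power_Suc)
  show "(\<Sum>v\<in>UNIV. skl (vec 1 1 1) (vec \<theta> (\<theta> ^ 4) (\<theta> ^ 7)) (vec (\<theta>\<^sup>2) (\<theta>\<^sup>2) (\<theta>\<^sup>2)) v
        * vec (\<theta> ^ 6 *\<^sub>s gZ) gX (\<theta> ^ 6 *\<^sub>s gY) v) =
    (\<Sum>v\<in>UNIV. gen v * vec (\<theta> ^ 4 *\<^sub>s skl (vec 1 1 1) (vec \<theta> (\<theta> ^ 4) (\<theta> ^ 7)) (vec (\<theta>\<^sup>2) (\<theta>\<^sup>2) (\<theta>\<^sup>2)) VY)
       (\<theta> ^ 4 *\<^sub>s skl (vec 1 1 1) (vec \<theta> (\<theta> ^ 4) (\<theta> ^ 7)) (vec (\<theta>\<^sup>2) (\<theta>\<^sup>2) (\<theta>\<^sup>2)) VZ)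
       (\<theta> ^ 7 *\<^sub>s skl (vec 1 1 1) (vec \<theta> (\<theta> ^ 4) (\<theta> ^ 7)) (vec (\<theta>\<^sup>2) (\<theta>\<^sup>2) (\<theta>\<^sup>2)) VX) v)"
    by (simp add: sum_var skl_def gen_eq_mon distrib_left distrib_right fa.scale_right_distrib add_ac
        pw assms(1) flip: power_add power_Suc power_Suc2)
  show "vec (\<theta> ^ 6 *\<^sub>s gZ) gX (\<theta> ^ 6 *\<^sub>s gY) v \<in> homog (Suc 0)" for v
    by (cases v) (simp_all add: homog_smul)
  show "vec (\<theta> ^ 4 *\<^sub>s skl (vec 1 1 1) (vec \<theta> (\<theta> ^ 4) (\<theta> ^ 7)) (vec (\<theta>\<^sup>2) (\<theta>\<^sup>2) (\<theta>\<^sup>2)) VY)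
       (\<theta> ^ 4 *\<^sub>s skl (vec 1 1 1) (vec \<theta> (\<theta> ^ 4) (\<theta> ^ 7)) (vec (\<theta>\<^sup>2) (\<theta>\<^sup>2) (\<theta>\<^sup>2)) VZ)
       (\<theta> ^ 7 *\<^sub>s skl (vec 1 1 1) (vec \<theta> (\<theta> ^ 4) (\<theta> ^ 7)) (vec (\<theta>\<^sup>2) (\<theta>\<^sup>2) (\<theta>\<^sup>2)) VX) v
    \<in> fa.span (range (skl (vec 1 1 1) (vec \<theta> (\<theta> ^ 4) (\<theta> ^ 7)) (vec (\<theta>\<^sup>2) (\<theta>\<^sup>2) (\<theta>\<^sup>2))))" for v
    by (cases v) (simp_all add: fa.span_scale fa.span_base)
qed simp

lemma potential_good:
  assumes "potential r l nn z"
  shows "koszul (range r)" "hilbert_series (range r) = inverse ((1 - fps_X) ^ 3)"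
  using potential.koszul[OF assms] potential.growth[OF assms]
    hilbert_series_iff[OF potential.quad[OF assms]] by simp_all

lemma class_P1_to_P5_koszul_hilbert:
  assumes "j \<in> {1..5}" "R' \<in> class_P j"
  shows "koszul (set R' :: 'k::alg_closed_field free_alg set)"
    "hilbert_series (set R') = inverse ((1 - fps_X) ^ 3)"
proof -
  have "\<exists>(r :: var \<Rightarrow> 'k free_alg) l nn z. set R' = range r \<and> potential r l nn z"
  proof -
    consider "j = 1" | "j = 2" | "j = 3" | "j = 4" | "j = 5" using assms(1) by force
    then show ?thesis
    proof cases
      case 1
      then obtain p q r :: 'k where R': "R' = sklyanin_rels p p p q q q r r r"
        and pqr: "(p * q, p * r, q * r) \<noteq> (0, 0, 0)" "(p ^ 3 - q ^ 3, p ^ 3 - r ^ 3) \<noteq> (0, 0)"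
        using assms(2) by (auto simp: class_P_def class_P1_def sklyanin_rels_def)
      have "nondegenerate (vec p p p) (vec q q q) (vec r r r)"
        using pqr by (auto simp: nondegenerate_def all_var power3_eq_cube)
      then have "potential (skl (vec p p p) (vec q q q) (vec r r r)) (\<lambda>v. 1 *\<^sub>s gen v)
          (\<lambda>v. 1 *\<^sub>s skl (vec p p p) (vec q q q) (vec r r r) v) (1 *\<^sub>s gX)"
        by (rule balanced_potential[where P = p and Q = q]) (auto simp: vec_def split: var.split)
      then show ?thesis using R' set_sklyanin_rels by metis
    next
      case 2
      then obtain a b c :: 'k where R': "R' = [gY * gZ - scal a * gZ * gY, scal b * gZ * gX - gX * gZ,
          gX * gY - scal c * gY * gX]"
        using assms(2) by (auto simp: class_P_def class_P2_def)
      have "set R' = range (skl (vec 1 b 1) (vec (- a) (- 1) (- c)) (vec 0 0 0))"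
        unfolding R' UNIV_var by (simp add: skl_def scal_mult gen_eq_mon)
      then show ?thesis using solvable_potential[of 0 a c 0 b] by blast
    next
      case 3
      then obtain a b :: 'k where R': "R' = [gY * gZ - scal a * gZ * gY, scal b * gZ * gX - gX * gZ + gY * gY,
          gX * gY - scal a * gY * gX]"
        using assms(2) by (auto simp: class_P_def class_P3_def)
      have "set R' = range (skl (vec 1 b 1) (vec (- a) (- 1) (- a)) (vec 0 1 0))"
        unfolding R' UNIV_var by (simp add: skl_def scal_mult gen_eq_mon)
      then show ?thesis using solvable_potential[of 1 a a 0 b] by blast
    next
      case 4
      then obtain a :: 'k where R': "R' = [gY * gZ - scal a * gZ * gY, scal (1 / a) * gZ * gX - gX * gZ + gY * gY,
          gX * gY - scal a * gY * gX - gZ * gZ]" "a \<noteq> 0"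
        using assms(2) by (auto simp: class_P_def class_P4_def)
      have "set R' = range (skl (vec 1 (1 / a) 1) (vec (- a) (- 1) (- a)) (vec 0 1 (- 1)))"
        unfolding R' UNIV_var by (simp add: skl_def scal_mult gen_eq_mon)
      then show ?thesis using solvable_potential[of 1 a a "- 1" "1 / a"] R'(2) by auto
    next
      case 5
      then obtain \<theta> :: 'k where R': "R' = sklyanin_rels 1 1 1 \<theta> (\<theta> ^ 4) (\<theta> ^ 7) (\<theta>\<^sup>2) (\<theta>\<^sup>2) (\<theta>\<^sup>2)"
        and t: "\<theta> ^ 9 = 1" "\<theta> ^ 3 \<noteq> 1"
        using assms(2) by (auto simp: class_P_def class_P5_def sklyanin_rels_def scal_hom)
      then show ?thesis using exceptional_potential[OF t] set_sklyanin_rels by metis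
    qed
  qed
  then show "koszul (set R')" "hilbert_series (set R') = inverse ((1 - fps_X) ^ 3)"
    using potential_good by metis+
qed


section \<open>Invariance under permutations and scalings of the variables\<close>

locale alg_iso =
  fixes \<Phi> \<Psi> :: "'k::field free_alg \<Rightarrow> 'k free_alg" and r r' :: "var \<Rightarrow> 'k free_alg"
  assumes quad: "quadratic r" "quadratic r'"
    and add: "\<And>f g. \<Phi> (f + g) = \<Phi> f + \<Phi> g" and mult: "\<And>f g. \<Phi> (f * g) = \<Phi> f * \<Phi> g"
    and homog: "\<And>f n. f \<in> homog n \<Longrightarrow> \<Phi> f \<in> homog n"
    and aug: "\<And>f. lk (\<Phi> f) [] = lk f []"
    and inv: "\<And>f. \<Psi> (\<Phi> f) = f" "\<And>f. \<Phi> (\<Psi> f) = f"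
    and homog': "\<And>f n. f \<in> homog n \<Longrightarrow> \<Psi> f \<in> homog n"
    and ideal: "\<And>f. f \<in> rel_ideal (range r) \<longleftrightarrow> \<Phi> f \<in> rel_ideal (range r')"
begin

lemma diff: "\<Phi> (f - g) = \<Phi> f - \<Phi> g"
  by (metis add add_diff_cancel_right' diff_add_cancel)

lemma swap: "alg_iso \<Psi> \<Phi> r' r"
proof
  show "\<Psi> (f + g) = \<Psi> f + \<Psi> g" for f g by (metis add inv)
  show "\<Psi> (f * g) = \<Psi> f * \<Psi> g" for f g by (metis mult inv)
  show "lk (\<Psi> f) [] = lk f []" for f by (metis aug inv(2))
  show "f \<in> rel_ideal (range r') \<longleftrightarrow> \<Psi> f \<in> rel_ideal (range r)" for f by (metis ideal inv(2))
qed (simp_all add: quad homog homog' inv)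

lemma image_cls: "\<Phi> ` cls (range r) f = cls (range r') (\<Phi> f)"
proof
  show "\<Phi> ` cls (range r) f \<subseteq> cls (range r') (\<Phi> f)" by (auto simp: mem_cls ideal diff)
  show "cls (range r') (\<Phi> f) \<subseteq> \<Phi> ` cls (range r) f"
  proof
    fix g assume g: "g \<in> cls (range r') (\<Phi> f)"
    then have "\<Psi> g \<in> cls (range r) f" by (simp add: mem_cls ideal diff inv)
    then show "g \<in> \<Phi> ` cls (range r) f" using inv(2) by (metis imageI)
  qed
qed

definition T :: "(nat \<Rightarrow> 'k free_alg set) \<Rightarrow> nat \<Rightarrow> 'k free_alg set"
  where "T u = (\<lambda>i. \<Phi> ` u i)"

lemma T_cls: "T (\<lambda>i. cls (range r) (f i)) = (\<lambda>i. cls (range r') (\<Phi> (f i)))"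
  by (simp add: T_def image_cls)

lemma zero: "\<Phi> 0 = 0"
  using diff[of 0 0] by simp

lemma T_zero: "T (\<lambda>i. \<zero>\<^bsub>alg (range r)\<^esub>) = (\<lambda>i. \<zero>\<^bsub>alg (range r')\<^esub>)"
  using T_cls[of "\<lambda>_. 0"] by (simp add: zero cls_zero)

lemma image_zero_iff: "a \<in> carrier (alg (range r)) \<Longrightarrow> \<Phi> ` a = \<zero>\<^bsub>alg (range r')\<^esub> \<longleftrightarrow> a = \<zero>\<^bsub>alg (range r)\<^esub>"
  unfolding carrier_alg by (elim rangeE) (simp add: image_cls cls_eq_zero_iff ideal)

lemma image_carrier: "a \<in> carrier (alg (range r)) \<Longrightarrow> \<Phi> ` a \<in> carrier (alg (range r'))"
  unfolding carrier_alg by (elim rangeE) (simp add: image_cls)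

lemma T_free_module:
  assumes "u \<in> free_module (range r) B" shows "T u \<in> free_module (range r') B"
proof -
  have "\<Phi> ` \<zero>\<^bsub>alg (range r)\<^esub> = \<zero>\<^bsub>alg (range r')\<^esub>" using T_zero by (simp add: T_def fun_eq_iff)
  moreover have "u i \<in> carrier (alg (range r))" for i using assms by (simp add: free_module_def)
  ultimately show ?thesis using assms by (simp add: free_module_def T_def image_zero_iff image_carrier)
qed

lemma T_component:
  assumes "u \<in> free_module_component (range r) B m j" shows "T u \<in> free_module_component (range r') B m j"
proof -
  have c: "\<Phi> ` a \<in> component (range r') n" if "a \<in> component (range r) n" for a n
    using that unfolding component_def by (elim imageE) (simp add: image_cls homog)
  have z: "\<Phi> ` \<zero>\<^bsub>alg (range r)\<^esub> = \<zero>\<^bsub>alg (range r')\<^esub>" using T_zero by (simp add: T_def fun_eq_iff)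
  show ?thesis
    using assms T_free_module[of u B] c z unfolding free_module_component_def by (auto simp: T_def)
qed

lemma image_add: "a \<in> carrier (alg (range r)) \<Longrightarrow> b \<in> carrier (alg (range r)) \<Longrightarrow>
    \<Phi> ` (a \<oplus>\<^bsub>alg (range r)\<^esub> b) = \<Phi> ` a \<oplus>\<^bsub>alg (range r')\<^esub> \<Phi> ` b"
  unfolding carrier_alg by (elim rangeE) (simp add: image_cls add flip: cls_add)

lemma image_mult: "a \<in> carrier (alg (range r)) \<Longrightarrow> b \<in> carrier (alg (range r)) \<Longrightarrow>
    \<Phi> ` (a \<otimes>\<^bsub>alg (range r)\<^esub> b) = \<Phi> ` a \<otimes>\<^bsub>alg (range r')\<^esub> \<Phi> ` b"
  unfolding carrier_alg by (elim rangeE) (simp add: image_cls mult flip: cls_mult)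

lemma image_aug: "a \<in> carrier (alg (range r)) \<Longrightarrow> augmentation (range r') (\<Phi> ` a) = augmentation (range r) a"
  unfolding carrier_alg by (elim rangeE) (simp add: image_cls augmentation_cls quad aug)

end

lemma koszulE:
  assumes "koszul R"
  obtains B d where "B 0 = {0}"
    "\<forall>m. right_linear R (B (Suc m)) (B m) (d m)"
    "\<forall>m j. d m ` free_module_component R (B (Suc m)) (Suc m) j \<subseteq> free_module_component R (B m) m j"
    "\<forall>m. d (Suc m) ` free_module R (B (Suc (Suc m))) =
      {u \<in> free_module R (B (Suc m)). d m u = (\<lambda>i. \<zero>\<^bsub>alg R\<^esub>)}"
    "d 0 ` free_module R (B 1) = {u \<in> free_module R (B 0). augmentation R (u 0) = 0}"
    "augmentation R ` carrier (alg R) = UNIV"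
  using assms unfolding koszul_def by (elim exE conjE) (rule that; assumption)

lemma free_moduleD: "u \<in> free_module R B \<Longrightarrow> u i \<in> carrier (alg R)"
  by (simp add: free_module_def)

context alg_iso
begin

text \<open>The bases are kept, and each differential is conjugated by the bijection
  \<open>T\<close>, which applies \<open>\<Phi>\<close> to the coset in every coordinate.\<close>

lemma koszul_transfer:
  assumes "koszul (range r)" shows "koszul (range r')"
proof -
  interpret S: alg_iso \<Psi> \<Phi> r' r by (rule swap)
  have ST: "S.T (T u) = u" for u by (simp add: S.T_def T_def image_image inv)
  have TS: "T (S.T u) = u" for u by (simp add: S.T_def T_def image_image inv)
  let ?R = "range r" and ?R' = "range r'"
  obtain B d where B0: "B 0 = {0}"
    and lin: "\<forall>m. right_linear ?R (B (Suc m)) (B m) (d m)"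
    and gr: "\<forall>m j. d m ` free_module_component ?R (B (Suc m)) (Suc m) j \<subseteq> free_module_component ?R (B m) m j"
    and ex: "\<forall>m. d (Suc m) ` free_module ?R (B (Suc (Suc m))) =
      {u \<in> free_module ?R (B (Suc m)). d m u = (\<lambda>i. \<zero>\<^bsub>alg ?R\<^esub>)}"
    and ex0: "d 0 ` free_module ?R (B 1) = {u \<in> free_module ?R (B 0). augmentation ?R (u 0) = 0}"
    and surj: "augmentation ?R ` carrier (alg ?R) = UNIV"
    using assms by (rule koszulE)
  note lin = lin[rule_format] and gr = gr[rule_format] and ex = ex[rule_format]
  have FM: "free_module ?R' B' = T ` free_module ?R B'" for B'
    using T_free_module S.T_free_module TS by (metis (no_types, lifting) image_iff subsetI subset_antisym)
  have dFM: "d m u \<in> free_module ?R (B m)" if "u \<in> free_module ?R (B (Suc m))" for m u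
    using lin[of m] that unfolding right_linear_def by blast
  let ?d = "\<lambda>m u. T (d m (S.T u))"
  show ?thesis
    unfolding koszul_def
  proof (intro exI[of _ B] exI[of _ ?d] conjI allI)
    show "B 0 = {0}" by (rule B0)
    fix m
    show "right_linear ?R' (B (Suc m)) (B m) (?d m)"
      unfolding right_linear_def
    proof (intro conjI ballI funcsetI)
      fix u assume u: "u \<in> free_module ?R' (B (Suc m))"
      note Su = S.T_free_module[OF u]
      show "?d m u \<in> free_module ?R' (B m)" by (intro T_free_module dFM Su)
      { fix v assume v: "v \<in> free_module ?R' (B (Suc m))"
        note Sv = S.T_free_module[OF v]
        have "S.T (\<lambda>i. u i \<oplus>\<^bsub>alg ?R'\<^esub> v i) = (\<lambda>i. S.T u i \<oplus>\<^bsub>alg ?R\<^esub> S.T v i)"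
          using u v by (simp add: S.T_def S.image_add free_moduleD)
        then have "d m (S.T (\<lambda>i. u i \<oplus>\<^bsub>alg ?R'\<^esub> v i)) = (\<lambda>i. d m (S.T u) i \<oplus>\<^bsub>alg ?R\<^esub> d m (S.T v) i)"
          using lin[of m] Su Sv unfolding right_linear_def by simp
        then show "?d m (\<lambda>i. u i \<oplus>\<^bsub>alg ?R'\<^esub> v i) = (\<lambda>i. ?d m u i \<oplus>\<^bsub>alg ?R'\<^esub> ?d m v i)"
          using free_moduleD[OF dFM[OF Su]] free_moduleD[OF dFM[OF Sv]] by (simp add: T_def image_add) }
      fix a assume a: "a \<in> carrier (alg ?R')"
      have "S.T (\<lambda>i. u i \<otimes>\<^bsub>alg ?R'\<^esub> a) = (\<lambda>i. S.T u i \<otimes>\<^bsub>alg ?R\<^esub> (\<Psi> ` a))"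
        using u a by (simp add: S.T_def S.image_mult free_moduleD)
      then have "d m (S.T (\<lambda>i. u i \<otimes>\<^bsub>alg ?R'\<^esub> a)) = (\<lambda>i. d m (S.T u) i \<otimes>\<^bsub>alg ?R\<^esub> (\<Psi> ` a))"
        using lin[of m] Su S.image_carrier[OF a] unfolding right_linear_def by simp
      then show "?d m (\<lambda>i. u i \<otimes>\<^bsub>alg ?R'\<^esub> a) = (\<lambda>i. ?d m u i \<otimes>\<^bsub>alg ?R'\<^esub> a)"
        using free_moduleD[OF dFM[OF Su]] S.image_carrier[OF a]
        by (simp add: T_def image_mult image_image inv)
    qed
    show "?d m ` free_module_component ?R' (B (Suc m)) (Suc m) j \<subseteq> free_module_component ?R' (B m) m j" for j
      using gr[of m j] S.T_component T_component by blast
    show "?d (Suc m) ` free_module ?R' (B (Suc (Suc m))) =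
        {u \<in> free_module ?R' (B (Suc m)). ?d m u = (\<lambda>i. \<zero>\<^bsub>alg ?R'\<^esub>)}"
    proof -
      have z: "T x = (\<lambda>i. \<zero>\<^bsub>alg ?R'\<^esub>) \<longleftrightarrow> x = (\<lambda>i. \<zero>\<^bsub>alg ?R\<^esub>)" for x
        using ST S.T_zero T_zero by metis
      have "?d (Suc m) ` free_module ?R' (B (Suc (Suc m))) = T ` (d (Suc m) ` free_module ?R (B (Suc (Suc m))))"
        unfolding FM by (simp add: image_image ST)
      also have "\<dots> = {u \<in> free_module ?R' (B (Suc m)). ?d m u = (\<lambda>i. \<zero>\<^bsub>alg ?R'\<^esub>)}"
        unfolding ex FM z by (auto simp: ST)
      finally show ?thesis .
    qed
  next
    have "?d 0 ` free_module ?R' (B 1) = T ` (d 0 ` free_module ?R (B 1))"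
      unfolding FM by (simp add: image_image ST)
    also have "\<dots> = {u \<in> free_module ?R' (B 0). augmentation ?R' (u 0) = 0}"
    proof -
      have "augmentation ?R' (T u 0) = augmentation ?R (u 0)" if "u \<in> free_module ?R (B 0)" for u
        using image_aug free_moduleD[OF that] by (simp add: T_def)
      then show ?thesis unfolding ex0 FM by auto
    qed
    finally show "?d 0 ` free_module ?R' (B 1) = {u \<in> free_module ?R' (B 0). augmentation ?R' (u 0) = 0}" .
    show "augmentation ?R' ` carrier (alg ?R') = UNIV"
    proof -
      have "c \<in> augmentation ?R' ` carrier (alg ?R')" for c
      proof -
        obtain a where "a \<in> carrier (alg ?R)" "augmentation ?R a = c" using surj by (metis UNIV_I imageE)
        then show ?thesis using image_aug image_carrier by (metis imageI)
      qed
      then show ?thesis by blast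
    qed
  qed
qed

end

section \<open>Monomial changes of variables\<close>

definition scale_prod :: "(var \<Rightarrow> 'k::field) \<Rightarrow> var list \<Rightarrow> 'k"
  where "scale_prod s l = prod_list (map s l)"

locale var_change =
  fixes \<sigma> \<tau> :: "var \<Rightarrow> var" and s :: "var \<Rightarrow> 'k::field"
  assumes inv: "\<And>v. \<tau> (\<sigma> v) = v" "\<And>v. \<sigma> (\<tau> v) = v" and s: "\<And>v. s v \<noteq> 0"
begin

definition \<Phi> :: "'k free_alg \<Rightarrow> 'k free_alg"
  where "\<Phi> = subst_vars (\<lambda>v. scal (s v) * gen (\<sigma> v))"

lemma map_inv: "map \<tau> (map \<sigma> l) = l" "map \<sigma> (map \<tau> l) = l"
  by (simp_all add: inv comp_def)

lemma prod_list_gen: "prod_list (map (\<lambda>v. scal (s v) * gen (\<sigma> v)) l) = scale_prod s l *\<^sub>s mon (map \<sigma> l)"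
  by (induction l) (simp_all add: scale_prod_def one_eq_mon scal_mult gen_eq_mon)

text \<open>The substitution permutes the words and multiplies them by nonzero scalars, so each
  coefficient comes from a single word. Linearity, homogeneity and invertibility are then read off
  coefficientwise.\<close>

lemma lookup_\<Phi>: "lk (\<Phi> f) m = scale_prod s (map \<tau> m) * lk f (map \<tau> m)"
proof -
  have "lk (\<Phi> f) m = (\<Sum>w\<in>Poly_Mapping.keys f. if w = Word (map \<tau> m) then scale_prod s (map \<tau> m) * lk f (map \<tau> m) else 0)"
    unfolding \<Phi>_def subst_vars_def prod_list_gen lookup_sum
  proof (rule sum.cong)
    fix w :: word
    have "map \<sigma> (letters w) = m \<longleftrightarrow> w = Word (map \<tau> m)"
      by (metis map_inv word.collapse word.sel)
    then show "lk (scal (Poly_Mapping.lookup f w) * scale_prod s (letters w) *\<^sub>s mon (map \<sigma> (letters w))) m =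
        (if w = Word (map \<tau> m) then scale_prod s (map \<tau> m) * lk f (map \<tau> m) else 0)"
      by (auto simp: scal_mult lookup_smul lookup_mon)
  qed simp
  also have "\<dots> = scale_prod s (map \<tau> m) * lk f (map \<tau> m)"
    by (auto simp: sum.delta in_keys_iff)
  finally show ?thesis .
qed

lemma \<Phi>_add: "\<Phi> (f + g) = \<Phi> f + \<Phi> g" and \<Phi>_smul: "\<Phi> (c *\<^sub>s f) = c *\<^sub>s \<Phi> f"
  by (auto intro!: free_alg_eqI simp: lookup_\<Phi> lookup_add lookup_smul algebra_simps)

lemma \<Phi>_zero: "\<Phi> 0 = 0" by (auto intro!: free_alg_eqI simp: lookup_\<Phi>)

lemma \<Phi>_mon: "\<Phi> (mon l) = scale_prod s l *\<^sub>s mon (map \<sigma> l)"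
proof (rule free_alg_eqI)
  fix m
  have "l = map \<tau> m \<longleftrightarrow> map \<sigma> l = m" by (metis map_inv)
  then show "lk (\<Phi> (mon l)) m = lk (scale_prod s l *\<^sub>s mon (map \<sigma> l)) m"
    by (auto simp: lookup_\<Phi> lookup_mon lookup_smul)
qed

lemma single_eq: "Poly_Mapping.single (Word l) c = c *\<^sub>s mon l"
  by (rule free_alg_eqI) (simp add: lookup_smul lookup_mon lookup_single when_def)

lemma \<Phi>_mult: "\<Phi> (f * g) = \<Phi> f * \<Phi> g"
proof (induction f rule: free_alg_induct)
  case (single l c)
  show ?case
    by (induction g rule: free_alg_induct)
       (simp_all add: single_eq \<Phi>_add \<Phi>_smul \<Phi>_mon distrib_left scale_prod_def mult_ac)
qed (simp add: \<Phi>_add distrib_right)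

lemma \<Phi>_homog: "f \<in> homog n \<Longrightarrow> \<Phi> f \<in> homog n"
  by (auto simp: homog_iff lookup_\<Phi>)

lemma \<Phi>_gen: "\<Phi> (gen v) = s v *\<^sub>s gen (\<sigma> v)"
  by (simp add: gen_eq_mon \<Phi>_mon scale_prod_def)

lemma \<Phi>_linear: "Vector_Spaces.linear smul smul \<Phi>"
  by unfold_locales (simp_all add: \<Phi>_add \<Phi>_smul)

lemma \<Phi>_rel_part:
  assumes "\<And>v. \<Phi> (r v) \<in> fa.span (range r')" "f \<in> rel_part r n"
  shows "\<Phi> f \<in> rel_part r' n"
  using assms(2)
proof (induction rule: rel_part_induct)
  case (gen n f v)
  then show ?case by (simp add: \<Phi>_mult \<Phi>_gen rel_part_smul rel_part_gen_mult)
next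
  case (rel n f v)
  then show ?case unfolding \<Phi>_mult by (intro span_rels_mult assms \<Phi>_homog)
qed (simp_all add: \<Phi>_zero \<Phi>_add rel_part_add)

end

lemma var_change_inverse:
  assumes "var_change \<sigma> \<tau> s" shows "var_change \<tau> \<sigma> (\<lambda>v. 1 / s (\<tau> v))"
  using assms by (simp add: var_change_def)

lemma scale_prod_inverse:
  "(\<And>v. s v \<noteq> 0) \<Longrightarrow> scale_prod s (map \<tau> m) * scale_prod (\<lambda>v. 1 / s (\<tau> v)) m = (1 :: 'k::field)"
  by (induction m) (simp_all add: scale_prod_def divide_simps)

lemma var_change_\<Phi>_inverse:
  assumes "var_change \<sigma> \<tau> s"
  shows "var_change.\<Phi> \<sigma> s (var_change.\<Phi> \<tau> (\<lambda>v. 1 / s (\<tau> v)) f) = f"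
proof -
  interpret A: var_change \<sigma> \<tau> s by fact
  interpret B: var_change \<tau> \<sigma> "\<lambda>v. 1 / s (\<tau> v)" by (rule var_change_inverse) fact
  show ?thesis
    by (rule free_alg_eqI)
       (simp add: A.lookup_\<Phi> B.lookup_\<Phi> A.map_inv mult.assoc[symmetric] scale_prod_inverse A.s del: map_map)
qed

lemma var_change_invariant:
  assumes vc: "var_change \<sigma> \<tau> s" and quad: "quadratic r" and k: "\<And>v. k v \<noteq> 0"
    and r': "\<And>v. r' v = k v *\<^sub>s var_change.\<Phi> \<sigma> s (r v)"
  shows "hilbert_series (range r) = hilbert_series (range r')" "koszul (range r) \<longleftrightarrow> koszul (range r')"
proof -
  interpret A: var_change \<sigma> \<tau> s by (rule vc)
  interpret B: var_change \<tau> \<sigma> "\<lambda>v. 1 / s (\<tau> v)" by (rule var_change_inverse[OF vc])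
  have AB: "A.\<Phi> (B.\<Phi> f) = f" for f by (rule var_change_\<Phi>_inverse[OF vc])
  have BA: "B.\<Phi> (A.\<Phi> f) = f" for f
    using var_change_\<Phi>_inverse[OF var_change_inverse[OF vc]] by (simp add: A.inv)
  have quad': "quadratic r'" using quadraticD[OF quad] A.\<Phi>_homog by (auto simp: quadratic_def r')
  have 1: "A.\<Phi> (r v) \<in> fa.span (range r')" for v
  proof -
    have "A.\<Phi> (r v) = (1 / k v) *\<^sub>s r' v" by (simp add: r' k)
    then show ?thesis by (simp add: fa.span_scale fa.span_base)
  qed
  have 2: "B.\<Phi> (r' v) \<in> fa.span (range r)" for v
    by (simp add: r' B.\<Phi>_smul BA fa.span_scale fa.span_base)
  have J: "f \<in> rel_part r n \<longleftrightarrow> A.\<Phi> f \<in> rel_part r' n" for f n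
  proof
    assume "f \<in> rel_part r n" then show "A.\<Phi> f \<in> rel_part r' n" by (rule A.\<Phi>_rel_part[OF 1])
  next
    assume "A.\<Phi> f \<in> rel_part r' n"
    then have "B.\<Phi> (A.\<Phi> f) \<in> rel_part r n" by (rule B.\<Phi>_rel_part[OF 2])
    then show "f \<in> rel_part r n" by (simp add: BA)
  qed
  have part: "part n (A.\<Phi> f) = A.\<Phi> (part n f)" for n f
    by (rule free_alg_eqI) (simp add: lookup_part A.lookup_\<Phi>)
  have img: "rel_part r' n = A.\<Phi> ` rel_part r n" for n
  proof
    show "rel_part r' n \<subseteq> A.\<Phi> ` rel_part r n"
    proof
      fix f assume "f \<in> rel_part r' n"
      then have "B.\<Phi> f \<in> rel_part r n" by (simp add: J AB)
      then show "f \<in> A.\<Phi> ` rel_part r n" using AB[of f] by (metis imageI)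
    qed
  qed (use J in blast)
  have "fa.dim (rel_part r' n) = fa.dim (rel_part r n)" for n
    unfolding img by (rule dim_linear_image[OF A.\<Phi>_linear rel_part_subspace]) (metis BA inj_onI)
  then show "hilbert_series (range r) = hilbert_series (range r')"
    by (simp add: fps_eq_iff hilbert_nth quad quad')
  have "alg_iso A.\<Phi> B.\<Phi> r r'"
  proof
    show "f \<in> rel_ideal (range r) \<longleftrightarrow> A.\<Phi> f \<in> rel_ideal (range r')" for f
      by (simp add: mem_rel_ideal_iff quad quad' part J)
    show "lk (A.\<Phi> f) [] = lk f []" for f by (simp add: A.lookup_\<Phi> scale_prod_def)
  qed (simp_all add: quad quad' A.\<Phi>_add A.\<Phi>_mult A.\<Phi>_homog B.\<Phi>_homog AB BA)
  then show "koszul (range r) \<longleftrightarrow> koszul (range r')"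
    using alg_iso.koszul_transfer alg_iso.swap by metis
qed

text \<open>Equal multisets of relations have equal underlying sets, and the ideal depends on
  nothing else.\<close>

lemma turned_into_invariant:
  assumes ti: "turned_into R R'" and R: "R = [r VX, r VY, r VZ]" and quad: "quadratic r"
  shows "hilbert_series (set R) = hilbert_series (set R')" "koszul (set R) \<longleftrightarrow> koszul (set R')"
proof -
  obtain \<sigma> s c where \<sigma>: "bij \<sigma>" and s: "\<forall>v. s v \<noteq> 0" and c: "length c = length R" "0 \<notin> set c"
    and m: "mset (map2 (\<lambda>k f. scal k * subst_vars (\<lambda>v. scal (s v) * gen (\<sigma> v)) f) c R) = mset R'"
    using ti unfolding turned_into_def by blast
  have vc: "var_change \<sigma> (Hilbert_Choice.inv \<sigma>) s"
    using \<sigma> s by unfold_locales (simp_all add: bij_is_inj bij_is_surj surj_f_inv_f)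
  obtain k1 k2 k3 where k: "c = [k1, k2, k3]"
    using c(1) R by (auto simp: length_Suc_conv eval_nat_numeral)
  define r' where "r' v = vec k1 k2 k3 v *\<^sub>s var_change.\<Phi> \<sigma> s (r v)" for v
  have "set R' = range r'"
    using mset_eq_setD[OF m] unfolding R k r'_def UNIV_var var_change.\<Phi>_def[OF vc]
    by (simp add: scal_mult)
  moreover have "set R = range r" unfolding R UNIV_var by simp
  moreover have "vec k1 k2 k3 v \<noteq> 0" for v using c(2) unfolding k by (cases v) auto
  ultimately show "hilbert_series (set R) = hilbert_series (set R')" "koszul (set R) \<longleftrightarrow> koszul (set R')"
    using var_change_invariant[OF vc quad, of "vec k1 k2 k3" r'] by (simp_all add: r'_def)
qed


section \<open>Semicontinuity of the dimensions\<close>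

text \<open>Gaussian elimination over the polynomial ring: pivoting on a coordinate that does not vanish
  at \<open>0\<close> keeps the remaining vectors polynomial and independent at \<open>0\<close>.\<close>

lemma independent_at_0:
  fixes V :: "nat \<Rightarrow> 'i \<Rightarrow> 'k::field poly"
  assumes "\<And>\<mu>. (\<And>w. (\<Sum>k<m. \<mu> k * poly (V k w) 0) = 0) \<Longrightarrow> \<forall>k<m. \<mu> k = 0"
  shows "\<exists>D. poly D 0 \<noteq> 0 \<and> (\<forall>t. poly D t \<noteq> 0 \<longrightarrow>
    (\<forall>\<mu>. (\<forall>w. (\<Sum>k<m. \<mu> k * poly (V k w) t) = 0) \<longrightarrow> (\<forall>k<m. \<mu> k = 0)))"
  using assms
proof (induction m arbitrary: V)
  case 0
  then show ?case by (intro exI[of _ 1]) simp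
next
  case (Suc m)
  have "\<exists>c. poly (V m c) 0 \<noteq> 0"
  proof (rule ccontr)
    assume "\<not> ?thesis"
    then have "(\<Sum>k<Suc m. (if k = m then 1 else 0) * poly (V k w) 0) = 0" for w by simp
    then show False using Suc.prems[of "\<lambda>k. if k = m then 1 else 0"] by auto
  qed
  then obtain c where c: "poly (V m c) 0 \<noteq> 0" by blast
  define W where "W k w = V m c * V k w - V k c * V m w" for k w
  have "\<forall>k<m. \<mu> k = 0" if l: "\<And>w. (\<Sum>k<m. \<mu> k * poly (W k w) 0) = 0" for \<mu>
  proof -
    let ?s = "\<Sum>k<m. \<mu> k * poly (V k c) 0"
    have "(\<Sum>k<Suc m. (if k = m then - ?s else poly (V m c) 0 * \<mu> k) * poly (V k w) 0) = 0" for w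
    proof -
      have "(\<Sum>k<Suc m. (if k = m then - ?s else poly (V m c) 0 * \<mu> k) * poly (V k w) 0)
          = (\<Sum>k<m. \<mu> k * poly (W k w) 0)"
        by (simp add: W_def algebra_simps sum_subtractf sum_distrib_left sum_distrib_right)
      then show ?thesis using l by simp
    qed
    then have "\<forall>k<Suc m. (if k = m then - ?s else poly (V m c) 0 * \<mu> k) = 0" by (rule Suc.prems)
    then show ?thesis using c by (metis less_Suc_eq less_irrefl mult_eq_0_iff)
  qed
  then obtain D where D: "poly D 0 \<noteq> 0" "\<And>t \<mu>. poly D t \<noteq> 0 \<Longrightarrow>
      (\<forall>w. (\<Sum>k<m. \<mu> k * poly (W k w) t) = 0) \<Longrightarrow> \<forall>k<m. \<mu> k = 0"
    using Suc.IH[of W] by blast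
  show ?case
  proof (intro exI[of _ "D * V m c"] conjI allI impI)
    show "poly (D * V m c) 0 \<noteq> 0" using D c by simp
    fix t \<mu> k assume t: "poly (D * V m c) t \<noteq> 0" and l: "\<forall>w. (\<Sum>k<Suc m. \<mu> k * poly (V k w) t) = 0"
      and k: "k < Suc m"
    have e: "(\<Sum>k<m. \<mu> k * poly (V k w) t) = - (\<mu> m * poly (V m w) t)" for w
      using l by (simp add: eq_neg_iff_add_eq_0)
    have "(\<Sum>k<m. \<mu> k * poly (W k w) t) = 0" for w
    proof -
      have "(\<Sum>k<m. \<mu> k * poly (W k w) t) = poly (V m c) t * (\<Sum>k<m. \<mu> k * poly (V k w) t)
          - (\<Sum>k<m. \<mu> k * poly (V k c) t) * poly (V m w) t"
        by (simp add: W_def algebra_simps sum_subtractf sum_distrib_left sum_distrib_right)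
      then show ?thesis by (simp add: e algebra_simps)
    qed
    then have 0: "\<forall>k<m. \<mu> k = 0" using D(2)[of t \<mu>] t by simp
    then have "\<mu> m * poly (V m c) t = 0" using e[of c] by simp
    then have "\<mu> m = 0" using t by simp
    then show "\<mu> k = 0" using 0 k by (metis less_Suc_eq)
  qed
qed

lemma mon_span: "f \<in> homog n \<Longrightarrow> f \<in> fa.span {mon l | l. length l = n}"
proof (induction n arbitrary: f)
  case 0
  then show ?case by (subst homog_0_eq[OF 0]) (auto simp: one_eq_mon intro: fa.span_scale fa.span_base)
next
  case (Suc n)
  have "gen v * tail v f \<in> fa.span {mon l | l. length l = Suc n}" for v
  proof -
    interpret Vector_Spaces.linear smul smul "(*) (gen v)" by (rule smul_linear_left)
    have "gen v * tail v f \<in> fa.span ((*) (gen v) ` {mon l | l. length l = n})"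
      using Suc.IH[OF homog_tail[OF Suc.prems]] span_image by blast
    moreover have "(*) (gen v) ` {mon l | l. length l = n} \<subseteq> {mon l | l. length l = Suc n}"
    proof clarify
      fix l :: "var list" assume "n = length l"
      then show "\<exists>la. gen v * mon l = mon la \<and> length la = Suc (length l)"
        by (intro exI[of _ "v # l"]) (simp add: gen_eq_mon)
    qed
    ultimately show ?thesis using fa.span_mono by blast
  qed
  then show ?case by (subst homog_expand[OF Suc.prems]) (rule fa.span_sum)
qed

definition rel_words :: "(var \<Rightarrow> 'k::field free_alg) \<Rightarrow> nat \<Rightarrow> 'k free_alg set"
  where "rel_words r n = {mon x * r v * mon y | x v y. length x + 2 + length y = n}"

lemma rel_part_span_words:
  assumes "f \<in> rel_part r n" shows "f \<in> fa.span (rel_words r n)"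
  using assms
proof (induction rule: rel_part_induct)
  case (gen n f v)
  interpret Vector_Spaces.linear smul smul "(*) (gen v)" by (rule smul_linear_left)
  have "(*) (gen v) ` rel_words r n \<subseteq> rel_words r (Suc n)"
  proof (clarsimp simp: rel_words_def)
    fix x u y
    show "\<exists>xa va ya. gen v * (mon x * r u * mon y) = mon xa * r va * mon ya \<and>
      length xa + length ya = Suc (length x + length y)"
      by (intro exI[of _ "v # x"] exI[of _ u] exI[of _ y])
         (simp add: gen_eq_mon mult.assoc[symmetric])
  qed
  then show ?case using gen.IH span_image[of "rel_words r n"] fa.span_mono by blast
next
  case (rel n f v)
  interpret Vector_Spaces.linear smul smul "(*) (r v)" by (rule smul_linear_left)
  have "(*) (r v) ` {mon l | l. length l = n} \<subseteq> rel_words r (Suc (Suc n))"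
  proof (clarsimp simp: rel_words_def)
    fix l :: "var list"
    show "\<exists>x va y. r v * mon l = mon x * r va * mon y \<and> length x + length y = length l"
      by (intro exI[of _ "[]"] exI[of _ v] exI[of _ l]) (simp flip: one_eq_mon)
  qed
  then show ?case using mon_span[OF rel] span_image[of "{mon l | l. length l = n}"] fa.span_mono by blast
qed (simp_all add: fa.span_zero fa.span_add)

lemma rel_words_subset: "quadratic r \<Longrightarrow> rel_words r n \<subseteq> rel_part r n"
proof
  fix f assume r: "quadratic r" and "f \<in> rel_words r n"
  then obtain x v y where f: "f = mon x * r v * mon y" and n: "length x + 2 + length y = n"
    unfolding rel_words_def by blast
  have "r v * mon y \<in> rel_part r (Suc (Suc (length y)))" by (rule rel_part_rel_mult) (simp add: homog_mon)
  then have "mon x * (r v * mon y) \<in> rel_part r (length x + Suc (Suc (length y)))"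
    by (rule rel_part_homog_left_mult) (simp add: homog_mon)
  then show "f \<in> rel_part r n" using n by (simp add: f mult.assoc)
qed

text \<open>A basis of the unperturbed ideal is chosen among the products of a single relation with
  words. Replacing \<open>r\<close> by \<open>r + t s\<close> in these products makes their
  coefficients polynomials of degree at most one in \<open>t\<close>, and independence at
  \<open>0\<close> persists wherever \<open>D\<close> does not vanish.\<close>

lemma dim_semicontinuous:
  fixes r s :: "var \<Rightarrow> 'k::field free_alg"
  assumes r: "quadratic r" and s: "quadratic s"
  shows "\<exists>D. poly D 0 \<noteq> 0 \<and> (\<forall>t. poly D t \<noteq> 0 \<longrightarrow>
    fa.dim (rel_part r n) \<le> fa.dim (rel_part (\<lambda>v. r v + t *\<^sub>s s v) n))"
proof -
  obtain B where B: "B \<subseteq> rel_words r n" "fa.independent B" "rel_words r n \<subseteq> fa.span B"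
    using fa.maximal_independent_subset[of "rel_words r n"] by blast
  have Bs: "B \<subseteq> rel_part r n" using B(1) rel_words_subset[OF r] by blast
  have fB: "finite B" by (rule fa.independent_finite[OF rel_part_fin_spanned[OF r] B(2) Bs])
  have "rel_part r n \<subseteq> fa.span B"
  proof
    fix f assume "f \<in> rel_part r n"
    then have "f \<in> fa.span (rel_words r n)" by (rule rel_part_span_words)
    then show "f \<in> fa.span B" using fa.span_minimal[OF B(3)] by blast
  qed
  then have cB: "card B = fa.dim (rel_part r n)" using fa.basis_card_eq_dim[OF Bs _ B(2)] by simp
  define m where "m = card B"
  obtain b where b: "bij_betw b {..<m} B" using ex_bij_betw_nat_finite[OF fB] by (auto simp: m_def atLeast0LessThan)
  have "\<forall>k. \<exists>x v y. k < m \<longrightarrow> b k = mon x * r v * mon y \<and> length x + 2 + length y = n"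
  proof
    fix k
    show "\<exists>x v y. k < m \<longrightarrow> b k = mon x * r v * mon y \<and> length x + 2 + length y = n"
    proof (cases "k < m")
      case True
      then have "b k \<in> rel_words r n" using b B(1) by (auto simp: bij_betw_def)
      then show ?thesis unfolding rel_words_def by blast
    qed simp
  qed
  then obtain x v y where xvy: "\<And>k. k < m \<Longrightarrow> b k = mon (x k) * r (v k) * mon (y k) \<and>
      length (x k) + 2 + length (y k) = n" by metis
  let ?r = "\<lambda>t v. r v + t *\<^sub>s s v"
  have quad: "quadratic (?r t)" for t using r s by (auto simp: quadratic_def)
  define e where "e t k = mon (x k) * ?r t (v k) * mon (y k)" for t k
  define V where "V k w = [:lk (e 0 k) w, lk (mon (x k) * s (v k) * mon (y k)) w:]" for k w
  have Vt: "poly (V k w) t = lk (e t k) w" for k w t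
    by (simp add: V_def e_def distrib_left distrib_right lookup_add lookup_smul)
  have e0: "e 0 k = b k" if "k < m" for k using xvy[OF that] by (simp add: e_def)
  have indep0: "\<forall>k<m. \<mu> k = 0" if "\<And>w. (\<Sum>k<m. \<mu> k * poly (V k w) 0) = 0" for \<mu>
  proof -
    have "(\<Sum>k<m. \<mu> k *\<^sub>s b k) = 0"
      by (rule free_alg_eqI) (use that e0 in \<open>simp add: lookup_sum lookup_smul Vt\<close>)
    also have "(\<Sum>k<m. \<mu> k *\<^sub>s b k) = (\<Sum>c\<in>B. \<mu> (the_inv_into {..<m} b c) *\<^sub>s c)"
    proof -
      have "(\<Sum>c\<in>B. \<mu> (the_inv_into {..<m} b c) *\<^sub>s c) = (\<Sum>k<m. \<mu> (the_inv_into {..<m} b (b k)) *\<^sub>s b k)"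
        by (rule sum.reindex_bij_betw[OF b, symmetric])
      also have "\<dots> = (\<Sum>k<m. \<mu> k *\<^sub>s b k)"
        using the_inv_into_f_f[OF bij_betw_imp_inj_on[OF b]] by (intro sum.cong) auto
      finally show ?thesis by simp
    qed
    finally have "\<And>c. c \<in> B \<Longrightarrow> \<mu> (the_inv_into {..<m} b c) = 0"
      using fa.independentD[OF B(2) fB subset_refl, of "\<lambda>c. \<mu> (the_inv_into {..<m} b c)"] by blast
    then show ?thesis using b by (metis bij_betwE bij_betw_imp_inj_on lessThan_iff the_inv_into_f_f)
  qed
  obtain D where D: "poly D 0 \<noteq> 0" "\<And>t \<mu>. poly D t \<noteq> 0 \<Longrightarrow>
      (\<forall>w. (\<Sum>k<m. \<mu> k * poly (V k w) t) = 0) \<Longrightarrow> \<forall>k<m. \<mu> k = 0"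
    using independent_at_0[where m = m and V = V, OF indep0] by blast
  have "fa.dim (rel_part r n) \<le> fa.dim (rel_part (?r t) n)" if t: "poly D t \<noteq> 0" for t
  proof -
    have ind: "\<forall>k<m. \<mu> k = 0" if "(\<Sum>k<m. \<mu> k *\<^sub>s e t k) = 0" for \<mu>
    proof (rule D(2)[OF t], rule allI)
      fix w show "(\<Sum>k<m. \<mu> k * poly (V k w) t) = 0"
        using arg_cong[OF that, of "\<lambda>f. lk f w"] by (simp add: lookup_sum lookup_smul Vt)
    qed
    have inj: "inj_on (e t) {..<m}"
    proof (rule inj_onI, rule ccontr)
      fix i j assume ij: "i \<in> {..<m}" "j \<in> {..<m}" "e t i = e t j" "i \<noteq> j"
      let ?\<mu> = "\<lambda>k. (if k = i then 1 else 0) - (if k = j then 1 else 0)"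
      have "(\<Sum>k<m. ?\<mu> k *\<^sub>s e t k) = (\<Sum>k<m. (if k = i then e t i else 0)) - (\<Sum>k<m. (if k = j then e t j else 0))"
        unfolding sum_subtractf[symmetric] by (rule sum.cong) (auto simp: fa.scale_left_diff_distrib)
      also have "\<dots> = 0" using ij by (simp add: sum.delta)
      finally have z: "(\<Sum>k<m. ?\<mu> k *\<^sub>s e t k) = 0" .
      from ind[of ?\<mu>, OF z, rule_format, of i] ij(1,4) show False by simp
    qed
    have "fa.independent (e t ` {..<m})"
    proof (rule fa.independent_if_scalars_zero)
      fix g c assume 0: "(\<Sum>c\<in>e t ` {..<m}. g c *\<^sub>s c) = 0" and c: "c \<in> e t ` {..<m}"
      then have "(\<Sum>k<m. g (e t k) *\<^sub>s e t k) = 0" by (simp add: sum.reindex[OF inj])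
      then have "\<forall>k<m. g (e t k) = 0" using ind[of "\<lambda>k. g (e t k)"] by blast
      then show "g c = 0" using c by auto
    qed simp
    moreover have "e t ` {..<m} \<subseteq> rel_part (?r t) n"
    proof -
      have "e t k \<in> rel_words (?r t) n" if "k < m" for k
        using xvy[OF that] unfolding rel_words_def e_def by blast
      then show ?thesis using rel_words_subset[OF quad] by blast
    qed
    ultimately have "card (e t ` {..<m}) \<le> fa.dim (rel_part (?r t) n)"
      by (rule fa.independent_card_le[OF rel_part_fin_spanned[OF quad]])
    then show ?thesis using card_image[OF inj] cB by (simp add: m_def)
  qed
  then show ?thesis using D(1) by blast
qed

text \<open>A root \<open>t\<close> of \<open>X E - 1\<close> satisfies \<open>t E(t) = 1\<close>,
  so neither factor vanishes.\<close>

lemma poly_nonroot: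
  fixes E :: "'k::alg_closed_field poly"
  assumes "E \<noteq> 0" shows "\<exists>t. t \<noteq> 0 \<and> poly E t \<noteq> 0"
proof -
  have "[:0, 1:] * E - 1 = pCons (- 1) E" by (simp add: one_pCons)
  then have "degree ([:0, 1:] * E - 1) > 0" using assms by (simp add: degree_pCons_eq_if)
  then obtain t where "poly ([:0, 1:] * E - 1) t = 0" using alg_closed_imp_poly_has_root by blast
  then have "t * poly E t = 1" by simp
  then show ?thesis by (intro exI[of _ t]) auto
qed


section \<open>Class \<open>\<P>\<^sub>6\<close>\<close>

context
  fixes \<alpha> :: "'k::alg_closed_field"
  assumes \<alpha>: "\<alpha> \<noteq> 0"
begin

definition skl6 :: "var \<Rightarrow> 'k free_alg"
  where "skl6 = skl (vec 0 \<alpha> 1) (vec 0 1 (1 / \<alpha>)) (vec 1 1 1)"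

lemma skl6_quadratic: "quadratic skl6"
  by (simp add: skl6_def skl_quadratic)

lemma skl6_point_system: "point_system skl6 {a. \<exists>v. a v \<noteq> 0}"
  unfolding skl6_def
proof (rule minor_point_system)
  fix a v
  let ?M = "skl_mat (vec 0 \<alpha> 1) (vec 0 1 (1 / \<alpha>)) (vec 1 1 1) a"
  assume "rank_le_one ?M"
  note m = this[unfolded rank_le_one_def, rule_format]
  have "a VX = 0" using m[of VX VX VY VZ] by (simp add: skl_mat_def)
  moreover have "a VY = 0" using m[of VY VX VZ VY] \<alpha> calculation by (simp add: skl_mat_def)
  moreover have "a VZ = 0" using m[of VY VX VZ VZ] \<alpha> calculation by (simp add: skl_mat_def)
  ultimately show "a v = 0" by (cases v) auto
qed

text \<open>The cubic of this algebra is \<open>a_x (a_y a_z - a_x^2)\<close>. These are the points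
  of its conic off the line \<open>a_x = 0\<close>. On that line the killed relation can be the
  square \<open>xx\<close>, which is a product of linear forms and may leave
  \<open>l = 0\<close>.\<close>

definition conic :: "'k \<Rightarrow> var \<Rightarrow> 'k"
  where "conic s = vec 1 s (1 / s)"

definition skl6_lines :: "'k free_alg set"
  where "skl6_lines = {z \<in> homog (Suc 0). z \<noteq> 0 \<and> (\<exists>s. s \<noteq> 0 \<and> ev (conic s) z = 0)}"

text \<open>The mirror image of \<open>con\<close> for quadratic elements: contraction of the second
  letter.\<close>

definition rcon :: "(var \<Rightarrow> 'k) \<Rightarrow> 'k free_alg \<Rightarrow> 'k free_alg"
  where "rcon a f = (\<Sum>u\<in>UNIV. ev a (tail u f) *\<^sub>s gen u)"

lemma rcon_add: "rcon a (f + g) = rcon a f + rcon a g"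
  by (simp add: rcon_def ev_add sum_var fa.scale_left_distrib add_ac)

lemma rcon_lin_mult: "u \<in> homog (Suc 0) \<Longrightarrow> rcon a (u * w) = ev a w *\<^sub>s u"
  by (subst (2) lin_expand)
     (simp_all add: rcon_def tail_mult tail_lin homog_iff ev_smul sum_var fa.scale_right_distrib mult.commute)

lemma ev_zero [simp]: "ev a 0 = 0"
  by (simp add: ev_def)

lemma tail_mon2: "tail v (mon [u, t]) = (if u = v then gen t else 0)"
  by (rule free_alg_eqI) (auto simp: lookup_tail lookup_mon lookup_gen)

text \<open>A form vanishing at the conic point \<open>s\<close> leads to one vanishing at the conic
  point \<open>s / \<alpha>\<close>, which keeps the family closed: the relation killed by
  \<open>con\<close> at \<open>s\<close> is also killed by \<open>rcon\<close> at
  \<open>s / \<alpha>\<close>.\<close>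

lemma skl6_line_system: "line_system skl6 {a. \<exists>v. a v \<noteq> 0} skl6_lines"
  unfolding line_system_def
proof (intro ballI conjI)
  fix z assume "z \<in> skl6_lines"
  then show z: "z \<in> homog (Suc 0)" "z \<noteq> 0" by (auto simp: skl6_lines_def)
  obtain s where s: "s \<noteq> 0" "ev (conic s) z = 0" using \<open>z \<in> skl6_lines\<close> by (auto simp: skl6_lines_def)
  let ?a = "conic s"
  have w: "?a VX \<noteq> 0" by (simp add: conic_def)
  obtain y where y: "y \<in> homog (Suc 0)" "\<forall>u\<in>homog (Suc 0). ev ?a u = 0 \<longrightarrow> u \<in> fa.span {z, y}"
    using ker_complement[OF w z s(2)] by blast
  \<comment> \<open>The contractions of the three relations at \<open>?a\<close> are
    \<open>x\<close>, \<open>(\<alpha>/s) x + s y + z\<close> and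
    \<open>(s/\<alpha>) x + y + (1/s) z\<close>; up to a factor, \<open>c\<close> is the only linear
    dependence between them.\<close>
  define c where "c = vec (\<alpha> / s\<^sup>2 - s / \<alpha>) (- 1 / s) 1"
  define \<rho> where "\<rho> = (\<Sum>v\<in>UNIV. c v *\<^sub>s skl6 v)"
  have \<rho>: "\<rho> \<in> fa.span (range skl6)" unfolding \<rho>_def span_range_iff by blast
  have \<rho>2: "\<rho> \<in> homog (Suc (Suc 0))"
    using span_rels_homog[OF skl6_quadratic \<rho>] by (simp add: numeral_2_eq_2)
  have con\<rho>: "con ?a \<rho> = 0"
  proof (rule lin_coef_eqI)
    show "con ?a \<rho> \<in> homog (Suc 0)" by (rule con_homog[OF \<rho>2])
    show "coef (con ?a \<rho>) u = coef 0 u" for u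
      using s(1) \<alpha> by (cases u) (simp_all add: \<rho>_def sum_var con_add con_diff con_smul skl6_def con_skl c_def
        conic_def field_simps power2_eq_square)
  qed simp
  have rcon\<rho>: "rcon (conic (s / \<alpha>)) \<rho> = 0"
    using s(1) \<alpha> by (intro lin_coef_eqI)
      (auto simp: rcon_def sum_var homog_smul homog_add \<rho>_def c_def skl6_def skl_def ev_add ev_diff ev_smul
        ev_gen tail_mon2 conic_def divide_simps power2_eq_square)
  \<comment> \<open>By this minor the coefficient matrix of \<open>\<rho>\<close> has rank at least
    two, which excludes \<open>\<rho> = z * m\<close>.\<close>
  have \<rho>_lk: "lk \<rho> [VY, VY] * lk \<rho> [VZ, VZ] \<noteq> lk \<rho> [VY, VZ] * lk \<rho> [VZ, VY]"
    using s(1) by (simp add: \<rho>_def sum_var lookup_add lookup_minus lookup_smul skl6_def lookup_skl c_def)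
  define u where "u v = gen v - (?a v / ?a VX) *\<^sub>s gen VX" for v
  have u0: "u v \<in> homog (Suc 0)" "ev ?a (u v) = 0" for v
    unfolding u_def using ev_ker_basis[of ?a VX v] w by (intro homog_diff homog_smul homog_gen, simp)
  then have "\<exists>\<alpha> \<beta>. u v = \<alpha> *\<^sub>s z + \<beta> *\<^sub>s y" for v using y span_pair_coeffs by blast
  then obtain \<gamma> \<beta> where u: "\<And>v. u v = \<gamma> v *\<^sub>s z + \<beta> v *\<^sub>s y" by metis
  have "\<rho> = (\<Sum>v\<in>UNIV. u v * tail v \<rho>)"
    unfolding u_def by (rule con_eq_0_expand[where n = "Suc 0"]) (rule \<rho>2 con\<rho> w)+
  then have \<rho>_eq: "\<rho> = y * (\<Sum>v\<in>UNIV. \<beta> v *\<^sub>s tail v \<rho>) + z * (\<Sum>v\<in>UNIV. \<gamma> v *\<^sub>s tail v \<rho>)"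
    (is "_ = y * ?l + z * ?m") by (simp add: u sum_var algebra_simps)
  have lm: "?l \<in> homog (Suc 0)" "?m \<in> homog (Suc 0)"
    by (intro homog_sum homog_smul homog_tail \<rho>2)+
  have "?l \<noteq> 0"
  proof
    assume "?l = 0"
    then have eq: "\<rho> = z * ?m" using \<rho>_eq by simp
    have "lk \<rho> [u, t] = lk z [u] * lk ?m [t]" for u t
    proof -
      have "lk (z * ?m) [u, t] = lk (tail u (z * ?m)) [t]" by (simp only: lookup_tail)
      also have "\<dots> = lk z [u] * lk ?m [t]"
        using z(1) by (simp add: tail_mult tail_lin homog_iff lookup_smul)
      finally show ?thesis using eq by simp
    qed
    then show False using \<rho>_lk by simp
  qed
  moreover have "ev (conic (s / \<alpha>)) ?l = 0"
  proof (rule ccontr)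
    \<comment> \<open>Contracting \<open>\<rho> = y * l + z * m\<close> on the right would make
      \<open>y\<close> a multiple of \<open>z\<close>, but together they span the two independent
      forms \<open>u VY\<close> and \<open>u VZ\<close>.\<close>
    assume ne: "ev (conic (s / \<alpha>)) ?l \<noteq> 0"
    have "ev (conic (s / \<alpha>)) ?l *\<^sub>s y + ev (conic (s / \<alpha>)) ?m *\<^sub>s z = 0"
      using rcon\<rho> by (subst (asm) \<rho>_eq) (simp add: rcon_add rcon_lin_mult y z)
    then have "y = (- ev (conic (s / \<alpha>)) ?m / ev (conic (s / \<alpha>)) ?l) *\<^sub>s z"
    proof -
      let ?e = "ev (conic (s / \<alpha>)) ?l" and ?f = "ev (conic (s / \<alpha>)) ?m"
      assume "?e *\<^sub>s y + ?f *\<^sub>s z = 0"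
      then have "?e *\<^sub>s y = (- ?f) *\<^sub>s z" by (simp add: eq_neg_iff_add_eq_0)
      then have "(1 / ?e) *\<^sub>s ?e *\<^sub>s y = (1 / ?e) *\<^sub>s (- ?f) *\<^sub>s z" by simp
      then show ?thesis using ne by simp
    qed
    then obtain k where "y = k *\<^sub>s z" by blast
    then have uz: "u v = (\<gamma> v + \<beta> v * k) *\<^sub>s z" for v using u[of v] by (simp add: fa.scale_left_distrib)
    have cu: "coef (u VY) VY = 1" "coef (u VY) VZ = 0" "coef (u VZ) VZ = 1" by (simp_all add: u_def)
    then have "coef z VZ = 0 \<or> \<gamma> VY + \<beta> VY * k = 0" "\<gamma> VY + \<beta> VY * k \<noteq> 0" "coef z VZ \<noteq> 0"
      unfolding uz by auto
    then show False by blast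
  qed
  ultimately have "?l \<in> skl6_lines"
    using lm s(1) \<alpha> unfolding skl6_lines_def by (auto intro!: exI[of _ "s / \<alpha>"])
  then show "\<exists>a\<in>{a. \<exists>v. a v \<noteq> 0}. \<exists>y\<in>homog (Suc 0). \<exists>l\<in>skl6_lines. \<exists>m\<in>homog (Suc 0).
    (\<forall>u\<in>homog (Suc 0). ev a u = 0 \<longrightarrow> u \<in> fa.span {z, y}) \<and> y * l + z * m \<in> fa.span (range skl6)"
    using w y lm \<rho> \<rho>_eq
    by - (rule bexI[of _ ?a], rule bexI[of _ y], rule bexI[of _ ?l], rule bexI[of _ ?m], auto)
qed

lemma skl6_upper: "3 ^ n \<le> fa.dim (rel_part skl6 n) + (n + 2 choose 2)"
proof (induction n)
  case 0
  then show ?case using poly_growth_0[of skl6] unfolding poly_growth_def by simp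
next
  case (Suc n)
  let ?z = "gX - gY :: 'k free_alg"
  have ne: "?z \<noteq> 0" by (metis coef_simps(2,4,5) diff_zero var.distinct(1) zero_neq_one)
  have "?z \<in> skl6_lines"
    unfolding skl6_lines_def using ne by (auto simp: ev_diff ev_gen conic_def intro!: exI[of _ 1])
  then have "line_bound skl6 ?z n"
    by (rule line_system_bound[OF skl6_quadratic skl6_point_system skl6_line_system])
  then show ?case using Suc ne by (intro line_bound_upper[OF skl6_quadratic]) auto
qed

text \<open>The relations are the limit for \<open>t \<rightarrow> 0\<close> of \<open>xx + t (\<alpha> yz + zy)\<close> and the two unchanged ones,
  which are of type \<open>\<P>\<^sub>1\<close> up to scaling.\<close>

lemma skl6_lower: "fa.dim (rel_part skl6 n) + (n + 2 choose 2) \<le> 3 ^ n"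
proof -
  define s where "s v = (if v = VX then \<alpha> *\<^sub>s mon [VY, VZ] + mon [VZ, VY] else 0 :: 'k free_alg)" for v
  have s: "quadratic s" by (auto simp: quadratic_def s_def homog_mon intro!: homog_add homog_smul)
  obtain D where D: "poly D 0 \<noteq> 0" "\<And>t. poly D t \<noteq> 0 \<Longrightarrow>
      fa.dim (rel_part skl6 n) \<le> fa.dim (rel_part (\<lambda>v. skl6 v + t *\<^sub>s s v) n)"
    using dim_semicontinuous[OF skl6_quadratic s] by blast
  \<comment> \<open>The second polynomial excludes \<open>t * \<alpha>\<^sup>2 = 1\<close>, where
    the product of the \<open>p\<close> would equal the product of the \<open>r\<close>.\<close>
  have "D \<noteq> 0" "[:-1, \<alpha>\<^sup>2:] \<noteq> 0" using D(1) by auto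
  then have "D * [:-1, \<alpha>\<^sup>2:] \<noteq> 0" using no_zero_divisors by blast
  then obtain t where "t \<noteq> 0" "poly (D * [:-1, \<alpha>\<^sup>2:]) t \<noteq> 0" using poly_nonroot by blast
  then have t: "t \<noteq> 0" "poly D t \<noteq> 0" "t * \<alpha>\<^sup>2 \<noteq> 1" by auto
  let ?p = "vec (t * \<alpha>) \<alpha> 1" and ?q = "vec t 1 (1 / \<alpha>)" and ?r = "vec 1 1 1"
  have eq: "(\<lambda>v. skl6 v + t *\<^sub>s s v) = skl ?p ?q ?r"
  proof
    fix v show "skl6 v + t *\<^sub>s s v = skl ?p ?q ?r v"
      by (cases v) (simp_all add: skl6_def skl_def s_def fa.scale_right_distrib)
  qed
  have "nondegenerate ?p ?q ?r"
    using t \<alpha> by (auto simp: nondegenerate_def all_var power2_eq_square mult.assoc)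
  then have "potential (skl ?p ?q ?r) (\<lambda>v. vec 1 t (t * \<alpha>) v *\<^sub>s gen v)
      (\<lambda>v. vec 1 t (t * \<alpha>) v *\<^sub>s skl ?p ?q ?r v) (vec 1 t (t * \<alpha>) VX *\<^sub>s gX)"
    by (rule balanced_potential[where P = "t * \<alpha>" and Q = t]) (use \<alpha> in \<open>auto simp: vec_def split: var.split\<close>)
  then have "poly_growth (skl ?p ?q ?r) n" by (rule potential.growth)
  then show ?thesis using D(2)[OF t(2)] unfolding eq poly_growth_def by linarith
qed

lemma skl6_growth: "poly_growth skl6 n"
  using skl6_upper[of n] skl6_lower[of n] by (simp add: poly_growth_def)

lemma skl6_hilbert: "hilbert_series (range skl6) = inverse ((1 - fps_X) ^ 3)"
  using hilbert_series_iff[OF skl6_quadratic] skl6_growth by blast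

end


subsection \<open>Non-Koszulness\<close>

lemma free_module_componentD:
  "u \<in> free_module_component R B m j \<Longrightarrow> u \<in> free_module R B"
  "u \<in> free_module_component R B m j \<Longrightarrow> m \<le> j \<Longrightarrow> u i \<in> component R (j - m)"
  unfolding free_module_component_def by (auto split: if_splits)

text \<open>An abstract resolution is turned into matrices over the free algebra: degree-preserving
  maps between modules generated in consecutive degrees have linear entries. Since nothing bounds
  the bases in advance, the sums run over finite index sets chosen large enough for the elements at
  hand.\<close>

lemma koszul_matrices:
  fixes r :: "var \<Rightarrow> 'k::field free_alg"
  assumes r: "quadratic r" and "koszul (range r)"
  defines "I \<equiv> rel_ideal (range r)"
  shows "\<exists>(B :: nat \<Rightarrow> nat set) D. B 0 = {0} \<and> (\<forall>m k i. D m k i \<in> homog (Suc 0)) \<and>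
    (\<forall>m k i. k \<notin> B m \<longrightarrow> D m k i = 0) \<and> (\<forall>m i. finite {k. D m k i \<noteq> 0}) \<and>
    (\<forall>f. lk f [] = 0 \<longrightarrow> (\<exists>g S. finite S \<and> S \<subseteq> B 1 \<and> f - (\<Sum>i\<in>S. D 0 0 i * g i) \<in> I)) \<and>
    (\<forall>m f S. finite S \<longrightarrow> S \<subseteq> B (Suc m) \<longrightarrow> (\<forall>k. (\<Sum>i\<in>S. D m k i * f i) \<in> I) \<longrightarrow>
      (\<exists>g T. finite T \<and> T \<subseteq> B (Suc (Suc m)) \<and>
        (\<forall>i. (if i \<in> S then f i else 0) - (\<Sum>j\<in>T. D (Suc m) i j * g j) \<in> I))) \<and>
    (\<forall>m j k S. finite S \<longrightarrow> S \<subseteq> B (Suc m) \<longrightarrow> j \<in> B (Suc (Suc m)) \<longrightarrow> {i. D (Suc m) i j \<noteq> 0} \<subseteq> S \<longrightarrow>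
      (\<Sum>i\<in>S. D m k i * D (Suc m) i j) \<in> I)"
proof -
  let ?R = "range r"
  let ?c = "cls ?R"
  obtain B d where B0: "B 0 = {0}"
    and lin: "\<forall>m. right_linear ?R (B (Suc m)) (B m) (d m)"
    and gr: "\<forall>m j. d m ` free_module_component ?R (B (Suc m)) (Suc m) j \<subseteq> free_module_component ?R (B m) m j"
    and ex: "\<forall>m. d (Suc m) ` free_module ?R (B (Suc (Suc m))) =
      {u \<in> free_module ?R (B (Suc m)). d m u = (\<lambda>i. \<zero>\<^bsub>alg ?R\<^esub>)}"
    and ex0: "d 0 ` free_module ?R (B 1) = {u \<in> free_module ?R (B 0). augmentation ?R (u 0) = 0}"
    using assms(2) by (rule koszulE)
  define b where "b i = (\<lambda>k::nat. ?c (if k = i then 1 else 0))" for i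
  have bFM: "b i \<in> free_module ?R (B (Suc m))" if "i \<in> B (Suc m)" for i m
  proof -
    have "b i \<in> free_module ?R {i}" unfolding b_def by (rule cls_free_module) auto
    then show ?thesis using that by (auto simp: free_module_def)
  qed
  have dFM: "d m u \<in> free_module ?R (B m)" if "u \<in> free_module ?R (B (Suc m))" for m u
    using lin that unfolding right_linear_def by blast
  have dmult: "d m (\<lambda>i. u i \<otimes>\<^bsub>alg ?R\<^esub> a) = (\<lambda>i. d m u i \<otimes>\<^bsub>alg ?R\<^esub> a)"
    if "u \<in> free_module ?R (B (Suc m))" "a \<in> carrier (alg ?R)" for m u a
    using lin[rule_format, of m] that unfolding right_linear_def by simp
  have db: "d m (b i) \<in> free_module_component ?R (B m) m (Suc m)" if "i \<in> B (Suc m)" for m i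
  proof -
    have "b i \<in> free_module_component ?R (B (Suc m)) (Suc m) (Suc m)"
      using bFM[OF that] unfolding free_module_component_def component_def by (auto simp: b_def)
    then show ?thesis using gr by blast
  qed
  \<comment> \<open>The zero class is represented by 0, so that the finite support of
    \<open>d m (b i)\<close> gives finite columns of \<open>D\<close>.\<close>
  define P where "P m k i f \<longleftrightarrow> f \<in> homog (Suc 0) \<and>
      (i \<in> B (Suc m) \<longrightarrow> ?c f = d m (b i) k \<and> (d m (b i) k = \<zero>\<^bsub>alg ?R\<^esub> \<longrightarrow> f = 0)) \<and>
      (i \<notin> B (Suc m) \<longrightarrow> f = 0)" for m k i f
  have Pex: "\<exists>f. P m k i f" for m k i
  proof (cases "i \<in> B (Suc m) \<and> d m (b i) k \<noteq> \<zero>\<^bsub>alg ?R\<^esub>")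
    case True
    then have "d m (b i) k \<in> component ?R (Suc 0)" using free_module_componentD(2)[OF db, of i m k] by simp
    then obtain f where "f \<in> homog (Suc 0)" "d m (b i) k = ?c f" unfolding component_def by blast
    then show ?thesis using True unfolding P_def by (intro exI[of _ f]) simp
  next
    case False
    then show ?thesis unfolding P_def by (intro exI[of _ 0]) (auto simp: cls_zero)
  qed
  define D where "D m k i = (SOME f. P m k i f)" for m k i
  have "P m k i (D m k i)" for m k i unfolding D_def by (rule someI_ex[OF Pex])
  then have D: "\<And>m k i. D m k i \<in> homog (Suc 0)"
    "\<And>m k i. i \<in> B (Suc m) \<Longrightarrow> ?c (D m k i) = d m (b i) k"
    "\<And>m k i. i \<in> B (Suc m) \<Longrightarrow> d m (b i) k = \<zero>\<^bsub>alg ?R\<^esub> \<Longrightarrow> D m k i = 0"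
    "\<And>m k i. i \<notin> B (Suc m) \<Longrightarrow> D m k i = 0" by (simp_all add: P_def)
  have D0: "D m k i = 0" if "k \<notin> B m" for m k i
    using D(3,4)[of i m k] dFM[OF bFM, of i m] that by (cases "i \<in> B (Suc m)") (auto simp: free_module_def)
  have Dfin: "finite {k. D m k i \<noteq> 0}" for m i
  proof (cases "i \<in> B (Suc m)")
    case True
    have "{k. D m k i \<noteq> 0} \<subseteq> {k. d m (b i) k \<noteq> \<zero>\<^bsub>alg ?R\<^esub>}" using D(3)[OF True] by blast
    moreover have "finite {k. d m (b i) k \<noteq> \<zero>\<^bsub>alg ?R\<^esub>}" using dFM[OF bFM[OF True]] by (simp add: free_module_def)
    ultimately show ?thesis by (rule finite_subset)
  qed (simp add: D(4))
  have sFM: "(\<lambda>i. ?c (if i \<in> S then f i else 0)) \<in> free_module ?R (B m)" if "finite S" "S \<subseteq> B m" for S f m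
  proof -
    have "(\<lambda>i. ?c (if i \<in> S then f i else 0)) \<in> free_module ?R S" by (rule cls_free_module) (use that in auto)
    then show ?thesis using that by (auto simp: free_module_def)
  qed
  have dS: "d m (\<lambda>i. ?c (if i \<in> S then f i else 0)) = (\<lambda>k. ?c (\<Sum>i\<in>S. D m k i * f i))"
    if "finite S" "S \<subseteq> B (Suc m)" for S f m
    using that
  proof (induction S)
    case empty
    let ?U = "\<lambda>i::nat. ?c 0"
    have z: "?U \<in> free_module ?R (B (Suc m))" using sFM[of "{}" "Suc m"] by simp
    obtain g where g: "d m ?U = (\<lambda>i. ?c (g i))"
      using free_module_rep[OF dFM[OF z]] by (elim exE conjE) (rule that)
    have "?U = (\<lambda>i. ?U i \<otimes>\<^bsub>alg ?R\<^esub> ?c 0)" by (rule ext) (simp flip: cls_mult)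
    then have "d m ?U = d m (\<lambda>i. ?U i \<otimes>\<^bsub>alg ?R\<^esub> ?c 0)" by (rule arg_cong)
    also have "\<dots> = (\<lambda>i. d m ?U i \<otimes>\<^bsub>alg ?R\<^esub> ?c 0)" by (rule dmult[OF z cls_closed])
    also have "\<dots> = ?U" unfolding g by (rule ext) (simp flip: cls_mult)
    finally show ?case by simp
  next
    case (insert x S)
    have x: "x \<in> B (Suc m)" and S: "S \<subseteq> B (Suc m)" using insert.prems by auto
    have s: "(\<lambda>i. ?c (if i \<in> S then f i else 0)) \<in> free_module ?R (B (Suc m))" by (rule sFM[OF insert.hyps(1) S])
    have bx: "d m (\<lambda>i. b x i \<otimes>\<^bsub>alg ?R\<^esub> ?c (f x)) = (\<lambda>i. d m (b x) i \<otimes>\<^bsub>alg ?R\<^esub> ?c (f x))"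
      by (rule dmult[OF bFM[OF x] cls_closed])
    have e: "(\<lambda>i. b x i \<otimes>\<^bsub>alg ?R\<^esub> ?c (f x)) = (\<lambda>i. ?c (if i \<in> {x} then f x else 0))"
      by (rule ext) (simp add: b_def flip: cls_mult)
    have bm: "(\<lambda>i. b x i \<otimes>\<^bsub>alg ?R\<^esub> ?c (f x)) \<in> free_module ?R (B (Suc m))"
      unfolding e by (rule sFM[of "{x}" "Suc m" "\<lambda>_. f x"]) (use x in auto)
    have "(\<lambda>i. ?c (if i \<in> insert x S then f i else 0)) =
        (\<lambda>i. ?c (if i \<in> S then f i else 0) \<oplus>\<^bsub>alg ?R\<^esub> (b x i \<otimes>\<^bsub>alg ?R\<^esub> ?c (f x)))"
      using insert.hyps(2) by (intro ext) (auto simp: b_def simp flip: cls_mult cls_add)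
    then have "d m (\<lambda>i. ?c (if i \<in> insert x S then f i else 0)) =
        (\<lambda>k. d m (\<lambda>i. ?c (if i \<in> S then f i else 0)) k \<oplus>\<^bsub>alg ?R\<^esub> d m (\<lambda>i. b x i \<otimes>\<^bsub>alg ?R\<^esub> ?c (f x)) k)"
      using lin s bm unfolding right_linear_def by simp
    also have "\<dots> = (\<lambda>k. ?c (\<Sum>i\<in>S. D m k i * f i) \<oplus>\<^bsub>alg ?R\<^esub> (?c (D m k x) \<otimes>\<^bsub>alg ?R\<^esub> ?c (f x)))"
      unfolding insert.IH[OF S] bx D(2)[OF x] ..
    also have "\<dots> = (\<lambda>k. ?c (\<Sum>i\<in>insert x S. D m k i * f i))"
      using insert.hyps by (intro ext) (simp add: add.commute flip: cls_mult cls_add)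
    finally show ?case .
  qed
  have rep: "\<exists>g T. finite T \<and> T \<subseteq> B m \<and> u = (\<lambda>i. ?c (if i \<in> T then g i else 0))"
    if u: "u \<in> free_module ?R (B m)" for u m
  proof -
    obtain g where g: "u = (\<lambda>i. ?c (g i))" using free_module_rep[OF u] by (elim exE conjE) (rule that)
    let ?T = "{i. u i \<noteq> \<zero>\<^bsub>alg ?R\<^esub>}"
    have "u = (\<lambda>i. ?c (if i \<in> ?T then g i else 0))" using g by (intro ext) (simp add: cls_zero)
    moreover have "finite ?T" "?T \<subseteq> B m" using u by (auto simp: free_module_def)
    ultimately show ?thesis by (intro exI[of _ g] exI[of _ ?T] conjI)
  qed
  have E0: "\<exists>g S. finite S \<and> S \<subseteq> B 1 \<and> f - (\<Sum>i\<in>S. D 0 0 i * g i) \<in> I" if "lk f [] = 0" for f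
  proof -
    have "(\<lambda>i. ?c (if i \<in> {0} then f else 0)) \<in> free_module ?R (B 0)" by (rule sFM) (simp_all add: B0)
    then have "(\<lambda>i. ?c (if i \<in> {0} then f else 0)) \<in> d 0 ` free_module ?R (B 1)"
      unfolding ex0 using that by (simp add: augmentation_cls[OF r])
    then obtain u where u: "u \<in> free_module ?R (B 1)" "(\<lambda>i. ?c (if i \<in> {0} then f else 0)) = d 0 u" by blast
    obtain g S where S: "finite S" "S \<subseteq> B 1" "u = (\<lambda>i. ?c (if i \<in> S then g i else 0))" using rep[OF u(1)] by blast
    have "?c f = ?c (\<Sum>i\<in>S. D 0 0 i * g i)"
      using fun_cong[OF u(2), of 0] dS[OF S(1), of 0 g] S(2,3) by simp
    then show ?thesis using S by (intro exI[of _ g] exI[of _ S]) (simp add: cls_eq_iff I_def)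
  qed
  have E1: "\<exists>g T. finite T \<and> T \<subseteq> B (Suc (Suc m)) \<and>
        (\<forall>i. (if i \<in> S then f i else 0) - (\<Sum>j\<in>T. D (Suc m) i j * g j) \<in> I)"
    if S: "finite S" "S \<subseteq> B (Suc m)" and 0: "\<forall>k. (\<Sum>i\<in>S. D m k i * f i) \<in> I" for m f S
  proof -
    let ?u = "\<lambda>i. ?c (if i \<in> S then f i else 0)"
    have "d m ?u = (\<lambda>i. \<zero>\<^bsub>alg ?R\<^esub>)" unfolding dS[OF S] using 0 by (intro ext) (simp add: cls_eq_zero_iff I_def)
    then have "?u \<in> d (Suc m) ` free_module ?R (B (Suc (Suc m)))" using ex sFM[OF S] by blast
    then obtain v where v: "v \<in> free_module ?R (B (Suc (Suc m)))" "?u = d (Suc m) v" by blast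
    obtain g T where T: "finite T" "T \<subseteq> B (Suc (Suc m))" "v = (\<lambda>i. ?c (if i \<in> T then g i else 0))"
      using rep[OF v(1)] by blast
    have "?u = (\<lambda>k. ?c (\<Sum>j\<in>T. D (Suc m) k j * g j))" using v(2) dS[OF T(1,2), of g] T(3) by simp
    then have "?c (if i \<in> S then f i else 0) = ?c (\<Sum>j\<in>T. D (Suc m) i j * g j)" for i by (rule fun_cong)
    then show ?thesis using T by (intro exI[of _ g] exI[of _ T]) (simp only: cls_eq_iff I_def simp_thms)
  qed
  have E2: "(\<Sum>i\<in>S. D m k i * D (Suc m) i j) \<in> I"
    if S: "finite S" "S \<subseteq> B (Suc m)" and j: "j \<in> B (Suc (Suc m))" and sup: "{i. D (Suc m) i j \<noteq> 0} \<subseteq> S" for m j k S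
  proof -
    have "d (Suc m) (b j) \<in> {u \<in> free_module ?R (B (Suc m)). d m u = (\<lambda>i. \<zero>\<^bsub>alg ?R\<^esub>)}"
      using ex bFM[OF j] by blast
    then have "d m (d (Suc m) (b j)) = (\<lambda>i. \<zero>\<^bsub>alg ?R\<^esub>)" by simp
    moreover have "d (Suc m) (b j) = (\<lambda>i. ?c (if i \<in> S then D (Suc m) i j else 0))"
    proof (rule ext)
      fix i
      have "(if i \<in> S then D (Suc m) i j else 0) = D (Suc m) i j" using sup by auto
      then show "d (Suc m) (b j) i = ?c (if i \<in> S then D (Suc m) i j else 0)" using D(2)[OF j, of i] by simp
    qed
    ultimately have "(\<lambda>k. ?c (\<Sum>i\<in>S. D m k i * D (Suc m) i j)) = (\<lambda>i. \<zero>\<^bsub>alg ?R\<^esub>)"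
      using dS[OF S, of "\<lambda>i. D (Suc m) i j"] by simp
    from fun_cong[OF this, of k] show ?thesis by (simp add: cls_eq_zero_iff I_def)
  qed
  show ?thesis
    by (intro exI[of _ B] exI[of _ D] conjI allI impI)
       (simp_all add: B0 D(1) D0 Dfin E0[simplified] E1 E2)
qed

section \<open>Syzygies of degree four in a Koszul algebra\<close>

lemma part_0: "part 0 f = lk f [] *\<^sub>s 1"
  using homog_0_eq[OF part_homog[of 0 f]] by (simp add: lookup_part)

lemma rel_part_2_span:
  assumes "f \<in> rel_part r (Suc (Suc 0))" shows "f \<in> fa.span (range r)"
proof -
  obtain a b where a: "a \<in> combos gen {0}" and b: "b \<in> combos r (homog 0)" and f: "f = a + b"
    using assms by (auto simp: rel_part.simps(3) elim: ssumE)
  obtain s where "\<forall>v. s v \<in> {0}" "a = (\<Sum>v\<in>UNIV. gen v * s v)" using a by (rule combosE)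
  then have "a = 0" by simp
  obtain t where t: "\<forall>v. t v \<in> homog 0" "b = (\<Sum>v\<in>UNIV. r v * t v)" using b by (rule combosE)
  have "r v * t v = lk (t v) [] *\<^sub>s r v" for v
    by (subst homog_0_eq[OF t(1)[rule_format, of v]]) simp
  then show ?thesis using f \<open>a = 0\<close> t(2) span_range_iff[of f r] by (intro iffD2[OF span_range_iff]) auto
qed

lemma rel_part_1_part: "quadratic r \<Longrightarrow> f \<in> rel_ideal (range r) \<Longrightarrow> part (Suc 0) f = 0"
proof -
  assume "quadratic r" "f \<in> rel_ideal (range r)"
  then have "part (Suc 0) f \<in> rel_part r (Suc 0)" using mem_rel_ideal_iff[of r f] by blast
  then show ?thesis by simp
qed

lemma sum_part_lin:
  assumes "\<And>j. D j \<in> homog (Suc 0)"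
  shows "part (Suc n) (\<Sum>j\<in>T. D j * g j) = (\<Sum>j\<in>T. D j * part n (g j))"
  using part_mult_homog[OF assms, of n] by (simp add: part_sum)

text \<open>In a Koszul resolution \<open>M_3\<close> is generated in degree three, so a syzygy
  \<open>\<kappa>\<close> of degree four is, up to trivial ones, a combination of syzygies of degree
  three with linear coefficients. The given resolution need not be built on the variables and the
  relations themselves. So \<open>\<kappa>\<close> is translated into it by the scalar matrices
  \<open>E\<close> and \<open>G\<close>, lifted there by exactness, and translated back by
  \<open>H\<close>.\<close>

lemma koszul_syzygies:
  fixes r :: "var \<Rightarrow> 'k::field free_alg"
  assumes r: "quadratic r" and kz: "koszul (range r)"
    and \<kappa>: "\<kappa> \<in> combos gen (rel_part r 3) \<inter> combos r (homog 2)"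
  shows "\<kappa> \<in> ssum (combos r (rel_part r 2)) (fa.span {\<tau> * h | \<tau> h.
    \<tau> \<in> combos gen (rel_part r 2) \<inter> combos r (homog (Suc 0)) \<and> h \<in> homog (Suc 0)})"
proof -
  let ?I = "rel_ideal (range r)"
  obtain B D where B0: "B (0::nat) = {0::nat}" and D: "\<forall>m k i. D m k i \<in> homog (Suc 0)"
    and D0: "\<forall>m k i. k \<notin> B m \<longrightarrow> D m k i = 0" and Dfin: "\<forall>m i. finite {k. D m k i \<noteq> 0}"
    and ex0: "\<forall>f. lk f [] = 0 \<longrightarrow> (\<exists>g S. finite S \<and> S \<subseteq> B 1 \<and> f - (\<Sum>i\<in>S. D 0 0 i * g i) \<in> ?I)"
    and ex: "\<forall>m f S. finite S \<longrightarrow> S \<subseteq> B (Suc m) \<longrightarrow> (\<forall>k. (\<Sum>i\<in>S. D m k i * f i) \<in> ?I) \<longrightarrow>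
      (\<exists>g T. finite T \<and> T \<subseteq> B (Suc (Suc m)) \<and>
        (\<forall>i. (if i \<in> S then f i else 0) - (\<Sum>j\<in>T. D (Suc m) i j * g j) \<in> ?I))"
    and cx: "\<forall>m j k S. finite S \<longrightarrow> S \<subseteq> B (Suc m) \<longrightarrow> j \<in> B (Suc (Suc m)) \<longrightarrow> {i. D (Suc m) i j \<noteq> 0} \<subseteq> S \<longrightarrow>
      (\<Sum>i\<in>S. D m k i * D (Suc m) i j) \<in> ?I"
    using koszul_matrices[OF r kz] by (elim exE conjE)
  note D = D[rule_format] and D0 = D0[rule_format] and Dfin = Dfin[rule_format]
  have mem2: "f \<in> rel_part r (Suc (Suc 0))" if "f \<in> ?I" "f \<in> homog (Suc (Suc 0))" for f
    using mem_rel_ideal_homog[OF r that(2)] that(1) by simp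
  have "\<forall>u. \<exists>g S. finite S \<and> S \<subseteq> B 1 \<and> gen u - (\<Sum>i\<in>S. D 0 0 i * g i) \<in> ?I"
    using ex0 by (simp add: lookup_gen)
  then obtain g0 S0 where S0: "\<And>u. finite (S0 u)" "\<And>u. S0 u \<subseteq> B 1"
    and g0: "\<And>u. gen u - (\<Sum>i\<in>S0 u. D 0 0 i * g0 u i) \<in> ?I" by metis
  define S where "S = (\<Union>u. S0 u)"
  have S: "finite S" "S \<subseteq> B 1" using S0 by (auto simp: S_def)
  \<comment> \<open>In degree one only the constant terms of the coefficients \<open>g0\<close>
    survive, so the variables are scalar combinations of the entries of \<open>D 0\<close>.\<close>
  define E where "E u i = (if i \<in> S0 u then lk (g0 u i) [] else 0)" for u i
  have gen_eq: "gen u = (\<Sum>i\<in>S. E u i *\<^sub>s D 0 0 i)" for u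
  proof -
    have "part (Suc 0) (gen u - (\<Sum>i\<in>S0 u. D 0 0 i * g0 u i)) = 0" by (rule rel_part_1_part[OF r g0])
    then have "gen u = (\<Sum>i\<in>S0 u. lk (g0 u i) [] *\<^sub>s D 0 0 i)"
      by (simp add: part_of_homog[OF homog_gen] part_diff sum_part_lin D part_0)
    also have "\<dots> = (\<Sum>i\<in>S0 u. E u i *\<^sub>s D 0 0 i)" by (rule sum.cong) (simp_all add: E_def)
    also have "\<dots> = (\<Sum>i\<in>S. E u i *\<^sub>s D 0 0 i)"
      by (rule sum.mono_neutral_left) (use S in \<open>auto simp: S_def E_def\<close>)
    finally show ?thesis .
  qed
  \<comment> \<open>The coordinates of the relation \<open>r v\<close> in \<open>M_1\<close>: linear
    forms that \<open>D 0\<close> maps to \<open>r v\<close>.\<close>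
  define nn where "nn i v = (if i \<in> S then \<Sum>u\<in>UNIV. E u i *\<^sub>s tail u (r v) else 0)" for i v
  have r2: "r v \<in> homog (Suc (Suc 0))" for v using quadraticD[OF r, of v] by (simp add: numeral_2_eq_2)
  have nh: "nn i v \<in> homog (Suc 0)" for i v
    unfolding nn_def by (auto intro!: homog_sum homog_smul homog_tail r2)
  have r_eq: "r v = (\<Sum>i\<in>S. D 0 0 i * nn i v)" for v
  proof -
    have "r v = (\<Sum>u\<in>UNIV. gen u * tail u (r v))" by (rule homog_expand[OF r2])
    also have "\<dots> = (\<Sum>u\<in>UNIV. \<Sum>i\<in>S. D 0 0 i * (E u i *\<^sub>s tail u (r v)))"
      by (subst gen_eq) (simp add: sum_distrib_right)
    also have "\<dots> = (\<Sum>i\<in>S. \<Sum>u\<in>UNIV. D 0 0 i * (E u i *\<^sub>s tail u (r v)))" by (rule sum.swap)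
    also have "\<dots> = (\<Sum>i\<in>S. D 0 0 i * nn i v)"
      by (rule sum.cong) (simp_all add: nn_def sum_distrib_left)
    finally show ?thesis .
  qed
  have "\<exists>g T. finite T \<and> T \<subseteq> B 2 \<and> (\<forall>i. nn i v - (\<Sum>j\<in>T. D 1 i j * g j) \<in> ?I)" for v
  proof -
    have "\<forall>k. (\<Sum>i\<in>S. D 0 k i * nn i v) \<in> ?I"
    proof
      fix k show "(\<Sum>i\<in>S. D 0 k i * nn i v) \<in> ?I"
      proof (cases "k = 0")
        case True
        have "r v \<in> ?I" using rel_ideal_subset[of "range r"] by blast
        then show ?thesis using True r_eq[of v] by simp
      next
        case False
        then show ?thesis using D0[of k 0] B0 by simp
      qed
    qed
    moreover have "(if i \<in> S then nn i v else 0) = nn i v" for i by (simp add: nn_def)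
    ultimately show ?thesis using ex[rule_format, of S 0 "\<lambda>i. nn i v"] S by (simp add: numeral_2_eq_2)
  qed
  then obtain g1 T1 where T1: "\<And>v. finite (T1 v)" "\<And>v. T1 v \<subseteq> B 2"
    and g1: "\<And>v i. nn i v - (\<Sum>j\<in>T1 v. D 1 i j * g1 v j) \<in> ?I" by metis
  define T where "T = (\<Union>v. T1 v)"
  have T: "finite T" "T \<subseteq> B 2" using T1 by (auto simp: T_def)
  \<comment> \<open>Elements of degree two in \<open>M_2\<close> have constant coordinates;
    \<open>G v\<close> is the one that stands for the relation \<open>r v\<close>.\<close>
  define G where "G v j = (if j \<in> T1 v then lk (g1 v j) [] else 0)" for v j
  have n_eq: "nn i v = (\<Sum>j\<in>T. G v j *\<^sub>s D 1 i j)" for i v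
  proof -
    have "part (Suc 0) (nn i v - (\<Sum>j\<in>T1 v. D 1 i j * g1 v j)) = 0" by (rule rel_part_1_part[OF r g1])
    then have "nn i v = (\<Sum>j\<in>T1 v. lk (g1 v j) [] *\<^sub>s D 1 i j)"
      using part_of_homog[OF nh, of "Suc 0" i v] by (simp add: part_diff sum_part_lin D part_0)
    also have "\<dots> = (\<Sum>j\<in>T1 v. G v j *\<^sub>s D 1 i j)" by (rule sum.cong) (simp_all add: G_def)
    also have "\<dots> = (\<Sum>j\<in>T. G v j *\<^sub>s D 1 i j)"
      by (rule sum.mono_neutral_left) (use T in \<open>auto simp: T_def G_def\<close>)
    finally show ?thesis .
  qed
  obtain w where w: "\<forall>v. w v \<in> homog 2" "\<kappa> = (\<Sum>v\<in>UNIV. r v * w v)" using \<kappa> by (blast elim: combosE)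
  obtain jj where jj: "\<forall>u. jj u \<in> rel_part r 3" "\<kappa> = (\<Sum>u\<in>UNIV. gen u * jj u)" using \<kappa> by (blast elim: combosE)
  have lkr: "lk (r v) [] = 0" for v using r2[of v] by (simp add: homog_iff)
  have jj_eq: "(\<Sum>v\<in>UNIV. tail u (r v) * w v) = jj u" for u
  proof -
    have "tail u \<kappa> = (\<Sum>v\<in>UNIV. tail u (r v) * w v)" unfolding w(2) by (simp add: tail_sum tail_mult lkr)
    moreover have "tail u \<kappa> = jj u" unfolding jj(2) by (cases u) (simp_all add: sum_var)
    ultimately show ?thesis by simp
  qed
  \<comment> \<open>The coefficients \<open>w\<close> of \<open>\<kappa>\<close>, moved to
    \<open>M_2\<close>; they will form a cycle, because \<open>D 1\<close> maps them into the
    ideal.\<close>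
  define f where "f j = (\<Sum>v\<in>UNIV. G v j *\<^sub>s w v)" for j
  have fT: "f j = 0" if "j \<notin> T" for j using that by (simp add: f_def G_def T_def)
  have fh: "f j \<in> homog 2" for j unfolding f_def using w(1) by (intro homog_sum homog_smul) auto
  have Df: "(\<Sum>j\<in>T. D 1 i j * f j) = (\<Sum>v\<in>UNIV. nn i v * w v)" for i
  proof -
    have "(\<Sum>j\<in>T. D 1 i j * f j) = (\<Sum>j\<in>T. \<Sum>v\<in>UNIV. (G v j *\<^sub>s D 1 i j) * w v)"
      by (simp add: f_def sum_distrib_left)
    also have "\<dots> = (\<Sum>v\<in>UNIV. \<Sum>j\<in>T. (G v j *\<^sub>s D 1 i j) * w v)" by (rule sum.swap)
    also have "\<dots> = (\<Sum>v\<in>UNIV. nn i v * w v)" by (simp add: n_eq sum_distrib_right)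
    finally show ?thesis .
  qed
  have "\<forall>i. (\<Sum>j\<in>T. D 1 i j * f j) \<in> ?I"
  proof
    fix i
    show "(\<Sum>j\<in>T. D 1 i j * f j) \<in> ?I"
    proof (cases "i \<in> S")
      case True
      have "(\<Sum>v\<in>UNIV. nn i v * w v) = (\<Sum>u\<in>UNIV. E u i *\<^sub>s (\<Sum>v\<in>UNIV. tail u (r v) * w v))"
        using True by (simp add: nn_def sum_var distrib_right fa.scale_right_distrib add_ac)
      also have "\<dots> \<in> ?I" unfolding jj_eq
        using jj(1) rel_part_in_rel_ideal[OF r] by (intro rel_ideal_sum rel_ideal_smul) auto
      finally show ?thesis unfolding Df .
    next
      case False
      then show ?thesis unfolding Df by (simp add: nn_def)
    qed
  qed
  then have "\<exists>g U. finite U \<and> U \<subseteq> B 3 \<and> (\<forall>j. (if j \<in> T then f j else 0) - (\<Sum>k\<in>U. D 2 j k * g k) \<in> ?I)"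
    using ex[rule_format, of T 1 f] T by (simp add: eval_nat_numeral)
  then obtain h U where U: "finite U" "U \<subseteq> B 3"
    and h: "\<And>j. (if j \<in> T then f j else 0) - (\<Sum>k\<in>U. D 2 j k * h k) \<in> ?I" by blast
  define hh where "hh k = part (Suc 0) (h k)" for k
  define q where "q j = f j - (\<Sum>k\<in>U. D 2 j k * hh k)" for j
  have q: "q j \<in> rel_part r 2" for j
  proof -
    have "f j - (\<Sum>k\<in>U. D 2 j k * h k) \<in> ?I" using h[of j] fT[of j] by (cases "j \<in> T") simp_all
    then have "part (Suc (Suc 0)) (f j - (\<Sum>k\<in>U. D 2 j k * h k)) \<in> rel_part r (Suc (Suc 0))"
      using mem_rel_ideal_iff[OF r] by blast
    then show ?thesis using part_of_homog[OF fh, of "Suc (Suc 0)" j]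
      by (simp add: q_def hh_def part_diff sum_part_lin D numeral_2_eq_2)
  qed
  \<comment> \<open>The index sets are enlarged to contain the supports of all columns in use, since
    the vanishing of a composite is available only for complete columns.\<close>
  define T' where "T' = T \<union> (\<Union>k\<in>U. {j. D 2 j k \<noteq> 0})"
  have D0': "i \<in> B m" if "D m i k \<noteq> 0" for m i k using D0[of i m k] that by blast
  have T': "finite T'" "T' \<subseteq> B 2" using T U Dfin D0'[of 2] by (auto simp: T'_def)
  define S' where "S' = S \<union> (\<Union>j\<in>T'. {i. D 1 i j \<noteq> 0})"
  have S': "finite S'" "S' \<subseteq> B 1" using S T' Dfin D0'[of 1] by (auto simp: S'_def)
  have "\<exists>c. (\<Sum>i\<in>S'. D 0 0 i * D 1 i j) = (\<Sum>v\<in>UNIV. c v *\<^sub>s r v)" if "j \<in> T'" for j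
  proof -
    have "(\<Sum>i\<in>S'. D 0 0 i * D 1 i j) \<in> ?I"
      using cx[rule_format, of S' 0 j 0] S' T' that by (auto simp: S'_def eval_nat_numeral)
    moreover have "(\<Sum>i\<in>S'. D 0 0 i * D 1 i j) \<in> homog (Suc (Suc 0))"
      by (intro homog_sum homog_lin_mult D)
    ultimately show ?thesis using rel_part_2_span[OF mem2] span_range_iff by blast
  qed
  \<comment> \<open>The way back: \<open>D 0\<close> after \<open>D 1\<close> takes the basis vector
    \<open>j\<close> of \<open>M_2\<close> to a quadratic element of the ideal, that is, to a scalar
    combination of the relations.\<close>
  then obtain H where H: "\<And>j. j \<in> T' \<Longrightarrow> (\<Sum>i\<in>S'. D 0 0 i * D 1 i j) = (\<Sum>v\<in>UNIV. H j v *\<^sub>s r v)" by metis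
  have HD: "(\<Sum>v\<in>UNIV. r v * (\<Sum>j\<in>T'. H j v *\<^sub>s x j)) = (\<Sum>i\<in>S'. D 0 0 i * (\<Sum>j\<in>T'. D 1 i j * x j))" for x
  proof -
    have "(\<Sum>v\<in>UNIV. r v * (\<Sum>j\<in>T'. H j v *\<^sub>s x j)) = (\<Sum>v\<in>UNIV. \<Sum>j\<in>T'. (H j v *\<^sub>s r v) * x j)"
      by (simp add: sum_distrib_left)
    also have "\<dots> = (\<Sum>j\<in>T'. \<Sum>v\<in>UNIV. (H j v *\<^sub>s r v) * x j)" by (rule sum.swap)
    also have "\<dots> = (\<Sum>j\<in>T'. (\<Sum>i\<in>S'. D 0 0 i * D 1 i j) * x j)"
      by (intro sum.cong refl) (simp only: H sum_distrib_right)
    also have "\<dots> = (\<Sum>j\<in>T'. \<Sum>i\<in>S'. D 0 0 i * (D 1 i j * x j))" by (simp only: sum_distrib_right mult.assoc)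
    also have "\<dots> = (\<Sum>i\<in>S'. \<Sum>j\<in>T'. D 0 0 i * (D 1 i j * x j))" by (rule sum.swap)
    also have "\<dots> = (\<Sum>i\<in>S'. D 0 0 i * (\<Sum>j\<in>T'. D 1 i j * x j))" by (simp only: sum_distrib_left)
    finally show ?thesis .
  qed
  \<comment> \<open>The syzygy of degree three for which the basis vector \<open>k\<close> of
    \<open>M_3\<close> stands.\<close>
  define \<tau> where "\<tau> k = (\<Sum>v\<in>UNIV. r v * (\<Sum>j\<in>T'. H j v *\<^sub>s D 2 j k))" for k
  have \<tau>: "\<tau> k \<in> combos gen (rel_part r 2) \<inter> combos r (homog (Suc 0))" if k: "k \<in> U" for k
  proof
    show "\<tau> k \<in> combos r (homog (Suc 0))" unfolding \<tau>_def by (intro combosI homog_sum homog_smul D)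
    have sub: "{j. D 2 j k \<noteq> 0} \<subseteq> T'" using k by (auto simp: T'_def)
    have "(\<Sum>j\<in>T'. D 1 i j * D 2 j k) \<in> ?I" for i
      using cx[rule_format, of T' 1 k i] T' U(2) k sub by (auto simp: eval_nat_numeral)
    moreover have "(\<Sum>j\<in>T'. D 1 i j * D 2 j k) \<in> homog (Suc (Suc 0))" for i
      by (intro homog_sum homog_lin_mult D)
    ultimately have J2: "(\<Sum>j\<in>T'. D 1 i j * D 2 j k) \<in> rel_part r 2" for i
      using mem2 by (simp add: numeral_2_eq_2)
    have "D 0 0 i * (\<Sum>j\<in>T'. D 1 i j * D 2 j k) \<in> combos gen (rel_part r 2)" for i
    proof -
      have "D 0 0 i * x = (\<Sum>u\<in>UNIV. gen u * (lk (D 0 0 i) [u] *\<^sub>s x))" for x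
        by (subst lin_expand[OF D]) (simp add: sum_distrib_right)
      then show ?thesis using J2[of i] by (simp only:) (intro combosI rel_part_smul)
    qed
    then show "\<tau> k \<in> combos gen (rel_part r 2)"
      unfolding \<tau>_def HD by (intro fa.subspace_sum combos_subspace rel_part_subspace)
  qed
  have "\<kappa> = (\<Sum>v\<in>UNIV. r v * (\<Sum>j\<in>T'. H j v *\<^sub>s f j))"
  proof -
    have "(\<Sum>j\<in>T'. D 1 i j * f j) = (\<Sum>v\<in>UNIV. nn i v * w v)" for i
      unfolding Df[symmetric] by (rule sum.mono_neutral_right) (use T' fT in \<open>auto simp: T'_def\<close>)
    then have "(\<Sum>v\<in>UNIV. r v * (\<Sum>j\<in>T'. H j v *\<^sub>s f j)) = (\<Sum>i\<in>S'. D 0 0 i * (\<Sum>v\<in>UNIV. nn i v * w v))"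
      by (simp only: HD)
    also have "\<dots> = (\<Sum>i\<in>S. D 0 0 i * (\<Sum>v\<in>UNIV. nn i v * w v))"
      by (rule sum.mono_neutral_right) (use S' in \<open>auto simp: S'_def nn_def\<close>)
    also have "\<dots> = (\<Sum>i\<in>S. \<Sum>v\<in>UNIV. D 0 0 i * nn i v * w v)" by (simp only: sum_distrib_left mult.assoc)
    also have "\<dots> = (\<Sum>v\<in>UNIV. \<Sum>i\<in>S. D 0 0 i * nn i v * w v)" by (rule sum.swap)
    also have "\<dots> = \<kappa>" unfolding w(2) sum_distrib_right[symmetric] r_eq[symmetric] ..
    finally show ?thesis by simp
  qed
  also have "\<dots> = (\<Sum>v\<in>UNIV. r v * (\<Sum>j\<in>T'. H j v *\<^sub>s q j)) + (\<Sum>k\<in>U. \<tau> k * hh k)"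
  proof -
    have "f j = q j + (\<Sum>k\<in>U. D 2 j k * hh k)" for j by (simp add: q_def)
    then have "(\<Sum>v\<in>UNIV. r v * (\<Sum>j\<in>T'. H j v *\<^sub>s f j)) = (\<Sum>v\<in>UNIV. r v * (\<Sum>j\<in>T'. H j v *\<^sub>s q j))
        + (\<Sum>v\<in>UNIV. r v * (\<Sum>j\<in>T'. \<Sum>k\<in>U. H j v *\<^sub>s (D 2 j k * hh k)))"
      by (simp add: fa.scale_right_distrib sum.distrib distrib_left fa.scale_sum_right)
    also have "(\<Sum>v\<in>UNIV. r v * (\<Sum>j\<in>T'. \<Sum>k\<in>U. H j v *\<^sub>s (D 2 j k * hh k))) = (\<Sum>k\<in>U. \<tau> k * hh k)"
    proof -
      have "(\<Sum>j\<in>T'. \<Sum>k\<in>U. H j v *\<^sub>s (D 2 j k * hh k)) = (\<Sum>k\<in>U. (\<Sum>j\<in>T'. H j v *\<^sub>s D 2 j k) * hh k)" for v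
        by (subst sum.swap) (simp add: sum_distrib_right)
      moreover have left_mult: "a * (\<Sum>k\<in>U. x k * hh k) = (\<Sum>k\<in>U. a * x k * hh k)" for a x
        by (simp add: sum_distrib_left mult.assoc)
      ultimately have "(\<Sum>v\<in>UNIV. r v * (\<Sum>j\<in>T'. \<Sum>k\<in>U. H j v *\<^sub>s (D 2 j k * hh k)))
          = (\<Sum>v\<in>UNIV. r v * (\<Sum>k\<in>U. (\<Sum>j\<in>T'. H j v *\<^sub>s D 2 j k) * hh k))"
        by (simp only:)
      also have "\<dots> = (\<Sum>v\<in>UNIV. \<Sum>k\<in>U. r v * (\<Sum>j\<in>T'. H j v *\<^sub>s D 2 j k) * hh k)"
        by (intro sum.cong refl left_mult)
      also have "\<dots> = (\<Sum>k\<in>U. \<Sum>v\<in>UNIV. r v * (\<Sum>j\<in>T'. H j v *\<^sub>s D 2 j k) * hh k)" by (rule sum.swap)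
      also have "\<dots> = (\<Sum>k\<in>U. \<tau> k * hh k)" by (simp only: \<tau>_def sum_distrib_right)
      finally show ?thesis .
    qed
    finally show ?thesis .
  qed
  finally have \<kappa>_eq: "\<kappa> = (\<Sum>v\<in>UNIV. r v * (\<Sum>j\<in>T'. H j v *\<^sub>s q j)) + (\<Sum>k\<in>U. \<tau> k * hh k)" .
  show ?thesis
    unfolding \<kappa>_eq
  proof (intro ssumI)
    show "(\<Sum>v\<in>UNIV. r v * (\<Sum>j\<in>T'. H j v *\<^sub>s q j)) \<in> combos r (rel_part r 2)"
      by (intro combosI rel_part_sum rel_part_smul q)
    show "(\<Sum>k\<in>U. \<tau> k * hh k) \<in> fa.span {\<tau> * h | \<tau> h.
        \<tau> \<in> combos gen (rel_part r 2) \<inter> combos r (homog (Suc 0)) \<and> h \<in> homog (Suc 0)}"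
    proof (rule fa.span_sum, rule fa.span_base, intro CollectI exI conjI)
      fix k assume "k \<in> U"
      then show "\<tau> k \<in> combos gen (rel_part r 2) \<inter> combos r (homog (Suc 0))" by (rule \<tau>)
      show "\<tau> k * hh k = \<tau> k * hh k" ..
      show "hh k \<in> homog (Suc 0)" by (simp add: hh_def part_homog)
    qed
  qed
qed

text \<open>The growth gives the dimensions 3, 17, 66 for the ideal, hence 1 for the syzygies of
  degree three and 12 for those of degree four. The former are spanned by \<open>xxx\<close>. Its
  multiples \<open>xxxx\<close>, \<open>xxxy\<close>, \<open>xxxz\<close> add at most two dimensions
  to the 9 of \<open>\<Sum> r v J_2\<close>, because \<open>xxxx\<close> already lies there, and 11
  is less than 12.\<close>

lemma not_koszul_of_square:
  assumes r: "quadratic r" and indep: "right_indep r" and growth: "\<And>n. poly_growth r n"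
    and rX: "r VX = mon [VX, VX]"
  shows "\<not> koszul (range r)"
proof
  assume kz: "koszul (range r)"
  have choose: "(2 + 2 choose 2) = (6::nat)" "(3 + 2 choose 2) = (10::nat)" "(4 + 2 choose 2) = (15::nat)"
    by (simp_all add: choose_two)
  have i: "fa.dim (rel_part r 2) = 3" "fa.dim (rel_part r 3) = 17" "fa.dim (rel_part r 4) = 66"
    using growth[of 2] growth[of 3] growth[of 4] unfolding poly_growth_def choose by simp_all
  let ?W = "combos gen (rel_part r 2) \<inter> combos r (homog (Suc 0))"
  let ?K = "combos gen (rel_part r 3) \<inter> combos r (homog 2)"
  have dW: "fa.dim ?W = 1" using dim_rel_part_Suc_Suc[OF r indep, of 1] i by (simp add: eval_nat_numeral)
  have dK: "fa.dim ?K = 12" using dim_rel_part_Suc_Suc[OF r indep, of 2] i by (simp add: eval_nat_numeral)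
  have sW: "fa.subspace ?W" by (intro fa.subspace_inter combos_subspace rel_part_subspace homog_subspace)
  have fW: "fa.fin_spanned ?W"
    using fa.fin_spanned_subset[OF combos_fin_spanned[OF homog_fin_spanned, of r "Suc 0"]] by blast
  let ?x = "mon [VX, VX, VX] :: 'a free_alg"
  have sq: "mon [VX, VX] \<in> rel_part r 2"
    using rel_part_rel_mult[OF homog_one, of r VX] by (simp add: rX numeral_2_eq_2)
  have "?x \<in> combos gen (rel_part r 2)"
    using combos_single[OF sq rel_part_subspace, of gen VX] by (simp add: gen_eq_mon)
  moreover have "?x \<in> combos r (homog (Suc 0))"
    using combos_single[OF homog_gen homog_subspace, of r VX VX] by (simp add: rX gen_eq_mon)
  ultimately have x: "?x \<in> ?W" by blast
  have x0: "?x \<noteq> 0" by (metis lookup_mon lookup_zero zero_neq_one)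
  have "fa.span {?x} = ?W"
  proof (rule fa.subspace_eq_of_dim_le[OF fW])
    show "fa.span {?x} \<subseteq> ?W" using x sW by (intro fa.span_minimal) auto
    have "fa.independent {?x}" using x0 by simp
    then show "fa.dim ?W \<le> fa.dim (fa.span {?x})" unfolding dW by (subst fa.dim_span_eq_card_independent) auto
  qed simp
  then have W: "\<exists>c. \<tau> = c *\<^sub>s ?x" if "\<tau> \<in> ?W" for \<tau>
    using that by (auto simp: fa.span_singleton)
  let ?C = "combos r (rel_part r 2)" and ?B = "{mon [VX, VX, VX, VY], mon [VX, VX, VX, VZ]} :: 'a free_alg set"
  have sC: "fa.subspace ?C" and fC: "fa.fin_spanned ?C"
    by (intro combos_subspace combos_fin_spanned rel_part_subspace rel_part_fin_spanned r)+
  have fB: "fa.fin_spanned (fa.span ?B)" unfolding fa.fin_spanned_def by (intro exI[of _ ?B]) simp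
  have sS: "fa.subspace (ssum ?C (fa.span ?B))" by (intro ssum_subspace sC fa.subspace_span)
  have xxxx: "mon [VX, VX, VX, VX] \<in> ?C"
    using combos_single[OF sq rel_part_subspace, of r VX] by (simp add: rX)
  have "\<tau> * h \<in> ssum ?C (fa.span ?B)" if \<tau>: "\<tau> \<in> ?W" and h: "h \<in> homog (Suc 0)" for \<tau> h
  proof -
    obtain c where "\<tau> = c *\<^sub>s ?x" using W[OF \<tau>] by blast
    then have "\<tau> * h = (c * lk h [VX]) *\<^sub>s mon [VX, VX, VX, VX]
        + (c *\<^sub>s lk h [VY] *\<^sub>s mon [VX, VX, VX, VY] + c *\<^sub>s lk h [VZ] *\<^sub>s mon [VX, VX, VX, VZ])"
      by (subst lin_expand[OF h])
         (simp add: sum_var gen_eq_mon distrib_left fa.scale_right_distrib add_ac mult.commute)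
    then show ?thesis
      by (simp only:) (intro ssumI fa.subspace_scale[OF sC] xxxx fa.span_add fa.span_scale fa.span_base insertI1 insertI2)
  qed
  then have "fa.span {\<tau> * h | \<tau> h. \<tau> \<in> ?W \<and> h \<in> homog (Suc 0)} \<subseteq> ssum ?C (fa.span ?B)"
    by (intro fa.span_minimal[OF _ sS] subsetI) (elim CollectE exE conjE, simp only:)
  moreover have "?C \<subseteq> ssum ?C (fa.span ?B)"
  proof
    fix f assume "f \<in> ?C"
    then have "f + 0 \<in> ssum ?C (fa.span ?B)" by (intro ssumI fa.span_zero)
    then show "f \<in> ssum ?C (fa.span ?B)" by simp
  qed
  ultimately have sub: "fa.span {\<tau> * h | \<tau> h. \<tau> \<in> ?W \<and> h \<in> homog (Suc 0)} \<subseteq> ssum ?C (fa.span ?B)"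
    "?C \<subseteq> ssum ?C (fa.span ?B)" .
  have "ssum ?C (fa.span {\<tau> * h | \<tau> h. \<tau> \<in> ?W \<and> h \<in> homog (Suc 0)}) \<subseteq> ssum ?C (fa.span ?B)"
  proof
    fix f assume "f \<in> ssum ?C (fa.span {\<tau> * h | \<tau> h. \<tau> \<in> ?W \<and> h \<in> homog (Suc 0)})"
    then obtain x y where "x \<in> ?C" "y \<in> fa.span {\<tau> * h | \<tau> h. \<tau> \<in> ?W \<and> h \<in> homog (Suc 0)}" "f = x + y"
      by (rule ssumE)
    from fa.subspace_add[OF sS subsetD[OF sub(2) this(1)] subsetD[OF sub(1) this(2)]] this(3)
    show "f \<in> ssum ?C (fa.span ?B)" by (simp only:)
  qed
  then have "?K \<subseteq> ssum ?C (fa.span ?B)" using koszul_syzygies[OF r kz] by blast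
  then have "fa.dim ?K \<le> fa.dim (ssum ?C (fa.span ?B))"
    by (rule fa.dim_le_fin_spanned[OF ssum_fin_spanned[OF fC fB]])
  also have "\<dots> \<le> fa.dim ?C + fa.dim (fa.span ?B)"
    using dim_ssum[OF sC fa.subspace_span fC fB] by linarith
  also have "fa.dim ?C = 9"
    using dim_combos[OF indep rel_part_subspace rel_part_fin_spanned[OF r], of 2] i by simp
  also have "fa.dim (fa.span ?B) \<le> 2"
    using fa.dim_le_card'[of ?B] card_insert_le_m1[of 2 "{mon [VX, VX, VX, VZ] :: 'a free_alg}" "mon [VX, VX, VX, VY]"]
    unfolding fa.dim_span by simp
  finally show False using dK by simp
qed

lemma class_P6_not_koszul_hilbert:
  assumes "R' \<in> class_P 6"
  shows "\<not> koszul (set R' :: 'k::alg_closed_field free_alg set)"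
    "hilbert_series (set R') = inverse ((1 - fps_X) ^ 3)"
proof -
  obtain \<alpha> :: 'k where R': "R' = [gX * gX, scal \<alpha> * gZ * gX + gX * gZ + gY * gY,
      gX * gY + scal (1 / \<alpha>) * gY * gX + gZ * gZ]" and \<alpha>: "\<alpha> \<noteq> 0"
    using assms by (auto simp: class_P_def class_P6_def)
  have eq: "set R' = range (skl6 \<alpha>)"
    unfolding R' UNIV_var by (simp add: skl6_def[OF \<alpha>] skl_def scal_mult gen_eq_mon)
  show "hilbert_series (set R') = inverse ((1 - fps_X) ^ 3)"
    unfolding eq by (rule skl6_hilbert[OF \<alpha>])
  show "\<not> koszul (set R')"
    unfolding eq
  proof (rule not_koszul_of_square)
    show "quadratic (skl6 \<alpha>)" by (rule skl6_quadratic[OF \<alpha>])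
    show "right_indep (skl6 \<alpha>)"
      unfolding skl6_def[OF \<alpha>] by (rule skl_right_indep) (simp add: vec_def split: var.split)
    show "poly_growth (skl6 \<alpha>) n" for n by (rule skl6_growth[OF \<alpha>])
    show "skl6 \<alpha> VX = mon [VX, VX]" by (simp add: skl6_def[OF \<alpha>] skl_def)
  qed
qed


section \<open>Consequences of the polynomial growth\<close>

text \<open>The equations between the coefficients of \<open>\<Sum> a u u (skl (t u)) = \<Sum> b u (skl (t u)) u\<close>, where \<open>t u\<close>
  is \<open>u\<close>, \<open>nxt (nxt u)\<close> or \<open>nxt u\<close>. By the grading modulo \<open>3\<close>, every syzygy of degree three is a sum of
  syzygies of these three types.\<close>

definition syz0 :: "(var \<Rightarrow> 'k::field) \<Rightarrow> (var \<Rightarrow> 'k) \<Rightarrow> (var \<Rightarrow> 'k) \<Rightarrow> (var \<Rightarrow> 'k) \<Rightarrow> (var \<Rightarrow> 'k) \<Rightarrow> bool"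
  where "syz0 p q r a b \<longleftrightarrow> (\<forall>v. a v * p v = b (nxt (nxt v)) * p (nxt (nxt v)) \<and>
    a v * q v = b (nxt v) * q (nxt v) \<and> a v * r v = b v * r v)"

definition syz1 :: "(var \<Rightarrow> 'k::field) \<Rightarrow> (var \<Rightarrow> 'k) \<Rightarrow> (var \<Rightarrow> 'k) \<Rightarrow> (var \<Rightarrow> 'k) \<Rightarrow> (var \<Rightarrow> 'k) \<Rightarrow> bool"
  where "syz1 p q r a b \<longleftrightarrow> (\<forall>v. a v * p (nxt (nxt v)) = b (nxt v) * r v \<and>
    a v * q (nxt (nxt v)) = b v * p (nxt (nxt v)) \<and> a v * r (nxt (nxt v)) = b (nxt (nxt v)) * q (nxt v))"

definition syz2 :: "(var \<Rightarrow> 'k::field) \<Rightarrow> (var \<Rightarrow> 'k) \<Rightarrow> (var \<Rightarrow> 'k) \<Rightarrow> (var \<Rightarrow> 'k) \<Rightarrow> (var \<Rightarrow> 'k) \<Rightarrow> bool"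
  where "syz2 p q r a b \<longleftrightarrow> (\<forall>v. a v * p (nxt v) = b v * q (nxt v) \<and>
    a v * q (nxt v) = b (nxt (nxt v)) * r v \<and> a v * r (nxt v) = b (nxt v) * p (nxt (nxt v)))"

definition syzygy :: "(var \<Rightarrow> var) \<Rightarrow> (var \<Rightarrow> 'k::field free_alg) \<Rightarrow> (var \<Rightarrow> 'k) \<Rightarrow> (var \<Rightarrow> 'k) \<Rightarrow> bool"
  where "syzygy t f a b \<longleftrightarrow> (\<Sum>u\<in>UNIV. gen u * (a u *\<^sub>s f (t u))) = (\<Sum>u\<in>UNIV. f (t u) * (b u *\<^sub>s gen u))"

lemma syzygy_of_syz:
  "syz0 p q r a b \<Longrightarrow> syzygy id (skl p q r) a b"
  "syz1 p q r a b \<Longrightarrow> syzygy (\<lambda>v. nxt (nxt v)) (skl p q r) a b"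
  "syz2 p q r a b \<Longrightarrow> syzygy nxt (skl p q r) a b"
proof -
  note ss = sum_var skl_def gen_eq_mon distrib_left distrib_right fa.scale_right_distrib
  { assume "syz0 p q r a b"
    note h = this[unfolded syz0_def all_var nxt.simps]
    show "syzygy id (skl p q r) a b" unfolding syzygy_def by (simp add: ss h add_ac) }
  { assume "syz1 p q r a b"
    note h = this[unfolded syz1_def all_var nxt.simps]
    show "syzygy (\<lambda>v. nxt (nxt v)) (skl p q r) a b" unfolding syzygy_def by (simp add: ss h add_ac) }
  assume "syz2 p q r a b"
  note h = this[unfolded syz2_def all_var nxt.simps]
  show "syzygy nxt (skl p q r) a b" unfolding syzygy_def by (simp add: ss h add_ac)
qed

lemma lookup_skl_gen:
  "lk (skl p q r v * gen u) [x, y, z] = (if u = z then lk (skl p q r v) [x, y] else 0)"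
  by (simp add: skl_def distrib_right gen_eq_mon lookup_add lookup_smul lookup_mon)

text \<open>\<open>A\<close> and \<open>B\<close> are the full coefficient matrices of a syzygy,
  with relations on the right and on the left. Words of a fixed weight modulo 3 involve only the
  entries on one cyclic diagonal, so the equations split into the three types.\<close>

lemma syz_of_syzygies:
  assumes eq: "\<And>x y z. (\<Sum>v\<in>UNIV. A x v * lk (skl p q r v) [y, z]) = (\<Sum>v\<in>UNIV. lk (skl p q r v) [x, y] * B v z)"
  shows "syz0 p q r (\<lambda>u. A u u) (\<lambda>u. B u u)"
    "syz1 p q r (\<lambda>u. A u (nxt (nxt u))) (\<lambda>u. B (nxt (nxt u)) u)"
    "syz2 p q r (\<lambda>u. A u (nxt u)) (\<lambda>u. B (nxt u) u)"
proof -
  have e: "A x VX * lk (skl p q r VX) [y, z] + A x VY * lk (skl p q r VY) [y, z] + A x VZ * lk (skl p q r VZ) [y, z]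
      = B VX z * lk (skl p q r VX) [x, y] + B VY z * lk (skl p q r VY) [x, y] + B VZ z * lk (skl p q r VZ) [x, y]" for x y z
    using eq[of x y z] by (simp add: sum_var mult.commute add_ac)
  show "syz0 p q r (\<lambda>u. A u u) (\<lambda>u. B u u)"
    unfolding syz0_def
  proof (rule allI)
    fix v show "A v v * p v = B (nxt (nxt v)) (nxt (nxt v)) * p (nxt (nxt v)) \<and>
        A v v * q v = B (nxt v) (nxt v) * q (nxt v) \<and> A v v * r v = B v v * r v"
      using e[of v "nxt v" "nxt (nxt v)"] e[of v "nxt (nxt v)" "nxt v"] e[of v v v]
      by (cases v) (simp_all add: lookup_skl)
  qed
  show "syz1 p q r (\<lambda>u. A u (nxt (nxt u))) (\<lambda>u. B (nxt (nxt u)) u)"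
    unfolding syz1_def
  proof (rule allI)
    fix v show "A v (nxt (nxt v)) * p (nxt (nxt v)) = B (nxt (nxt (nxt v))) (nxt v) * r v \<and>
        A v (nxt (nxt v)) * q (nxt (nxt v)) = B (nxt (nxt v)) v * p (nxt (nxt v)) \<and>
        A v (nxt (nxt v)) * r (nxt (nxt v)) = B (nxt (nxt (nxt (nxt v)))) (nxt (nxt v)) * q (nxt v)"
      using e[of v v "nxt v"] e[of v "nxt v" v] e[of v "nxt (nxt v)" "nxt (nxt v)"]
      by (cases v) (simp_all add: lookup_skl)
  qed
  show "syz2 p q r (\<lambda>u. A u (nxt u)) (\<lambda>u. B (nxt u) u)"
    unfolding syz2_def
  proof (rule allI)
    fix v show "A v (nxt v) * p (nxt v) = B (nxt v) v * q (nxt v) \<and>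
        A v (nxt v) * q (nxt v) = B (nxt (nxt (nxt v))) (nxt (nxt v)) * r v \<and>
        A v (nxt v) * r (nxt v) = B (nxt (nxt v)) (nxt v) * p (nxt (nxt v))"
      using e[of v "nxt (nxt v)" v] e[of v v "nxt (nxt v)"] e[of v "nxt v" "nxt v"]
      by (cases v) (simp_all add: lookup_skl)
  qed
qed

text \<open>What the one-dimensional space of syzygies of degree three means for the three types.\<close>

definition rigid :: "(var \<Rightarrow> 'k::field) \<Rightarrow> (var \<Rightarrow> 'k) \<Rightarrow> (var \<Rightarrow> 'k) \<Rightarrow> bool"
  where "rigid p q r \<longleftrightarrow> (\<forall>v. p v \<noteq> 0 \<or> q v \<noteq> 0 \<or> r v \<noteq> 0) \<and>
    (\<exists>a b. (\<exists>v. a v \<noteq> 0) \<and> (syz0 p q r a b \<or> syz1 p q r a b \<or> syz2 p q r a b)) \<and>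
    (\<forall>a b a' b' u v. syz0 p q r a b \<longrightarrow> syz0 p q r a' b' \<longrightarrow> a u * a' v = a v * a' u) \<and>
    (\<forall>a b a' b'. syz0 p q r a b \<longrightarrow> syz1 p q r a' b' \<or> syz2 p q r a' b' \<longrightarrow> (\<forall>v. a v = 0) \<or> (\<forall>v. a' v = 0))"

lemma right_indep_sumD: "right_indep g \<Longrightarrow> (\<Sum>v\<in>UNIV. g v * s v) = 0 \<Longrightarrow> s v = 0"
  by (simp add: right_indep_def)

lemma rel_in_rel_part: "r v \<in> rel_part r 2"
  using rel_part_rel_mult[OF homog_one, of r v] by (simp add: numeral_2_eq_2)

text \<open>If one relation vanished, the other two would span the ideal in degree two, where
  dimension 3 is prescribed.\<close>

lemma growth_imp_nonzero:
  assumes "poly_growth (skl p q r) 2" shows "p v \<noteq> 0 \<or> q v \<noteq> 0 \<or> r v \<noteq> 0"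
proof (rule ccontr)
  assume "\<not> ?thesis"
  then have 0: "skl p q r v = 0" by (simp add: skl_def)
  have d: "fa.dim (rel_part (skl p q r) 2) = 3"
    using assms unfolding poly_growth_def by (simp add: numeral_2_eq_2)
  let ?B = "{skl p q r (nxt v), skl p q r (nxt (nxt v))}"
  have "range (skl p q r) \<subseteq> insert 0 ?B"
  proof
    fix f assume "f \<in> range (skl p q r)"
    then obtain u where f: "f = skl p q r u" by blast
    show "f \<in> insert 0 ?B" unfolding f using 0 by (cases u; cases v) auto
  qed
  then have "fa.span (range (skl p q r)) \<subseteq> fa.span ?B" using fa.span_mono fa.span_insert_0 by metis
  then have sub: "rel_part (skl p q r) 2 \<subseteq> fa.span ?B"
    using rel_part_2_span by (auto simp: numeral_2_eq_2)
  have "fa.fin_spanned (fa.span ?B)" unfolding fa.fin_spanned_def by (intro exI[of _ ?B]) simp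
  from fa.dim_le_fin_spanned[OF this sub] have "3 \<le> fa.dim ?B" using d by simp
  also have "\<dots> \<le> card ?B" by (rule fa.dim_le_card') simp
  also have "\<dots> \<le> 2" by (rule card_insert_le_m1) auto
  finally show False by simp
qed

text \<open>The dimensions 3 and 17 of the ideal in degrees two and three leave a one-dimensional
  space \<open>?W\<close> of syzygies, which contains those of all three types. Dependent syzygies
  of one type have proportional coefficients. For types that differ at every letter, the two
  relations attached to a letter are independent, so that one of the syzygies is zero.\<close>

lemma growth_imp_rigid:
  assumes g: "\<And>n. poly_growth (skl p q r) n" shows "rigid p q r"
proof -
  let ?f = "skl p q r"
  let ?W = "combos gen (rel_part ?f (Suc (Suc 0))) \<inter> combos ?f (homog (Suc 0))"
  note quad = skl_quadratic[of p q r]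
  have nz: "p v \<noteq> 0 \<or> q v \<noteq> 0 \<or> r v \<noteq> 0" for v by (rule growth_imp_nonzero[OF g])
  have ind: "right_indep ?f" by (rule skl_right_indep) (rule nz)
  have f0: "?f v \<noteq> 0" for v
  proof
    assume "?f v = 0"
    then have "lk (?f v) l = 0" for l by simp
    from this[of "[nxt v, nxt (nxt v)]"] this[of "[nxt (nxt v), nxt v]"] this[of "[v, v]"] nz[of v]
    show False by (cases v) (auto simp: lookup_skl)
  qed
  have d2: "fa.dim (rel_part ?f (Suc (Suc 0))) = 3"
    using g[of 2] unfolding poly_growth_def by (simp add: numeral_2_eq_2)
  have d3: "fa.dim (rel_part ?f (Suc (Suc (Suc 0)))) = 17"
    using g[of 3] unfolding poly_growth_def by (simp add: eval_nat_numeral)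
  have dW: "fa.dim ?W = 1" using dim_rel_part_Suc_Suc[OF quad ind, of "Suc 0"] d2 d3 by simp
  have sW: "fa.subspace ?W"
    by (intro fa.subspace_inter combos_subspace rel_part_subspace homog_subspace)
  have fW: "fa.fin_spanned ?W"
    using fa.fin_spanned_subset[OF combos_fin_spanned[OF homog_fin_spanned, of ?f "Suc 0"]] by blast
  have memW: "(\<Sum>u\<in>UNIV. gen u * (a u *\<^sub>s ?f (t u))) \<in> ?W" if "syzygy t ?f a b" for t a b
  proof
    show "(\<Sum>u\<in>UNIV. gen u * (a u *\<^sub>s ?f (t u))) \<in> combos gen (rel_part ?f (Suc (Suc 0)))"
      using rel_in_rel_part[of ?f] by (intro combosI rel_part_smul) (simp add: numeral_2_eq_2)
    show "(\<Sum>u\<in>UNIV. gen u * (a u *\<^sub>s ?f (t u))) \<in> combos ?f (homog (Suc 0))"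
      unfolding that[unfolded syzygy_def]
      by (intro fa.subspace_sum combos_subspace homog_subspace combos_single homog_smul homog_gen)
  qed
  have dep: "\<exists>c c'. (c \<noteq> 0 \<or> c' \<noteq> 0) \<and> (\<forall>u. (c * a u) *\<^sub>s ?f (t u) + (c' * a' u) *\<^sub>s ?f (t' u) = 0)"
    if s: "syzygy t ?f a b" and s': "syzygy t' ?f a' b'" for t a b t' a' b'
  proof -
    let ?w = "\<Sum>u\<in>UNIV. gen u * (a u *\<^sub>s ?f (t u))" and ?w' = "\<Sum>u\<in>UNIV. gen u * (a' u *\<^sub>s ?f (t' u))"
    have "\<exists>c c'. (c \<noteq> 0 \<or> c' \<noteq> 0) \<and> c *\<^sub>s ?w + c' *\<^sub>s ?w' = 0"
    proof (cases "?w = 0")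
      case True
      then show ?thesis by (intro exI[of _ 1] exI[of _ 0]) simp
    next
      case False
      have "fa.span {?w} = ?W"
      proof (rule fa.subspace_eq_of_dim_le[OF fW])
        show "fa.span {?w} \<subseteq> ?W" using memW[OF s] sW by (intro fa.span_minimal) auto
        have "fa.independent {?w}" using False by simp
        then show "fa.dim ?W \<le> fa.dim (fa.span {?w})" unfolding dW by (subst fa.dim_span_eq_card_independent) auto
      qed simp
      then obtain k where "?w' = k *\<^sub>s ?w" using memW[OF s'] by (auto simp only: fa.span_singleton)
      then show ?thesis by (intro exI[of _ "- k"] exI[of _ 1]) (simp only: fa.scale_minus_left fa.scale_one, simp)
    qed
    then obtain c c' where c: "c \<noteq> 0 \<or> c' \<noteq> 0" and 0: "c *\<^sub>s ?w + c' *\<^sub>s ?w' = 0" by (elim exE conjE) (rule that)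
    have "(\<Sum>u\<in>UNIV. gen u * ((c * a u) *\<^sub>s ?f (t u) + (c' * a' u) *\<^sub>s ?f (t' u))) = c *\<^sub>s ?w + c' *\<^sub>s ?w'"
      by (simp add: distrib_left sum_var fa.scale_right_distrib add_ac)
    then have "(c * a u) *\<^sub>s ?f (t u) + (c' * a' u) *\<^sub>s ?f (t' u) = 0" for u
      using right_indep_sumD[OF right_indep_gen, of "\<lambda>u. (c * a u) *\<^sub>s ?f (t u) + (c' * a' u) *\<^sub>s ?f (t' u)" u] 0
      by simp
    then show ?thesis using c by (intro exI[of _ c] exI[of _ c'] conjI allI)
  qed
  have same: "a u * a' v = a v * a' u" if s: "syzygy t ?f a b" "syzygy t ?f a' b'" for t a b a' b' u v
  proof -
    obtain c c' where c: "c \<noteq> 0 \<or> c' \<noteq> 0" and 0: "\<forall>u. (c * a u) *\<^sub>s ?f (t u) + (c' * a' u) *\<^sub>s ?f (t u) = 0"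
      using dep[OF s] by (elim exE conjE) (rule that)
    have 1: "c * a u + c' * a' u = 0" for u
    proof -
      have "(c * a u + c' * a' u) *\<^sub>s ?f (t u) = 0" using 0 by (simp add: fa.scale_left_distrib)
      then show ?thesis using f0 by simp
    qed
    have "c * (a u * a' v - a v * a' u) = (c * a u + c' * a' u) * a' v - (c * a v + c' * a' v) * a' u"
      by (simp add: algebra_simps)
    moreover have "c' * (a u * a' v - a v * a' u) = a u * (c * a v + c' * a' v) - a v * (c * a u + c' * a' u)"
      by (simp add: algebra_simps)
    ultimately show ?thesis using c unfolding 1 by auto
  qed
  have other: "(\<forall>v. a v = 0) \<or> (\<forall>v. a' v = 0)"
    if s: "syzygy t ?f a b" "syzygy t' ?f a' b'" and t: "\<And>u. t u \<noteq> t' u" for t t' a b a' b'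
  proof -
    obtain c c' where c: "c \<noteq> 0 \<or> c' \<noteq> 0" and 0: "\<forall>u. (c * a u) *\<^sub>s ?f (t u) + (c' * a' u) *\<^sub>s ?f (t' u) = 0"
      using dep[OF s] by (elim exE conjE) (rule that)
    have "c * a u = 0 \<and> c' * a' u = 0" for u
    proof -
      let ?s = "\<lambda>v. if v = t u then (c * a u) *\<^sub>s 1 else if v = t' u then (c' * a' u) *\<^sub>s 1 else 0"
      have "(\<Sum>v\<in>UNIV. ?f v * ?s v) = (c * a u) *\<^sub>s ?f (t u) + (c' * a' u) *\<^sub>s ?f (t' u)"
        using t[of u] by (cases "t u"; cases "t' u") (simp_all add: sum_var add_ac)
      then have "?s v = 0" for v using 0 right_indep_sumD[OF ind, of ?s v] by simp
      from this[of "t u"] this[of "t' u"] show ?thesis using t[of u] by simp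
    qed
    then show ?thesis using c by auto
  qed
  have "\<exists>w\<in>?W. w \<noteq> 0"
  proof (rule ccontr)
    assume "\<not> ?thesis"
    then have "?W \<subseteq> {0}" by blast
    from fa.dim_le_fin_spanned[OF _ this] have "fa.dim ?W \<le> fa.dim ({0} :: 'a free_alg set)"
      unfolding fa.fin_spanned_def by (metis finite.emptyI fa.span_empty order_refl)
    then show False using dW by (simp add: dim_0)
  qed
  then obtain w where w: "w \<in> ?W" "w \<noteq> 0" by blast
  obtain j where j: "\<forall>u. j u \<in> rel_part ?f (Suc (Suc 0))" "w = (\<Sum>u\<in>UNIV. gen u * j u)"
    using IntD1[OF w(1)] by (rule combosE)
  obtain h where h: "\<forall>v. h v \<in> homog (Suc 0)" "w = (\<Sum>v\<in>UNIV. ?f v * h v)"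
    using IntD2[OF w(1)] by (rule combosE)
  have "\<forall>u. \<exists>c. j u = (\<Sum>v\<in>UNIV. c v *\<^sub>s ?f v)"
    using j(1) rel_part_2_span span_range_iff by blast
  then obtain A where A: "\<And>u. j u = (\<Sum>v\<in>UNIV. A u v *\<^sub>s ?f v)" by metis
  define B where "B v u = lk (h v) [u]" for v u
  have hB: "h v = (\<Sum>u\<in>UNIV. B v u *\<^sub>s gen u)" for v unfolding B_def by (rule lin_expand) (use h in blast)
  have eq: "(\<Sum>v\<in>UNIV. A x v * lk (?f v) [y, z]) = (\<Sum>v\<in>UNIV. lk (?f v) [x, y] * B v z)" for x y z
  proof -
    have "lk w [x, y, z] = (\<Sum>v\<in>UNIV. A x v * lk (?f v) [y, z])"
      unfolding j(2) A by (cases x) (simp_all add: sum_var lookup_add lookup_smul lookup_gen_mult)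
    moreover have "lk w [x, y, z] = (\<Sum>v\<in>UNIV. lk (?f v) [x, y] * B v z)"
      unfolding h(2) hB by (cases z) (simp_all add: sum_var distrib_left lookup_add lookup_smul lookup_skl_gen mult.commute)
    ultimately show ?thesis by simp
  qed
  have "\<exists>u v. A u v \<noteq> 0"
  proof (rule ccontr)
    assume "\<not> ?thesis"
    then have "w = 0" unfolding j(2) A by simp
    then show False using w(2) by simp
  qed
  then obtain u v where uv: "A u v \<noteq> 0" by blast
  have "v = u \<or> v = nxt u \<or> v = nxt (nxt u)" by (cases u; cases v) simp_all
  then have ex: "\<exists>a b. (\<exists>v. a v \<noteq> 0) \<and> (syz0 p q r a b \<or> syz1 p q r a b \<or> syz2 p q r a b)"
  proof (elim disjE)
    assume "v = u"
    then have "\<exists>u. A u u \<noteq> 0" using uv by (intro exI[of _ u]) simp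
    then show ?thesis using syz_of_syzygies(1)[OF eq]
      by (intro exI[of _ "\<lambda>u. A u u"] exI[of _ "\<lambda>u. B u u"]) simp
  next
    assume "v = nxt u"
    then have "\<exists>u. A u (nxt u) \<noteq> 0" using uv by (intro exI[of _ u]) simp
    then show ?thesis using syz_of_syzygies(3)[OF eq]
      by (intro exI[of _ "\<lambda>u. A u (nxt u)"] exI[of _ "\<lambda>u. B (nxt u) u"]) simp
  next
    assume "v = nxt (nxt u)"
    then have "\<exists>u. A u (nxt (nxt u)) \<noteq> 0" using uv by (intro exI[of _ u]) simp
    then show ?thesis using syz_of_syzygies(2)[OF eq]
      by (intro exI[of _ "\<lambda>u. A u (nxt (nxt u))"] exI[of _ "\<lambda>u. B (nxt (nxt u)) u"]) simp
  qed
  have n1: "id u \<noteq> nxt u" and n2: "id u \<noteq> nxt (nxt u)" for u by (cases u; simp)+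
  have cross: "(\<forall>v. a v = 0) \<or> (\<forall>v. a' v = 0)"
    if "syz0 p q r a b" "syz1 p q r a' b' \<or> syz2 p q r a' b'" for a b a' b'
    using that(2)
  proof
    assume "syz1 p q r a' b'"
    from other[OF syzygy_of_syz(1)[OF that(1)] syzygy_of_syz(2)[OF this] n2] show ?thesis .
  next
    assume "syz2 p q r a' b'"
    from other[OF syzygy_of_syz(1)[OF that(1)] syzygy_of_syz(3)[OF this] n1] show ?thesis .
  qed
  show ?thesis
    unfolding rigid_def
    by (intro conjI allI impI nz ex same[OF syzygy_of_syz(1) syzygy_of_syz(1)] cross)
qed


subsection \<open>Relations supported on few words\<close>

text \<open>The transfer matrix of the directed graph \<open>P\<close> on the letters, applied to a
  triple of numbers so that concrete iterates can be computed by rewriting.\<close>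

definition step :: "(var \<Rightarrow> var \<Rightarrow> bool) \<Rightarrow> nat \<times> nat \<times> nat \<Rightarrow> nat \<times> nat \<times> nat"
  where "step P = (\<lambda>(x, y, z).
    ((if P VX VX then x else 0) + (if P VX VY then y else 0) + (if P VX VZ then z else 0),
     (if P VY VX then x else 0) + (if P VY VY then y else 0) + (if P VY VZ then z else 0),
     (if P VZ VX then x else 0) + (if P VZ VY then y else 0) + (if P VZ VZ then z else 0)))"

definition extensions :: "(var \<Rightarrow> var \<Rightarrow> bool) \<Rightarrow> nat \<Rightarrow> var \<Rightarrow> var list set"
  where "extensions P n a = {l. length l = n \<and> successively P (a # l)}"

lemma finite_words: "finite {l :: var list. length l = n \<and> Q l}"
proof -
  have "{l :: var list. length l = n \<and> Q l} \<subseteq> {l. set l \<subseteq> UNIV \<and> length l = n}" by blast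
  moreover have "finite (UNIV :: var set)" by (simp add: UNIV_var)
  ultimately show ?thesis using finite_lists_length_eq finite_subset by blast
qed

lemma words_Suc: "{l. length l = Suc n \<and> Q l} = (\<Union>b\<in>UNIV. (#) b ` {l. length l = n \<and> Q (b # l)})"
  by (auto simp: length_Suc_conv)

lemma card_words_Suc:
  "card {l :: var list. length l = Suc n \<and> Q l} = (\<Sum>b\<in>UNIV. card {l. length l = n \<and> Q (b # l)})"
proof -
  have "card {l :: var list. length l = Suc n \<and> Q l} = (\<Sum>b\<in>UNIV. card ((#) b ` {l. length l = n \<and> Q (b # l)}))"
    unfolding words_Suc by (rule card_UN_disjoint) (auto simp: UNIV_var finite_words)
  also have "\<dots> = (\<Sum>b\<in>UNIV. card {l. length l = n \<and> Q (b # l)})"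
    by (intro sum.cong refl card_image) simp
  finally show ?thesis .
qed

lemma card_words: "card {l :: var list. length l = n} = 3 ^ n"
proof (induction n)
  case (Suc n)
  then show ?case using card_words_Suc[of n "\<lambda>_. True"] by (simp add: UNIV_var)
qed simp

lemma extensions_Suc:
  "card (extensions P (Suc n) a) = (\<Sum>b\<in>UNIV. if P a b then card (extensions P n b) else 0)"
  unfolding extensions_def card_words_Suc by (intro sum.cong refl) auto

lemma card_extensions:
  "(card (extensions P n VX), card (extensions P n VY), card (extensions P n VZ)) = (step P ^^ n) (1, 1, 1)"
proof (induction n)
  case 0
  have "extensions P 0 a = {[]}" for a by (auto simp: extensions_def)
  then show ?case by simp
next
  case (Suc n)
  show ?case unfolding funpow.simps comp_def Suc[symmetric]
    by (simp add: step_def extensions_Suc sum_var)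
qed

text \<open>Only finitely many degrees are compatible with the growth, since the number of words
  avoiding all words of the relations grows exponentially.\<close>

lemma card_avoiding:
  assumes r: "quadratic r" and g: "poly_growth r (Suc n)"
    and supp: "\<And>v a b. P a b \<Longrightarrow> lk (r v) [a, b] = 0"
    and n: "(step P ^^ n) (1, 1, 1) = (x, y, z)"
  shows "x + y + z \<le> (n + 3) choose 2"
proof -
  let ?N = "{l. length l = Suc n \<and> successively P l}" and ?B = "{l. length l = Suc n \<and> \<not> successively P l}"
  have "rel_words r (Suc n) \<subseteq> fa.span (mon ` ?B)"
  proof
    fix f assume "f \<in> rel_words r (Suc n)"
    then obtain u v w where f: "f = mon u * r v * mon w" and len: "length u + 2 + length w = Suc n"
      unfolding rel_words_def by blast
    have rv: "r v = (\<Sum>a\<in>UNIV. \<Sum>b\<in>UNIV. lk (r v) [a, b] *\<^sub>s mon [a, b])"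
    proof -
      have h: "r v \<in> homog (Suc (Suc 0))" using quadraticD[OF r, of v] by (simp add: numeral_2_eq_2)
      have t: "tail a (r v) = (\<Sum>b\<in>UNIV. lk (r v) [a, b] *\<^sub>s gen b)" for a
        using lin_expand[OF homog_tail[OF h, of a]] by (simp add: lookup_tail)
      show ?thesis by (subst homog_expand[OF h]) (simp add: t gen_eq_mon sum_var distrib_left)
    qed
    have "f = (\<Sum>a\<in>UNIV. \<Sum>b\<in>UNIV. lk (r v) [a, b] *\<^sub>s mon (u @ [a, b] @ w))"
      unfolding f by (subst rv) (simp add: sum_distrib_left sum_distrib_right)
    also have "\<dots> \<in> fa.span (mon ` ?B)"
    proof (intro fa.span_sum)
      fix a b
      show "lk (r v) [a, b] *\<^sub>s mon (u @ [a, b] @ w) \<in> fa.span (mon ` ?B)"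
      proof (cases "P a b")
        case True
        then show ?thesis by (simp add: supp fa.span_zero)
      next
        case False
        then have "\<not> successively P (u @ [a, b] @ w)"
          by (cases w) (auto simp: successively_append_iff)
        then have "u @ [a, b] @ w \<in> ?B" using len by simp
        then show ?thesis by (intro fa.span_scale fa.span_base imageI)
      qed
    qed
    finally show "f \<in> fa.span (mon ` ?B)" .
  qed
  then have sub: "rel_part r (Suc n) \<subseteq> fa.span (mon ` ?B)"
    using rel_part_span_words fa.span_minimal[OF _ fa.subspace_span] by blast
  have fB: "finite ?B" "finite ?N" by (rule finite_words)+
  have "fa.dim (rel_part r (Suc n)) \<le> fa.dim (fa.span (mon ` ?B :: 'a free_alg set))"
    by (rule fa.dim_le_fin_spanned[OF _ sub])
       (unfold fa.fin_spanned_def, intro exI[of _ "mon ` ?B"] conjI finite_imageI fB order_refl)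
  also have "\<dots> \<le> card (mon ` ?B :: 'a free_alg set)"
    unfolding fa.dim_span by (rule fa.dim_le_card') (intro finite_imageI fB)
  also have "\<dots> \<le> card ?B" by (rule card_image_le[OF fB(1)])
  finally have d: "fa.dim (rel_part r (Suc n)) \<le> card ?B" .
  have "?N \<union> ?B = {l. length l = Suc n}" "?N \<inter> ?B = {}" by auto
  then have "card ?N + card ?B = 3 ^ Suc n" using card_Un_disjoint[OF fB(2,1)] card_words[of "Suc n"] by simp
  then have "card ?N \<le> (Suc n + 2) choose 2" using g d unfolding poly_growth_def by linarith
  moreover have "card ?N = x + y + z"
    using card_extensions[of P n] unfolding n card_words_Suc by (simp add: extensions_def sum_var)
  ultimately show ?thesis by (simp add: numeral_3_eq_3)
qed


subsection \<open>A first relation that is a square\<close>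

lemma not_distinct_adj_split: "\<not> distinct_adj l \<Longrightarrow> \<exists>u v w. l = u @ [v, v] @ w"
proof (induction l rule: induct_list012)
  case (3 a b l)
  show ?case
  proof (cases "a = b")
    case True
    then show ?thesis by (intro exI[of _ "[]"] exI[of _ a] exI[of _ l]) simp
  next
    case False
    then obtain u v w where "b # l = u @ [v, v] @ w" using 3 by auto
    then show ?thesis by (intro exI[of _ "a # u"] exI[of _ v] exI[of _ w]) simp
  qed
qed auto

text \<open>Modulo the relations \<open>xx\<close> is zero, and \<open>yy\<close> and
  \<open>zz\<close> become combinations of words with one \<open>x\<close> each. The number of
  letters other than \<open>x\<close> decreases, so the rewriting ends in words without equal
  neighbours.\<close>

lemma mon_reduce:
  assumes sq: "\<And>v. \<exists>c d. (v = VX \<longrightarrow> c = 0 \<and> d = 0) \<and>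
    mon [v, v] - c *\<^sub>s mon [nxt v, nxt (nxt v)] - d *\<^sub>s mon [nxt (nxt v), nxt v] \<in> fa.span (range r)"
    and len: "length l = n"
  shows "mon l \<in> ssum (rel_part r n) (fa.span {mon m | m. length m = n \<and> distinct_adj m})"
  using len
proof (induction "length (filter (\<lambda>v. v \<noteq> VX) l)" arbitrary: l rule: less_induct)
  case less
  let ?S = "ssum (rel_part r n) (fa.span {mon m | m. length m = n \<and> distinct_adj m})"
  have sS: "fa.subspace ?S" by (intro ssum_subspace rel_part_subspace fa.subspace_span)
  show ?case
  proof (cases "distinct_adj l")
    case True
    then have "0 + mon l \<in> ?S" using less.prems by (intro ssumI rel_part_zero fa.span_base) blast
    then show ?thesis by simp
  next
    case False
    from not_distinct_adj_split[OF this] obtain u w v where l: "l = u @ [v, v] @ w" by blast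
    obtain c d where cd: "v = VX \<longrightarrow> c = 0 \<and> d = 0" and
      in_span: "mon [v, v] - c *\<^sub>s mon [nxt v, nxt (nxt v)] - d *\<^sub>s mon [nxt (nxt v), nxt v] \<in> fa.span (range r)"
      (is "?e \<in> _") using sq[of v] by (elim exE conjE) (rule that)
    have len: "length u + 2 + length w = n" using less.prems l by simp
    have "?e * mon w \<in> rel_part r (Suc (Suc (length w)))"
      by (rule span_rels_mult[OF in_span]) (simp add: homog_mon)
    then have "mon u * (?e * mon w) \<in> rel_part r (length u + Suc (Suc (length w)))"
      by (rule rel_part_homog_left_mult) (simp add: homog_mon)
    then have "mon u * (?e * mon w) \<in> rel_part r n" using len by simp
    then have "mon u * (?e * mon w) + 0 \<in> ?S" by (intro ssumI fa.span_zero)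
    then have J: "mon u * (?e * mon w) \<in> ?S" unfolding add_0_right .
    have "c *\<^sub>s mon (u @ [nxt v, nxt (nxt v)] @ w) + d *\<^sub>s mon (u @ [nxt (nxt v), nxt v] @ w) \<in> ?S"
    proof (cases "v = VX")
      case True
      then show ?thesis using cd fa.subspace_0[OF sS] by simp
    next
      case False
      have "mon (u @ [nxt v, nxt (nxt v)] @ w) \<in> ?S"
      proof (rule less.hyps)
        show "length (filter (\<lambda>v. v \<noteq> VX) (u @ [nxt v, nxt (nxt v)] @ w)) < length (filter (\<lambda>v. v \<noteq> VX) l)"
          using False unfolding l by (cases v) simp_all
        show "length (u @ [nxt v, nxt (nxt v)] @ w) = n" using len by simp
      qed
      moreover have "mon (u @ [nxt (nxt v), nxt v] @ w) \<in> ?S"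
      proof (rule less.hyps)
        show "length (filter (\<lambda>v. v \<noteq> VX) (u @ [nxt (nxt v), nxt v] @ w)) < length (filter (\<lambda>v. v \<noteq> VX) l)"
          using False unfolding l by (cases v) simp_all
        show "length (u @ [nxt (nxt v), nxt v] @ w) = n" using len by simp
      qed
      ultimately show ?thesis by (intro fa.subspace_add[OF sS] fa.subspace_scale[OF sS])
    qed
    from fa.subspace_add[OF sS J this]
    show ?thesis unfolding l by (simp add: right_diff_distrib left_diff_distrib)
  qed
qed

text \<open>Three choices for the first letter and two for each of the following three.\<close>

lemma card_distinct_adj_4: "card {l :: var list. length l = 4 \<and> distinct_adj l} = 24"
proof -
  have "\<And>n a. card {l :: var list. length l = n \<and> distinct_adj (a # l)} = 2 ^ n"
  proof -
    fix n a show "card {l :: var list. length l = n \<and> distinct_adj (a # l)} = 2 ^ n"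
    proof (induction n arbitrary: a)
      case 0
      have "{l. length l = 0 \<and> distinct_adj (a # l)} = {[]}" by auto
      then show ?case by simp
    next
      case (Suc n)
      have "card {l. length l = Suc n \<and> distinct_adj (a # l)}
          = (\<Sum>b\<in>UNIV. card {l. length l = n \<and> a \<noteq> b \<and> distinct_adj (b # l)})"
        unfolding card_words_Suc by (intro sum.cong refl arg_cong[of _ _ card]) auto
      also have "\<dots> = (\<Sum>b\<in>UNIV. if a \<noteq> b then 2 ^ n else 0)"
        by (intro sum.cong refl) (simp add: Suc[simplified])
      also have "\<dots> = 2 ^ Suc n" by (cases a) (simp_all add: sum_var)
      finally show ?case .
    qed
  qed
  then show ?thesis using card_words_Suc[of 3 "distinct_adj"] by (simp add: UNIV_var)
qed

lemma independent_familyI: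
  fixes e :: "nat \<Rightarrow> 'k::field free_alg"
  assumes "\<And>c. (\<Sum>i<n. c i *\<^sub>s e i) = 0 \<Longrightarrow> \<forall>i<n. c i = 0"
  shows "n \<le> fa.dim (fa.span (e ` {..<n}))"
proof -
  have inj: "inj_on e {..<n}"
  proof (rule inj_onI, rule ccontr)
    fix i j assume ij: "i \<in> {..<n}" "j \<in> {..<n}" "e i = e j" "i \<noteq> j"
    have "(\<Sum>k<n. (if k = i then 1 else if k = j then -1 else 0) *\<^sub>s e k)
        = (\<Sum>k<n. (if k = i then e k else 0) + (if k = j then - e k else 0))"
      using ij by (intro sum.cong) auto
    also have "\<dots> = 0" using ij by (simp add: sum.distrib)
    finally show False using assms[of "\<lambda>k. if k = i then 1 else if k = j then -1 else 0"] ij by auto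
  qed
  have "fa.independent (e ` {..<n})"
  proof (rule fa.independent_if_scalars_zero)
    fix f x assume 0: "(\<Sum>x\<in>e ` {..<n}. f x *\<^sub>s x) = 0" and x: "x \<in> e ` {..<n}"
    have "(\<Sum>i<n. f (e i) *\<^sub>s e i) = 0" using 0 by (simp add: sum.reindex[OF inj])
    then show "f x = 0" using assms[of "\<lambda>i. f (e i)"] x by auto
  qed simp
  then have "fa.dim (fa.span (e ` {..<n})) = n"
    using fa.dim_span_eq_card_independent card_image[OF inj] by force
  then show ?thesis by simp
qed

text \<open>Overlapping the relations \<open>xx\<close>, \<open>yy + \<dots>\<close> and \<open>zz + \<dots>\<close> produces, if the determinant does not
  vanish, ten independent elements of degree four without repeated letters, one more than the growth
  permits.\<close>

lemma square_determinant:
  fixes p q s t :: "'k::field"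
  assumes g: "poly_growth (skl (vec 0 p s) (vec 0 q t) (vec 1 1 1)) 4"
    and pq: "p \<noteq> 0 \<or> q \<noteq> 0" and st: "s \<noteq> 0 \<or> t \<noteq> 0"
  shows "p * t = q * s"
proof (rule ccontr)
  assume D: "p * t \<noteq> q * s"
  let ?r = "skl (vec 0 p s) (vec 0 q t) (vec 1 1 1)"
  let ?J = "rel_part ?r 4" and ?A = "{mon l | l. length l = 4 \<and> distinct_adj l} :: 'k free_alg set"
  \<comment> \<open>The words \<open>xyyy\<close>, \<open>xzzz\<close>, \<open>yyyx\<close>,
    \<open>zzzx\<close>, \<open>yyyy\<close>, \<open>zyyy\<close>, \<open>yyyz\<close>,
    \<open>yzzz\<close>, \<open>zzzy\<close>, \<open>zzzz\<close> contain overlapping squares.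
    Reducing each of them in two ways and subtracting gives the entries of \<open>M\<close> in this
    order; \<open>M_eq\<close> displays the reductions.\<close>
  define M :: "'k free_alg list" where "M =
    [p *\<^sub>s mon [VX,VY,VZ,VX] + q *\<^sub>s mon [VX,VY,VX,VZ] - p *\<^sub>s mon [VX,VZ,VX,VY],
     s *\<^sub>s mon [VX,VZ,VX,VY] + t *\<^sub>s mon [VX,VZ,VY,VX] - t *\<^sub>s mon [VX,VY,VX,VZ],
     q *\<^sub>s mon [VY,VX,VZ,VX] - p *\<^sub>s mon [VZ,VX,VY,VX] - q *\<^sub>s mon [VX,VZ,VY,VX],
     s *\<^sub>s mon [VZ,VX,VY,VX] - s *\<^sub>s mon [VX,VY,VZ,VX] - t *\<^sub>s mon [VY,VX,VZ,VX],
     (p * p) *\<^sub>s mon [VZ,VX,VZ,VX] + (q * q) *\<^sub>s mon [VX,VZ,VX,VZ] + p *\<^sub>s mon [VY,VZ,VX,VY] + q *\<^sub>s mon [VY,VX,VZ,VY],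
     p *\<^sub>s mon [VZ,VY,VZ,VX] + q *\<^sub>s mon [VZ,VY,VX,VZ] + (p * s) *\<^sub>s mon [VX,VY,VX,VY] - q *\<^sub>s mon [VZ,VX,VZ,VY],
     p *\<^sub>s mon [VY,VZ,VX,VZ] - (q * t) *\<^sub>s mon [VY,VX,VY,VX] - p *\<^sub>s mon [VZ,VX,VY,VZ] - q *\<^sub>s mon [VX,VZ,VY,VZ],
     s *\<^sub>s mon [VY,VZ,VX,VY] + t *\<^sub>s mon [VY,VZ,VY,VX] - s *\<^sub>s mon [VY,VX,VY,VZ] + (t * q) *\<^sub>s mon [VX,VZ,VX,VZ],
     t *\<^sub>s mon [VZ,VY,VX,VY] - (s * p) *\<^sub>s mon [VZ,VX,VZ,VX] - s *\<^sub>s mon [VX,VY,VZ,VY] - t *\<^sub>s mon [VY,VX,VZ,VY],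
     (s * s) *\<^sub>s mon [VX,VY,VX,VY] + (t * t) *\<^sub>s mon [VY,VX,VY,VX] + s *\<^sub>s mon [VZ,VX,VY,VZ] + t *\<^sub>s mon [VZ,VY,VX,VZ]]"
  have "list_all (\<lambda>f. f \<in> fa.span ?A) M"
  proof -
    have b: "mon [a,b,c,d] \<in> fa.span ?A" if "a \<noteq> b" "b \<noteq> c" "c \<noteq> d" for a b c d
      using that by (intro fa.span_base CollectI exI[of _ "[a,b,c,d]"]) simp
    show ?thesis
      unfolding M_def list.pred_inject
      by (intro conjI TrueI fa.span_add fa.span_diff fa.span_scale b) simp_all
  qed
  then have eA: "M ! i \<in> fa.span ?A" if "i < 10" for i
    using that unfolding list_all_length by (simp add: M_def)
  define W where "W u v x = mon u * ?r v * mon x" for u v x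
  have W: "W u VX x = mon (u @ [VX, VX] @ x)"
    "W u VY x = p *\<^sub>s mon (u @ [VZ, VX] @ x) + q *\<^sub>s mon (u @ [VX, VZ] @ x) + mon (u @ [VY, VY] @ x)"
    "W u VZ x = s *\<^sub>s mon (u @ [VX, VY] @ x) + t *\<^sub>s mon (u @ [VY, VX] @ x) + mon (u @ [VZ, VZ] @ x)" for u x
    unfolding W_def skl_def by (simp_all add: distrib_left distrib_right)
  have M_eq: "M = [
      W [VX,VY] VY [] - W [VX] VY [VY] + q *\<^sub>s W [] VX [VZ,VY],
      W [VX,VZ] VZ [] - W [VX] VZ [VZ] + s *\<^sub>s W [] VX [VY,VZ],
      W [VY] VY [VX] - W [] VY [VY,VX] - p *\<^sub>s W [VY,VZ] VX [],
      W [VZ] VZ [VX] - W [] VZ [VZ,VX] - t *\<^sub>s W [VZ,VY] VX [],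
      p *\<^sub>s W [] VY [VZ,VX] + q *\<^sub>s W [] VY [VX,VZ] - W [VY,VY] VY [] + W [VY] VY [VY] - (p * q) *\<^sub>s W [VZ] VX [VZ] - (p * q) *\<^sub>s W [VX] VZ [VX] + (p * q * s) *\<^sub>s W [] VX [VY,VX] + (p * q * t) *\<^sub>s W [VX,VY] VX [],
      W [VZ,VY] VY [] - W [VZ] VY [VY] + p *\<^sub>s W [] VZ [VX,VY] - (p * t) *\<^sub>s W [VY] VX [VY],
      W [VY] VY [VZ] - W [] VY [VY,VZ] - q *\<^sub>s W [VY,VX] VZ [] + (q * s) *\<^sub>s W [VY] VX [VY],
      W [VY,VZ] VZ [] - W [VY] VZ [VZ] + t *\<^sub>s W [] VY [VX,VZ] - (t * p) *\<^sub>s W [VZ] VX [VZ],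
      W [VZ] VZ [VY] - W [] VZ [VZ,VY] - s *\<^sub>s W [VZ,VX] VY [] + (s * q) *\<^sub>s W [VZ] VX [VZ],
      s *\<^sub>s W [] VZ [VX,VY] + t *\<^sub>s W [] VZ [VY,VX] - W [VZ,VZ] VZ [] + W [VZ] VZ [VZ] - (s * t) *\<^sub>s W [VY] VX [VY] - (s * t) *\<^sub>s W [VX] VY [VX] + (s * t * p) *\<^sub>s W [VX,VZ] VX [] + (s * t * q) *\<^sub>s W [] VX [VZ,VX]]"
    unfolding M_def W
    by (simp add: algebra_simps fa.scale_right_distrib fa.scale_right_diff_distrib)
  have "list_all (\<lambda>f. f \<in> ?J) M"
  proof -
    have w: "W u v x \<in> ?J" if "length u + length x = 2" for u v x
    proof -
      have "W u v x \<in> rel_words ?r 4" unfolding rel_words_def W_def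
        by (intro CollectI exI[of _ u] exI[of _ v] exI[of _ x] conjI refl) (use that in linarith)
      then show ?thesis using rel_words_subset[OF skl_quadratic] by blast
    qed
    show ?thesis
      unfolding M_eq list.pred_inject
      by (intro conjI TrueI rel_part_add rel_part_diff rel_part_smul w) simp_all
  qed
  then have eJ: "M ! i \<in> ?J" if "i < 10" for i
    using that unfolding list_all_length by (simp add: M_def)
  have ind: "\<forall>i<10. c i = 0" if 0: "(\<Sum>i<10. c i *\<^sub>s (M ! i)) = 0" for c :: "nat \<Rightarrow> 'k"
  proof -
    have S: "(\<Sum>i<10. f i) = f 0 + f 1 + f 2 + f 3 + f 4 + f 5 + f 6 + f 7 + f 8 + f 9" for f :: "nat \<Rightarrow> 'k"
      by (simp add: eval_nat_numeral add_ac)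
    have "(\<Sum>i<10. c i * lk (M ! i) l) = 0" for l
      using arg_cong[OF 0, of "\<lambda>f. lk f l"] by (simp add: lookup_sum lookup_smul)
    note e = this[unfolded S M_def]
    note ss = lookup_add lookup_minus lookup_smul lookup_mon
    have g0: "p * c 0 = s * c 3" using e[of "[VX,VY,VZ,VX]"] by (simp add: ss mult.commute)
    have g1: "q * c 0 = t * c 1" using e[of "[VX,VY,VX,VZ]"] by (simp add: ss mult.commute)
    have g2: "p * c 0 = s * c 1" using e[of "[VX,VZ,VX,VY]"] by (simp add: ss mult.commute)
    have g3: "q * c 2 = t * c 3" using e[of "[VY,VX,VZ,VX]"] by (simp add: ss mult.commute)
    have g4: "p * c 2 = s * c 3" using e[of "[VZ,VX,VY,VX]"] by (simp add: ss mult.commute)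
    have g5: "t * c 1 = q * c 2" using e[of "[VX,VZ,VY,VX]"] by (simp add: ss mult.commute)
    have h: "c 7 * t = 0" "c 7 * s = 0" "c 8 * t = 0" "c 8 * s = 0"
      using e[of "[VY,VZ,VY,VX]"] e[of "[VY,VX,VY,VZ]"] e[of "[VZ,VY,VX,VY]"] e[of "[VX,VY,VZ,VY]"]
      by (simp_all add: ss)
    have c78: "c 7 = 0" "c 8 = 0" using h st by auto
    have "c 4 * (p * p) = 0" "c 4 * (q * q) = 0"
      using e[of "[VZ,VX,VZ,VX]"] e[of "[VX,VZ,VX,VZ]"] c78 by (simp_all add: ss)
    then have c4: "c 4 = 0" using pq by auto
    have "c 5 * p = 0" "c 5 * q = 0" "c 6 * p = 0" "c 6 * q = 0"
      using e[of "[VZ,VY,VZ,VX]"] e[of "[VZ,VX,VZ,VY]"] e[of "[VY,VZ,VX,VZ]"] e[of "[VX,VZ,VY,VZ]"]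
      by (simp_all add: ss)
    then have c56: "c 5 = 0" "c 6 = 0" using pq by auto
    have "c 9 * s = 0" "c 9 * t = 0"
      using e[of "[VZ,VX,VY,VZ]"] e[of "[VZ,VY,VX,VZ]"] c56 by (simp_all add: ss)
    then have c9: "c 9 = 0" using st by auto
    \<comment> \<open>The coefficients \<open>c 4\<close> to \<open>c 9\<close> have been killed by
      single words. The first four are tied together cyclically, and only the determinant breaks
      this cycle.\<close>
    have "(p * t - q * s) * c 0 = t * (p * c 0) - s * (q * c 0)" by (simp add: algebra_simps)
    also have "\<dots> = 0" unfolding g1 g2 by (simp add: algebra_simps)
    finally have c0: "c 0 = 0" using D by simp
    have c1: "c 1 = 0" using g1 g2 c0 st by auto
    have c2: "c 2 = 0" using g0 g4 g5 c0 c1 pq by auto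
    have c3: "c 3 = 0" using g0 g3 c0 c2 st by auto
    have "c i = 0" if "i < 10" for i
    proof -
      have "i \<in> {0, 1, 2, 3, 4, 5, 6, 7, 8, 9}" using that by auto
      then show ?thesis using c0 c1 c2 c3 c4 c56 c78 c9 by (elim insertE emptyE) simp_all
    qed
    then show ?thesis by blast
  qed
  have fA: "finite ?A"
  proof -
    have "?A = mon ` {l. length l = 4 \<and> distinct_adj l}" by blast
    then show ?thesis using finite_words[of 4 distinct_adj] by simp
  qed
  have cA: "card ?A \<le> 24"
  proof -
    have "?A = mon ` {l. length l = 4 \<and> distinct_adj l}" by blast
    then show ?thesis using card_image_le[OF finite_words[of 4 distinct_adj], of mon] card_distinct_adj_4 by simp
  qed
  have fsA: "fa.fin_spanned (fa.span ?A)" unfolding fa.fin_spanned_def using fA by (intro exI[of _ ?A]) simp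
  have fsJ: "fa.fin_spanned ?J" by (rule rel_part_fin_spanned[OF skl_quadratic])
  have "10 \<le> fa.dim (fa.span ((\<lambda>i. M ! i) ` {..<10}))" by (rule independent_familyI) (rule ind)
  also have "\<dots> \<le> fa.dim (?J \<inter> fa.span ?A)"
  proof (rule fa.dim_le_fin_spanned)
    show "fa.fin_spanned (?J \<inter> fa.span ?A)" using fa.fin_spanned_subset[OF fsJ] by blast
    show "fa.span ((\<lambda>i. M ! i) ` {..<10}) \<subseteq> ?J \<inter> fa.span ?A"
      by (intro fa.span_minimal fa.subspace_inter rel_part_subspace fa.subspace_span) (use eA eJ in auto)
  qed
  finally have 10: "10 \<le> fa.dim (?J \<inter> fa.span ?A)" .
  have "homog 4 \<subseteq> ssum ?J (fa.span ?A)"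
  proof
    fix f :: "'k free_alg" assume "f \<in> homog 4"
    then have "f \<in> fa.span {mon l | l. length l = 4}" by (rule mon_span)
    moreover have "fa.span {mon l | l. length l = 4} \<subseteq> ssum ?J (fa.span ?A)"
    proof (rule fa.span_minimal)
      have "\<exists>c d. (v = VX \<longrightarrow> c = 0 \<and> d = 0) \<and>
          mon [v, v] - c *\<^sub>s mon [nxt v, nxt (nxt v)] - d *\<^sub>s mon [nxt (nxt v), nxt v] \<in> fa.span (range ?r)" for v
      proof -
        have "mon [v, v] - (- vec 0 p s v) *\<^sub>s mon [nxt v, nxt (nxt v)] - (- vec 0 q t v) *\<^sub>s mon [nxt (nxt v), nxt v] = ?r v"
          by (cases v) (simp_all add: skl_def)
        then show ?thesis
          by (intro exI[of _ "- vec 0 p s v"] exI[of _ "- vec 0 q t v"]) (auto intro: fa.span_base)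
      qed
      from mon_reduce[OF this]
      show "{mon l | l. length l = 4} \<subseteq> ssum ?J (fa.span ?A)" by blast
    qed (intro ssum_subspace rel_part_subspace fa.subspace_span)
    ultimately show "f \<in> ssum ?J (fa.span ?A)" by blast
  qed
  \<comment> \<open>The words without repetitions span everything modulo the ideal, which would
    require \<open>81 \<le> 66 + 24 - 10\<close>.\<close>
  from fa.dim_le_fin_spanned[OF ssum_fin_spanned[OF fsJ fsA] this]
  have "81 \<le> fa.dim (ssum ?J (fa.span ?A))" by (simp add: dim_homog)
  moreover have "fa.dim (ssum ?J (fa.span ?A)) + fa.dim (?J \<inter> fa.span ?A) = fa.dim ?J + fa.dim (fa.span ?A)"
    by (rule dim_ssum[OF rel_part_subspace fa.subspace_span fsJ fsA])
  moreover have "fa.dim (fa.span ?A) \<le> 24"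
    using fa.dim_le_card'[OF fA] cA unfolding fa.dim_span by linarith
  moreover have "fa.dim ?J = 66" using g unfolding poly_growth_def by (simp add: eval_nat_numeral)
  ultimately show False using 10 by linarith
qed


section \<open>The classification\<close>

definition has_growth :: "(var \<Rightarrow> 'k::field) \<Rightarrow> (var \<Rightarrow> 'k) \<Rightarrow> (var \<Rightarrow> 'k) \<Rightarrow> bool"
  where "has_growth p q r \<longleftrightarrow> (\<forall>n. poly_growth (skl p q r) n)"

definition rels :: "(var \<Rightarrow> 'k::field) \<Rightarrow> (var \<Rightarrow> 'k) \<Rightarrow> (var \<Rightarrow> 'k) \<Rightarrow> 'k free_alg list"
  where "rels p q r = map (skl p q r) [VX, VY, VZ]"

definition turnable :: "(var \<Rightarrow> 'k::field) \<Rightarrow> (var \<Rightarrow> 'k) \<Rightarrow> (var \<Rightarrow> 'k) \<Rightarrow> bool"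
  where "turnable p q r \<longleftrightarrow> (\<exists>j\<in>{1..6}. \<exists>R'\<in>class_P j. turned_into (rels p q r) R')"

section \<open>Reduction to normal position by changes of variables\<close>

lemma subst_vars_comp:
  assumes "var_change \<sigma> \<tau> t" "var_change \<sigma>' \<tau>' s"
  shows "var_change.\<Phi> \<sigma>' s (var_change.\<Phi> \<sigma> t f) = var_change.\<Phi> (\<lambda>v. \<sigma>' (\<sigma> v)) (\<lambda>v. t v * s (\<sigma> v)) f"
proof -
  interpret A: var_change \<sigma> \<tau> t by fact
  interpret B: var_change \<sigma>' \<tau>' s by fact
  interpret C: var_change "\<lambda>v. \<sigma>' (\<sigma> v)" "\<lambda>v. \<tau> (\<tau>' v)" "\<lambda>v. t v * s (\<sigma> v)"
    by unfold_locales (simp_all add: A.inv B.inv A.s B.s)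
  have "scale_prod (\<lambda>v. t v * s (\<sigma> v)) (map (\<lambda>v. \<tau> (\<tau>' v)) m)
      = scale_prod s (map \<tau>' m) * scale_prod t (map (\<lambda>v. \<tau> (\<tau>' v)) m)" for m
    by (induction m) (simp_all add: scale_prod_def A.inv)
  then show ?thesis
    by (intro free_alg_eqI) (simp add: A.lookup_\<Phi> B.lookup_\<Phi> C.lookup_\<Phi> comp_def)
qed

lemma mset_map_perm:
  assumes "bij (\<pi> :: var \<Rightarrow> var)" shows "mset (map (\<lambda>v. g (\<pi> v)) [VX, VY, VZ]) = mset (map g [VX, VY, VZ])"
proof -
  have "distinct (map \<pi> [VX, VY, VZ])" using assms by (simp add: distinct_map bij_is_inj inj_eq)
  moreover have "set (map \<pi> [VX, VY, VZ]) = set [VX, VY, VZ]"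
    using bij_is_surj[OF assms] unfolding set_map by (simp add: UNIV_var)
  ultimately have "mset (map \<pi> [VX, VY, VZ]) = mset [VX, VY, VZ]"
    by (subst set_eq_iff_mset_eq_distinct[symmetric]) simp_all
  from arg_cong[OF this, of "image_mset g"] show ?thesis by simp
qed

text \<open>Growth is invariant, and a way of turning the new relations into a class is composed
  with the change of variables. The reductions below are instances: growth is passed forward to the
  normal position and \<open>turnable\<close> is passed back.\<close>

lemma transport:
  assumes vc: "var_change \<sigma> \<tau> t" and k: "\<And>v. k v \<noteq> 0"
    and eq: "\<And>v. k v *\<^sub>s var_change.\<Phi> \<sigma> t (skl p q r v) = skl p' q' r' (\<sigma> v)"
  shows "has_growth p q r \<longleftrightarrow> has_growth p' q' r'" "turnable p' q' r' \<Longrightarrow> turnable p q r"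
proof -
  interpret A: var_change \<sigma> \<tau> t by (rule vc)
  have "range (\<lambda>v. skl p' q' r' (\<sigma> v)) = range (skl p' q' r')"
  proof
    show "range (skl p' q' r') \<subseteq> range (\<lambda>v. skl p' q' r' (\<sigma> v))"
    proof
      fix f assume "f \<in> range (skl p' q' r')"
      then obtain v where "f = skl p' q' r' (\<sigma> (\<tau> v))" by (auto simp: A.inv)
      then show "f \<in> range (\<lambda>v. skl p' q' r' (\<sigma> v))" by blast
    qed
  qed blast
  moreover have "hilbert_series (range (skl p q r)) = hilbert_series (range (\<lambda>v. skl p' q' r' (\<sigma> v)))"
    by (rule var_change_invariant(1)[OF vc skl_quadratic k eq[symmetric]])
  ultimately show "has_growth p q r \<longleftrightarrow> has_growth p' q' r'"
    unfolding has_growth_def by (simp flip: hilbert_series_iff[OF skl_quadratic])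
  have bij: "bij \<sigma>" by (rule bij_betw_byWitness[of _ \<tau>]) (simp_all add: A.inv)
  assume "turnable p' q' r'"
  then obtain j R' where j: "j \<in> {1..6}" "R' \<in> class_P j" and ti: "turned_into (rels p' q' r') R'"
    unfolding turnable_def by blast
  obtain \<sigma>' s c where \<sigma>': "bij \<sigma>'" and s: "\<forall>v. s v \<noteq> 0" and c: "length c = length (rels p' q' r')" "0 \<notin> set c"
    and m: "mset (map2 (\<lambda>k f. scal k * subst_vars (\<lambda>v. scal (s v) * gen (\<sigma>' v)) f) c (rels p' q' r')) = mset R'"
    using ti unfolding turned_into_def by blast
  have vc': "var_change \<sigma>' (Hilbert_Choice.inv \<sigma>') s"
    using \<sigma>' s by unfold_locales (simp_all add: bij_is_inj bij_is_surj surj_f_inv_f)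
  obtain k1 k2 k3 where c_eq: "c = [k1, k2, k3]"
    using c(1) by (auto simp: length_Suc_conv eval_nat_numeral rels_def)
  define K where "K = vec k1 k2 k3"
  have K: "K v \<noteq> 0" for v using c(2) unfolding c_eq K_def by (cases v) auto
  have vc'': "var_change (\<lambda>v. \<sigma>' (\<sigma> v)) (\<lambda>v. \<tau> (Hilbert_Choice.inv \<sigma>' v)) (\<lambda>v. t v * s (\<sigma> v))"
    using vc vc' by (simp add: var_change_def)
  let ?g = "\<lambda>v. K v *\<^sub>s var_change.\<Phi> \<sigma>' s (skl p' q' r' v)"
  have g: "(K (\<sigma> v) * k v) *\<^sub>s var_change.\<Phi> (\<lambda>v. \<sigma>' (\<sigma> v)) (\<lambda>v. t v * s (\<sigma> v)) (skl p q r v) = ?g (\<sigma> v)" for v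
    unfolding subst_vars_comp[OF vc vc', symmetric] eq[symmetric] var_change.\<Phi>_smul[OF vc'] by simp
  have "turned_into (rels p q r) R'"
    unfolding turned_into_def
  proof (intro exI conjI)
    show "bij (\<lambda>v. \<sigma>' (\<sigma> v))" using bij_comp[OF bij \<sigma>'] by (simp add: comp_def)
    show "\<forall>v. t v * s (\<sigma> v) \<noteq> 0" using A.s s by simp
    show "length (map (\<lambda>v. K (\<sigma> v) * k v) [VX, VY, VZ]) = length (rels p q r)" by (simp add: rels_def)
    show "0 \<notin> set (map (\<lambda>v. K (\<sigma> v) * k v) [VX, VY, VZ])" using K k by simp
    have "mset (map2 (\<lambda>k f. scal k * subst_vars (\<lambda>v. scal (t v * s (\<sigma> v)) * gen (\<sigma>' (\<sigma> v))) f)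
        (map (\<lambda>v. K (\<sigma> v) * k v) [VX, VY, VZ]) (rels p q r)) = mset (map (\<lambda>v. ?g (\<sigma> v)) [VX, VY, VZ])"
      unfolding rels_def using g[unfolded var_change.\<Phi>_def[OF vc'']] by (simp add: scal_mult)
    also have "\<dots> = mset (map ?g [VX, VY, VZ])" by (rule mset_map_perm[OF bij])
    also have "\<dots> = mset R'"
      unfolding m[symmetric] c_eq rels_def K_def by (simp add: scal_mult var_change.\<Phi>_def[OF vc'])
    finally show "mset (map2 (\<lambda>k f. scal k * subst_vars (\<lambda>v. scal (t v * s (\<sigma> v)) * gen (\<sigma>' (\<sigma> v))) f)
        (map (\<lambda>v. K (\<sigma> v) * k v) [VX, VY, VZ]) (rels p q r)) = mset R'" .
  qed
  then show "turnable p q r" unfolding turnable_def using j by blast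
qed

lemma \<Phi>_skl:
  assumes "var_change \<sigma> \<tau> t"
  shows "var_change.\<Phi> \<sigma> t (skl p q r v) =
    (p v * (t (nxt v) * t (nxt (nxt v)))) *\<^sub>s mon [\<sigma> (nxt v), \<sigma> (nxt (nxt v))]
    + (q v * (t (nxt v) * t (nxt (nxt v)))) *\<^sub>s mon [\<sigma> (nxt (nxt v)), \<sigma> (nxt v)]
    + (r v * (t v * t v)) *\<^sub>s mon [\<sigma> v, \<sigma> v]"
proof -
  interpret A: var_change \<sigma> \<tau> t by fact
  show ?thesis by (simp add: skl_def A.\<Phi>_add A.\<Phi>_smul A.\<Phi>_mon scale_prod_def mult_ac)
qed

lemma nxt3 [simp]: "nxt (nxt (nxt v)) = v"
  by (cases v) simp_all

lemma rotate:
  "has_growth p q r \<Longrightarrow> has_growth (\<lambda>v. p (nxt v)) (\<lambda>v. q (nxt v)) (\<lambda>v. r (nxt v))"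
  "turnable (\<lambda>v. p (nxt v)) (\<lambda>v. q (nxt v)) (\<lambda>v. r (nxt v)) \<Longrightarrow> turnable p q r"
proof -
  have vc: "var_change (\<lambda>v. nxt (nxt v)) nxt (\<lambda>_. 1 :: 'a)" by unfold_locales simp_all
  have eq: "1 *\<^sub>s var_change.\<Phi> (\<lambda>v. nxt (nxt v)) (\<lambda>_. 1) (skl p q r v)
      = skl (\<lambda>v. p (nxt v)) (\<lambda>v. q (nxt v)) (\<lambda>v. r (nxt v)) (nxt (nxt v))" for v
    unfolding \<Phi>_skl[OF vc] by (simp add: skl_def)
  note tr = transport[OF vc _ eq, simplified]
  show "has_growth p q r \<Longrightarrow> has_growth (\<lambda>v. p (nxt v)) (\<lambda>v. q (nxt v)) (\<lambda>v. r (nxt v))" by (simp add: tr(1))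
  show "turnable (\<lambda>v. p (nxt v)) (\<lambda>v. q (nxt v)) (\<lambda>v. r (nxt v)) \<Longrightarrow> turnable p q r" by (rule tr(2))
qed

fun flp :: "var \<Rightarrow> var" where
  "flp VX = VX" | "flp VY = VZ" | "flp VZ = VY"

text \<open>Exchanging \<open>y\<close> and \<open>z\<close> reverses the cyclic order and therefore
  interchanges the roles of \<open>p\<close> and \<open>q\<close>.\<close>

lemma flip:
  "has_growth p q r \<Longrightarrow> has_growth (\<lambda>v. q (flp v)) (\<lambda>v. p (flp v)) (\<lambda>v. r (flp v))"
  "turnable (\<lambda>v. q (flp v)) (\<lambda>v. p (flp v)) (\<lambda>v. r (flp v)) \<Longrightarrow> turnable p q r"
proof -
  have f2: "flp (flp v) = v" for v by (cases v) simp_all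
  have vc: "var_change flp flp (\<lambda>_. 1 :: 'a)" by unfold_locales (simp_all add: f2)
  have eq: "1 *\<^sub>s var_change.\<Phi> flp (\<lambda>_. 1) (skl p q r v)
      = skl (\<lambda>v. q (flp v)) (\<lambda>v. p (flp v)) (\<lambda>v. r (flp v)) (flp v)" for v
    unfolding \<Phi>_skl[OF vc] by (cases v) (simp_all add: skl_def add_ac)
  note tr = transport[OF vc _ eq, simplified]
  show "has_growth p q r \<Longrightarrow> has_growth (\<lambda>v. q (flp v)) (\<lambda>v. p (flp v)) (\<lambda>v. r (flp v))" by (simp add: tr(1))
  show "turnable (\<lambda>v. q (flp v)) (\<lambda>v. p (flp v)) (\<lambda>v. r (flp v)) \<Longrightarrow> turnable p q r" by (rule tr(2))
qed

lemma rescale: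
  assumes s: "\<And>v. s v \<noteq> 0" and c: "\<And>v. c v \<noteq> 0"
    and p: "\<And>v. c v * p v * (s (nxt v) * s (nxt (nxt v))) = p' v"
    and q: "\<And>v. c v * q v * (s (nxt v) * s (nxt (nxt v))) = q' v"
    and r: "\<And>v. c v * r v * (s v * s v) = r' v"
  shows "has_growth p q r \<longleftrightarrow> has_growth p' q' r'" "turnable p' q' r' \<Longrightarrow> turnable p q r"
proof -
  have vc: "var_change (\<lambda>v. v) (\<lambda>v. v) s" by unfold_locales (simp_all add: s)
  have eq: "c v *\<^sub>s var_change.\<Phi> (\<lambda>v. v) s (skl p q r v) = skl p' q' r' v" for v
    unfolding \<Phi>_skl[OF vc] by (simp add: skl_def p[symmetric] q[symmetric] r[symmetric] fa.scale_right_distrib mult_ac)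
  show "has_growth p q r \<longleftrightarrow> has_growth p' q' r'" "turnable p' q' r' \<Longrightarrow> turnable p q r"
    using transport[OF vc c eq] by blast+
qed

lemma turnable_class:
  assumes "rels p q r \<in> class_P j" "j \<in> {1..6}" shows "turnable p q r"
proof -
  have vc: "var_change (\<lambda>v. v) (\<lambda>v. v) (\<lambda>_. 1 :: 'a)" by unfold_locales simp_all
  have "var_change.\<Phi> (\<lambda>v. v) (\<lambda>_. 1) (skl p q r v) = skl p q r v" for v
    unfolding \<Phi>_skl[OF vc] by (simp add: skl_def)
  then have "turned_into (rels p q r) (rels p q r)"
    unfolding turned_into_def
    by (intro exI[of _ "\<lambda>v. v"] exI[of _ "\<lambda>_. 1"] exI[of _ "[1, 1, 1]"])
       (simp add: rels_def scal_mult var_change.\<Phi>_def[OF vc] bij_id[unfolded id_def])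
  then show ?thesis using assms unfolding turnable_def by blast
qed

lemmas list_simps = rels_def skl_def scal_mult gen_eq_mon

section \<open>Normal forms of the six classes\<close>

lemma turnable_P1:
  assumes "(P * Q, P * R, Q * R) \<noteq> (0, 0, 0)" "(P ^ 3 - Q ^ 3, P ^ 3 - R ^ 3) \<noteq> (0, 0)"
  shows "turnable (\<lambda>_. P) (\<lambda>_. Q) (\<lambda>_. R)"
proof (rule turnable_class[of _ _ _ 1])
  have "rels (\<lambda>_. P) (\<lambda>_. Q) (\<lambda>_. R) =
     [scal P * gY * gZ + scal Q * gZ * gY + scal R * gX * gX,
      scal P * gZ * gX + scal Q * gX * gZ + scal R * gY * gY,
      scal P * gX * gY + scal Q * gY * gX + scal R * gZ * gZ]"
    by (simp add: list_simps)
  then show "rels (\<lambda>_. P) (\<lambda>_. Q) (\<lambda>_. R) \<in> class_P 1"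
    using assms unfolding class_P_def class_P1_def by auto
qed simp

lemma turnable_P2: "turnable (vec 1 b 1) (vec (- a) (- 1) (- c)) (vec 0 0 0)"
proof (rule turnable_class[of _ _ _ 2])
  have "rels (vec 1 b 1) (vec (- a) (- 1) (- c)) (vec 0 0 0) =
     [gY * gZ - scal a * gZ * gY, scal b * gZ * gX - gX * gZ, gX * gY - scal c * gY * gX]"
    by (simp add: list_simps)
  then show "rels (vec 1 b 1) (vec (- a) (- 1) (- c)) (vec 0 0 0) \<in> class_P 2"
    unfolding class_P_def class_P2_def by auto
qed simp

lemma turnable_P3: "turnable (vec 1 b 1) (vec (- a) (- 1) (- a)) (vec 0 1 0)"
proof (rule turnable_class[of _ _ _ 3])
  have "rels (vec 1 b 1) (vec (- a) (- 1) (- a)) (vec 0 1 0) =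
     [gY * gZ - scal a * gZ * gY, scal b * gZ * gX - gX * gZ + gY * gY, gX * gY - scal a * gY * gX]"
    by (simp add: list_simps)
  then show "rels (vec 1 b 1) (vec (- a) (- 1) (- a)) (vec 0 1 0) \<in> class_P 3"
    unfolding class_P_def class_P3_def by auto
qed simp

lemma turnable_P4:
  assumes "a \<noteq> 0" shows "turnable (vec 1 (1 / a) 1) (vec (- a) (- 1) (- a)) (vec 0 1 (- 1))"
proof (rule turnable_class[of _ _ _ 4])
  have "rels (vec 1 (1 / a) 1) (vec (- a) (- 1) (- a)) (vec 0 1 (- 1)) =
     [gY * gZ - scal a * gZ * gY, scal (1 / a) * gZ * gX - gX * gZ + gY * gY,
      gX * gY - scal a * gY * gX - gZ * gZ]"
    by (simp add: list_simps)
  then show "rels (vec 1 (1 / a) 1) (vec (- a) (- 1) (- a)) (vec 0 1 (- 1)) \<in> class_P 4"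
    using assms unfolding class_P_def class_P4_def by auto
qed simp

lemma turnable_P5:
  assumes "\<theta> ^ 9 = 1" "\<theta> ^ 3 \<noteq> 1"
  shows "turnable (\<lambda>_. 1) (vec \<theta> (\<theta> ^ 4) (\<theta> ^ 7)) (\<lambda>_. \<theta> ^ 2)"
proof (rule turnable_class[of _ _ _ 5])
  have "rels (\<lambda>_. 1) (vec \<theta> (\<theta> ^ 4) (\<theta> ^ 7)) (\<lambda>_. \<theta> ^ 2) =
     [gY * gZ + scal \<theta> * gZ * gY + scal (\<theta> ^ 2) * gX * gX,
      gZ * gX + scal (\<theta> ^ 4) * gX * gZ + scal (\<theta> ^ 2) * gY * gY,
      gX * gY + scal (\<theta> ^ 7) * gY * gX + scal (\<theta> ^ 2) * gZ * gZ]"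
    by (simp add: list_simps)
  then show "rels (\<lambda>_. 1) (vec \<theta> (\<theta> ^ 4) (\<theta> ^ 7)) (\<lambda>_. \<theta> ^ 2) \<in> class_P 5"
    using assms unfolding class_P_def class_P5_def by auto
qed simp

lemma turnable_P6:
  assumes "\<alpha> \<noteq> 0" shows "turnable (vec 0 \<alpha> 1) (vec 0 1 (1 / \<alpha>)) (\<lambda>_. 1)"
proof (rule turnable_class[of _ _ _ 6])
  have "rels (vec 0 \<alpha> 1) (vec 0 1 (1 / \<alpha>)) (\<lambda>_. 1) =
     [gX * gX, scal \<alpha> * gZ * gX + gX * gZ + gY * gY, gX * gY + scal (1 / \<alpha>) * gY * gX + gZ * gZ]"
    by (simp add: list_simps)
  then show "rels (vec 0 \<alpha> 1) (vec 0 1 (1 / \<alpha>)) (\<lambda>_. 1) \<in> class_P 6"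
    using assms unfolding class_P_def class_P6_def by auto
qed simp

lemma has_growth_rigid: "has_growth p q r \<Longrightarrow> rigid p q r"
  by (rule growth_imp_rigid) (simp add: has_growth_def)

lemma rigid_nonzero: "rigid p q r \<Longrightarrow> p v \<noteq> 0 \<or> q v \<noteq> 0 \<or> r v \<noteq> 0"
  unfolding rigid_def by blast

lemma rigid_same:
  assumes "rigid p q r" "syz0 p q r a b" "syz0 p q r a' b'" shows "a u * a' v = a v * a' u"
proof -
  from assms(1) have "\<forall>a b a' b' u v. syz0 p q r a b \<longrightarrow> syz0 p q r a' b' \<longrightarrow> a u * a' v = a v * a' u"
    unfolding rigid_def by (elim conjE)
  from this[rule_format, OF assms(2,3)] show ?thesis .
qed

lemma rigid_other:
  assumes "rigid p q r" "syz0 p q r a b" "syz1 p q r a' b' \<or> syz2 p q r a' b'" "a u \<noteq> 0"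
  shows "a' v = 0"
proof -
  from assms(1) have "\<forall>a b a' b'. syz0 p q r a b \<longrightarrow> syz1 p q r a' b' \<or> syz2 p q r a' b' \<longrightarrow>
      (\<forall>v. a v = 0) \<or> (\<forall>v. a' v = 0)"
    unfolding rigid_def by (elim conjE)
  from this[rule_format, OF assms(2,3)] assms(4) show ?thesis by blast
qed

lemma cube_root: "\<exists>y. y ^ 3 = (x :: 'k::alg_closed_field)"
  using nth_root_exists[of 3 x] by simp

lemma avoiding:
  assumes "has_growth p q r" "(step P ^^ n) (1, 1, 1) = (x, y, z)" "(n + 3) choose 2 < x + y + z"
    and "\<And>v a b. P a b \<Longrightarrow> lk (skl p q r v) [a, b] = 0"
  shows False
  using card_avoiding[OF skl_quadratic, of p q r n P x y z] assms unfolding has_growth_def by fastforce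


subsection \<open>A square among the relations\<close>

text \<open>The pairs of letters outside the relations form a graph in which a cycle of length two
  and one of length three share letters, so the number of words grows like powers of the real root
  of \<open>X^3 = X + 1\<close>. At length 15 there are 151 such words against the permitted
  136.\<close>

lemma square_no_growth:
  "\<not> has_growth (vec 0 0 0) (vec 0 q t) (vec 1 1 1)" "\<not> has_growth (vec 0 p s) (vec 0 0 0) (vec 1 1 1)"
proof -
  show "\<not> has_growth (vec 0 0 0) (vec 0 q t) (vec 1 1 1)"
  proof
    assume "has_growth (vec 0 0 0) (vec 0 q t) (vec 1 1 1)"
    moreover have "(step (\<lambda>a b. (a, b) \<in> {(VX, VY), (VY, VZ), (VZ, VX), (VZ, VY)}) ^^ 14) (1, 1, 1) = (37, 49, 65)"
      by (simp add: eval_nat_numeral step_def)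
    ultimately show False
    proof (rule avoiding)
      show "(14 + 3 choose 2) < (37 + 49 + 65 :: nat)" by (simp add: choose_two)
    qed (case_tac v; auto simp: lookup_skl)
  qed
  show "\<not> has_growth (vec 0 p s) (vec 0 0 0) (vec 1 1 1)"
  proof
    assume "has_growth (vec 0 p s) (vec 0 0 0) (vec 1 1 1)"
    moreover have "(step (\<lambda>a b. (a, b) \<in> {(VX, VZ), (VY, VX), (VY, VZ), (VZ, VY)}) ^^ 14) (1, 1, 1) = (37, 65, 49)"
      by (simp add: eval_nat_numeral step_def)
    ultimately show False
    proof (rule avoiding)
      show "(14 + 3 choose 2) < (37 + 65 + 49 :: nat)" by (simp add: choose_two)
    qed (case_tac v; auto simp: lookup_skl)
  qed
qed

lemma turnable_square_normal:
  fixes p q s t :: "'k::alg_closed_field"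
  assumes has_growth: "has_growth (vec 0 p s) (vec 0 q t) (vec 1 1 1)" and pq: "p \<noteq> 0 \<or> q \<noteq> 0" and st: "s \<noteq> 0 \<or> t \<noteq> 0"
  shows "turnable (vec 0 p s) (vec 0 q t) (vec 1 1 1)"
proof -
  have D: "p * t = q * s" by (rule square_determinant[OF _ pq st]) (use has_growth in \<open>simp add: has_growth_def\<close>)
  have "p \<noteq> 0"
  proof
    assume "p = 0"
    then have "s = 0" using D pq by simp
    then show False using has_growth square_no_growth(1) \<open>p = 0\<close> by blast
  qed
  have "q \<noteq> 0"
  proof
    assume "q = 0"
    then have "t = 0" using D pq by simp
    then show False using has_growth square_no_growth(2) \<open>q = 0\<close> by blast
  qed
  have "s \<noteq> 0" "t \<noteq> 0" using D st \<open>p \<noteq> 0\<close> \<open>q \<noteq> 0\<close> by auto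
  \<comment> \<open>With \<open>x\<close> left unscaled, normalising \<open>xz\<close> and
    \<open>yy\<close> in the second relation forces \<open>z = y\<^sup>2 / q\<close>, and
    normalising \<open>xy\<close> and \<open>zz\<close> in the third forces
    \<open>z\<^sup>2 = s * y\<close>. Eliminating \<open>z\<close> gives this cube. The coefficient
    of \<open>yx\<close> then comes out right by \<open>D\<close>.\<close>
  obtain y where y: "y ^ 3 = s * q ^ 2" using cube_root by blast
  have y0: "y \<noteq> 0" using y \<open>s \<noteq> 0\<close> \<open>q \<noteq> 0\<close> by auto
  have sq: "s * (q * q) = y * (y * y)" using y by (simp add: power2_eq_square power3_eq_cube mult.assoc)
  have "turnable (vec 0 (p / q) 1) (vec 0 1 (1 / (p / q))) (\<lambda>_. 1)"
    using \<open>p \<noteq> 0\<close> \<open>q \<noteq> 0\<close> by (intro turnable_P6) simp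
  then show ?thesis
  proof (rule rescale(2)[where s = "vec 1 y (y ^ 2 / q)" and c = "vec 1 (1 / y ^ 2) (q ^ 2 / y ^ 4)", rotated 5])
    fix v
    show "vec 1 y (y ^ 2 / q) v \<noteq> 0" "vec 1 (1 / y ^ 2) (q ^ 2 / y ^ 4) v \<noteq> 0"
      using y0 \<open>q \<noteq> 0\<close> by (cases v; simp)+
    show "vec 1 (1 / y ^ 2) (q ^ 2 / y ^ 4) v * vec 0 p s v * (vec 1 y (y ^ 2 / q) (nxt v) * vec 1 y (y ^ 2 / q) (nxt (nxt v)))
        = vec 0 (p / q) 1 v"
      using y0 \<open>q \<noteq> 0\<close> sq by (cases v) (simp_all add: field_simps eval_nat_numeral)
    show "vec 1 (1 / y ^ 2) (q ^ 2 / y ^ 4) v * vec 0 q t v * (vec 1 y (y ^ 2 / q) (nxt v) * vec 1 y (y ^ 2 / q) (nxt (nxt v)))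
        = vec 0 1 (1 / (p / q)) v"
    proof (cases v)
      case VZ
      have "p * (q ^ 2 / y ^ 4 * t * y) = (p * t) * q * q * y / y ^ 4" by (simp add: power2_eq_square)
      also have "\<dots> = (s * (q * q)) * y * q / y ^ 4" unfolding D by (simp add: mult_ac)
      also have "\<dots> = q" unfolding sq using y0 by (simp add: eval_nat_numeral)
      finally show ?thesis using VZ \<open>p \<noteq> 0\<close> by (simp add: field_simps)
    qed (use y0 \<open>q \<noteq> 0\<close> in \<open>simp_all add: field_simps eval_nat_numeral\<close>)
    show "vec 1 (1 / y ^ 2) (q ^ 2 / y ^ 4) v * vec 1 1 1 v * (vec 1 y (y ^ 2 / q) v * vec 1 y (y ^ 2 / q) v) = 1"
      using y0 \<open>q \<noteq> 0\<close> by (cases v) (simp_all add: field_simps eval_nat_numeral)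
  qed
qed

text \<open>Here \<open>xxx\<close> is a syzygy of weight 0, and by rigidity the only one up to a
  factor. A mere square as second or third relation would give another one, \<open>yyy\<close> or
  \<open>zzz\<close>; a missing square would give one of nonzero weight from overlaps with
  \<open>xx\<close>. So both relations contain their square and a mixed word.\<close>

lemma turnable_square_X:
  fixes p q r :: "var \<Rightarrow> 'k::alg_closed_field"
  assumes has_growth: "has_growth p q r" and 0: "p VX = 0" "q VX = 0"
  shows "turnable p q r"
proof -
  have R: "rigid p q r" by (rule has_growth_rigid[OF has_growth])
  have rX: "r VX \<noteq> 0" using rigid_nonzero[OF R, of VX] 0 by simp
  have e0: "syz0 p q r (vec 1 0 0) (vec 1 0 0)" using 0 by (simp add: syz0_def all_var)
  have Y: "p VY \<noteq> 0 \<or> q VY \<noteq> 0"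
  proof (rule ccontr)
    assume "\<not> ?thesis"
    then have "syz0 p q r (vec 0 1 0) (vec 0 1 0)" by (simp add: syz0_def all_var)
    from rigid_same[OF R e0 this, of VX VY] show False by simp
  qed
  have Z: "p VZ \<noteq> 0 \<or> q VZ \<noteq> 0"
  proof (rule ccontr)
    assume "\<not> ?thesis"
    then have "syz0 p q r (vec 0 0 1) (vec 0 0 1)" by (simp add: syz0_def all_var)
    from rigid_same[OF R e0 this, of VX VZ] show False by simp
  qed
  have rZ: "r VZ \<noteq> 0"
  proof
    assume "r VZ = 0"
    \<comment> \<open>\<open>p\<close> times the left multiple of the third relation by
      \<open>x\<close> and \<open>q\<close> times its right multiple share the term in
      \<open>xyx\<close>; the remaining terms in \<open>xxy\<close> and \<open>yxx\<close> are
      supplied by the relation \<open>xx\<close>.\<close>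
    then have "syz1 p q r (vec (p VZ) ((q VZ)\<^sup>2 / r VX) 0) (vec (q VZ) ((p VZ)\<^sup>2 / r VX) 0)"
      using 0 rX by (simp add: syz1_def all_var power2_eq_square)
    then have "vec (p VZ) ((q VZ)\<^sup>2 / r VX) 0 v = 0" for v
      by (rule rigid_other[OF R e0 disjI1, of _ _ VX]) simp_all
    from this[of VX] this[of VY] show False using Z rX by simp
  qed
  have rY: "r VY \<noteq> 0"
  proof
    assume "r VY = 0"
    then have "syz2 p q r (vec (q VY) 0 ((p VY)\<^sup>2 / r VX)) (vec (p VY) 0 ((q VY)\<^sup>2 / r VX))"
      using 0 rX by (simp add: syz2_def all_var power2_eq_square)
    then have "vec (q VY) 0 ((p VY)\<^sup>2 / r VX) v = 0" for v
      by (rule rigid_other[OF R e0 disjI2, of _ _ VX]) simp_all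
    from this[of VX] this[of VZ] show False using Y rX by simp
  qed
  let ?p = "vec 0 (p VY / r VY) (p VZ / r VZ)" and ?q = "vec 0 (q VY / r VY) (q VZ / r VZ)"
  have r: "r v \<noteq> 0" for v using rX rY rZ by (cases v) simp_all
  have eq: "1 / r v * p v * (1 * 1) = ?p v" "1 / r v * q v * (1 * 1) = ?q v" "1 / r v * r v * (1 * 1) = vec 1 1 1 v" for v
    using 0 r by (cases v; simp)+
  note sc = rescale[of "\<lambda>_. 1" "\<lambda>v. 1 / r v" p ?p q ?q r "vec 1 1 1", OF _ _ eq]
  have "has_growth ?p ?q (vec 1 1 1)" using sc(1) has_growth r by simp
  then have "turnable ?p ?q (vec 1 1 1)" by (rule turnable_square_normal) (use Y Z r in auto)
  then show ?thesis using sc(2) r by simp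
qed

lemma turnable_square:
  fixes p q r :: "var \<Rightarrow> 'k::alg_closed_field"
  assumes has_growth: "has_growth p q r" and 0: "p v = 0" "q v = 0"
  shows "turnable p q r"
proof (cases v)
  case VX
  then show ?thesis using turnable_square_X has_growth 0 by blast
next
  case VY
  show ?thesis by (rule rotate(2), rule turnable_square_X, rule rotate(1)[OF has_growth]) (use 0 VY in simp_all)
next
  case VZ
  show ?thesis
    by (rule rotate(2), rule rotate(2), rule turnable_square_X, rule rotate(1), rule rotate(1)[OF has_growth])
       (use 0 VZ in simp_all)
qed


subsection \<open>A syzygy of nonzero weight\<close>

lemma turnable_P5_form:
  fixes p q r :: "var \<Rightarrow> 'k::alg_closed_field"
  assumes \<theta>: "\<theta> ^ 9 = 1" "\<theta> ^ 3 \<noteq> 1" and nz: "\<And>v. p v \<noteq> 0" "\<And>v. r v \<noteq> 0"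
    and q: "q VX = \<theta> * p VX" "q VY = \<theta> ^ 4 * p VY" "q VZ = \<theta> ^ 7 * p VZ"
    and r: "r VX * r VY * r VZ = \<theta> ^ 6 * (p VX * p VY * p VZ)"
  shows "turnable p q r"
proof -
  obtain x where x: "x ^ 3 = p VX / r VX" using cube_root by blast
  obtain y where y: "y ^ 3 = p VY / r VY" using cube_root by blast
  have \<theta>0: "\<theta> \<noteq> 0" using \<theta> by auto
  have x0: "x \<noteq> 0" and y0: "y \<noteq> 0" using x y nz by auto
  \<comment> \<open>The normal form requires \<open>\<theta>\<^sup>2 * (x * y * z) = 1\<close>. This
    determines \<open>z\<close>, and the hypothesis on the product of the \<open>r\<close> makes its
    cube the right one.\<close>
  define z where "z = 1 / (\<theta> ^ 2 * x * y)"
  have z0: "z \<noteq> 0" using \<theta>0 x0 y0 by (simp add: z_def)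
  have xyz: "\<theta> ^ 2 * (x * y * z) = 1" using \<theta>0 x0 y0 by (simp add: z_def)
  have "z ^ 3 = 1 / (\<theta> ^ 6 * x ^ 3 * y ^ 3)" by (simp add: z_def power_divide power_mult_distrib flip: power_mult)
  also have "\<dots> = r VX * r VY / (\<theta> ^ 6 * (p VX * p VY))" unfolding x y by simp
  also have "\<dots> = p VZ / r VZ" using r nz \<theta>0 by (simp add: field_simps)
  finally have z: "z ^ 3 = p VZ / r VZ" .
  define s where "s = vec x y z"
  have s0: "s v \<noteq> 0" for v using x0 y0 z0 by (cases v) (simp_all add: s_def)
  have s3: "r v * (s v * s v * s v) = p v" for v
    using x y z nz by (cases v) (simp_all add: s_def power3_eq_cube mult.assoc)
  have s_prod: "\<theta> ^ 2 * (s v * s (nxt v) * s (nxt (nxt v))) = 1" for v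
    using xyz by (cases v) (simp_all add: s_def mult_ac)
  have main: "\<theta> ^ 2 / (r v * (s v * s v)) * p v * (s (nxt v) * s (nxt (nxt v))) = 1" for v
    unfolding s3[of v, symmetric] using s_prod[of v] s0[of v] nz(2)[of v] by (simp add: mult_ac)
  have q': "q v = vec \<theta> (\<theta> ^ 4) (\<theta> ^ 7) v * p v" for v using q by (cases v) simp_all
  show ?thesis
  proof (rule rescale(2)[where s = s and c = "\<lambda>v. \<theta> ^ 2 / (r v * (s v * s v))", OF s0 _ main _ _ turnable_P5[OF \<theta>]])
    fix v
    show "\<theta> ^ 2 / (r v * (s v * s v)) \<noteq> 0" using \<theta>0 nz s0 by simp
    have "\<theta> ^ 2 / (r v * (s v * s v)) * q v * (s (nxt v) * s (nxt (nxt v))) =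
        vec \<theta> (\<theta> ^ 4) (\<theta> ^ 7) v * (\<theta> ^ 2 / (r v * (s v * s v)) * p v * (s (nxt v) * s (nxt (nxt v))))"
      unfolding q' by (simp add: mult_ac)
    then show "\<theta> ^ 2 / (r v * (s v * s v)) * q v * (s (nxt v) * s (nxt (nxt v))) = vec \<theta> (\<theta> ^ 4) (\<theta> ^ 7) v"
      unfolding main by simp
    show "\<theta> ^ 2 / (r v * (s v * s v)) * r v * (s v * s v) = \<theta> ^ 2" using nz s0 by simp
  qed
qed

text \<open>Zeros propagate along the cyclic order: \<open>a v = b v = 0\<close> carries over to the
  preceding letter and then to all of them. With this excluded, a zero of \<open>r\<close>,
  \<open>a\<close>, \<open>b\<close> or \<open>p\<close> is refuted by following the equations
  around.\<close>

lemma syz1_nonzero: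
  assumes pq: "\<And>v. p v \<noteq> 0 \<or> q v \<noteq> 0" and e: "syz1 p q r a b" and ne: "a w \<noteq> (0 :: 'k::field)"
  shows "a v \<noteq> 0" "b v \<noteq> 0" "r v \<noteq> 0" "p v \<noteq> 0"
proof -
  have \<alpha>: "a v * p (nxt (nxt v)) = b (nxt v) * r v" for v using e unfolding syz1_def by blast
  have \<beta>: "a v * q (nxt (nxt v)) = b v * p (nxt (nxt v))" for v using e unfolding syz1_def by blast
  have \<gamma>: "a v * r (nxt (nxt v)) = b (nxt (nxt v)) * q (nxt v)" for v using e unfolding syz1_def by blast
  have pred: "a (nxt (nxt v)) = 0 \<and> b (nxt (nxt v)) = 0" if 0: "a v = 0" "b v = 0" for v
  proof -
    have "a (nxt (nxt v)) * p (nxt v) = 0" using \<alpha>[of "nxt (nxt v)"] 0 by simp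
    moreover have "a (nxt (nxt v)) * q (nxt v) = b (nxt (nxt v)) * p (nxt v)" using \<beta>[of "nxt (nxt v)"] by simp
    moreover have "b (nxt (nxt v)) * q (nxt v) = 0" using \<gamma>[of v] 0 by simp
    ultimately show ?thesis using pq[of "nxt v"] by auto
  qed
  have ab: "a v \<noteq> 0 \<or> b v \<noteq> 0" for v
  proof (rule ccontr)
    assume "\<not> ?thesis"
    then have 0: "a v = 0" "b v = 0" by auto
    have 1: "a (nxt (nxt v)) = 0" "b (nxt (nxt v)) = 0" using pred[OF 0] by auto
    have 2: "a (nxt v) = 0" using pred[OF 1] by simp
    have "w = v \<or> w = nxt v \<or> w = nxt (nxt v)" by (cases v; cases w) simp_all
    then show False using 0 1 2 ne by auto
  qed
  show r0: "r v \<noteq> 0" for v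
  proof
    assume 0: "r v = 0"
    have "a v * p (nxt (nxt v)) = 0" using \<alpha>[of v] 0 by simp
    moreover have "b v * q (nxt (nxt v)) = 0" using \<gamma>[of "nxt v"] 0 by simp
    ultimately show False using \<beta>[of v] ab[of v] pq[of "nxt (nxt v)"] by auto
  qed
  show a0: "a v \<noteq> 0" for v
  proof
    let ?u = "nxt v" and ?t = "nxt (nxt v)"
    assume 0: "a v = 0"
    have b: "b v \<noteq> 0" using ab[of v] 0 by simp
    have pt: "p ?t = 0" using \<beta>[of v] 0 b by simp
    have bu: "b ?u = 0" using \<alpha>[of v] 0 r0[of v] by simp
    have au: "a ?u \<noteq> 0" using ab[of ?u] bu by simp
    have qv: "q v = 0" using \<beta>[of ?u] bu au by simp
    have "b ?t \<noteq> 0" using \<alpha>[of ?u] au qv pq[of v] by auto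
    moreover have "b ?t * q ?u = 0" using \<gamma>[of v] 0 by simp
    ultimately show False using \<beta>[of ?t] pq[of ?u] by auto
  qed
  show b0: "b v \<noteq> 0" for v
  proof
    let ?u = "nxt v" and ?t = "nxt (nxt v)"
    assume 0: "b v = 0"
    have "q ?t = 0" using \<beta>[of v] 0 a0[of v] by simp
    then have "a ?u * r v = 0" using \<gamma>[of ?u] by simp
    then show False using a0 r0 by simp
  qed
  show "p v \<noteq> 0"
  proof
    assume "p v = 0"
    then have "b (nxt (nxt v)) * r (nxt v) = 0" using \<alpha>[of "nxt v"] by simp
    then show False using b0 r0 by simp
  qed
qed

text \<open>The ratios \<open>B v = b v / a v\<close> satisfy
  \<open>B v * B v * B (nxt v) = 1\<close>, so they are powers of one \<open>\<theta>\<close> with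
  \<open>\<theta>^9 = 1\<close>. If \<open>\<theta>^3 = 1\<close>, the ratios of \<open>q\<close> to
  \<open>p\<close> coincide and there is also a syzygy of weight 0, against rigidity. Exchanging
  \<open>y\<close> and \<open>z\<close> brings the exponents into the order 1, 4, 7.\<close>

lemma turnable_syz1:
  fixes p q r :: "var \<Rightarrow> 'k::alg_closed_field"
  assumes has_growth: "has_growth p q r" and pq: "\<And>v. p v \<noteq> 0 \<or> q v \<noteq> 0" and e: "syz1 p q r a b" and ne: "a w \<noteq> 0"
  shows "turnable p q r"
proof -
  note nz = syz1_nonzero[OF pq e ne]
  have \<alpha>: "a v * p (nxt (nxt v)) = b (nxt v) * r v" for v using e unfolding syz1_def by blast
  have \<beta>: "a v * q (nxt (nxt v)) = b v * p (nxt (nxt v))" for v using e unfolding syz1_def by blast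
  have \<gamma>: "a v * r (nxt (nxt v)) = b (nxt (nxt v)) * q (nxt v)" for v using e unfolding syz1_def by blast
  define B where "B v = b v / a v" for v
  have B0: "B v \<noteq> 0" for v using nz by (simp add: B_def)
  have q: "q (nxt (nxt v)) = B v * p (nxt (nxt v))" for v using \<beta>[of v] nz(1)[of v] by (simp add: B_def field_simps)
  have BB: "B v * B v * B (nxt v) = 1" for v
  proof -
    let ?t = "nxt (nxt v)"
    have "(a v * a v * a (nxt v)) * p ?t = a v * a (nxt v) * (b (nxt v) * r v)"
      unfolding \<alpha>[symmetric] by (simp add: mult_ac)
    also have "\<dots> = a v * b (nxt v) * (a (nxt v) * r v)" by (simp add: mult_ac)
    also have "\<dots> = b v * b (nxt v) * (a v * q ?t)" using \<gamma>[of "nxt v"] by (simp add: mult_ac)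
    also have "\<dots> = (b v * b v * b (nxt v)) * p ?t" unfolding \<beta> by (simp add: mult_ac)
    finally have "a v * a v * a (nxt v) = b v * b v * b (nxt v)" using nz(4) by simp
    then show ?thesis using nz(1,2) by (simp add: B_def)
  qed
  define \<theta> where "\<theta> = 1 / B VY"
  have \<theta>0: "\<theta> \<noteq> 0" using B0 by (simp add: \<theta>_def)
  have BY: "B VY = 1 / \<theta>" by (simp add: \<theta>_def)
  have BZ: "B VZ = \<theta> ^ 2" using BB[of VY] \<theta>0 unfolding BY by (simp add: power2_eq_square field_simps)
  have BX: "B VX = 1 / \<theta> ^ 4" using BB[of VZ] \<theta>0 unfolding BZ by (simp add: field_simps flip: power_add)
  have "\<theta> ^ 9 * (B VX * B VX * B VY) = 1" unfolding BX BY using \<theta>0 by (simp add: eval_nat_numeral)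
  then have \<theta>9: "\<theta> ^ 9 = 1" using BB[of VX] by simp
  have qX: "q VX = p VX / \<theta>" using q[of VY] by (simp add: BY)
  have qY: "q VY = \<theta> ^ 2 * p VY" using q[of VZ] by (simp add: BZ)
  have qZ: "q VZ = p VZ / \<theta> ^ 4" using q[of VX] by (simp add: BX)
  have \<theta>3: "\<theta> ^ 3 \<noteq> 1"
  proof
    assume 1: "\<theta> ^ 3 = 1"
    then have 2: "\<theta> ^ 4 = \<theta>" "\<theta> ^ 2 = 1 / \<theta>" using \<theta>0 by (simp_all add: eval_nat_numeral field_simps)
    have "q v = p v / \<theta>" for v using qX qY qZ unfolding 2 by (cases v) simp_all
    then have "syz0 p q r (\<lambda>v. 1 / p v) (\<lambda>v. 1 / p v)" using nz by (simp add: syz0_def)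
    from rigid_other[OF has_growth_rigid[OF has_growth] this _, of a b VX w] e show False using nz ne by simp
  qed
  show ?thesis
  proof (rule flip(2), rule turnable_P5_form[OF \<theta>9 \<theta>3])
    have q0: "q v \<noteq> 0" for v using qX qY qZ nz \<theta>0 by (cases v) simp_all
    show "q (flp v) \<noteq> 0" "r (flp v) \<noteq> 0" for v using q0 nz by simp_all
    show "p (flp VX) = \<theta> * q (flp VX)" using qX \<theta>0 by simp
    show "p (flp VY) = \<theta> ^ 4 * q (flp VY)" using qZ \<theta>0 by simp
    show "p (flp VZ) = \<theta> ^ 7 * q (flp VZ)"
    proof -
      have "\<theta> ^ 7 * q VY = \<theta> ^ 9 * p VY" unfolding qY by (simp flip: power_add mult.assoc)
      then show ?thesis unfolding \<theta>9 by simp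
    qed
    have Bprod: "B VX * B VY * B VZ * \<theta> ^ 3 = 1"
      unfolding BX BY BZ using \<theta>0 by (simp add: eval_nat_numeral)
    have rv: "r v * B (nxt v) * a (nxt v) = a v * p (nxt (nxt v))" for v using \<alpha>[of v] nz(1) by (simp add: B_def mult.commute)
    have "(r VX * r VY * r VZ) * (B VX * B VY * B VZ) * (a VX * a VY * a VZ) =
        (r VX * B VY * a VY) * (r VY * B VZ * a VZ) * (r VZ * B VX * a VX)" by (simp add: mult_ac)
    also have "\<dots> = (p VX * p VY * p VZ) * (a VX * a VY * a VZ)"
      using rv[of VX] rv[of VY] rv[of VZ] by (simp add: mult_ac)
    finally have "(r VX * r VY * r VZ) * (B VX * B VY * B VZ) = p VX * p VY * p VZ" using nz(1) by simp
    then have "\<theta> ^ 3 * (p VX * p VY * p VZ) = (r VX * r VY * r VZ) * (B VX * B VY * B VZ * \<theta> ^ 3)"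
      by (simp add: mult_ac)
    then have rp: "r VX * r VY * r VZ = \<theta> ^ 3 * (p VX * p VY * p VZ)" unfolding Bprod by simp
    have "\<theta> ^ 6 * (q VX * q VZ * q VY) = \<theta> ^ 3 * (p VX * p VY * p VZ)"
      unfolding qX qY qZ using \<theta>0 by (simp add: field_simps flip: power_add power_Suc power_Suc2)
    then show "r (flp VX) * r (flp VY) * r (flp VZ) = \<theta> ^ 6 * (q (flp VX) * q (flp VY) * q (flp VZ))"
      using rp by (simp add: mult_ac)
  qed
qed

lemma turnable_syz2:
  fixes p q r :: "var \<Rightarrow> 'k::alg_closed_field"
  assumes has_growth: "has_growth p q r" and pq: "\<And>v. p v \<noteq> 0 \<or> q v \<noteq> 0" and e: "syz2 p q r a b" and ne: "a w \<noteq> 0"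
  shows "turnable p q r"
proof -
  have "syz1 (\<lambda>v. q (flp v)) (\<lambda>v. p (flp v)) (\<lambda>v. r (flp v)) (\<lambda>v. a (flp v)) (\<lambda>v. b (flp v))"
    using e unfolding syz1_def syz2_def all_var by (simp add: eq_commute)
  moreover have "a (flp (flp w)) \<noteq> 0" using ne by (cases w) simp_all
  moreover have "q (flp v) \<noteq> 0 \<or> p (flp v) \<noteq> 0" for v using pq by blast
  ultimately show ?thesis using turnable_syz1[OF flip(1)[OF has_growth]] flip(2) by blast
qed


subsection \<open>A syzygy of weight zero\<close>

lemma turnable_P2_form:
  fixes p q r :: "var \<Rightarrow> 'k::field"
  assumes r: "\<And>v. r v = 0" and nz: "p VX \<noteq> 0" "p VZ \<noteq> 0" "q VY \<noteq> 0"
  shows "turnable p q r"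
proof (rule rescale(2)[OF _ _ _ _ _ turnable_P2])
  let ?c = "vec (1 / p VX) (- 1 / q VY) (1 / p VZ)"
  fix v
  show "(1 :: 'k) \<noteq> 0" by simp
  show "?c v \<noteq> 0" using nz by (cases v) simp_all
  show "?c v * p v * (1 * 1) = vec 1 (- p VY / q VY) 1 v" using nz by (cases v) simp_all
  show "?c v * q v * (1 * 1) = vec (- (- q VX / p VX)) (- 1) (- (- q VZ / p VZ)) v" using nz by (cases v) simp_all
  show "?c v * r v * (1 * 1) = vec 0 0 0 v" by (cases v) (simp_all add: r)
qed

lemma turnable_P3_form:
  fixes p q r :: "var \<Rightarrow> 'k::field"
  assumes r: "r VX = 0" "r VZ = 0" "r VY \<noteq> 0" and nz: "p VX \<noteq> 0" "p VZ \<noteq> 0" "q VY \<noteq> 0"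
    and eq: "p VX * q VZ = p VZ * q VX"
  shows "turnable p q r"
proof (rule rescale(2)[OF _ _ _ _ _ turnable_P3])
  \<comment> \<open>Once the coefficient of \<open>yy\<close> is normalised to 1, this scaling of
    \<open>z\<close> turns the coefficient of \<open>xz\<close> into \<open>- 1\<close>.\<close>
  let ?z = "- r VY / q VY"
  let ?s = "vec 1 1 ?z" and ?c = "vec (1 / (p VX * ?z)) (1 / r VY) (1 / p VZ)"
  fix v
  show "?s v \<noteq> 0" using r nz by (cases v) simp_all
  show "?c v \<noteq> 0" using r nz by (cases v) simp_all
  show "?c v * p v * (?s (nxt v) * ?s (nxt (nxt v))) = vec 1 (- p VY / q VY) 1 v"
    using r nz by (cases v) simp_all
  show "?c v * q v * (?s (nxt v) * ?s (nxt (nxt v))) = vec (- (- q VX / p VX)) (- 1) (- (- q VX / p VX)) v"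
    using r nz eq by (cases v) (simp_all add: field_simps)
  show "?c v * r v * (?s v * ?s v) = vec 0 1 0 v" using r by (cases v) simp_all
qed

lemma turnable_P4_form:
  fixes p q r :: "var \<Rightarrow> 'k::alg_closed_field"
  assumes r: "r VX = 0" "r VY \<noteq> 0" "r VZ \<noteq> 0" and p: "\<And>v. p v \<noteq> 0" and q: "\<And>v. q v = - a * p v" and a: "a \<noteq> 0"
  shows "turnable p q r"
proof (rule rescale(2)[OF _ _ _ _ _ turnable_P4[OF a]])
  \<comment> \<open>The coefficients of \<open>zx\<close> and \<open>xy\<close> require
    \<open>a p_Y z = r_Y y\<^sup>2\<close> and \<open>- p_Z y = r_Z z\<^sup>2\<close>; eliminating
    \<open>z\<close> prescribes the cube of \<open>y\<close>.\<close>
  define y where "y = (SOME y. y ^ 3 = - p VZ * a\<^sup>2 * (p VY)\<^sup>2 / (r VZ * (r VY)\<^sup>2))"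
  have y3: "y ^ 3 = - p VZ * a\<^sup>2 * (p VY)\<^sup>2 / (r VZ * (r VY)\<^sup>2)"
    unfolding y_def by (rule someI_ex[OF cube_root])
  have y0: "y \<noteq> 0" using y3 p r a by auto
  have y: "- p VZ * y * (a\<^sup>2 * (p VY)\<^sup>2) = r VZ * (r VY)\<^sup>2 * y ^ 4"
  proof -
    have "r VZ * (r VY)\<^sup>2 * y ^ 4 = r VZ * (r VY)\<^sup>2 * y ^ 3 * y" by (simp add: eval_nat_numeral)
    then show ?thesis unfolding y3 using r by simp
  qed
  define z where "z = r VY * y\<^sup>2 / (a * p VY)"
  have z0: "z \<noteq> 0" using y0 r p a by (simp add: z_def)
  have az: "a * p VY * z = r VY * y\<^sup>2" using p a by (simp add: z_def)
  have "(- p VZ * y) * (a * p VY)\<^sup>2 = r VZ * (a * p VY * z)\<^sup>2"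
    unfolding az using y by (simp add: power_mult_distrib mult_ac)
  then have "(- p VZ * y) * (a * p VY)\<^sup>2 = (r VZ * z\<^sup>2) * (a * p VY)\<^sup>2"
    by (simp only: power_mult_distrib mult_ac)
  then have zz: "- p VZ * y = r VZ * z\<^sup>2" using a p by (subst (asm) mult_right_cancel) simp_all
  let ?s = "vec 1 y z" and ?c = "vec (1 / (p VX * y * z)) (1 / (r VY * y\<^sup>2)) (- 1 / (r VZ * z\<^sup>2))"
  fix v
  show "?s v \<noteq> 0" using y0 z0 by (cases v) simp_all
  show "?c v \<noteq> 0" using y0 z0 p r by (cases v) simp_all
  show pp: "?c v * p v * (?s (nxt v) * ?s (nxt (nxt v))) = vec 1 (1 / a) 1 v" for v
  proof (cases v)
    case VX then show ?thesis using y0 z0 p by simp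
  next
    case VY then show ?thesis using az[symmetric] y0 z0 p r a by simp
  next
    case VZ then show ?thesis using zz[symmetric] y0 z0 p r a by simp
  qed
  have "?c v * q v * (?s (nxt v) * ?s (nxt (nxt v))) = - a * (?c v * p v * (?s (nxt v) * ?s (nxt (nxt v))))"
    unfolding q by (simp add: mult_ac)
  then show "?c v * q v * (?s (nxt v) * ?s (nxt (nxt v))) = vec (- a) (- 1) (- a) v"
    unfolding pp using a by (cases v) simp_all
  show "?c v * r v * (?s v * ?s v) = vec 0 1 (- 1) v"
    using y0 z0 r by (cases v) (simp_all add: power2_eq_square)
qed

text \<open>Cube roots make the three squares occur with the same coefficient, after which the
  relations have constant coefficients \<open>P\<close>, \<open>Q\<close> and \<open>1 / k\<close>.
  If the cubes of these agreed, a cube root of unity would give a syzygy of nonzero weight besides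
  the evident cyclic one.\<close>

lemma turnable_P1_form:
  fixes p q r :: "var \<Rightarrow> 'k::alg_closed_field"
  assumes has_growth: "has_growth p q r" and r: "\<And>v. r v \<noteq> 0" and a: "\<And>v. a v \<noteq> 0"
    and P: "\<And>v. a v * p v = P" and Q: "\<And>v. a v * q v = Q" and PQ: "P \<noteq> 0 \<or> Q \<noteq> 0"
  shows "turnable p q r"
proof -
  have "\<forall>v. \<exists>y. y ^ 3 = 1 / (a v * r v)" using cube_root by blast
  then obtain s where s: "s v ^ 3 = 1 / (a v * r v)" for v by metis
  have s0: "s v \<noteq> 0" for v
  proof
    assume "s v = 0"
    then show False using s[of v] a r by simp
  qed
  define k where "k = s VX * s VY * s VZ"
  have k0: "k \<noteq> 0" using s0 by (simp add: k_def)
  have k: "s v * (s (nxt v) * s (nxt (nxt v))) = k" for v by (cases v) (simp_all add: k_def mult_ac)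
  have x: "a v * s v / k * x * (s (nxt v) * s (nxt (nxt v))) = a v * x" for v x
  proof -
    have "a v * s v / k * x * (s (nxt v) * s (nxt (nxt v))) = a v * x * (s v * (s (nxt v) * s (nxt (nxt v)))) / k"
      by (simp add: mult_ac)
    then show ?thesis unfolding k using k0 by simp
  qed
  have y: "a v * s v / k * r v * (s v * s v) = 1 / k" for v
  proof -
    have "a v * s v / k * r v * (s v * s v) = (a v * r v) * s v ^ 3 / k" by (simp add: power3_eq_cube mult_ac)
    then show ?thesis unfolding s using a r by simp
  qed
  have c: "a v * s v / k \<noteq> 0" for v using a s0 k0 by simp
  note sc = rescale[where s = s and c = "\<lambda>v. a v * s v / k" and p' = "\<lambda>_. P" and q' = "\<lambda>_. Q" and r' = "\<lambda>_. 1 / k",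
      OF s0 c _ _ y, unfolded x, OF P Q]
  have rig: "rigid (\<lambda>_. P) (\<lambda>_. Q) (\<lambda>_. 1 / k)" using sc(1) has_growth by (intro has_growth_rigid) simp
  show ?thesis
  proof (rule sc(2), rule turnable_P1)
    show "(P * Q, P * (1 / k), Q * (1 / k)) \<noteq> (0, 0, 0)" using PQ k0 by auto
    show "(P ^ 3 - Q ^ 3, P ^ 3 - (1 / k) ^ 3) \<noteq> (0, 0)"
    proof
      assume "(P ^ 3 - Q ^ 3, P ^ 3 - (1 / k) ^ 3) = (0, 0)"
      then have e: "P ^ 3 = Q ^ 3" "P ^ 3 = (1 / k) ^ 3"
        unfolding prod.inject right_minus_eq by (rule conjunct1, rule conjunct2)
      have P0: "P \<noteq> 0" using e(2) k0 by auto
      have Q0: "Q \<noteq> 0" using e(1) P0 by auto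
      define R where "R = 1 / k"
      have R0: "R \<noteq> 0" using k0 by (simp add: R_def)
      have e2: "P * P * P = Q * Q * Q" "P * P * P = R * R * R"
        using e unfolding R_def[symmetric] by (simp_all add: power3_eq_cube)
      \<comment> \<open>With \<open>P^3 = Q^3 = R^3\<close> this is a cube root of unity.\<close>
      define m where "m = P\<^sup>2 / (Q * R)"
      have m: "m * (Q * R) = P * P" using Q0 R0 by (simp add: m_def power2_eq_square)
      have "m ^ 3 = (P * P * P) * (P * P * P) / ((Q * Q * Q) * (R * R * R))"
        by (simp add: m_def power3_eq_cube power2_eq_square mult_ac)
      then have m3: "m * m * m = 1" using P0 unfolding e2[symmetric] by (simp add: power3_eq_cube)
      have mm: "m * m * (Q * Q) = P * R"
      proof -
        have "(m * m * (Q * Q)) * (R * R) = (m * (Q * R)) * (m * (Q * R))" by (simp add: mult_ac)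
        also have "\<dots> = P * (P * P * P)" unfolding m by (simp add: mult_ac)
        also have "\<dots> = (P * R) * (R * R)" unfolding e2(2) by (simp add: mult_ac)
        finally show ?thesis using R0 by simp
      qed
      have m1: "P * (R * m) = Q * Q"
      proof -
        have "P * (R * m) * Q = P * (m * (Q * R))" by (simp add: mult_ac)
        also have "\<dots> = Q * Q * Q" unfolding m e2(1)[symmetric] by (simp add: mult_ac)
        finally show ?thesis using Q0 by simp
      qed
      have m2: "P * (P * (m * m)) = Q * R"
      proof -
        have "P * (P * (m * m)) = (m * m * m) * (Q * R)" using m by (simp add: mult_ac)
        then show ?thesis unfolding m3 by simp
      qed
      have s1: "syz1 (\<lambda>_. P) (\<lambda>_. Q) (\<lambda>_. R) (vec 1 m (m * m)) (vec (Q / P) (m * Q / P) (m * m * Q / P))"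
        using P0 m mm m3 m1 m2 unfolding syz1_def all_var
        by (simp add: field_simps)
      have s0: "syz0 (\<lambda>_. P) (\<lambda>_. Q) (\<lambda>_. R) (\<lambda>_. 1) (\<lambda>_. 1)" by (simp add: syz0_def)
      have "vec 1 m (m * m) VX = 0"
        by (rule rigid_other[OF rig[folded R_def] s0 disjI1[OF s1]]) simp
      then show False by simp
    qed
  qed
qed

text \<open>A loop at \<open>x\<close> and a cycle of length three through \<open>x\<close> consist
  of admissible pairs, so the number of words grows like powers of the real root of
  \<open>X^3 = X^2 + 1\<close>. At length 9 there are 60 words against the permitted 55.\<close>

lemma few_words_no_growth:
  fixes p q r :: "var \<Rightarrow> 'k::field"
  assumes r: "r VX = 0"
  shows "(\<And>v. p v = 0) \<Longrightarrow> \<not> has_growth p q r" "(\<And>v. q v = 0) \<Longrightarrow> \<not> has_growth p q r"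
proof -
  show "\<not> has_growth p q r" if 0: "\<And>v. p v = 0"
  proof
    assume "has_growth p q r"
    moreover have "(step (\<lambda>a b. (a, b) \<in> {(VX, VX), (VX, VY), (VY, VZ), (VZ, VX)}) ^^ 8) (1, 1, 1) = (28, 13, 19)"
      by (simp add: eval_nat_numeral step_def)
    ultimately show False
    proof (rule avoiding)
      show "(8 + 3 choose 2) < (28 + 13 + 19 :: nat)" by (simp add: choose_two)
    qed (case_tac v; auto simp: lookup_skl 0 r)
  qed
  show "\<not> has_growth p q r" if 0: "\<And>v. q v = 0"
  proof
    assume "has_growth p q r"
    moreover have "(step (\<lambda>a b. (a, b) \<in> {(VX, VX), (VX, VZ), (VY, VX), (VZ, VY)}) ^^ 8) (1, 1, 1) = (28, 19, 13)"
      by (simp add: eval_nat_numeral step_def)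
    ultimately show False
    proof (rule avoiding)
      show "(8 + 3 choose 2) < (28 + 19 + 13 :: nat)" by (simp add: choose_two)
    qed (case_tac v; auto simp: lookup_skl 0 r)
  qed
qed

lemma syz0D:
  assumes "syz0 p q r a b"
  shows "a v * p v = b (nxt (nxt v)) * p (nxt (nxt v))" "a v * q v = b (nxt v) * q (nxt v)"
    "r v \<noteq> 0 \<Longrightarrow> a v = b v"
  using assms unfolding syz0_def by auto

text \<open>If all \<open>p\<close> or all \<open>q\<close> vanish, the monomial relations admit two
  independent syzygies of weight 0. Otherwise some letter has a nonzero \<open>q\<close> while the
  other two have nonzero \<open>p\<close>, or the same with \<open>p\<close> and \<open>q\<close>
  exchanged; up to rotation and flip this is the pattern of \<open>\<P>\<^sub>2\<close>.\<close>

lemma turnable_no_squares: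
  fixes p q r :: "var \<Rightarrow> 'k::alg_closed_field"
  assumes has_growth: "has_growth p q r" and pq: "\<And>v. p v \<noteq> 0 \<or> q v \<noteq> 0" and r: "\<And>v. r v = 0"
  shows "turnable p q r"
proof -
  note R = has_growth_rigid[OF has_growth]
  have form: "turnable p q r" if r: "\<And>v. r v = 0" and nz: "q v \<noteq> 0" "p (nxt v) \<noteq> 0" "p (nxt (nxt v)) \<noteq> 0"
    for v and p q r :: "var \<Rightarrow> 'k"
  proof (cases v)
    case VX
    show ?thesis by (rule rotate(2), rule rotate(2), rule turnable_P2_form) (use nz r VX in simp_all)
  next
    case VY
    show ?thesis by (rule turnable_P2_form) (use nz r VY in simp_all)
  next
    case VZ
    show ?thesis by (rule rotate(2), rule turnable_P2_form) (use nz r VZ in simp_all)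
  qed
  have form': "turnable p q r" if "p v \<noteq> 0" "q (nxt v) \<noteq> 0" "q (nxt (nxt v)) \<noteq> 0" for v
    by (rule flip(2), rule form[of _ _ "flp v"]) (use that r in \<open>cases v; simp\<close>)+
  have ex_var: "(\<exists>v. A v) \<longleftrightarrow> A VX \<or> A VY \<or> A VZ" for A by (metis var.exhaust)
  have "\<exists>v. p v \<noteq> 0"
  proof (rule ccontr)
    assume "\<not> ?thesis"
    then have p0: "p v = 0" for v by blast
    have q0: "q v \<noteq> 0" for v using pq[of v] p0 by simp
    have "syz0 p q r (vec (1 / q VX) 0 0) (vec 0 (1 / q VY) 0)" "syz0 p q r (vec 0 (1 / q VY) 0) (vec 0 0 (1 / q VZ))"
      using q0 by (simp_all add: syz0_def all_var p0 r)
    from rigid_same[OF R this, of VX VY] show False using q0 by simp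
  qed
  moreover have "\<exists>v. q v \<noteq> 0"
  proof (rule ccontr)
    assume "\<not> ?thesis"
    then have q0: "q v = 0" for v by blast
    have p0: "p v \<noteq> 0" for v using pq[of v] q0 by simp
    have "syz0 p q r (vec (1 / p VX) 0 0) (vec 0 0 (1 / p VZ))" "syz0 p q r (vec 0 (1 / p VY) 0) (vec (1 / p VX) 0 0)"
      using p0 by (simp_all add: syz0_def all_var q0 r)
    from rigid_same[OF R this, of VX VY] show False using p0 by simp
  qed
  ultimately have "(\<exists>v. q v \<noteq> 0 \<and> p (nxt v) \<noteq> 0 \<and> p (nxt (nxt v)) \<noteq> 0) \<or>
      (\<exists>v. p v \<noteq> 0 \<and> q (nxt v) \<noteq> 0 \<and> q (nxt (nxt v)) \<noteq> 0)"
    using pq[of VX] pq[of VY] pq[of VZ] unfolding ex_var nxt.simps by blast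
  then show ?thesis by (elim disjE exE conjE) (rule form[OF r] form'; assumption)+
qed

text \<open>The syzygy forces \<open>p\<close> and \<open>q\<close> to be in the same ratio in the
  second and in the third relation, as \<open>\<P>\<^sub>3\<close> requires. Apart from the normal
  position and its mirror image, all \<open>p\<close> or all \<open>q\<close> vanish, and then two
  explicit syzygies contradict rigidity.\<close>

lemma turnable_one_square:
  fixes p q r :: "var \<Rightarrow> 'k::alg_closed_field"
  assumes has_growth: "has_growth p q r" and pq: "\<And>v. p v \<noteq> 0 \<or> q v \<noteq> 0" and r: "r VX \<noteq> 0" "r VY = 0" "r VZ = 0"
    and e: "syz0 p q r a b" and ne: "a w \<noteq> 0"
  shows "turnable p q r"
proof -
  note R = has_growth_rigid[OF has_growth]
  have ab: "a VX = b VX" using syz0D(3)[OF e, of VX] r by simp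
  have e1: "a VX * p VX = b VZ * p VZ" using syz0D(1)[OF e, of VX] by simp
  have e2: "a VY * p VY = a VX * p VX" using syz0D(1)[OF e, of VY] ab by simp
  have e3: "a VZ * p VZ = b VY * p VY" using syz0D(1)[OF e, of VZ] by simp
  have e4: "a VX * q VX = b VY * q VY" using syz0D(2)[OF e, of VX] by simp
  have e5: "a VY * q VY = b VZ * q VZ" using syz0D(2)[OF e, of VY] by simp
  have e6: "a VZ * q VZ = a VX * q VX" using syz0D(2)[OF e, of VZ] ab by simp
  have eq: "p VY * q VZ = p VZ * q VY"
  proof (cases "a VX = 0")
    case True
    have "a VY \<noteq> 0 \<or> a VZ \<noteq> 0" using ne True by (cases w) simp_all
    then show ?thesis
    proof
      assume n: "a VY \<noteq> 0"
      have "p VY = 0" using e2 True n by simp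
      then have "b VZ * q VZ \<noteq> 0" using e5 n pq[of VY] by auto
      moreover have "b VZ * p VZ = 0" using e1 True by simp
      ultimately have "p VZ = 0" by auto
      then show ?thesis using \<open>p VY = 0\<close> by simp
    next
      assume n: "a VZ \<noteq> 0"
      have "q VZ = 0" using e6 True n by simp
      then have "b VY * p VY \<noteq> 0" using e3 n pq[of VZ] by auto
      moreover have "b VY * q VY = 0" using e4 True by simp
      ultimately have "q VY = 0" by auto
      then show ?thesis using \<open>q VZ = 0\<close> by simp
    qed
  next
    case False
    from pq[of VX] show ?thesis
    proof
      assume "p VX \<noteq> 0"
      then have n: "a VY \<noteq> 0" "b VZ \<noteq> 0" using e1 e2 False by auto
      have "(p VY * q VZ) * (a VY * b VZ) = (a VY * p VY) * (b VZ * q VZ)" by (simp add: mult_ac)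
      also have "\<dots> = (b VZ * p VZ) * (a VY * q VY)" unfolding e2 e1 e5 ..
      also have "\<dots> = (p VZ * q VY) * (a VY * b VZ)" by (simp add: mult_ac)
      finally show ?thesis using n by simp
    next
      assume "q VX \<noteq> 0"
      then have n: "a VZ \<noteq> 0" "b VY \<noteq> 0" using e4 e6 False by auto
      have "(p VY * q VZ) * (a VZ * b VY) = (b VY * p VY) * (a VZ * q VZ)" by (simp add: mult_ac)
      also have "\<dots> = (a VZ * p VZ) * (b VY * q VY)" unfolding e3 e6 e4 ..
      also have "\<dots> = (p VZ * q VY) * (a VZ * b VY)" by (simp add: mult_ac)
      finally show ?thesis using n by simp
    qed
  qed
  have form: "turnable p q r" if "r VX \<noteq> 0" "r VY = 0" "r VZ = 0" "p VY \<noteq> 0" "p VZ \<noteq> 0" "q VX \<noteq> 0"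
      "p VY * q VZ = p VZ * q VY" for p q r :: "var \<Rightarrow> 'k"
    by (rule rotate(2), rule rotate(2), rule turnable_P3_form) (use that in simp_all)
  have p_iff: "p VY = 0 \<longleftrightarrow> p VZ = 0" and q_iff: "q VY = 0 \<longleftrightarrow> q VZ = 0"
    using eq pq[of VY] pq[of VZ] by auto
  consider (1) "p VY \<noteq> 0" "q VX \<noteq> 0" | (2) "q VY \<noteq> 0" "p VX \<noteq> 0"
    | (3) "p VX = 0" "p VY = 0" | (4) "q VX = 0" "q VY = 0"
    using pq[of VX] pq[of VY] by blast
  then show ?thesis
  proof cases
    case 1
    then show ?thesis using form r eq p_iff by blast
  next
    case 2
    show ?thesis by (rule flip(2), rule form) (use 2 r eq q_iff in \<open>simp_all add: mult.commute\<close>)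
  next
    case 3
    then have p0: "p v = 0" for v using p_iff by (cases v) auto
    have q0: "q v \<noteq> 0" for v using pq[of v] p0 by simp
    have "syz0 p q r (vec (1 / q VX) 0 (1 / q VZ)) (vec (1 / q VX) (1 / q VY) 0)"
      "syz0 p q r (vec 0 (1 / q VY) 0) (vec 0 0 (1 / q VZ))"
      using q0 r by (simp_all add: syz0_def all_var p0)
    from rigid_same[OF R this, of VX VY] show ?thesis using q0 by simp
  next
    case 4
    then have q0: "q v = 0" for v using q_iff by (cases v) auto
    have p0: "p v \<noteq> 0" for v using pq[of v] q0 by simp
    have "syz0 p q r (vec (1 / p VX) (1 / p VY) 0) (vec (1 / p VX) 0 (1 / p VZ))"
      "syz0 p q r (vec 0 0 (1 / p VZ)) (vec 0 (1 / p VY) 0)"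
      using p0 r by (simp_all add: syz0_def all_var q0)
    from rigid_same[OF R this, of VX VZ] show ?thesis using p0 by simp
  qed
qed

lemma constant_products:
  assumes pq: "\<And>v. p v \<noteq> 0 \<or> q v \<noteq> (0 :: 'k::field)" and ne: "a w \<noteq> 0"
    and P: "\<And>v. a v * p v = P" and Q: "\<And>v. a v * q v = Q"
  shows "a v \<noteq> 0" "P \<noteq> 0 \<or> Q \<noteq> 0"
proof -
  show PQ: "P \<noteq> 0 \<or> Q \<noteq> 0" using P[of w] Q[of w] pq[of w] ne by auto
  show "a v \<noteq> 0" using P[of v] Q[of v] PQ by auto
qed

text \<open>The squares give \<open>a = b\<close> at \<open>y\<close> and \<open>z\<close>, and the
  remaining equations make \<open>a v * p v\<close> and \<open>a v * q v\<close> constant. If one of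
  the constants vanished, too many words would avoid the relations; otherwise \<open>q\<close> is a
  constant multiple of \<open>p\<close>, as in \<open>\<P>\<^sub>4\<close>.\<close>

lemma turnable_two_squares:
  fixes p q r :: "var \<Rightarrow> 'k::alg_closed_field"
  assumes has_growth: "has_growth p q r" and pq: "\<And>v. p v \<noteq> 0 \<or> q v \<noteq> 0" and r: "r VX = 0" "r VY \<noteq> 0" "r VZ \<noteq> 0"
    and e: "syz0 p q r a b" and ne: "a w \<noteq> 0"
  shows "turnable p q r"
proof -
  have ab: "b VY = a VY" "b VZ = a VZ" using syz0D(3)[OF e] r by metis+
  have e1: "a VX * p VX = a VZ * p VZ" using syz0D(1)[OF e, of VX] ab by simp
  have e3: "a VZ * p VZ = a VY * p VY" using syz0D(1)[OF e, of VZ] ab by simp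
  have e4: "a VX * q VX = a VY * q VY" using syz0D(2)[OF e, of VX] ab by simp
  have e5: "a VY * q VY = a VZ * q VZ" using syz0D(2)[OF e, of VY] ab by simp
  define P where "P = a VX * p VX"
  define Q where "Q = a VX * q VX"
  have P: "a v * p v = P" for v using e1 e3 by (cases v) (simp_all add: P_def)
  have Q: "a v * q v = Q" for v using e4 e5 by (cases v) (simp_all add: Q_def)
  note a = constant_products(1)[where p = p and q = q and a = a and w = w and P = P and Q = Q, OF pq ne P Q]
  have "P \<noteq> 0"
  proof
    assume "P = 0"
    then have "p v = 0" for v using P[of v] a[of v] by simp
    then show False using few_words_no_growth(1)[of r p q, OF r(1)] has_growth by blast
  qed
  have "Q \<noteq> 0"
  proof
    assume "Q = 0"
    then have "q v = 0" for v using Q[of v] a[of v] by simp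
    then show False using few_words_no_growth(2)[of r q p, OF r(1)] has_growth by blast
  qed
  have p: "p v \<noteq> 0" for v using P[of v] \<open>P \<noteq> 0\<close> by auto
  have q: "q v = - (- (Q / P)) * p v" for v
  proof -
    have "a v * (q v * P) = a v * (Q * p v)"
      unfolding P[of v, symmetric] Q[of v, symmetric] by (simp add: mult_ac)
    then show ?thesis using a[of v] \<open>P \<noteq> 0\<close> by (simp add: field_simps)
  qed
  show ?thesis by (rule turnable_P4_form[OF r p q]) (use \<open>P \<noteq> 0\<close> \<open>Q \<noteq> 0\<close> in simp)
qed

lemma turnable_three_squares:
  fixes p q r :: "var \<Rightarrow> 'k::alg_closed_field"
  assumes has_growth: "has_growth p q r" and pq: "\<And>v. p v \<noteq> 0 \<or> q v \<noteq> 0" and r: "\<And>v. r v \<noteq> 0"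
    and e: "syz0 p q r a b" and ne: "a w \<noteq> 0"
  shows "turnable p q r"
proof -
  have b: "b v = a v" for v using syz0D(3)[OF e r] by simp
  have P: "a v * p v = a VX * p VX" for v
    using syz0D(1)[OF e, of VX] syz0D(1)[OF e, of VY] by (cases v) (simp_all add: b)
  have Q: "a v * q v = a VX * q VX" for v
    using syz0D(2)[OF e, of VX] syz0D(2)[OF e, of VZ] by (cases v) (simp_all add: b)
  note c = constant_products[where p = p and q = q and a = a and w = w and P = "a VX * p VX" and Q = "a VX * q VX", OF pq ne P Q]
  show ?thesis by (rule turnable_P1_form[OF has_growth r c(1) P Q c(2)])
qed

lemma syz0_rotate:
  "syz0 p q r a b \<Longrightarrow> syz0 (\<lambda>v. p (nxt v)) (\<lambda>v. q (nxt v)) (\<lambda>v. r (nxt v)) (\<lambda>v. a (nxt v)) (\<lambda>v. b (nxt v))"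
  unfolding syz0_def by blast

text \<open>Among the three coefficients \<open>r v\<close> two are both zero or both nonzero; a
  rotation moves these to \<open>y\<close> and \<open>z\<close>, and the number of squares then
  decides the class.\<close>

lemma turnable_syz0:
  fixes p q r :: "var \<Rightarrow> 'k::alg_closed_field"
  assumes has_growth: "has_growth p q r" and pq: "\<And>v. p v \<noteq> 0 \<or> q v \<noteq> 0" and e: "syz0 p q r a b" and ne: "a w \<noteq> 0"
  shows "turnable p q r"
proof -
  have X: "turnable p q r"
    if has_growth: "has_growth p q r" and pq: "\<And>v. p v \<noteq> 0 \<or> q v \<noteq> 0" and e: "syz0 p q r a b" and ne: "a w \<noteq> 0"
      and r: "(r VY = 0) = (r VZ = 0)" for p q r a b :: "var \<Rightarrow> 'k" and w
  proof (cases "r VX = 0"; cases "r VY = 0")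
    assume "r VX = 0" "r VY = 0"
    then have "r v = 0" for v using r by (cases v) auto
    then show ?thesis by (rule turnable_no_squares[OF has_growth pq])
  next
    assume "r VX = 0" "r VY \<noteq> 0"
    then show ?thesis using r by (intro turnable_two_squares[where a = a and w = w, OF has_growth pq _ _ _ e ne]) auto
  next
    assume "r VX \<noteq> 0" "r VY = 0"
    then show ?thesis using r by (intro turnable_one_square[where a = a and w = w, OF has_growth pq _ _ _ e ne]) auto
  next
    assume "r VX \<noteq> 0" "r VY \<noteq> 0"
    then have "r v \<noteq> 0" for v using r by (cases v) auto
    then show ?thesis by (rule turnable_three_squares[where a = a and w = w, OF has_growth pq _ e ne])
  qed
  note std1 = rotate(1)[OF has_growth] and e1 = syz0_rotate[OF e]
  note std2 = rotate(1)[OF std1] and e2 = syz0_rotate[OF e1]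
  consider "(r VY = 0) = (r VZ = 0)" | "(r VZ = 0) = (r VX = 0)" | "(r VX = 0) = (r VY = 0)" by blast
  then show ?thesis
  proof cases
    case 1
    then show ?thesis by (rule X[OF has_growth pq e ne])
  next
    case 2
    show ?thesis
      by (rule rotate(2), rule X[OF std1 _ e1, of "nxt (nxt w)"]) (use pq ne 2 in simp_all)
  next
    case 3
    show ?thesis
      by (rule rotate(2), rule rotate(2), rule X[OF std2 _ e2, of "nxt w"]) (use pq ne 3 in simp_all)
  qed
qed

lemma has_growth_imp_turnable:
  fixes p q r :: "var \<Rightarrow> 'k::alg_closed_field"
  assumes has_growth: "has_growth p q r" shows "turnable p q r"
proof (cases "\<exists>v. p v = 0 \<and> q v = 0")
  case True
  then show ?thesis using turnable_square[OF has_growth] by blast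
next
  case False
  then have pq: "p v \<noteq> 0 \<or> q v \<noteq> 0" for v by blast
  from has_growth_rigid[OF has_growth] obtain a b w where ne: "a w \<noteq> 0"
    and e: "syz0 p q r a b \<or> syz1 p q r a b \<or> syz2 p q r a b"
    unfolding rigid_def by blast
  from e show ?thesis
    using turnable_syz0[where a = a and w = w, OF has_growth pq _ ne] turnable_syz1[where a = a and w = w, OF has_growth pq _ ne]
      turnable_syz2[where a = a and w = w, OF has_growth pq _ ne] by blast
qed

lemma sklyanin_rels_eq:
  "sklyanin_rels p1 p2 p3 q1 q2 q3 r1 r2 r3 = rels (vec p1 p2 p3) (vec q1 q2 q3) (vec r1 r2 r3)"
  by (simp add: sklyanin_rels_def list_simps mult.assoc)


theorem theorem7p4:
  fixes p1 p2 p3 q1 q2 q3 r1 r2 r3 :: "'k::alg_closed_field"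
  assumes "R = sklyanin_rels p1 p2 p3 q1 q2 q3 r1 r2 r3"
  shows "(hilbert_series (set R) = inverse ((1 - fps_X) ^ 3)
            \<longleftrightarrow> (\<exists>j\<in>{1..6}. \<exists>R'\<in>class_P j. turned_into R R'))
       \<and> (\<forall>j\<in>{1..5}. \<forall>R'\<in>class_P j. turned_into R R' \<longrightarrow> koszul (set R))
       \<and> (\<forall>R'\<in>class_P 6. turned_into R R' \<longrightarrow> \<not> koszul (set R))"
proof -
  let ?p = "vec p1 p2 p3" and ?q = "vec q1 q2 q3" and ?r = "vec r1 r2 r3"
  have R: "R = rels ?p ?q ?r" unfolding assms by (rule sklyanin_rels_eq)
  have set_R: "set R = range (skl ?p ?q ?r)" unfolding R by (simp add: rels_def UNIV_var)
  have good: "hilbert_series (set R) = hilbert_series (set R')" "koszul (set R) \<longleftrightarrow> koszul (set R')"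
    if "turned_into R R'" for R'
    using turned_into_invariant[OF that _ skl_quadratic] unfolding R rels_def by simp_all
  show ?thesis
  proof (intro conjI iffI ballI impI)
    assume "hilbert_series (set R) = inverse ((1 - fps_X) ^ 3)"
    then have "has_growth ?p ?q ?r" unfolding set_R hilbert_series_iff[OF skl_quadratic] has_growth_def .
    then show "\<exists>j\<in>{1..6}. \<exists>R'\<in>class_P j. turned_into R R'"
      using has_growth_imp_turnable unfolding turnable_def R by blast
  next
    assume "\<exists>j\<in>{1..6}. \<exists>R'\<in>class_P j. turned_into R R'"
    then obtain j R' where j: "j \<in> {1..6}" and R': "R' \<in> class_P j" and ti: "turned_into R R'" by blast
    have "j \<in> {1..5} \<or> j = 6" using j by auto
    then have "hilbert_series (set R') = inverse ((1 - fps_X) ^ 3)"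
      using class_P1_to_P5_koszul_hilbert(2) class_P6_not_koszul_hilbert(2) R' by blast
    then show "hilbert_series (set R) = inverse ((1 - fps_X) ^ 3)" using good(1)[OF ti] by simp
  next
    fix j R' assume "j \<in> {1..5}" "R' \<in> class_P j" "turned_into R R'"
    then show "koszul (set R)" using good(2) class_P1_to_P5_koszul_hilbert(1) by blast
  next
    fix R' assume "R' \<in> class_P 6" "turned_into R R'"
    then show "\<not> koszul (set R)" using good(2) class_P6_not_koszul_hilbert(1) by blast
  qed
qed

end
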